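(* Let $\boldsymbol k$ be a field of characteristic $0$, let $S=\boldsymbol k[x_1,\dots,x_n]$ ($n\ge 1$) be equipped with a Poisson bracket $\{\,,\}$, let $I=(f_1,\dots,f_k)\subset S$ be a Poisson ideal (i.e. $\{I,S\}\subseteq I$), and let $A=S/I$ with the induced Poisson bracket. Let $(R,\partial)$ be a resolvent of $S\to A$ on the generators $f_1,\dots,f_k$. Then there exists a $P_\infty$-algebra structure $(\{\,,\dots,\}_m)_{m\ge 1}$ on $R$ such that: (1) $\{\,\}_1=\partial$; (2) the quasi-isomorphism $R\to A$ is compatible with the brackets (where $A$ carries only the binary bracket $\{\,,\}$); (3) in the graded case, if the internal degree of the Poisson bracket on $S$ is $p$, then for every $m$ the internal degree of the $m$-ary bracket on $R$ is $(m-1)p$; (4) if $f_1,\dots,f_k$ are Casimirs of $S$ and form a complete intersection (in which case $R$ is the Koszul complex $S[y_1,\dots,y_k]$, $\partial y_\mu=f_\mu$), then the $P_\infty$-algebra structure is trivial in the sense that the only nonzero brackets are $\partial=\{\,\}_1$ and the binary bracket $\{\,,\}_2$ given by the bracket $\{\,,\}$ on $S$ (i.e. the values of the brackets of arity $\ge 2$ on the algebra generators $x_i,y_\mu$ vanish, except $\{x_i,x_j\}_2=\{x_i,x_j\}$).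
   Context: Poisson bracket: a Lie bracket on a commutative algebra that is a derivation in each argument. $f\in S$ is a Casimir if $\{f,\cdot\}=0$ on $S$. The sequence $f_1,\dots,f_k$ is a complete intersection if its Koszul complex $S[y_1,\dots,y_k]$ ($y_\mu$ odd, $\partial y_\mu=f_\mu$) has no homology in homological degrees $\ge 1$. Resolvent. A graded set is $\mathcal I=\bigsqcup_{m\ge1}\mathcal I_m$ with all $\mathcal I_m$ finite. To $i\in\mathcal I_m$ attach a variable $x_i^{(m)}$ of cohomological degree $|x_i^{(m)}|=-m$ and parity that of $m$; $S[\boldsymbol x]$ is the graded-commutative polynomial $S$-algebra in all these variables ($S$ in degree $0$), and $S[\boldsymbol x_{\le r}]$ its subalgebra on the variables with $m\le r$. A semifree dg $S$-algebra is $R=S[\boldsymbol x]$ with an $S$-linear differential $\partial$ of degree $+1$, $\partial(ab)=(\partial a)b+(-1)^{|a|}a\,\partial b$, $\partial^2=0$, $\partial x_i^{(m)}\in S[\boldsymbol x_{\le m-1}]$. It is a resolvent of $A=S/I$ if the composite $R\to S\to S/I$ (first map sending all variables $x_i^{(m)}$ to $0$) is a quasi-isomorphism, $A$ being placed in degree $0$. It is a resolvent on the generators $f_1,\dots,f_k$ if $\mathcal I_1=\{1,\dots,k\}$ and $\partial x_\mu^{(1)}=f_\mu$. When $f_1,\dots,f_k$ is a complete intersection, the resolvent is taken to be the Koszul complex (no variables with $m\ge2$). Graded case: $S$ is $\mathbb Z_{\ge0}$-graded by an internal degree with $\deg x_i\ge1$, the $f_\mu$ and the Poisson bracket are homogeneous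 (the bracket has internal degree $p$ if $\deg\{a,b\}=\deg a+\deg b+p$ for homogeneous $a,b$), and the variables $x_i^{(m)}$ are given internal degrees such that $\partial$ has internal degree $0$. An $m$-ary bracket has internal degree $q$ if it adds $q$ to the sum of internal degrees. $L_\infty$-algebra: a graded $\boldsymbol k$-vector space $L=\bigoplus_{k\in\mathbb Z} L^k$ with graded antisymmetric operations $[\,,\dots,]_m:\bigwedge^mL\to L$ of degree $2-m$, $m\ge1$, such that for all $m\ge1$ and homogeneous $x_1,\dots,x_m$ $$\sum_{p+q=m+1}\ \sum_{\sigma\in \mathrm{UnSh}_{q,p-1}}(-1)^\sigma\varepsilon(\sigma,\boldsymbol x)(-1)^{q(p-1)}\big[[x_{\sigma(1)},\dots,x_{\sigma(q)}]_q,x_{\sigma(q+1)},\dots,x_{\sigma(m)}\big]_p=0,$$ where $\mathrm{UnSh}_{q,p-1}$ is the set of permutations with $\sigma(1)<\dots<\sigma(q)$ and $\sigma(q+1)<\dots<\sigma(m)$, $(-1)^\sigma$ is the sign of $\sigma$, and $\varepsilon(\sigma,\boldsymbol x)$ is the Koszul sign, i.e. $x_1\cdots x_m=\varepsilon(\sigma,\boldsymbol x)x_{\sigma(1)}\cdots x_{\sigma(m)}$ in the free graded-commutative algebra. $P_\infty$-algebra: a graded-commutative $\mathbb Z$-graded $\boldsymbol k$-algebra $R$ that is also an $L_\infty$-algebra with brackets $\{\,,\dots,\}_m$ which are graded derivations in each argument: $\{ab,a_2,\dots,a_m\}_m=(-1)^{m|a|}a\{b,a_2,\dots,a_m\}_m+(-1)^{|b|(|a|+m)}b\{a,a_2,\dots,a_m\}_m$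 for homogeneous $a,b$. Compatibility of $\phi:R\to A$ with the brackets: $\phi(\{a,b\}_2)=\{\phi(a),\phi(b)\}$ and $\phi(\{a_1,\dots,a_m\}_m)=0$ for $m\ne2$. *)

theory Defs
  imports Complex_Main
    "HOL-Library.Poly_Mapping"
    "HOL-Library.Product_Lexorder"
    "HOL-Combinatorics.Permutations"
begin

text \<open>
  All graded objects live on a subset \<open>L\<close> of an ambient abelian group \<open>'r\<close>;
  \<open>gr d\<close> is the homogeneous piece of degree \<open>d\<close>.
\<close>

definition graded_space ::
  "('k::field \<Rightarrow> 'r::ab_group_add \<Rightarrow> 'r) \<Rightarrow> 'r set \<Rightarrow> (int \<Rightarrow> 'r set) \<Rightarrow> bool" where
  "graded_space scale L gr \<longleftrightarrow>
     vector_space scale \<and> module.subspace scale L \<and>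
     (\<forall>d. module.subspace scale (gr d) \<and> gr d \<subseteq> L) \<and>
     (\<forall>a\<in>L. \<exists>!c :: int \<Rightarrow> 'r.
        (\<forall>d. c d \<in> gr d) \<and> finite {d. c d \<noteq> 0} \<and> a = (\<Sum>d | c d \<noteq> 0. c d))"

definition graded_comm_algebra ::
  "('k::field \<Rightarrow> 'r::ab_group_add \<Rightarrow> 'r) \<Rightarrow> ('r \<Rightarrow> 'r \<Rightarrow> 'r) \<Rightarrow> 'r \<Rightarrow> 'r set \<Rightarrow> (int \<Rightarrow> 'r set) \<Rightarrow> bool"
  where
  "graded_comm_algebra scale mul unit L gr \<longleftrightarrow>
     graded_space scale L gr \<and>
     unit \<in> gr 0 \<and>
     (\<forall>d e. \<forall>a\<in>gr d. \<forall>b\<in>gr e. mul a b \<in> gr (d + e)) \<and>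
     (\<forall>a\<in>L. \<forall>b\<in>L. \<forall>c\<in>L. \<forall>s.
        mul (scale s a + b) c = scale s (mul a c) + mul b c \<and>
        mul c (scale s a + b) = scale s (mul c a) + mul c b) \<and>
     (\<forall>a\<in>L. \<forall>b\<in>L. \<forall>c\<in>L. mul (mul a b) c = mul a (mul b c)) \<and>
     (\<forall>a\<in>L. mul unit a = a \<and> mul a unit = a) \<and>
     (\<forall>d e. \<forall>a\<in>gr d. \<forall>b\<in>gr e. mul a b = scale ((-1) powi (d * e)) (mul b a))"

definition homogeneous_list :: "(int \<Rightarrow> 'r set) \<Rightarrow> int list \<Rightarrow> 'r list \<Rightarrow> bool" where
  "homogeneous_list gr ds xs \<longleftrightarrow> list_all2 (\<lambda>d x. x \<in> gr d) ds xs"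

text \<open>
  Positions in a list of length \<open>m\<close> are \<open>0, \<dots>, m - 1\<close>, and \<open>permute_list \<sigma> xs\<close> is
  \<open>[xs ! \<sigma> 0, \<dots>, xs ! \<sigma> (m - 1)]\<close>.  Rewriting \<open>x\<^sub>0 \<cdots> x\<^sub>m\<^sub>-\<^sub>1\<close> as a multiple of the permuted
  product costs a sign \<open>(-1)\<^bsup>|x||y|\<^esup>\<close> for every pair whose order is reversed.
\<close>

definition koszul_sign :: "(nat \<Rightarrow> nat) \<Rightarrow> int list \<Rightarrow> 'k::field" where
  "koszul_sign \<sigma> ds =
     (\<Prod>(i, j) \<in> {(i, j). i < j \<and> j < length ds \<and> \<sigma> j < \<sigma> i}.
        (-1) powi (ds ! \<sigma> i * ds ! \<sigma> j))"

definition unshuffles :: "nat \<Rightarrow> nat \<Rightarrow> (nat \<Rightarrow> nat) set" where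
  "unshuffles q m =
     {\<sigma>. \<sigma> permutes {..<m} \<and> strict_mono_on {..<q} \<sigma> \<and> strict_mono_on {q..<m} \<sigma>}"

text \<open>
  The bracket of arity \<open>m\<close> is the restriction of \<open>br\<close> to lists of length \<open>m\<close>; the value
  \<open>br []\<close> is irrelevant.  In the Jacobi identity \<open>p = m + 1 - q\<close>, so \<open>p - 1 = m - q\<close>.
\<close>

definition L_infinity_algebra ::
  "('k::field \<Rightarrow> 'r::ab_group_add \<Rightarrow> 'r) \<Rightarrow> 'r set \<Rightarrow> (int \<Rightarrow> 'r set) \<Rightarrow> ('r list \<Rightarrow> 'r) \<Rightarrow> bool"
  where
  "L_infinity_algebra scale L gr br \<longleftrightarrow>
     graded_space scale L gr \<and>
     (\<forall>xs ys. \<forall>a\<in>L. \<forall>b\<in>L. \<forall>c. set xs \<subseteq> L \<longrightarrow> set ys \<subseteq> L \<longrightarrow>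
        br (xs @ (scale c a + b) # ys) = scale c (br (xs @ a # ys)) + br (xs @ b # ys)) \<and>
     (\<forall>ds xs. xs \<noteq> [] \<longrightarrow> homogeneous_list gr ds xs \<longrightarrow>
        br xs \<in> gr (sum_list ds + 2 - int (length xs))) \<and>
     (\<forall>ds xs \<sigma>. xs \<noteq> [] \<longrightarrow> homogeneous_list gr ds xs \<longrightarrow> \<sigma> permutes {..<length xs} \<longrightarrow>
        br xs = scale (of_int (sign \<sigma>) * koszul_sign \<sigma> ds) (br (permute_list \<sigma> xs))) \<and>
     (\<forall>ds xs m. m \<ge> 1 \<longrightarrow> length xs = m \<longrightarrow> homogeneous_list gr ds xs \<longrightarrow>
        (\<Sum>q = 1..m. \<Sum>\<sigma>\<in>unshuffles q m.
           scale (of_int (sign \<sigma>) * koszul_sign \<sigma> ds * (-1) ^ (q * (m - q)))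
             (br (br (take q (permute_list \<sigma> xs)) # drop q (permute_list \<sigma> xs)))) = 0)"

definition P_infinity_algebra ::
  "('k::field \<Rightarrow> 'r::ab_group_add \<Rightarrow> 'r) \<Rightarrow> ('r \<Rightarrow> 'r \<Rightarrow> 'r) \<Rightarrow> 'r \<Rightarrow> 'r set \<Rightarrow> (int \<Rightarrow> 'r set) \<Rightarrow>
   ('r list \<Rightarrow> 'r) \<Rightarrow> bool" where
  "P_infinity_algebra scale mul unit L gr br \<longleftrightarrow>
     graded_comm_algebra scale mul unit L gr \<and>
     L_infinity_algebra scale L gr br \<and>
     (\<forall>d e. \<forall>a\<in>gr d. \<forall>b\<in>gr e. \<forall>ys. set ys \<subseteq> L \<longrightarrow>
        (let m = int (length ys) + 1 in
         br (mul a b # ys) =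
           scale ((-1) powi (m * d)) (mul a (br (b # ys))) +
           scale ((-1) powi (e * (d + m))) (mul b (br (a # ys)))))"

definition poisson_bracket ::
  "('k::field \<Rightarrow> 'a::comm_ring_1 \<Rightarrow> 'a) \<Rightarrow> ('a \<Rightarrow> 'a \<Rightarrow> 'a) \<Rightarrow> bool" where
  "poisson_bracket scale P \<longleftrightarrow>
     (\<forall>s a b c. P (scale s a + b) c = scale s (P a c) + P b c) \<and>
     (\<forall>s a b c. P c (scale s a + b) = scale s (P c a) + P c b) \<and>
     (\<forall>a. P a a = 0) \<and>
     (\<forall>a b c. P a (P b c) + P b (P c a) + P c (P a b) = 0) \<and>
     (\<forall>a b c. P (a * b) c = a * P b c + b * P a c) \<and>
     (\<forall>a b c. P c (a * b) = a * P c b + b * P c a)"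

definition casimir :: "('a \<Rightarrow> 'a \<Rightarrow> 'a::zero) \<Rightarrow> 'a \<Rightarrow> bool" where
  "casimir P f \<longleftrightarrow> (\<forall>s. P f s = 0)"

definition generated_ideal :: "nat \<Rightarrow> (nat \<Rightarrow> 'a::comm_ring_1) \<Rightarrow> 'a set" where
  "generated_ideal k f = range (\<lambda>g. \<Sum>\<mu> = 1..k. g \<mu> * f \<mu>)"

definition poisson_ideal :: "('a \<Rightarrow> 'a \<Rightarrow> 'a) \<Rightarrow> 'a set \<Rightarrow> bool" where
  "poisson_ideal P I \<longleftrightarrow> (\<forall>a\<in>I. \<forall>s. P a s \<in> I)"

text \<open>The quotient \<open>A = S/I\<close> is \<open>UNIV // ideal_rel I\<close>; its zero element is \<open>coset I 0\<close>.\<close>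

definition ideal_rel :: "'a::ab_group_add set \<Rightarrow> ('a \<times> 'a) set" where
  "ideal_rel I = {(s, t). s - t \<in> I}"

definition coset :: "'a::ab_group_add set \<Rightarrow> 'a \<Rightarrow> 'a set" where
  "coset I s = ideal_rel I `` {s}"

definition quotient_bracket ::
  "'a::ab_group_add set \<Rightarrow> ('a \<Rightarrow> 'a \<Rightarrow> 'a) \<Rightarrow> 'a set \<Rightarrow> 'a set \<Rightarrow> 'a set" where
  "quotient_bracket I P X Y = (\<Union>s\<in>X. \<Union>t\<in>Y. coset I (P s t))"

text \<open>\<open>('n, 'k) mpoly\<close> is the polynomial ring over \<open>'k\<close> in variables indexed by \<open>'n\<close>.\<close>

type_synonym ('n, 'k) mpoly = "('n \<Rightarrow>\<^sub>0 nat) \<Rightarrow>\<^sub>0 'k"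

definition pvar :: "'n \<Rightarrow> ('n, 'k::comm_ring_1) mpoly" where
  "pvar i = Poly_Mapping.single (Poly_Mapping.single i 1) 1"

definition pscale :: "'k::comm_ring_1 \<Rightarrow> ('n, 'k) mpoly \<Rightarrow> ('n, 'k) mpoly" where
  "pscale c = Poly_Mapping.map ((*) c)"

text \<open>
  The pair \<open>(m, i)\<close> stands for the variable \<open>x\<^sub>i\<^bsup>(m)\<^esup>\<close>, of cohomological degree \<open>-m\<close>.
  A monomial is given by its exponents and stands for the product of its variables in increasing
  (lexicographic) order; \<open>gpoly_carrier\<close> selects the elements all of whose monomials contain
  every odd variable at most once.  These monomials form a basis over the ground ring.
\<close>

type_synonym gvar = "nat \<times> nat"
type_synonym gmon = "gvar \<Rightarrow>\<^sub>0 nat"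
type_synonym 's gpoly = "gmon \<Rightarrow>\<^sub>0 's"

definition graded_vars :: "(nat \<Rightarrow> nat set) \<Rightarrow> gvar set" where
  "graded_vars J = {(m, i). m \<ge> 1 \<and> i \<in> J m}"

definition vars_upto :: "(nat \<Rightarrow> nat set) \<Rightarrow> nat \<Rightarrow> gvar set" where
  "vars_upto J r = {v \<in> graded_vars J. fst v \<le> r}"

definition gpoly_carrier :: "gvar set \<Rightarrow> 's::comm_ring_1 gpoly set" where
  "gpoly_carrier V =
     {a. \<forall>M \<in> Poly_Mapping.keys a. Poly_Mapping.keys M \<subseteq> V \<and> (\<forall>v \<in> Poly_Mapping.keys M. odd (fst v) \<longrightarrow> Poly_Mapping.lookup M v = 1)}"

definition mon_degree :: "gmon \<Rightarrow> int" where
  "mon_degree M = - (\<Sum>v \<in> Poly_Mapping.keys M. int (fst v) * int (Poly_Mapping.lookup M v))"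

definition gpoly_gr :: "gvar set \<Rightarrow> int \<Rightarrow> 's::comm_ring_1 gpoly set" where
  "gpoly_gr V d = {a \<in> gpoly_carrier V. \<forall>M \<in> Poly_Mapping.keys a. mon_degree M = d}"

text \<open>
  Reordering \<open>M N\<close> into an ordered monomial exchanges every odd variable \<open>u\<close> of \<open>M\<close> with every
  smaller odd variable \<open>v\<close> of \<open>N\<close>; the product is zero if an odd variable occurs twice.
\<close>

definition mon_sign :: "gmon \<Rightarrow> gmon \<Rightarrow> 's::comm_ring_1" where
  "mon_sign M N =
     (if \<exists>v \<in> Poly_Mapping.keys M \<inter> Poly_Mapping.keys N. odd (fst v) then 0
      else (-1) ^ card {(u, v). u \<in> Poly_Mapping.keys M \<and> v \<in> Poly_Mapping.keys N \<and> odd (fst u) \<and> odd (fst v) \<and> v < u})"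

definition gmult :: "'s::comm_ring_1 gpoly \<Rightarrow> 's gpoly \<Rightarrow> 's gpoly" (infixl \<open>\<star>\<close> 70) where
  "a \<star> b =
     (\<Sum>M \<in> Poly_Mapping.keys a. \<Sum>N \<in> Poly_Mapping.keys b.
        Poly_Mapping.single (M + N) (mon_sign M N * (Poly_Mapping.lookup a M * Poly_Mapping.lookup b N)))"

definition gconst :: "'s::comm_ring_1 \<Rightarrow> 's gpoly" where
  "gconst s = Poly_Mapping.single 0 s"

definition gvar_elem :: "gvar \<Rightarrow> 's::comm_ring_1 gpoly" where
  "gvar_elem v = Poly_Mapping.single (Poly_Mapping.single v 1) 1"

definition gpoly_scale ::
  "'k::comm_ring_1 \<Rightarrow> ('n, 'k) mpoly gpoly \<Rightarrow> ('n, 'k) mpoly gpoly" where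
  "gpoly_scale c = Poly_Mapping.map (pscale c)"

definition semifree_dg ::
  "(nat \<Rightarrow> nat set) \<Rightarrow> ('s::comm_ring_1 gpoly \<Rightarrow> 's gpoly) \<Rightarrow> bool" where
  "semifree_dg J \<delta> \<longleftrightarrow>
     (let R = gpoly_carrier (graded_vars J); gr = gpoly_gr (graded_vars J) in
      (\<forall>m\<ge>1. finite (J m)) \<and>
      (\<forall>d. \<forall>a\<in>gr d. \<delta> a \<in> gr (d + 1)) \<and>
      (\<forall>s. \<forall>a\<in>R. \<forall>b\<in>R. \<delta> (gconst s \<star> a + b) = gconst s \<star> \<delta> a + \<delta> b) \<and>
      (\<forall>d. \<forall>a\<in>gr d. \<forall>b\<in>R.
         \<delta> (a \<star> b) = \<delta> a \<star> b + (if even d then a \<star> \<delta> b else - (a \<star> \<delta> b))) \<and>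
      (\<forall>a\<in>R. \<delta> (\<delta> a) = 0) \<and>
      (\<forall>(m, i) \<in> graded_vars J. \<delta> (gvar_elem (m, i)) \<in> gpoly_carrier (vars_upto J (m - 1))))"

definition cocycles :: "(int \<Rightarrow> 'r set) \<Rightarrow> ('r \<Rightarrow> 'r::ab_group_add) \<Rightarrow> int \<Rightarrow> 'r set" where
  "cocycles gr \<delta> d = {a \<in> gr d. \<delta> a = 0}"

definition coboundaries :: "(int \<Rightarrow> 'r set) \<Rightarrow> ('r \<Rightarrow> 'r::ab_group_add) \<Rightarrow> int \<Rightarrow> 'r set" where
  "coboundaries gr \<delta> d = \<delta> ` gr (d - 1)"

definition cohomology :: "(int \<Rightarrow> 'r set) \<Rightarrow> ('r \<Rightarrow> 'r::ab_group_add) \<Rightarrow> int \<Rightarrow> 'r set set" where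
  "cohomology gr \<delta> d =
     cocycles gr \<delta> d //
       {(a, b). a \<in> cocycles gr \<delta> d \<and> b \<in> cocycles gr \<delta> d \<and> a - b \<in> coboundaries gr \<delta> d}"

definition augmentation :: "'s::comm_ring_1 set \<Rightarrow> 's gpoly \<Rightarrow> 's set" where
  "augmentation I a = coset I (Poly_Mapping.lookup a 0)"

definition quotient_complex :: "'s::comm_ring_1 set \<Rightarrow> int \<Rightarrow> 's set set" where
  "quotient_complex I d = (if d = 0 then UNIV // ideal_rel I else {coset I 0})"

text \<open>
  \<open>S/I\<close> carries the zero differential, hence is its own cohomology: the chain map
  \<open>augmentation I\<close> is a quasi-isomorphism iff the map \<open>[a] \<mapsto> augmentation I a\<close> on cohomology
  is bijective in every degree.
\<close>

definition resolvent ::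
  "(nat \<Rightarrow> nat set) \<Rightarrow> ('s::comm_ring_1 gpoly \<Rightarrow> 's gpoly) \<Rightarrow> 's set \<Rightarrow> bool" where
  "resolvent J \<delta> I \<longleftrightarrow>
     semifree_dg J \<delta> \<and>
     (\<forall>a \<in> gpoly_carrier (graded_vars J). augmentation I (\<delta> a) = coset I 0) \<and>
     (\<forall>d. bij_betw (\<lambda>C. the_elem (augmentation I ` C))
            (cohomology (gpoly_gr (graded_vars J)) \<delta> d) (quotient_complex I d))"

definition resolvent_on_generators ::
  "(nat \<Rightarrow> nat set) \<Rightarrow> ('s::comm_ring_1 gpoly \<Rightarrow> 's gpoly) \<Rightarrow> nat \<Rightarrow> (nat \<Rightarrow> 's) \<Rightarrow> bool" where
  "resolvent_on_generators J \<delta> k f \<longleftrightarrow>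
     resolvent J \<delta> (generated_ideal k f) \<and>
     J 1 = {1..k} \<and>
     (\<forall>\<mu>\<in>{1..k}. \<delta> (gvar_elem (1, \<mu>)) = gconst (f \<mu>))"

text \<open>
  The Koszul complex is the semifree dg algebra on the odd variables \<open>y\<^sub>\<mu> = (1, \<mu>)\<close>.  On its
  carrier, the differential is the unique one with \<open>\<delta> y\<^sub>\<mu> = f\<^sub>\<mu>\<close>.
\<close>

definition koszul_vars :: "nat \<Rightarrow> nat \<Rightarrow> nat set" where
  "koszul_vars k m = (if m = 1 then {1..k} else {})"

definition complete_intersection :: "nat \<Rightarrow> (nat \<Rightarrow> 's::comm_ring_1) \<Rightarrow> bool" where
  "complete_intersection k f \<longleftrightarrow>
     (\<exists>\<delta>. semifree_dg (koszul_vars k) \<delta> \<and>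
          (\<forall>\<mu>\<in>{1..k}. \<delta> (gvar_elem (1, \<mu>)) = gconst (f \<mu>)) \<and>
          (\<forall>d\<ge>1. cocycles (gpoly_gr (graded_vars (koszul_vars k))) \<delta> (- d)
                 = coboundaries (gpoly_gr (graded_vars (koszul_vars k))) \<delta> (- d)))"

definition poly_weight :: "('n::finite \<Rightarrow> nat) \<Rightarrow> int \<Rightarrow> ('n, 'k::comm_ring_1) mpoly set" where
  "poly_weight w d = {s. \<forall>M \<in> Poly_Mapping.keys s. int (\<Sum>i\<in>UNIV. w i * Poly_Mapping.lookup M i) = d}"

definition gpoly_weight ::
  "('n::finite \<Rightarrow> nat) \<Rightarrow> (gvar \<Rightarrow> int) \<Rightarrow> int \<Rightarrow> ('n, 'k::comm_ring_1) mpoly gpoly set" where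
  "gpoly_weight w wv d =
     {a. \<forall>M \<in> Poly_Mapping.keys a. Poly_Mapping.lookup a M \<in> poly_weight w (d - (\<Sum>v \<in> Poly_Mapping.keys M. wv v * int (Poly_Mapping.lookup M v)))}"

definition graded_case ::
  "('n::finite \<Rightarrow> nat) \<Rightarrow> (gvar \<Rightarrow> int) \<Rightarrow> int \<Rightarrow>
   (('n, 'k::comm_ring_1) mpoly \<Rightarrow> ('n, 'k) mpoly \<Rightarrow> ('n, 'k) mpoly) \<Rightarrow>
   nat \<Rightarrow> (nat \<Rightarrow> ('n, 'k) mpoly) \<Rightarrow>
   (nat \<Rightarrow> nat set) \<Rightarrow> (('n, 'k) mpoly gpoly \<Rightarrow> ('n, 'k) mpoly gpoly) \<Rightarrow> bool" where
  "graded_case w wv p P k f J \<delta> \<longleftrightarrow>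
     (\<forall>i. w i \<ge> 1) \<and>
     (\<forall>\<mu>\<in>{1..k}. \<exists>d. f \<mu> \<in> poly_weight w d) \<and>
     (\<forall>d e. \<forall>a\<in>poly_weight w d. \<forall>b\<in>poly_weight w e. P a b \<in> poly_weight w (d + e + p)) \<and>
     (\<forall>d. \<forall>a \<in> gpoly_carrier (graded_vars J) \<inter> gpoly_weight w wv d. \<delta> a \<in> gpoly_weight w wv d)"

definition brackets_internal_degree ::
  "('n::finite \<Rightarrow> nat) \<Rightarrow> (gvar \<Rightarrow> int) \<Rightarrow> (nat \<Rightarrow> nat set) \<Rightarrow> nat \<Rightarrow> int \<Rightarrow>
   (('n, 'k::comm_ring_1) mpoly gpoly list \<Rightarrow> ('n, 'k) mpoly gpoly) \<Rightarrow> bool" where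
  "brackets_internal_degree w wv J m q br \<longleftrightarrow>
     (\<forall>ds as. length as = m \<longrightarrow> set as \<subseteq> gpoly_carrier (graded_vars J) \<longrightarrow>
        homogeneous_list (gpoly_weight w wv) ds as \<longrightarrow>
        br as \<in> gpoly_weight w wv (sum_list ds + q))"

definition compatible_with_quotient ::
  "'s::comm_ring_1 set \<Rightarrow> ('s \<Rightarrow> 's \<Rightarrow> 's) \<Rightarrow> 's gpoly set \<Rightarrow> ('s gpoly list \<Rightarrow> 's gpoly) \<Rightarrow> bool" where
  "compatible_with_quotient I P R br \<longleftrightarrow>
     (\<forall>a\<in>R. \<forall>b\<in>R.
        augmentation I (br [a, b]) = quotient_bracket I P (augmentation I a) (augmentation I b)) \<and>
     (\<forall>as. set as \<subseteq> R \<longrightarrow> length as \<ge> 1 \<longrightarrow> length as \<noteq> 2 \<longrightarrow>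
        augmentation I (br as) = coset I 0)"

definition even_gens :: "('n, 'k::comm_ring_1) mpoly gpoly set" where
  "even_gens = range (\<lambda>i. gconst (pvar i))"

definition odd_gens :: "nat \<Rightarrow> ('n, 'k::comm_ring_1) mpoly gpoly set" where
  "odd_gens k = (\<lambda>\<mu>. gvar_elem (1, \<mu>)) ` {1..k}"

definition trivial_brackets ::
  "(('n, 'k::comm_ring_1) mpoly \<Rightarrow> ('n, 'k) mpoly \<Rightarrow> ('n, 'k) mpoly) \<Rightarrow> nat \<Rightarrow>
   ('n, 'k) mpoly gpoly set \<Rightarrow> (('n, 'k) mpoly gpoly list \<Rightarrow> ('n, 'k) mpoly gpoly) \<Rightarrow> bool" where
  "trivial_brackets P k R br \<longleftrightarrow>
     (\<forall>as. set as \<subseteq> R \<longrightarrow> length as \<ge> 3 \<longrightarrow> br as = 0) \<and>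
     (\<forall>s t. br [gconst s, gconst t] = gconst (P s t)) \<and>
     (\<forall>gs. set gs \<subseteq> even_gens \<union> odd_gens k \<longrightarrow> length gs \<ge> 2 \<longrightarrow>
        \<not> (length gs = 2 \<and> set gs \<subseteq> even_gens) \<longrightarrow> br gs = 0)"

end

theory Submission
  imports Defs
begin

text \<open>
  Adjoin to the resolvent \<open>R\<close> a momentum of opposite parity for every variable \<open>x\<^sub>j\<close> of \<open>S\<close> and every
  \<open>x\<^sub>i\<^bsup>(m)\<^esup>\<close>; polynomials in all these variables are polyvector fields on \<open>R\<close> and carry the Schouten
  bracket.  A Hamiltonian \<open>\<pi>\<close> of total degree 2 that vanishes at zero momenta and satisfies
  \<open>[\<pi>, \<pi>] = 0\<close> defines a \<open>P\<^sub>\<infinity>\<close>-structure by Voronov's derived brackets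
  \<open>{a\<^sub>1, \<dots>, a\<^sub>m} = [a\<^sub>1, [\<dots>, [a\<^sub>m, \<pi>]]]\<close> at zero momenta.

  Such a \<open>\<pi>\<close> is found by obstruction theory, starting from the part linear in the momenta, which
  encodes \<open>\<delta>\<close>, plus the bivector of \<open>P\<close>.  If \<open>[\<pi>, \<pi>]\<close> has weight at least \<open>n\<close> in the variables of \<open>R\<close>,
  then its component of weight \<open>n\<close> is a cocycle by the Jacobi identity, hence exact because \<open>R\<close> is a
  resolvent; for \<open>n = 0\<close> exactness needs that \<open>I\<close> is a Poisson ideal.  A primitive of weight \<open>n + 1\<close>
  is subtracted from \<open>\<pi>\<close>.  The corrections have unbounded weight, so on given arguments the brackets
  stabilise.  All choices can be made homogeneous for the internal degree, and no correction is needed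
  when the \<open>f\<^sub>\<mu>\<close> are Casimirs and \<open>R\<close> is the Koszul complex.
\<close>

text \<open>The resolvent may have infinitely many variables, and then the Hamiltonian is an
  infinite sum. All work is done at finite stages: stage \<open>n\<close> uses the coordinates of
  degree at most \<open>n + 1\<close>, its Hamiltonian solves the equation up to terms of weight at
  least \<open>n\<close>, and a bracket is the common value of all late stages. They agree because
  without momenta the weight is minus the degree, so a term of bounded degree cannot have large
  weight.

  The obstacle is that differentiating along a coordinate of degree \<open>d\<close> costs weight
  \<open>d\<close>. A correction has total degree 2 and at least two momenta, which forces its
  derivative along the conjugate momentum to have weight at least \<open>d\<close>, so nothing is
  lost. Only the part linear in the momenta lowers the weight, by exactly one, and this isolates the
  equation for the next correction.

  An element \<open>a\<close> of the resolvent has no momenta, so its Schouten bracket with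
  \<open>F\<close> is the single half \<open>DD B a F\<close>. The calculus is set up for such
  halves; they violate the Jacobi identity by one second-derivative term, which cancels in the full
  bracket.\<close>

definition sg :: "bool \<Rightarrow> 'a::ab_group_add \<Rightarrow> 'a" where
  "sg b x = (if b then - x else x)"

lemma sg_simps [simp]:
  "sg True x = - x" "sg False x = x" "sg b 0 = 0" "sg b (sg c x) = sg (b \<noteq> c) x"
  "sg b (- x) = - sg b x"
  by (auto simp: sg_def)

lemma sg_add: "sg b (x + y) = sg b x + sg b y"
  and sg_sum: "sg b (sum f A) = (\<Sum>i\<in>A. sg b (f i))"
  by (auto simp: sg_def sum_negf)

lemma sg_mult_left: "sg b x * y = sg b (x * y)"
  and sg_mult_right: "x * sg b y = sg b (x * y)" for x :: "'a::ring"
  by (auto simp: sg_def)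

section \<open>Supercommutative calculus with conjugate derivations\<close>

locale super_ring =
  fixes eps :: "'e::ring_1 \<Rightarrow> 'e"
  assumes eps_add: "eps (x + y) = eps x + eps y"
    and eps_mult: "eps (x * y) = eps x * eps y"
    and eps_eps [simp]: "eps (eps x) = x"
    and super_commute: "eps x = sg p x \<Longrightarrow> eps y = sg q y \<Longrightarrow> x * y = sg (p \<and> q) (y * x)"
    and double_eq_0: "x + x = 0 \<Longrightarrow> x = 0"
begin

text \<open>Parities are booleans: \<open>p \<noteq> q\<close> is the sum of two parities,
  \<open>p = q\<close> the sum plus one, \<open>p \<and> q\<close> the product. Sign identities
  thereby become propositional.\<close>

definition hom :: "bool \<Rightarrow> 'e \<Rightarrow> bool" where
  "hom p x \<longleftrightarrow> eps x = sg p x"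

definition epsp :: "bool \<Rightarrow> 'e \<Rightarrow> 'e" where
  "epsp b x = (if b then eps x else x)"

lemma eps_0 [simp]: "eps 0 = 0"
  using eps_add[of 0 0] by simp

lemma eps_minus: "eps (- x) = - eps x"
  using eps_add[of x "- x"] by (simp add: eq_neg_iff_add_eq_0 add.commute)

lemma eps_sg: "eps (sg b x) = sg b (eps x)"
  by (simp add: sg_def eps_minus)

lemma epsp_simps [simp]: "epsp True x = eps x" "epsp False x = x"
  by (auto simp: epsp_def)

lemma epsp_hom: "hom p x \<Longrightarrow> epsp b x = sg (b \<and> p) x"
  by (auto simp: epsp_def hom_def)

lemma epsp_add: "epsp b (x + y) = epsp b x + epsp b y"
  and epsp_mult: "epsp b (x * y) = epsp b x * epsp b y"
  and epsp_epsp: "epsp b (epsp c x) = epsp (b \<noteq> c) x"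
  and epsp_sg: "epsp b (sg c x) = sg c (epsp b x)"
  and epsp_eps: "epsp b (eps x) = eps (epsp b x)"
  by (auto simp: epsp_def eps_add eps_mult eps_sg)

lemma epsp_0 [simp]: "epsp b 0 = 0"
  by (simp add: epsp_def)

lemma hom_commute: "hom p x \<Longrightarrow> hom q y \<Longrightarrow> x * y = sg (p \<and> q) (y * x)"
  unfolding hom_def by (rule super_commute)

lemma hom_mult: "hom p x \<Longrightarrow> hom q y \<Longrightarrow> hom (p \<noteq> q) (x * y)"
  by (auto simp: hom_def eps_mult sg_def)

lemma hom_0 [simp]: "hom p 0"
  by (simp add: hom_def)

lemma hom_add: "hom p x \<Longrightarrow> hom p y \<Longrightarrow> hom p (x + y)"
  by (auto simp: hom_def eps_add sg_def)

lemma hom_sg: "hom p x \<Longrightarrow> hom p (sg b x)"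
  by (cases b; cases p) (auto simp: hom_def eps_minus)

lemma hom_sum: "(\<And>i. i \<in> A \<Longrightarrow> hom p (f i)) \<Longrightarrow> hom p (sum f A)"
  by (induction A rule: infinite_finite_induct) (auto intro: hom_add)

lemma hom_eps: "hom p x \<Longrightarrow> hom p (eps x)"
  by (auto simp: hom_def eps_sg)

lemma hom_epsp: "hom p x \<Longrightarrow> hom p (epsp b x)"
  by (auto simp: epsp_def hom_eps)

lemma sum_antisym_eq_0:
  assumes "\<And>b c. b \<in> B \<Longrightarrow> c \<in> B \<Longrightarrow> f b c = - f c b"
  shows "(\<Sum>b\<in>B. \<Sum>c\<in>B. f b c) = (0::'e)"
proof (rule double_eq_0)
  have "(\<Sum>b\<in>B. \<Sum>c\<in>B. f b c) = (\<Sum>c\<in>B. \<Sum>b\<in>B. f b c)" by (rule sum.swap)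
  also have "\<dots> = (\<Sum>c\<in>B. \<Sum>b\<in>B. - f c b)"
    by (intro sum.cong refl assms)
  also have "\<dots> = - (\<Sum>b\<in>B. \<Sum>c\<in>B. f b c)" by (simp add: sum_negf)
  finally show "(\<Sum>b\<in>B. \<Sum>c\<in>B. f b c) + (\<Sum>b\<in>B. \<Sum>c\<in>B. f b c) = 0"
    by (simp add: eq_neg_iff_add_eq_0)
qed

end

text \<open>
  \<open>dz c\<close> and \<open>dx c\<close> are the left derivatives along conjugate coordinates of opposite parity;
  \<open>rd c\<close> is the right derivative along the coordinate of \<open>dz c\<close>.
\<close>

locale conjugate_derivations = super_ring eps for eps :: "'e::ring_1 \<Rightarrow> 'e" +
  fixes cp :: "'c \<Rightarrow> bool" and dz dx :: "'c \<Rightarrow> 'e \<Rightarrow> 'e"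
  assumes dz_add: "dz c (x + y) = dz c x + dz c y"
    and dx_add: "dx c (x + y) = dx c x + dx c y"
    and dz_mult0: "dz c (x * y) = dz c x * y + (if cp c then eps x else x) * dz c y"
    and dx_mult0: "dx c (x * y) = dx c x * y + (if cp c then x else eps x) * dx c y"
    and dz_eps: "dz c (eps x) = sg (cp c) (eps (dz c x))"
    and dx_eps: "dx c (eps x) = sg (\<not> cp c) (eps (dx c x))"
    and dz_dz: "dz b (dz c x) = sg (cp b \<and> cp c) (dz c (dz b x))"
    and dx_dx: "dx b (dx c x) = sg (\<not> cp b \<and> \<not> cp c) (dx c (dx b x))"
    and dx_dz: "dx b (dz c x) = sg (\<not> cp b \<and> cp c) (dz c (dx b x))"
begin

lemma dz_mult: "dz c (x * y) = dz c x * y + epsp (cp c) x * dz c y"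
  and dx_mult: "dx c (x * y) = dx c x * y + epsp (\<not> cp c) x * dx c y"
  by (auto simp: dz_mult0 dx_mult0 epsp_def)

lemma dz_0 [simp]: "dz c 0 = 0" and dx_0 [simp]: "dx c 0 = 0"
  using dz_add[of c 0 0] dx_add[of c 0 0] by auto

lemma dz_minus: "dz c (- x) = - dz c x" and dx_minus: "dx c (- x) = - dx c x"
  using dz_add[of c x "- x"] dx_add[of c x "- x"]
  by (simp_all add: eq_neg_iff_add_eq_0 add.commute)

lemma dz_sg: "dz c (sg b x) = sg b (dz c x)" and dx_sg: "dx c (sg b x) = sg b (dx c x)"
  by (auto simp: sg_def dz_minus dx_minus)

lemma dx_sum: "dx c (sum f A) = (\<Sum>i\<in>A. dx c (f i))"
  by (induction A rule: infinite_finite_induct) (auto simp: dx_add)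

text \<open>The sign is that of moving the removed coordinate past the remaining factors from the
  left end to the right end.\<close>

definition rd :: "'c \<Rightarrow> 'e \<Rightarrow> 'e" where
  "rd c x = sg (cp c) (dz c (epsp (cp c) x))"

lemma rd_add: "rd c (x + y) = rd c x + rd c y"
  by (simp add: rd_def epsp_add dz_add sg_add)

lemma rd_0 [simp]: "rd c 0 = 0"
  by (simp add: rd_def)

lemma rd_sg: "rd c (sg b x) = sg b (rd c x)"
  by (cases b; cases "cp c") (simp_all add: rd_def epsp_sg dz_sg eps_minus dz_minus)

lemma rd_minus: "rd c (- x) = - rd c x"
  using rd_sg[of c True x] by simp

lemma rd_diff: "rd c (x - y) = rd c x - rd c y"
  using rd_add[of c x "- y"] by (simp add: rd_minus)

lemma rd_sum: "rd c (sum f A) = (\<Sum>i\<in>A. rd c (f i))"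
  by (induction A rule: infinite_finite_induct) (auto simp: rd_add)

lemma rd_mult: "rd c (x * y) = x * rd c y + rd c x * epsp (cp c) y"
  by (cases "cp c") (simp_all add: rd_def epsp_mult dz_mult epsp_epsp)

lemma hom_dz:
  assumes "hom p x"
  shows "hom (p \<noteq> cp c) (dz c x)"
proof -
  have "eps (dz c x) = sg (cp c) (dz c (eps x))" by (simp add: dz_eps)
  then show ?thesis
    using assms by (cases p; cases "cp c") (simp_all add: hom_def dz_minus)
qed

lemma hom_dx:
  assumes "hom p x"
  shows "hom (p = cp c) (dx c x)"
proof -
  have "eps (dx c x) = sg (\<not> cp c) (dx c (eps x))" by (simp add: dx_eps)
  then show ?thesis
    using assms by (cases p; cases "cp c") (simp_all add: hom_def dx_minus)
qed

lemma hom_rd: "hom p x \<Longrightarrow> hom (p \<noteq> cp c) (rd c x)"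
  unfolding rd_def by (intro hom_sg hom_dz hom_epsp)

text \<open>A left and a right derivative act from opposite ends, so no sign appears. This is the
  reason for pairing right derivatives along coordinates with left derivatives along
  momenta.\<close>

lemma dx_rd: "dx b (rd c x) = rd c (dx b x)"
  by (cases "cp b"; cases "cp c")
     (simp_all add: rd_def dx_sg dx_dz dz_sg dz_minus dx_minus dx_eps)

lemma rd_rd: "rd b (rd c x) = sg (cp b \<and> cp c) (rd c (rd b x))"
  using dz_dz[of b c x]
  by (cases "cp b"; cases "cp c")
     (simp_all add: rd_def dz_sg dz_minus dz_eps eps_minus dz_dz[of b c])

text \<open>Half of the Schouten bracket: only \<open>F\<close> is differentiated along the coordinates.\<close>

definition DD :: "'c set \<Rightarrow> 'e \<Rightarrow> 'e \<Rightarrow> 'e" where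
  "DD B F G = (\<Sum>c\<in>B. rd c F * dx c G)"

lemma DD_add_left: "DD B (F + F') G = DD B F G + DD B F' G"
  and DD_add_right: "DD B F (G + G') = DD B F G + DD B F G'"
  by (simp_all add: DD_def rd_add dx_add algebra_simps sum.distrib)

lemma DD_sg_left: "DD B (sg b F) G = sg b (DD B F G)"
  and DD_sg_right: "DD B F (sg b G) = sg b (DD B F G)"
  by (simp_all add: DD_def rd_sg dx_sg sg_mult_left sg_mult_right sg_sum)

lemma DD_minus_left: "DD B (- F) G = - DD B F G"
  and DD_minus_right: "DD B F (- G) = - DD B F G"
  using DD_sg_left[of B True F G] DD_sg_right[of B F True G] by simp_all

lemma DD_0 [simp]: "DD B 0 G = 0" "DD B F 0 = 0"
  by (simp_all add: DD_def)

lemma DD_diff_left: "DD B (F - F') G = DD B F G - DD B F' G"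
  and DD_diff_right: "DD B F (G - G') = DD B F G - DD B F G'"
  using DD_add_left[of B F "- F'" G] DD_add_right[of B F G "- G'"]
  by (simp_all add: DD_minus_left DD_minus_right)

lemma DD_sum_right: "DD B F (sum g A) = (\<Sum>i\<in>A. DD B F (g i))"
  by (induction A rule: infinite_finite_induct) (auto simp: DD_add_right)

lemma hom_DD:
  assumes "hom p F" "hom q G"
  shows "hom (p = q) (DD B F G)"
  unfolding DD_def
proof (rule hom_sum)
  fix c
  have "hom ((p \<noteq> cp c) \<noteq> (q = cp c)) (rd c F * dx c G)"
    by (intro hom_mult hom_rd hom_dx assms)
  moreover have "((p \<noteq> cp c) \<noteq> (q = cp c)) = (p = q)" by auto
  ultimately show "hom (p = q) (rd c F * dx c G)" by simp
qed

text \<open>Each operator \<open>rd c F * dx c\<close> has parity \<open>\<not> f\<close> whatever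
  \<open>c\<close> is, because conjugate coordinates have opposite parity; hence one Leibniz sign
  serves for the whole sum.\<close>

lemma DD_mult:
  assumes "hom f F" "hom p x"
  shows "DD B F (x * y) = DD B F x * y + sg (\<not> f \<and> p) (x * DD B F y)"
proof -
  have "rd c F * dx c (x * y) = rd c F * dx c x * y + sg (\<not> f \<and> p) (x * (rd c F * dx c y))" for c
  proof -
    have "rd c F * (epsp (\<not> cp c) x * dx c y) = sg (\<not> cp c \<and> p) (rd c F * x * dx c y)"
      by (simp add: epsp_hom[OF assms(2)] sg_mult_left sg_mult_right mult.assoc)
    also have "rd c F * x = sg ((f \<noteq> cp c) \<and> p) (x * rd c F)"
      by (intro hom_commute hom_rd assms)
    finally have "rd c F * (epsp (\<not> cp c) x * dx c y) = sg (\<not> f \<and> p) (x * (rd c F * dx c y))"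
      by (cases f; cases p; cases "cp c") (simp_all add: mult.assoc)
    then show ?thesis by (simp add: dx_mult distrib_left mult.assoc)
  qed
  then show ?thesis
    by (simp add: DD_def sum.distrib sum_distrib_right sum_distrib_left sg_sum mult.assoc)
qed

lemma dx_DD:
  assumes "hom a A" "\<And>c. c \<in> B \<Longrightarrow> dx d (rd c A) = 0"
  shows "dx d (DD B A F) = sg (\<not> cp d \<and> \<not> a) (DD B A (dx d F))"
proof -
  have "dx d (rd c A * dx c F) = sg (\<not> cp d \<and> \<not> a) (rd c A * dx c (dx d F))" if "c \<in> B" for c
  proof -
    have "epsp (\<not> cp d) (rd c A) = sg (\<not> cp d \<and> (a \<noteq> cp c)) (rd c A)"
      by (intro epsp_hom hom_rd assms)
    then show ?thesis
      using assms(2)[OF that]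
      by (cases a; cases "cp c"; cases "cp d") (simp_all add: dx_mult dx_dx[of d c])
  qed
  then show ?thesis
    by (simp add: DD_def dx_sum sg_sum)
qed

lemma DD_base_mult:
  assumes "hom p x" "hom q y"
  shows "DD B (x * y) F = x * DD B y F + sg (p \<and> q) (y * DD B x F)"
proof -
  have "rd c (x * y) * dx c F = x * (rd c y * dx c F) + sg (p \<and> q) (y * (rd c x * dx c F))" for c
  proof -
    have "rd c x * epsp (cp c) y = sg (cp c \<and> q) (rd c x * y)"
      by (simp add: epsp_hom[OF assms(2)] sg_mult_right)
    also have "rd c x * y = sg ((p \<noteq> cp c) \<and> q) (y * rd c x)"
      by (intro hom_commute hom_rd assms)
    finally have "rd c x * epsp (cp c) y = sg (p \<and> q) (y * rd c x)"
      by (cases p; cases q; cases "cp c") simp_all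
    then show ?thesis
      by (simp add: rd_mult distrib_right mult.assoc sg_mult_left)
  qed
  then show ?thesis
    by (simp add: DD_def sum.distrib sum_distrib_left sg_sum)
qed

text \<open>The coefficients \<open>rd c A\<close> and \<open>rd c C\<close> are killed by every
  \<open>dx\<close>, so both operators have constant coefficients along the momenta and supercommute
  as the \<open>dx\<close> themselves do.\<close>

lemma DD_commute:
  assumes "hom a A" "hom b C"
    and A: "\<And>c d. dx d (rd c A) = 0" and C: "\<And>c d. dx d (rd c C) = 0"
  shows "DD B A (DD B C F) = sg (\<not> a \<and> \<not> b) (DD B C (DD B A F))"
proof -
  have C0: "DD B A (rd d C) = 0" for d
    by (simp add: DD_def C)
  have "DD B A (rd d C * dx d F) = sg (\<not> a \<and> \<not> b) (rd d C * dx d (DD B A F))" for d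
  proof -
    have "DD B A (rd d C * dx d F) = sg (\<not> a \<and> (b \<noteq> cp d)) (rd d C * DD B A (dx d F))"
      using DD_mult[OF assms(1) hom_rd[OF assms(2), of d], of B "dx d F"] C0 by simp
    also have "DD B A (dx d F) = sg (\<not> cp d \<and> \<not> a) (dx d (DD B A F))"
      using dx_DD[OF assms(1), of B d F] A by simp
    finally show ?thesis
      by (cases a; cases b; cases "cp d") simp_all
  qed
  then show ?thesis
    unfolding DD_def[of B C] by (simp add: DD_sum_right sg_sum)
qed

text \<open>The second-derivative term by which the half bracket fails the Jacobi identity. By
  \<open>Cor_sym\<close> it has exactly the symmetry that makes it cancel in
  \<open>Br\<close>.\<close>

definition Cor :: "'c set \<Rightarrow> 'e \<Rightarrow> 'e \<Rightarrow> 'e \<Rightarrow> 'e" where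
  "Cor B A F G = (\<Sum>b\<in>B. \<Sum>c\<in>B. rd c (rd b A) * epsp (cp c) (dx b F) * dx c G)"

lemma Cor_sym:
  assumes "hom f F" "hom g G"
  shows "Cor B A F G = sg (\<not> f \<and> \<not> g) (Cor B A G F)"
proof -
  have "rd c (rd b A) * epsp (cp c) (dx b F) * dx c G
      = sg (\<not> f \<and> \<not> g) (rd b (rd c A) * epsp (cp b) (dx c G) * dx b F)" for b c
  proof -
    have 1: "dx b F * dx c G = sg ((f = cp b) \<and> (g = cp c)) (dx c G * dx b F)"
      by (intro hom_commute hom_dx assms)
    have 2: "epsp (cp c) (dx b F) = sg (cp c \<and> (f = cp b)) (dx b F)"
      "epsp (cp b) (dx c G) = sg (cp b \<and> (g = cp c)) (dx c G)"
      by (intro epsp_hom hom_dx assms)+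
    have 3: "rd c (rd b A) = sg (cp c \<and> cp b) (rd b (rd c A))" by (rule rd_rd)
    show ?thesis
      unfolding 2 3 using 1
      by (cases f; cases g; cases "cp b"; cases "cp c") (simp_all add: mult.assoc)
  qed
  then show ?thesis
    unfolding Cor_def by (subst sum.swap) (simp add: sg_sum)
qed

text \<open>\<open>DD B A\<close> commutes with \<open>dx\<close> up to sign, but not with
  \<open>rd c\<close>, which also differentiates the coefficients \<open>rd b A\<close>; this
  surplus is \<open>Cor\<close>.\<close>

lemma DD_DD:
  assumes "hom a A" "hom f F" and A: "\<And>c d. dx d (rd c A) = 0"
  shows "DD B A (DD B F G)
    = DD B (DD B A F) G + sg (\<not> a \<and> \<not> f) (DD B F (DD B A G)) - Cor B A F G"
proof -
  have rdA: "DD B A (rd c F) = rd c (DD B A F) - (\<Sum>b\<in>B. rd c (rd b A) * epsp (cp c) (dx b F))" for c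
    by (simp add: DD_def rd_sum rd_mult sum.distrib dx_rd)
  have "DD B A (rd c F * dx c G)
      = rd c (DD B A F) * dx c G + sg (\<not> a \<and> \<not> f) (rd c F * dx c (DD B A G))
        - (\<Sum>b\<in>B. rd c (rd b A) * epsp (cp c) (dx b F) * dx c G)" for c
  proof -
    have "DD B A (rd c F * dx c G)
      = DD B A (rd c F) * dx c G + sg (\<not> a \<and> (f \<noteq> cp c)) (rd c F * DD B A (dx c G))"
      by (intro DD_mult hom_rd assms)
    also have "DD B A (dx c G) = sg (\<not> cp c \<and> \<not> a) (dx c (DD B A G))"
      using dx_DD[OF assms(1), of B c G] A by simp
    finally have "DD B A (rd c F * dx c G)
      = DD B A (rd c F) * dx c G + sg (\<not> a \<and> \<not> f) (rd c F * dx c (DD B A G))"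
      by (cases a; cases f; cases "cp c") simp_all
    then show ?thesis
      by (simp add: rdA left_diff_distrib sum_distrib_right)
  qed
  then show ?thesis
    unfolding DD_def[of B F G] Cor_def
    by (subst sum.swap[of _ B B])
       (simp add: DD_sum_right sum.distrib sum_subtractf sg_sum DD_def[of B F] DD_def[of B "DD B A F"])
qed

definition Br :: "'c set \<Rightarrow> bool \<Rightarrow> bool \<Rightarrow> 'e \<Rightarrow> 'e \<Rightarrow> 'e" where
  "Br B f g F G = DD B F G - sg (\<not> f \<and> \<not> g) (DD B G F)"

text \<open>The two \<open>Cor\<close> terms produced by the two halves of \<open>Br\<close>
  cancel.\<close>

lemma DD_Br:
  assumes "hom a A" "hom f F" "hom g G" and A: "\<And>c d. dx d (rd c A) = 0"
  shows "DD B A (Br B f g F G)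
    = Br B (a = f) g (DD B A F) G + sg (\<not> a \<and> \<not> f) (Br B f (a = g) F (DD B A G))"
  using Cor_sym[OF assms(2,3), of B A]
  by (cases a; cases f; cases g)
     (simp_all add: Br_def DD_diff_right DD_minus_right DD_add_right
        DD_DD[OF assms(1,2) A] DD_DD[OF assms(1,3) A])

text \<open>The Jacobi identity for the triple bracket of an even \<pi> with itself, in half
  brackets. After expansion the terms with one mixed second derivative agree on both sides,
  \<open>Cor\<close> vanishes because its symmetry sign is -1 here, and the terms with two
  derivatives along momenta are antisymmetric in the summation indices.\<close>

lemma DD_self_commute:
  assumes "hom False \<pi>"
  shows "DD B \<pi> (DD B \<pi> \<pi>) = DD B (DD B \<pi> \<pi>) \<pi>"
proof -
  have "Cor B \<pi> \<pi> \<pi> = 0"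
  proof (rule double_eq_0)
    have "Cor B \<pi> \<pi> \<pi> = - Cor B \<pi> \<pi> \<pi>"
      using Cor_sym[OF assms assms, of B \<pi>] by (simp only: simp_thms sg_simps)
    then show "Cor B \<pi> \<pi> \<pi> + Cor B \<pi> \<pi> \<pi> = 0"
      by (simp only: eq_neg_iff_add_eq_0)
  qed
  moreover have "DD B (DD B \<pi> \<pi>) \<pi>
      = (\<Sum>c\<in>B. \<Sum>b\<in>B. rd b \<pi> * rd c (dx b \<pi>) * dx c \<pi>) + Cor B \<pi> \<pi> \<pi>"
    unfolding Cor_def
    by (subst (2) sum.swap)
       (simp add: DD_def rd_sum rd_mult sum.distrib sum_distrib_right distrib_right)
  moreover have "(\<Sum>c\<in>B. \<Sum>b\<in>B. rd c \<pi> * epsp (\<not> cp c) (rd b \<pi>) * dx c (dx b \<pi>)) = 0"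
  proof (rule sum_antisym_eq_0)
    fix b c
    have 1: "rd b \<pi> * rd c \<pi> = sg (cp b \<and> cp c) (rd c \<pi> * rd b \<pi>)"
      using hom_commute[OF hom_rd[OF assms] hom_rd[OF assms], of b c] by simp
    have 2: "epsp p (rd b \<pi>) = sg (p \<and> cp b) (rd b \<pi>)" for b p
      using epsp_hom[OF hom_rd[OF assms]] by simp
    show "rd b \<pi> * epsp (\<not> cp b) (rd c \<pi>) * dx b (dx c \<pi>)
        = - (rd c \<pi> * epsp (\<not> cp c) (rd b \<pi>) * dx c (dx b \<pi>))"
      unfolding 2 dx_dx[of b c] using 1
      by (cases "cp b"; cases "cp c") simp_all
  qed
  moreover have "DD B \<pi> (DD B \<pi> \<pi>)
      = (\<Sum>c\<in>B. \<Sum>b\<in>B. rd c \<pi> * dx c (rd b \<pi>) * dx b \<pi>)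
      + (\<Sum>c\<in>B. \<Sum>b\<in>B. rd c \<pi> * epsp (\<not> cp c) (rd b \<pi>) * dx c (dx b \<pi>))"
    by (simp add: DD_def dx_sum dx_mult sum.distrib sum_distrib_left distrib_left mult.assoc)
  moreover have "(\<Sum>c\<in>B. \<Sum>b\<in>B. rd c \<pi> * dx c (rd b \<pi>) * dx b \<pi>)
      = (\<Sum>c\<in>B. \<Sum>b\<in>B. rd b \<pi> * rd c (dx b \<pi>) * dx c \<pi>)"
    by (subst sum.swap) (simp add: dx_rd)
  ultimately show ?thesis by simp
qed

end

section \<open>Super polynomials\<close>

text \<open>Variables are pairs of naturals and are meant to stay atomic; by default the simplifier
  would split every quantifier over them into components.\<close>

declare split_paired_All [simp del] split_paired_Ex [simp del]

definition odd_keys :: "gmon \<Rightarrow> gvar set" where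
  "odd_keys M = {v \<in> Poly_Mapping.keys M. odd (fst v)}"

definition reduced :: "gmon \<Rightarrow> bool" where
  "reduced M \<longleftrightarrow> (\<forall>v \<in> Poly_Mapping.keys M. odd (fst v) \<longrightarrow> Poly_Mapping.lookup M v = 1)"

definition crossings :: "gvar set \<Rightarrow> gvar set \<Rightarrow> nat" where
  "crossings A B = card {(u, v). u \<in> A \<and> v \<in> B \<and> v < u}"

lemma keys_add_nat: "Poly_Mapping.keys (M + N) = Poly_Mapping.keys M \<union> Poly_Mapping.keys N"
  for M N :: "'a \<Rightarrow>\<^sub>0 nat"
  by (auto simp: in_keys_iff lookup_add)

lemma finite_odd_keys [simp]: "finite (odd_keys M)"
  by (simp add: odd_keys_def)

lemma odd_keys_add: "odd_keys (M + N) = odd_keys M \<union> odd_keys N"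
  by (auto simp: odd_keys_def keys_add_nat)

lemma odd_keys_0 [simp]: "odd_keys 0 = {}"
  by (simp add: odd_keys_def)

lemma reduced_0 [simp]: "reduced 0"
  by (simp add: reduced_def)

lemma reduced_iff: "reduced M \<longleftrightarrow> (\<forall>v. odd (fst v) \<longrightarrow> Poly_Mapping.lookup M v \<le> 1)"
proof -
  have "(v \<in> Poly_Mapping.keys M \<longrightarrow> odd (fst v) \<longrightarrow> Poly_Mapping.lookup M v = 1) \<longleftrightarrow>
    (odd (fst v) \<longrightarrow> Poly_Mapping.lookup M v \<le> 1)" for v
    by (cases "Poly_Mapping.lookup M v") (auto simp: in_keys_iff)
  then show ?thesis by (auto simp: reduced_def)
qed

lemma reduced_add_iff:
  "reduced (M + N) \<longleftrightarrow> reduced M \<and> reduced N \<and> odd_keys M \<inter> odd_keys N = {}"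
proof -
  have 1: "odd_keys M \<inter> odd_keys N = {} \<longleftrightarrow>
    (\<forall>v. odd (fst v) \<longrightarrow> Poly_Mapping.lookup M v = 0 \<or> Poly_Mapping.lookup N v = 0)"
    by (auto simp: odd_keys_def in_keys_iff)
  have 2: "m + n \<le> 1 \<longleftrightarrow> m \<le> 1 \<and> n \<le> 1 \<and> (m = 0 \<or> n = 0)" for m n :: nat
    by arith
  then show ?thesis
    unfolding 1 reduced_iff lookup_add 2 by auto
qed

lemma mon_sign_alt:
  "mon_sign M N = (if odd_keys M \<inter> odd_keys N \<noteq> {} then 0
     else (-1) ^ crossings (odd_keys M) (odd_keys N))"
proof -
  have "{(u, v). u \<in> Poly_Mapping.keys M \<and> v \<in> Poly_Mapping.keys N \<and> odd (fst u) \<and> odd (fst v) \<and> v < u}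
    = {(u, v). u \<in> odd_keys M \<and> v \<in> odd_keys N \<and> v < u}"
    by (auto simp: odd_keys_def)
  moreover have "(\<exists>v \<in> Poly_Mapping.keys M \<inter> Poly_Mapping.keys N. odd (fst v)) \<longleftrightarrow> odd_keys M \<inter> odd_keys N \<noteq> {}"
    by (auto simp: odd_keys_def)
  ultimately show ?thesis by (simp add: mon_sign_def crossings_def)
qed

lemma finite_crossings: "finite A \<Longrightarrow> finite B \<Longrightarrow> finite {(u, v). u \<in> A \<and> v \<in> B \<and> v < (u :: gvar)}"
  by (rule finite_subset[of _ "A \<times> B"]) auto

lemma crossings_Un_left:
  assumes "finite A" "finite A'" "finite B" "A \<inter> A' = {}"
  shows "crossings (A \<union> A') B = crossings A B + crossings A' B"
proof -
  have "{(u, v). u \<in> A \<union> A' \<and> v \<in> B \<and> v < u}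
    = {(u, v). u \<in> A \<and> v \<in> B \<and> v < u} \<union> {(u, v). u \<in> A' \<and> v \<in> B \<and> v < u}" by auto
  then show ?thesis
    using assms unfolding crossings_def
    by (simp only:, subst card_Un_disjoint) (auto simp: finite_crossings)
qed

lemma crossings_Un_right:
  assumes "finite A" "finite B'" "finite B" "B \<inter> B' = {}"
  shows "crossings A (B \<union> B') = crossings A B + crossings A B'"
proof -
  have "{(u, v). u \<in> A \<and> v \<in> B \<union> B' \<and> v < u}
    = {(u, v). u \<in> A \<and> v \<in> B \<and> v < u} \<union> {(u, v). u \<in> A \<and> v \<in> B' \<and> v < u}" by auto
  then show ?thesis
    using assms unfolding crossings_def
    by (simp only:, subst card_Un_disjoint) (auto simp: finite_crossings)
qed

lemma crossings_empty [simp]: "crossings {} B = 0" "crossings A {} = 0"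
  by (simp_all add: crossings_def)

lemma crossings_singleton_left: "crossings {v} B = card {w \<in> B. w < v}"
proof -
  have "{(u, w). u \<in> {v} \<and> w \<in> B \<and> w < u} = Pair v ` {w \<in> B. w < v}" by auto
  then show ?thesis by (simp add: crossings_def card_image inj_on_def)
qed

text \<open>Every pair is a crossing in exactly one of the two orders.\<close>

lemma crossings_flip:
  assumes "finite A" "finite B" "A \<inter> B = {}"
  shows "crossings A B + crossings B A = card A * card B"
proof -
  let ?S = "{(u, v). u \<in> A \<and> v \<in> B \<and> v < u}" and ?T = "{(u, v). u \<in> A \<and> v \<in> B \<and> u < v}"
  have "{(u, v). u \<in> B \<and> v \<in> A \<and> v < u} = prod.swap ` ?T" by force
  then have "crossings B A = card ?T" by (simp add: crossings_def card_image)
  moreover have "card ?S + card ?T = card A * card B"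
  proof -
    have "v < u \<or> u < v" if "u \<in> A" "v \<in> B" for u v
      using that assms(3) neq_iff[of u v] by blast
    then have un: "A \<times> B = ?S \<union> ?T" by blast
    have "finite ?S" "finite ?T"
      by (rule finite_subset[OF _ finite_cartesian_product[OF assms(1,2)]], blast)+
    then have "card (?S \<union> ?T) = card ?S + card ?T"
      by (rule card_Un_disjoint) auto
    then show ?thesis by (simp only: un[symmetric] card_cartesian_product)
  qed
  ultimately show ?thesis by (simp add: crossings_def)
qed

lemma mon_sign_0 [simp]: "mon_sign 0 N = 1" "mon_sign M 0 = 1"
  by (simp_all add: mon_sign_alt)

text \<open>Both sides count the crossings of all three pairs of monomials. This cocycle identity is
  the associativity of the product.\<close>

lemma mon_sign_assoc:
  "mon_sign M N * mon_sign (M + N) L = (mon_sign N L * mon_sign M (N + L) :: 's::comm_ring_1)"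
proof (cases "odd_keys M \<inter> odd_keys N = {} \<and> odd_keys M \<inter> odd_keys L = {} \<and> odd_keys N \<inter> odd_keys L = {}")
  case True
  then show ?thesis
    by (simp add: mon_sign_alt odd_keys_add Int_Un_distrib Int_Un_distrib2
        crossings_Un_left crossings_Un_right power_add mult.commute mult.left_commute)
next
  case False
  then show ?thesis
    by (auto simp: mon_sign_alt odd_keys_add Int_Un_distrib Int_Un_distrib2)
qed

lemma mon_sign_commute:
  "mon_sign M N = ((-1) ^ (card (odd_keys M) * card (odd_keys N)) * mon_sign N M :: 's::comm_ring_1)"
proof (cases "odd_keys M \<inter> odd_keys N = {}")
  case True
  have "even (crossings (odd_keys M) (odd_keys N)) \<longleftrightarrow>
    even (card (odd_keys M) * card (odd_keys N) + crossings (odd_keys N) (odd_keys M))"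
    using crossings_flip[OF finite_odd_keys finite_odd_keys True]
    by (metis even_add)
  then show ?thesis
    using True by (auto simp: mon_sign_alt Int_commute minus_one_power_iff)
qed (simp add: mon_sign_alt Int_commute)

lemma mon_sign_square: "odd_keys M \<inter> odd_keys N = {} \<Longrightarrow> mon_sign M N * mon_sign M N = (1::'s::comm_ring_1)"
  by (simp add: mon_sign_alt flip: power_add)

text \<open>Summing over fixed finite supersets of the supports makes the product visibly additive
  in each factor.\<close>

lemma keys_gmult_superset:
  assumes "finite A" "finite B" "Poly_Mapping.keys a \<subseteq> A" "Poly_Mapping.keys b \<subseteq> B"
  shows "a \<star> b = (\<Sum>M\<in>A. \<Sum>N\<in>B.
    Poly_Mapping.single (M + N) (mon_sign M N * (Poly_Mapping.lookup a M * Poly_Mapping.lookup b N)))"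
proof -
  have "(\<Sum>N \<in> Poly_Mapping.keys b.
        Poly_Mapping.single (M + N) (mon_sign M N * (Poly_Mapping.lookup a M * Poly_Mapping.lookup b N)))
     = (\<Sum>N\<in>B. Poly_Mapping.single (M + N) (mon_sign M N * (Poly_Mapping.lookup a M * Poly_Mapping.lookup b N)))" for M
    using assms by (intro sum.mono_neutral_left) (auto simp: in_keys_iff)
  then show ?thesis
    unfolding gmult_def using assms
    by (simp, intro sum.mono_neutral_left) (auto simp: in_keys_iff)
qed

lemma gmult_add_left: "(a + b) \<star> c = a \<star> c + b \<star> c"
  and gmult_add_right: "c \<star> (a + b) = c \<star> a + c \<star> b" for a b c :: "'s::comm_ring_1 gpoly"
proof -
  let ?A = "Poly_Mapping.keys a \<union> Poly_Mapping.keys b"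
  have sub: "Poly_Mapping.keys (a + b) \<subseteq> ?A" by (rule Poly_Mapping.keys_add)
  show "(a + b) \<star> c = a \<star> c + b \<star> c"
    using sub by (simp add: keys_gmult_superset[where A = ?A and B = "Poly_Mapping.keys c"]
      lookup_add distrib_left distrib_right single_add sum.distrib)
  show "c \<star> (a + b) = c \<star> a + c \<star> b"
    using sub by (simp add: keys_gmult_superset[where B = ?A and A = "Poly_Mapping.keys c"]
      lookup_add distrib_left distrib_right single_add sum.distrib)
qed

lemma gmult_single:
  "Poly_Mapping.single M a \<star> Poly_Mapping.single N b = Poly_Mapping.single (M + N) (mon_sign M N * (a * b))"
  by (subst keys_gmult_superset[where A = "{M}" and B = "{N}"]) (auto simp: lookup_single)

lemma in_gpoly_carrier_iff:
  "a \<in> gpoly_carrier V \<longleftrightarrow> (\<forall>M\<in>Poly_Mapping.keys a. Poly_Mapping.keys M \<subseteq> V \<and> reduced M)"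
  by (simp add: gpoly_carrier_def reduced_def)

lemma gmult_carrier:
  assumes "a \<in> gpoly_carrier V" "b \<in> gpoly_carrier V"
  shows "a \<star> b \<in> gpoly_carrier V"
proof -
  have "Poly_Mapping.keys K \<subseteq> V \<and> reduced K" if "K \<in> Poly_Mapping.keys (a \<star> b)" for K
  proof -
    have "Poly_Mapping.lookup (a \<star> b) K \<noteq> 0" using that by (simp add: in_keys_iff)
    then obtain M N where MN: "M \<in> Poly_Mapping.keys a" "N \<in> Poly_Mapping.keys b"
      "Poly_Mapping.lookup (Poly_Mapping.single (M + N)
        (mon_sign M N * (Poly_Mapping.lookup a M * Poly_Mapping.lookup b N))) K \<noteq> 0"
      unfolding gmult_def lookup_sum by (metis (no_types, lifting) sum.not_neutral_contains_not_neutral)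
    then have "K = M + N" "odd_keys M \<inter> odd_keys N = {}"
      by (auto simp: lookup_single when_def mon_sign_alt split: if_splits)
    then show ?thesis
      using assms MN by (auto simp: in_gpoly_carrier_iff reduced_add_iff keys_add_nat)
  qed
  then show ?thesis by (simp add: in_gpoly_carrier_iff)
qed

typedef (overloaded) 's sp = "gpoly_carrier UNIV :: 's::comm_ring_1 gpoly set"
  by (rule exI[of _ 0]) (simp add: in_gpoly_carrier_iff)

\<comment> \<open>Otherwise transfer would unfold past polynomials down to coefficient
  functions.\<close>
lifting_forget poly_mapping.lifting
setup_lifting type_definition_sp

lemma carrier_add: "a \<in> gpoly_carrier V \<Longrightarrow> b \<in> gpoly_carrier V \<Longrightarrow> a + b \<in> gpoly_carrier V"
  using Poly_Mapping.keys_add[of a b] by (auto simp: in_gpoly_carrier_iff)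

lemma carrier_uminus: "a \<in> gpoly_carrier V \<Longrightarrow> - a \<in> gpoly_carrier V"
  by (auto simp: in_gpoly_carrier_iff in_keys_iff)

text \<open>With the value 0 on monomials that are not reduced, the product formula
  \<open>monom_mult\<close> needs no condition on \<open>M + N\<close>.\<close>

lift_definition monom :: "gmon \<Rightarrow> 's \<Rightarrow> 's::comm_ring_1 sp" is
  "\<lambda>M c. if reduced M then Poly_Mapping.single M c else 0"
  by (auto simp: in_gpoly_carrier_iff)

lift_definition coef :: "'s::comm_ring_1 sp \<Rightarrow> gmon \<Rightarrow> 's" is Poly_Mapping.lookup .

lift_definition mons :: "'s::comm_ring_1 sp \<Rightarrow> gmon set" is Poly_Mapping.keys .

instantiation sp :: (comm_ring_1) ab_group_add
begin

lift_definition zero_sp :: "'a sp" is 0 by (simp add: in_gpoly_carrier_iff)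
lift_definition plus_sp :: "'a sp \<Rightarrow> 'a sp \<Rightarrow> 'a sp" is "(+)" by (rule carrier_add)
lift_definition uminus_sp :: "'a sp \<Rightarrow> 'a sp" is uminus by (rule carrier_uminus)
lift_definition minus_sp :: "'a sp \<Rightarrow> 'a sp \<Rightarrow> 'a sp" is "(-)"
  by (metis carrier_add carrier_uminus diff_conv_add_uminus)

instance by intro_classes (transfer; simp)+

end

lemma coef_simps [simp]:
  "coef (x + y) M = coef x M + coef y M" "coef (- x) M = - coef x M"
  "coef (x - y) M = coef x M - coef y M" "coef 0 M = 0"
  by (transfer; simp add: lookup_add lookup_minus)+

lemma coef_sum: "coef (sum f A) M = (\<Sum>i\<in>A. coef (f i) M)"
  by (induction A rule: infinite_finite_induct) auto

lemma finite_mons [simp]: "finite (mons x)"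
  by transfer simp

lemma mons_iff: "M \<in> mons x \<longleftrightarrow> coef x M \<noteq> 0"
  by transfer (simp add: in_keys_iff)

lemma mons_reduced: "M \<in> mons x \<Longrightarrow> reduced M"
  by transfer (simp add: in_gpoly_carrier_iff)

lemma coef_monom: "coef (monom M c) N = (if N = M \<and> reduced M then c else 0)"
  by transfer (auto simp: lookup_single when_def)

lemma sp_eqI: "(\<And>M. coef x M = coef y M) \<Longrightarrow> x = y"
  by transfer (simp add: poly_mapping_eqI)

lemma monom_0 [simp]: "monom M 0 = 0"
  by (rule sp_eqI) (simp add: coef_monom)

lemma monom_add: "monom M (c + d) = monom M c + monom M d"
  and monom_minus: "monom M (- c) = - monom M c"
  by (rule sp_eqI; simp add: coef_monom)+

lemma monom_diff: "monom M (c - d) = monom M c - monom M d"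
  by (rule sp_eqI) (simp add: coef_monom)

lemma monom_not_reduced: "\<not> reduced M \<Longrightarrow> monom M c = 0"
  by (rule sp_eqI) (simp add: coef_monom)

lemma monom_expansion: "x = (\<Sum>M\<in>mons x. monom M (coef x M))"
proof (rule sp_eqI)
  fix N
  have "coef (\<Sum>M\<in>mons x. monom M (coef x M)) N = (\<Sum>M\<in>mons x. if M = N then coef x N else 0)"
    unfolding coef_sum by (intro sum.cong) (auto simp: coef_monom mons_reduced)
  then show "coef x N = coef (\<Sum>M\<in>mons x. monom M (coef x M)) N"
    by (simp add: mons_iff)
qed

lemma sp_induct [case_names monom add]:
  assumes "\<And>M c. reduced M \<Longrightarrow> P (monom M c)" "\<And>x y. P x \<Longrightarrow> P y \<Longrightarrow> P (x + y)"
  shows "P x"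
proof -
  have "P (\<Sum>M\<in>A. monom M (coef x M))" if "finite A" for A
    using that
  proof (induction A)
    case empty
    then show ?case using assms(1)[of 0 0] by simp
  next
    case (insert M A)
    have "P (monom M (coef x M))"
      using assms(1)[of M] assms(1)[of 0 0] by (cases "reduced M") (auto simp: monom_not_reduced)
    then show ?case using insert assms(2) by simp
  qed
  then show ?thesis using monom_expansion[of x] by (metis finite_mons)
qed

instantiation sp :: (comm_ring_1) ring_1
begin

lift_definition times_sp :: "'a sp \<Rightarrow> 'a sp \<Rightarrow> 'a sp" is gmult by (rule gmult_carrier)
definition one_sp :: "'a sp" where "one_sp = monom 0 1"

lemma monom_mult: "reduced M \<Longrightarrow> reduced N \<Longrightarrow> monom M a * monom N b = monom (M + N) (mon_sign M N * (a * b))"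
  by transfer (auto simp: gmult_single reduced_add_iff mon_sign_alt)

instance
proof
  fix a b c :: "'a sp"
  show dl: "(a + b) * c = a * c + b * c" for a b c :: "'a sp"
    by transfer (rule gmult_add_left)
  show dr: "a * (b + c) = a * b + a * c" for a b c :: "'a sp"
    by transfer (rule gmult_add_right)
  have z: "0 * a = 0" "a * 0 = 0" for a :: "'a sp"
    using dl[of 0 0 a] dr[of a 0 0] by simp_all
  show "a * b * c = a * (b * c)"
  proof (induction a rule: sp_induct)
    case (monom M x)
    show ?case
    proof (induction b rule: sp_induct)
      case (monom N y)
      show ?case
      proof (induction c rule: sp_induct)
        case (monom L w)
        show ?case
        proof (cases "reduced (M + N) \<and> reduced (N + L)")
          case True
          then have "monom M x * monom N y * monom L w
            = monom (M + N + L) (mon_sign M N * mon_sign (M + N) L * (x * y * w))"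
            using \<open>reduced M\<close> \<open>reduced N\<close> \<open>reduced L\<close> by (simp add: monom_mult ac_simps)
          also have "\<dots> = monom M x * (monom N y * monom L w)"
            using True \<open>reduced M\<close> \<open>reduced N\<close> \<open>reduced L\<close>
            by (simp add: mon_sign_assoc monom_mult ac_simps)
          finally show ?thesis .
        next
          case False
          have "monom (M + N + L) c = 0" for c :: 'a
            using False by (intro monom_not_reduced) (auto simp: reduced_add_iff odd_keys_add)
          moreover have "monom (M + N) c * monom L w = 0" if "\<not> reduced (M + N)" for c :: 'a
            using that z by (simp add: monom_not_reduced)
          moreover have "monom M x * monom (N + L) c = 0" if "\<not> reduced (N + L)" for c :: 'a
            using that z by (simp add: monom_not_reduced)
          ultimately show ?thesis
            using \<open>reduced M\<close> \<open>reduced N\<close> \<open>reduced L\<close>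
            by (cases "reduced (M + N)"; cases "reduced (N + L)") (simp_all add: monom_mult add.assoc)
        qed
      qed (simp add: dr)
    qed (simp add: dl dr)
  qed (simp add: dl)
  show "1 * a = a"
    by (induction a rule: sp_induct) (simp_all add: one_sp_def monom_mult dr)
  show "a * 1 = a"
    by (induction a rule: sp_induct) (simp_all add: one_sp_def monom_mult dl)
  have "coef (1 :: 'a sp) 0 = 1" by (simp add: one_sp_def coef_monom)
  then show "(0 :: 'a sp) \<noteq> 1" by (metis coef_simps(4) zero_neq_one)
qed

end

definition linear_ext :: "(gmon \<Rightarrow> 's \<Rightarrow> 'b) \<Rightarrow> 's::comm_ring_1 sp \<Rightarrow> 'b::comm_monoid_add" where
  "linear_ext g x = (\<Sum>M\<in>mons x. g M (coef x M))"

lemma linear_ext_superset: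
  assumes "finite A" "mons x \<subseteq> A" "\<And>M. g M 0 = 0"
  shows "linear_ext g x = (\<Sum>M\<in>A. g M (coef x M))"
  unfolding linear_ext_def using assms by (intro sum.mono_neutral_left) (auto simp: mons_iff)

lemma linear_ext_add:
  assumes "\<And>M c d. g M (c + d) = g M c + g M d" "\<And>M. g M 0 = 0"
  shows "linear_ext g (x + y) = linear_ext g x + linear_ext g y"
proof -
  let ?A = "mons x \<union> mons y"
  have "mons (x + y) \<subseteq> ?A" by (auto simp: mons_iff)
  then show ?thesis
    by (simp add: linear_ext_superset[where A = ?A and g = g] assms sum.distrib)
qed

lemma linear_ext_monom:
  assumes "\<And>M. g M 0 = 0" "reduced M"
  shows "linear_ext g (monom M c) = g M c"
  using assms by (subst linear_ext_superset[where A = "{M}"]) (auto simp: mons_iff coef_monom split: if_splits)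

definition unit_mon :: "gvar \<Rightarrow> gmon" where
  "unit_mon v = Poly_Mapping.single v 1"

lemma lookup_unit_mon [simp]: "Poly_Mapping.lookup (unit_mon v) u = (if u = v then 1 else 0)"
  by (auto simp: unit_mon_def lookup_single)

lemma keys_unit_mon [simp]: "Poly_Mapping.keys (unit_mon v) = {v}"
  by (simp add: unit_mon_def)

lemma odd_keys_unit: "odd_keys (unit_mon v) = (if odd (fst v) then {v} else {})"
  by (auto simp: odd_keys_def)

lemma reduced_unit: "reduced (unit_mon v)"
  by (simp add: reduced_def)

definition vr :: "gvar \<Rightarrow> 's::comm_ring_1 sp" where
  "vr v = monom (unit_mon v) 1"

definition cst :: "'s::comm_ring_1 \<Rightarrow> 's sp" where
  "cst s = monom 0 s"

lemma unit_mon_split: "v \<in> Poly_Mapping.keys M \<Longrightarrow> M - unit_mon v + unit_mon v = M"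
  by (rule poly_mapping_eqI) (auto simp: lookup_add lookup_minus in_keys_iff)

definition wtm :: "(gvar \<Rightarrow> int) \<Rightarrow> gmon \<Rightarrow> int" where
  "wtm wt M = (\<Sum>v\<in>Poly_Mapping.keys M. wt v * int (Poly_Mapping.lookup M v))"

lemma wtm_0 [simp]: "wtm wt 0 = 0"
  by (simp add: wtm_def)

lemma wtm_superset:
  "finite A \<Longrightarrow> Poly_Mapping.keys M \<subseteq> A \<Longrightarrow> wtm wt M = (\<Sum>v\<in>A. wt v * int (Poly_Mapping.lookup M v))"
  unfolding wtm_def by (intro sum.mono_neutral_left) (auto simp: in_keys_iff)

lemma wtm_add: "wtm wt (M + N) = wtm wt M + wtm wt N"
  by (simp add: wtm_superset[where A = "Poly_Mapping.keys M \<union> Poly_Mapping.keys N"]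
      keys_add_nat lookup_add algebra_simps sum.distrib)

lemma wtm_unit [simp]: "wtm wt (unit_mon v) = wt v"
  by (simp add: wtm_def)

lemma wtm_nonneg: "(\<And>v. v \<in> Poly_Mapping.keys M \<Longrightarrow> wt v \<ge> 0) \<Longrightarrow> wtm wt M \<ge> 0"
  by (simp add: wtm_def sum_nonneg)

text \<open>A monomial is built by splitting off one variable at a time on the right, by induction
  on the total exponent.\<close>

lemma sp_gen_induct [consumes 1, case_names cst vr add mult]:
  assumes "mons x \<subseteq> {M. Poly_Mapping.keys M \<subseteq> V}"
    and cst: "\<And>s. P (cst s)" and vr: "\<And>v. v \<in> V \<Longrightarrow> P (vr v)"
    and add: "\<And>x y. P x \<Longrightarrow> P y \<Longrightarrow> P (x + y)"
    and mult: "\<And>x y. P x \<Longrightarrow> P y \<Longrightarrow> P (x * y)"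
  shows "P (x :: 's::comm_ring_1 sp)"
proof -
  have mon: "reduced M \<Longrightarrow> Poly_Mapping.keys M \<subseteq> V \<Longrightarrow> P (monom M c)" for M c
  proof (induction "nat (wtm (\<lambda>_. 1) M)" arbitrary: M c rule: less_induct)
    case less
    show ?case
    proof (cases "M = 0")
      case True
      then show ?thesis using cst by (simp add: cst_def)
    next
      case False
      then obtain v where v: "v \<in> Poly_Mapping.keys M" by (metis ex_in_conv keys_eq_empty)
      define M' where "M' = M - unit_mon v"
      have M: "M = M' + unit_mon v" by (simp add: M'_def unit_mon_split v)
      have red: "reduced M'" "odd_keys M' \<inter> odd_keys (unit_mon v) = {}" and sub: "Poly_Mapping.keys M' \<subseteq> V"
        using less.prems by (auto simp: M reduced_add_iff keys_add_nat)
      have "wtm (\<lambda>_. 1) M' \<ge> 0" by (rule wtm_nonneg) simp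
      \<comment> \<open>The coefficient carries the reordering sign in advance; the multiplication
        by \<open>vr v\<close> produces it a second time and it squares to 1.\<close>
      then have "P (monom M' (mon_sign M' (unit_mon v) * c))"
        using red sub by (intro less.hyps) (auto simp: M wtm_add)
      moreover have "P (vr v)" using v less.prems by (intro vr) auto
      ultimately have "P (monom M' (mon_sign M' (unit_mon v) * c) * vr v)" by (rule mult)
      also have "monom M' (mon_sign M' (unit_mon v) * c) * vr v
        = monom M ((mon_sign M' (unit_mon v) * mon_sign M' (unit_mon v)) * c)"
        unfolding vr_def using red by (simp add: monom_mult reduced_unit M ac_simps)
      finally show ?thesis using red by (simp add: mon_sign_square)
    qed
  qed
  have "P (\<Sum>M\<in>A. monom M (coef x M))" if "finite A" "A \<subseteq> mons x" for A
    using that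
  proof (induction A)
    case empty
    then show ?case using cst[of 0] by (simp add: cst_def)
  next
    case (insert M A)
    then have "P (monom M (coef x M))"
      using assms(1) by (intro mon mons_reduced) auto
    then show ?case using insert add by simp
  qed
  then show ?thesis using monom_expansion[of x] by (metis finite_mons order_refl)
qed

lemmas sp_induct_gens [case_names cst vr add mult] = sp_gen_induct[where V = UNIV, simplified]

subsection \<open>Parity involution and derivations\<close>

definition ep :: "'s::comm_ring_1 sp \<Rightarrow> 's sp" where
  "ep = linear_ext (\<lambda>M c. monom M ((-1) ^ card (odd_keys M) * c))"

text \<open>The number of odd variables that \<open>v\<close> passes on its way to the front of
  \<open>M\<close>, which is the sign exponent of the left derivative \<open>dvar\<close>. An even
  \<open>v\<close> moves freely.\<close>

definition below :: "gvar \<Rightarrow> gmon \<Rightarrow> nat" where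
  "below v M = (if odd (fst v) then card {u \<in> odd_keys M. u < v} else 0)"

definition dvar :: "gvar \<Rightarrow> 's::comm_ring_1 sp \<Rightarrow> 's sp" where
  "dvar v = linear_ext (\<lambda>M c. if v \<in> Poly_Mapping.keys M then
     monom (M - unit_mon v) (of_nat (Poly_Mapping.lookup M v) * (-1) ^ below v M * c) else 0)"

definition dcoef :: "('s \<Rightarrow> 's) \<Rightarrow> 's::comm_ring_1 sp \<Rightarrow> 's sp" where
  "dcoef d = linear_ext (\<lambda>M c. monom M (d c))"

definition derivation :: "('s \<Rightarrow> 's) \<Rightarrow> 's::comm_ring_1 itself \<Rightarrow> bool" where
  "derivation d _ \<longleftrightarrow> (\<forall>a b. d (a + b) = d a + d b) \<and> (\<forall>a b. d (a * b) = a * d b + b * d a)"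

lemma derivationD:
  assumes "derivation d TYPE('s::comm_ring_1)"
  shows "d (a + b) = d a + d b" "d (a * b) = a * d b + b * d a" "d 0 = (0::'s)" "d (- a) = - d a"
    "d 1 = 0"
proof -
  show add: "d (a + b) = d a + d b" for a b
    using assms by (simp add: derivation_def)
  show mult: "d (a * b) = a * d b + b * d a" for a b
    using assms by (simp add: derivation_def)
  show 0: "d 0 = 0" using add[of 0 0] by simp
  show "d (- a) = - d a" using add[of a "- a"] 0 by (simp add: eq_neg_iff_add_eq_0 add.commute)
  show "d 1 = 0" using mult[of 1 1] by simp
qed

lemma ep_add: "ep (x + y) = ep x + ep y"
  unfolding ep_def by (rule linear_ext_add) (simp_all add: monom_add distrib_left)

lemma dvar_add: "dvar v (x + y) = dvar v x + dvar v y"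
  unfolding dvar_def by (rule linear_ext_add) (simp_all add: monom_add distrib_left)

lemma dcoef_add: "derivation d TYPE('s) \<Longrightarrow> dcoef d (x + y) = dcoef d x + dcoef d (y :: 's::comm_ring_1 sp)"
  unfolding dcoef_def by (rule linear_ext_add) (simp_all add: monom_add derivationD)

lemma ep_monom: "ep (monom M c) = monom M ((-1) ^ card (odd_keys M) * c)"
proof (cases "reduced M")
  case True
  then show ?thesis unfolding ep_def by (subst linear_ext_monom) auto
next
  case False
  then show ?thesis using ep_add[of 0 0] by (simp add: monom_not_reduced)
qed

lemma dvar_monom:
  assumes "reduced M"
  shows "dvar v (monom M c) = (if v \<in> Poly_Mapping.keys M then
     monom (M - unit_mon v) (of_nat (Poly_Mapping.lookup M v) * (-1) ^ below v M * c) else 0)"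
  unfolding dvar_def using assms by (subst linear_ext_monom) auto

lemma dvar_monom_add:
  assumes "reduced (M + unit_mon v)"
  shows "dvar v (monom (M + unit_mon v) c)
    = monom M (of_nat (Poly_Mapping.lookup M v + 1) * (-1) ^ below v M * c)"
proof -
  have "{u \<in> odd_keys (M + unit_mon v). u < v} = {u \<in> odd_keys M. u < v}"
    by (auto simp: odd_keys_add odd_keys_unit split: if_splits)
  then have "below v (M + unit_mon v) = below v M" by (simp add: below_def)
  moreover have "v \<in> Poly_Mapping.keys (M + unit_mon v)" by (simp add: keys_add_nat)
  ultimately show ?thesis
    using assms by (simp add: dvar_monom lookup_add)
qed

lemma dvar_monom_notin: "v \<notin> Poly_Mapping.keys M \<Longrightarrow> dvar v (monom M c) = 0"
  using dvar_add[of v 0 0] by (cases "reduced M") (simp_all add: dvar_monom monom_not_reduced)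

lemma dcoef_monom: "derivation d TYPE('s) \<Longrightarrow> dcoef d (monom M c) = monom M (d (c::'s::comm_ring_1))"
proof (cases "reduced M")
  case True
  moreover assume "derivation d TYPE('s)"
  ultimately show ?thesis unfolding dcoef_def by (subst linear_ext_monom) (auto simp: derivationD)
next
  case False
  moreover assume "derivation d TYPE('s)"
  ultimately show ?thesis using dcoef_add[of d 0 0] by (simp add: monom_not_reduced)
qed

lemma ep_0 [simp]: "ep 0 = 0" using ep_add[of 0 0] by simp
lemma dvar_0 [simp]: "dvar v 0 = 0" using dvar_add[of v 0 0] by simp

lemma ep_minus: "ep (- x) = - ep x"
  using ep_add[of x "- x"] by (simp add: eq_neg_iff_add_eq_0 add.commute)

lemma dvar_minus: "dvar v (- x) = - dvar v x"
  using dvar_add[of v x "- x"] by (simp add: eq_neg_iff_add_eq_0 add.commute)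

lemma ep_ep [simp]: "ep (ep x) = x"
  by (induction x rule: sp_induct) (simp_all add: ep_monom ep_add minus_one_power_iff monom_minus)

lemma ep_mult: "ep (x * y) = ep x * ep y"
proof (induction x rule: sp_induct)
  case (monom M a)
  show ?case
  proof (induction y rule: sp_induct)
    case (monom N b)
    show ?case
    proof (cases "odd_keys M \<inter> odd_keys N = {}")
      case True
      then have "card (odd_keys (M + N)) = card (odd_keys M) + card (odd_keys N)"
        by (simp add: odd_keys_add card_Un_disjoint)
      then show ?thesis
        using \<open>reduced M\<close> \<open>reduced N\<close> by (simp add: monom_mult ep_monom power_add ac_simps)
    next
      case False
      then show ?thesis
        using \<open>reduced M\<close> \<open>reduced N\<close> by (simp add: monom_mult ep_monom mon_sign_alt)
    qed
  qed (simp add: ep_add distrib_left)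
qed (simp add: ep_add distrib_right)

lemma coef_ep: "coef (ep x) M = (-1) ^ card (odd_keys M) * coef x M"
  by (induction x rule: sp_induct) (simp_all add: ep_monom ep_add coef_monom distrib_left)

lemma sp_super_commute:
  assumes "ep x = sg p x" "ep y = sg q y" and tf: "\<And>c::'s. c + c = 0 \<Longrightarrow> c = 0"
  shows "x * y = sg (p \<and> q) (y * (x :: 's::comm_ring_1 sp))"
proof -
  \<comment> \<open>A coefficient at a monomial of the wrong parity would equal its own negative;
    here the absence of 2-torsion enters.\<close>
  have par: "odd (card (odd_keys M)) = r" if "ep z = sg r z" "M \<in> mons z" for r M and z :: "'s sp"
  proof (rule ccontr)
    assume "odd (card (odd_keys M)) \<noteq> r"
    moreover have "(-1) ^ card (odd_keys M) * coef z M = sg r (coef z M)"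
      using that(1) coef_ep[of z M] by (cases r) auto
    ultimately have "coef z M + coef z M = 0"
      by (cases r) (auto simp: minus_one_power_iff eq_neg_iff_add_eq_0)
    then show False using tf that(2) by (auto simp: mons_iff)
  qed
  have "monom M (coef x M) * monom N (coef y N) = sg (p \<and> q) (monom N (coef y N) * monom M (coef x M))"
    if "M \<in> mons x" "N \<in> mons y" for M N
  proof -
    have "mon_sign M N * (coef x M * coef y N) = sg (p \<and> q) (mon_sign N M * (coef y N * coef x M))"
      using par[OF assms(1) that(1)] par[OF assms(2) that(2)]
      by (subst mon_sign_commute) (auto simp: minus_one_power_iff sg_def ac_simps)
    moreover have "monom K (sg r c) = sg r (monom K c)" for K r and c :: 's
      by (simp add: sg_def monom_minus)
    ultimately show ?thesis
      using mons_reduced[OF that(1)] mons_reduced[OF that(2)]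
      by (simp add: monom_mult add.commute)
  qed
  then have "(\<Sum>M\<in>mons x. \<Sum>N\<in>mons y. monom M (coef x M) * monom N (coef y N))
    = (\<Sum>M\<in>mons x. \<Sum>N\<in>mons y. sg (p \<and> q) (monom N (coef y N) * monom M (coef x M)))"
    by (intro sum.cong refl) auto
  also have "\<dots> = sg (p \<and> q) (\<Sum>N\<in>mons y. \<Sum>M\<in>mons x. monom N (coef y N) * monom M (coef x M))"
    by (subst sum.swap) (simp add: sg_sum)
  finally show ?thesis
    by (simp flip: sum_product monom_expansion)
qed

lemma dvar_ep: "dvar v (ep x) = sg (odd (fst v)) (ep (dvar v x))"
proof (induction x rule: sp_induct)
  case (monom M c)
  show ?case
  proof (cases "v \<in> Poly_Mapping.keys M")
    case True
    define M' where "M' = M - unit_mon v"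
    have M: "M = M' + unit_mon v" by (simp add: M'_def unit_mon_split True)
    have "card (odd_keys M) = card (odd_keys M') + (if odd (fst v) then 1 else 0)"
      using \<open>reduced M\<close> unfolding M reduced_add_iff
      by (auto simp: odd_keys_add odd_keys_unit)
    then show ?thesis
      using \<open>reduced M\<close> unfolding M
      by (simp add: ep_monom dvar_monom_add ac_simps monom_minus)
  qed (simp add: dvar_monom_notin ep_monom)
qed (simp add: ep_add dvar_add sg_add)

lemma dcoef_ep:
  "derivation d TYPE('s) \<Longrightarrow> dcoef d (ep x) = ep (dcoef d (x :: 's::comm_ring_1 sp))"
  by (induction x rule: sp_induct)
     (simp_all add: ep_monom ep_add dcoef_add dcoef_monom minus_one_power_iff derivationD)

lemma dcoef_mult:
  assumes d: "derivation d TYPE('s)"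
  shows "dcoef d (x * y) = dcoef d x * y + x * dcoef d (y :: 's::comm_ring_1 sp)"
proof (induction x rule: sp_induct)
  case (monom M a)
  show ?case
  proof (induction y rule: sp_induct)
    case (monom N b)
    show ?case
      using \<open>reduced M\<close> \<open>reduced N\<close>
      by (simp add: monom_mult dcoef_monom d mon_sign_alt minus_one_power_iff derivationD[OF d]
          monom_add[symmetric] monom_minus algebra_simps)
  qed (simp add: dcoef_add d distrib_left add_ac)
qed (simp add: dcoef_add d distrib_right add_ac)

lemma below_add:
  assumes "odd_keys M \<inter> odd_keys N = {}"
  shows "below v (M + N) = below v M + below v N"
proof -
  have "{u \<in> odd_keys (M + N). u < v} = {u \<in> odd_keys M. u < v} \<union> {u \<in> odd_keys N. u < v}"
    by (auto simp: odd_keys_add)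
  then show ?thesis
    using assms by (simp add: below_def, subst card_Un_disjoint) auto
qed

lemma crossings_unit_left: "crossings (odd_keys (unit_mon v)) (odd_keys N) = below v N"
  by (simp add: odd_keys_unit crossings_singleton_left below_def)

text \<open>The odd variables of \<open>M\<close> above \<open>v\<close> are crossed when
  \<open>v\<close> stands to the right of \<open>M\<close>; those below \<open>v\<close> are counted
  by \<open>below\<close>.\<close>

lemma crossings_unit_right:
  assumes "odd_keys M \<inter> odd_keys (unit_mon v) = {}"
  shows "crossings (odd_keys M) (odd_keys (unit_mon v)) + below v M
    = (if odd (fst v) then card (odd_keys M) else 0)"
  using crossings_flip[OF finite_odd_keys finite_odd_keys assms] crossings_unit_left[of v M]
  by (auto simp: odd_keys_unit)

text \<open>On monomials this is a count of crossings, split by the factors in which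
  \<open>v\<close> occurs. If an odd \<open>v\<close> occurs in both, the product is zero and the
  two terms on the right cancel; if an even \<open>v\<close> does, its exponents add up.\<close>

lemma dvar_mult:
  "dvar v (x * y) = dvar v x * y + (if odd (fst v) then ep x else x) * dvar v y"
proof (induction x rule: sp_induct)
  case (monom M a)
  note M_red = \<open>reduced M\<close>
  show ?case
  proof (induction y rule: sp_induct)
    case (monom N b)
    note N_red = \<open>reduced N\<close>
    define e where "e = unit_mon v"
    have ep_M: "(if odd (fst v) then ep (monom M a) else monom M a)
      = monom M ((-1) ^ (if odd (fst v) then card (odd_keys M) else 0) * a)"
      by (simp add: ep_monom)
    have split: "\<exists>K'. K = K' + e" if "v \<in> Poly_Mapping.keys K" for K
      using unit_mon_split[OF that] unfolding e_def by metis
    have left: "dvar v (monom M a) * monom N b =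
      monom (M' + N) (of_nat (Poly_Mapping.lookup M' v + 1) * (-1) ^ below v M' * mon_sign M' N * (a * b))"
      if "M = M' + e" for M'
    proof -
      have 1: "reduced (M' + unit_mon v)" using M_red that by (simp add: e_def)
      then have "reduced M'" by (simp add: reduced_add_iff)
      then show ?thesis
        unfolding that e_def dvar_monom_add[OF 1] using N_red by (simp add: monom_mult ac_simps)
    qed
    have right: "(if odd (fst v) then ep (monom M a) else monom M a) * dvar v (monom N b) =
      monom (M + N') (of_nat (Poly_Mapping.lookup N' v + 1) * (-1) ^ below v N'
        * (-1) ^ (if odd (fst v) then card (odd_keys M) else 0) * mon_sign M N' * (a * b))"
      if "N = N' + e" for N'
    proof -
      have 1: "reduced (N' + unit_mon v)" using N_red that by (simp add: e_def)
      then have "reduced N'" by (simp add: reduced_add_iff)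
      then show ?thesis
        unfolding ep_M that e_def dvar_monom_add[OF 1] using M_red
        by (simp only: monom_mult) (simp add: ac_simps)
    qed
    consider (none) "v \<notin> Poly_Mapping.keys M" "v \<notin> Poly_Mapping.keys N"
      | (l) M' where "M = M' + e" "v \<notin> Poly_Mapping.keys N"
      | (r) N' where "N = N' + e" "v \<notin> Poly_Mapping.keys M"
      | (both) M' N' where "M = M' + e" "N = N' + e"
      using split[of M] split[of N] by metis
    then show ?case
    proof cases
      case none
      then show ?thesis
        using M_red N_red by (simp add: monom_mult dvar_monom_notin keys_add_nat)
    next
      case l
      have R: "dvar v (monom N b) = 0" using l by (simp add: dvar_monom_notin)
      have vN: "odd_keys e \<inter> odd_keys N = {}"
        using l by (auto simp: e_def odd_keys_def)
      have Me: "odd_keys M' \<inter> odd_keys e = {}" using M_red l by (simp add: reduced_add_iff)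
      show ?thesis
      proof (cases "odd_keys M' \<inter> odd_keys N = {}")
        case True
        have red: "reduced (M' + N + e)"
          using M_red N_red l True vN by (auto simp: reduced_add_iff odd_keys_add)
        have "crossings (odd_keys M) (odd_keys N) = crossings (odd_keys M') (odd_keys N) + below v N"
          using Me unfolding l(1) odd_keys_add
          by (simp add: crossings_Un_left crossings_unit_left e_def)
        then have "even (crossings (odd_keys M) (odd_keys N))
          \<longleftrightarrow> even (crossings (odd_keys M') (odd_keys N) + below v N)" by (rule arg_cong)
        then have "even (below v (M' + N) + crossings (odd_keys M) (odd_keys N))
          \<longleftrightarrow> even (below v M' + crossings (odd_keys M') (odd_keys N))"
          unfolding below_add[OF True] even_add by argo
        then have sgn: "(-1) ^ below v (M' + N) * mon_sign M N = ((-1) ^ below v M' * mon_sign M' N :: 'a)"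
          using True vN by (auto simp: mon_sign_alt l odd_keys_add Int_Un_distrib2 minus_one_power_iff)
        have MN: "M + N = M' + N + e" by (simp add: l add.assoc add.commute add.left_commute)
        have "dvar v (monom M a * monom N b) = dvar v (monom (M' + N + e) (mon_sign M N * (a * b)))"
          using M_red N_red MN by (simp add: monom_mult)
        also have "\<dots> = monom (M' + N) (of_nat (Poly_Mapping.lookup M' v + 1)
            * ((-1) ^ below v (M' + N) * mon_sign M N * (a * b)))"
          using dvar_monom_add[OF red[unfolded e_def]] l
          by (simp add: e_def lookup_add in_keys_iff mult.assoc)
        finally show ?thesis unfolding left[OF l(1)] R sgn by (simp add: mult.assoc)
      next
        case False
        then show ?thesis
          unfolding left[OF l(1)] R using M_red N_red
          by (auto simp: monom_mult mon_sign_alt l odd_keys_add Int_Un_distrib2)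
      qed
    next
      case r
      have L: "dvar v (monom M a) = 0" using r by (simp add: dvar_monom_notin)
      have vM: "odd_keys M \<inter> odd_keys e = {}"
        using r by (auto simp: e_def odd_keys_def)
      have Ne: "odd_keys N' \<inter> odd_keys e = {}" using N_red r by (simp add: reduced_add_iff)
      show ?thesis
      proof (cases "odd_keys M \<inter> odd_keys N' = {}")
        case True
        have red: "reduced (M + N' + e)"
          using M_red N_red r True vM by (auto simp: reduced_add_iff odd_keys_add)
        have "crossings (odd_keys M) (odd_keys N) + below v M
          = crossings (odd_keys M) (odd_keys N') + (if odd (fst v) then card (odd_keys M) else 0)"
          using Ne crossings_unit_right[OF vM[unfolded e_def]] unfolding r(1) odd_keys_add
          by (simp add: crossings_Un_right e_def)
        then have "even (crossings (odd_keys M) (odd_keys N) + below v M)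
          \<longleftrightarrow> even (crossings (odd_keys M) (odd_keys N') + (if odd (fst v) then card (odd_keys M) else 0))"
          by (rule arg_cong)
        then have "even (below v (M + N') + crossings (odd_keys M) (odd_keys N))
          \<longleftrightarrow> even (below v N' + (if odd (fst v) then card (odd_keys M) else 0) + crossings (odd_keys M) (odd_keys N'))"
          unfolding below_add[OF True] even_add by argo
        then have sgn: "(-1) ^ below v (M + N') * mon_sign M N
          = ((-1) ^ below v N' * (-1) ^ (if odd (fst v) then card (odd_keys M) else 0) * mon_sign M N' :: 'a)"
          using True vM by (auto simp: mon_sign_alt r odd_keys_add Int_Un_distrib minus_one_power_iff)
        have MN: "M + N = M + N' + e" by (simp add: r add.assoc)
        have "dvar v (monom M a * monom N b) = dvar v (monom (M + N' + e) (mon_sign M N * (a * b)))"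
          using M_red N_red MN by (simp add: monom_mult)
        also have "\<dots> = monom (M + N') (of_nat (Poly_Mapping.lookup N' v + 1)
            * ((-1) ^ below v (M + N') * mon_sign M N * (a * b)))"
          using dvar_monom_add[OF red[unfolded e_def]] r
          by (simp add: e_def lookup_add in_keys_iff mult.assoc)
        finally show ?thesis unfolding right[OF r(1)] L sgn by (simp add: mult.assoc)
      next
        case False
        then show ?thesis
          unfolding right[OF r(1)] L using M_red N_red
          by (auto simp: monom_mult mon_sign_alt r odd_keys_add Int_Un_distrib)
      qed
    next
      case both
      have swap: "M + N' = M' + N" by (simp add: both ac_simps)
      show ?thesis
      proof (cases "odd (fst v)")
        case True
        have oe: "odd_keys e = {v}" using True by (simp add: e_def odd_keys_unit)
        have Me: "odd_keys M' \<inter> odd_keys e = {}" and Ne: "odd_keys N' \<inter> odd_keys e = {}"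
          using M_red N_red both by (simp_all add: reduced_add_iff)
        have "mon_sign M N = (0 :: 'a)" by (simp add: mon_sign_alt both odd_keys_add oe)
        then have "dvar v (monom M a * monom N b) = 0"
          using M_red N_red by (simp add: monom_mult)
        moreover have "v \<notin> odd_keys M'" "v \<notin> odd_keys N'"
          using Me Ne by (simp_all add: oe)
        then have "Poly_Mapping.lookup M' v = 0" "Poly_Mapping.lookup N' v = 0"
          using True by (simp_all add: odd_keys_def in_keys_iff)
        \<comment> \<open>Up to even contributions the two exponents are
          \<open>card (odd_keys M')\<close> and \<open>card (odd_keys M)\<close> plus a common term,
          and these cardinalities differ by the variable \<open>v\<close> itself.\<close>
        moreover have "(-1) ^ below v M' * mon_sign M' N
          = - ((-1) ^ below v N' * (-1) ^ card (odd_keys M) * mon_sign M N' :: 'a)"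
        proof (cases "odd_keys M' \<inter> odd_keys N' = {}")
          case disj: True
          have "crossings (odd_keys M') (odd_keys N) = crossings (odd_keys M') (odd_keys N') + crossings (odd_keys M') (odd_keys e)"
            using Ne by (simp add: both odd_keys_add crossings_Un_right)
          moreover have "crossings (odd_keys M) (odd_keys N') = crossings (odd_keys M') (odd_keys N') + crossings (odd_keys e) (odd_keys N')"
            using Me by (simp add: both odd_keys_add crossings_Un_left)
          moreover have "card (odd_keys M) = card (odd_keys M') + 1"
            using Me by (simp add: both odd_keys_add oe)
          moreover have "crossings (odd_keys M') (odd_keys e) + below v M' = card (odd_keys M')"
            using crossings_unit_right[OF Me[unfolded e_def]] True by (simp add: e_def)
          moreover have "crossings (odd_keys e) (odd_keys N') = below v N'"
            by (simp add: e_def crossings_unit_left)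
          ultimately have "even (below v M' + crossings (odd_keys M') (odd_keys N))
            \<longleftrightarrow> odd (below v N' + card (odd_keys M) + crossings (odd_keys M) (odd_keys N'))"
            by presburger
          moreover have "odd_keys M' \<inter> odd_keys N = {}" "odd_keys M \<inter> odd_keys N' = {}"
            using Me Ne disj by (auto simp: both odd_keys_add)
          ultimately show ?thesis by (auto simp: mon_sign_alt minus_one_power_iff)
        next
          case False
          then show ?thesis by (auto simp: mon_sign_alt both odd_keys_add Int_Un_distrib Int_Un_distrib2)
        qed
        ultimately show ?thesis
          using True unfolding left[OF both(1)] right[OF both(2)] swap
          by (simp add: monom_minus)
      next
        case False
        have oe: "odd_keys e = {}" using False by (simp add: e_def odd_keys_unit)
        have ms: "mon_sign M N = (mon_sign M' N :: 'a)" "mon_sign M N' = (mon_sign M' N :: 'a)"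
          by (simp_all add: mon_sign_alt both odd_keys_add oe)
        have MN: "M + N = M' + N + e" by (simp add: both ac_simps)
        have red: "reduced (M' + N + e)" if "odd_keys M' \<inter> odd_keys N = {}"
          using M_red N_red that by (simp add: reduced_add_iff both oe odd_keys_add)
        have lk: "Poly_Mapping.lookup (M' + N) v + 1 = (Poly_Mapping.lookup M' v + 1) + (Poly_Mapping.lookup N' v + 1)"
          by (simp add: lookup_add both e_def)
        have b: "below v K = 0" for K using False by (simp add: below_def)
        show ?thesis
        proof (cases "odd_keys M' \<inter> odd_keys N = {}")
          case True
          have "dvar v (monom M a * monom N b) = monom (M' + N) (of_nat (Poly_Mapping.lookup (M' + N) v + 1) * (mon_sign M' N * (a * b)))"
            using M_red N_red dvar_monom_add[OF red[OF True, unfolded e_def]]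
            by (simp add: monom_mult MN e_def b ms[unfolded MN])
          then show ?thesis
            using False unfolding left[OF both(1)] right[OF both(2)] swap lk
            by (simp add: b ms monom_add[symmetric] algebra_simps)
        next
          case False
          then have "mon_sign M' N = (0 :: 'a)" by (simp add: mon_sign_alt)
          then show ?thesis
            unfolding left[OF both(1)] right[OF both(2)] using M_red N_red by (simp add: ms monom_mult)
        qed
      qed
    qed
  qed (simp add: dvar_add distrib_left add_ac)
qed (simp add: dvar_add ep_add distrib_right add_ac)

lemma cst_0 [simp]: "cst 0 = 0" and cst_1: "cst 1 = 1"
  by (simp_all add: cst_def one_sp_def)

lemma cst_add: "cst (a + b) = cst a + cst b" and cst_mult: "cst (a * b) = cst a * cst b"
  and cst_minus: "cst (- a) = - cst a"
  by (simp_all add: cst_def monom_add monom_mult monom_minus)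

lemma cst_sum: "cst (sum f A) = (\<Sum>i\<in>A. cst (f i))"
  by (induction A rule: infinite_finite_induct) (auto simp: cst_add)

lemma ep_cst [simp]: "ep (cst s) = cst s"
  by (simp add: cst_def ep_monom)

lemma ep_vr: "ep (vr v) = sg (odd (fst v)) (vr v)"
  by (simp add: vr_def ep_monom odd_keys_unit monom_minus)

lemma dvar_cst [simp]: "dvar v (cst s) = 0"
  by (simp add: cst_def dvar_monom_notin)

lemma dvar_1 [simp]: "dvar v 1 = 0"
  using dvar_cst[of v 1] by (simp add: cst_1)

lemma dvar_vr: "dvar v (vr w) = (if v = w then 1 else 0)"
  using dvar_monom_add[of 0 v 1] by (auto simp: vr_def dvar_monom_notin reduced_unit one_sp_def below_def)

lemma dcoef_cst: "derivation d TYPE('s) \<Longrightarrow> dcoef d (cst s) = cst (d (s::'s::comm_ring_1))"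
  by (simp add: cst_def dcoef_monom)

lemma dcoef_vr: "derivation d TYPE('s) \<Longrightarrow> dcoef d (vr v :: 's::comm_ring_1 sp) = 0"
  by (simp add: vr_def dcoef_monom derivationD)

text \<open>The Leibniz rules of both sides match, which reduces the claim to generators, where
  second derivatives vanish.\<close>

lemma dvar_dvar:
  "dvar u (dvar v x) = sg (odd (fst u) \<and> odd (fst v)) (dvar v (dvar u x))"
proof (induction x rule: sp_induct_gens)
  case (mult x y)
  then show ?case
    by (cases "odd (fst u)"; cases "odd (fst v)")
       (simp_all add: dvar_mult dvar_add dvar_ep dvar_minus ep_minus algebra_simps)
qed (simp_all add: dvar_vr dvar_add sg_add)

lemma dvar_dcoef:
  assumes d: "derivation d TYPE('s)"
  shows "dvar v (dcoef d x) = dcoef d (dvar v (x :: 's::comm_ring_1 sp))"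
proof -
  have d1: "dcoef d 1 = (0 :: 's sp)" "dcoef d 0 = (0 :: 's sp)"
    using dcoef_cst[OF d, of 1] dcoef_cst[OF d, of 0] by (simp_all add: cst_1 derivationD[OF d])
  show ?thesis
  proof (induction x rule: sp_induct_gens)
    case (mult x y)
    then show ?case
      by (cases "odd (fst v)")
         (simp_all add: dvar_mult dcoef_mult dvar_add dcoef_add d dcoef_ep algebra_simps)
  qed (simp_all add: dvar_vr dvar_add dcoef_add dcoef_cst dcoef_vr d d1)
qed

lemma dcoef_dcoef:
  assumes d: "derivation d TYPE('s)" "derivation e TYPE('s)" and "\<And>s. d (e s) = e (d s)"
  shows "dcoef d (dcoef e x) = dcoef e (dcoef d (x :: 's::comm_ring_1 sp))"
  by (induction x rule: sp_induct) (simp_all add: dcoef_monom dcoef_add d assms(3))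

subsection \<open>Gradings\<close>

text \<open>Only closure properties are asked for, with no direct sum. So the same lemmas cover
  coefficients placed in degree 0 (\<open>hw_eq\<close>), the descending filtration by weight
  (\<open>hw_ge\<close>) and the internal degree of polynomials
  (\<open>poly_weight\<close>).\<close>

locale ring_grading =
  fixes hw :: "int \<Rightarrow> 's::comm_ring_1 set"
  assumes hw_0: "0 \<in> hw d"
    and hw_add: "a \<in> hw d \<Longrightarrow> b \<in> hw d \<Longrightarrow> a + b \<in> hw d"
    and hw_minus: "a \<in> hw d \<Longrightarrow> - a \<in> hw d"
    and hw_mult: "a \<in> hw d \<Longrightarrow> b \<in> hw e \<Longrightarrow> a * b \<in> hw (d + e)"
    and hw_1: "1 \<in> hw 0"

definition hg :: "(gvar \<Rightarrow> int) \<Rightarrow> (int \<Rightarrow> 's set) \<Rightarrow> int \<Rightarrow> 's::comm_ring_1 sp set" where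
  "hg wt hw d = {x. \<forall>M. coef x M \<in> hw (d - wtm wt M)}"

context ring_grading
begin

lemma hg_0: "0 \<in> hg wt hw d"
  by (simp add: hg_def hw_0)

lemma hg_add: "x \<in> hg wt hw d \<Longrightarrow> y \<in> hg wt hw d \<Longrightarrow> x + y \<in> hg wt hw d"
  by (simp add: hg_def hw_add)

lemma hg_minus: "x \<in> hg wt hw d \<Longrightarrow> - x \<in> hg wt hw d"
  by (simp add: hg_def hw_minus)

lemma hg_diff: "x \<in> hg wt hw d \<Longrightarrow> y \<in> hg wt hw d \<Longrightarrow> x - y \<in> hg wt hw d"
  using hg_add[of x wt d "- y"] hg_minus by simp

lemma hg_sg: "x \<in> hg wt hw d \<Longrightarrow> sg b x \<in> hg wt hw d"
  by (simp add: sg_def hg_minus)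

lemma hg_sum: "(\<And>i. i \<in> A \<Longrightarrow> f i \<in> hg wt hw d) \<Longrightarrow> sum f A \<in> hg wt hw d"
  by (induction A rule: infinite_finite_induct) (auto intro: hg_0 hg_add)

lemma hg_monom: "c \<in> hw (d - wtm wt M) \<Longrightarrow> monom M c \<in> hg wt hw d"
  by (auto simp: hg_def coef_monom hw_0)

lemma hg_coef: "x \<in> hg wt hw d \<Longrightarrow> coef x M \<in> hw (d - wtm wt M)"
  by (simp add: hg_def)

lemma hw_of_nat_mult: "a \<in> hw d \<Longrightarrow> of_nat n * a \<in> hw d"
  by (induction n) (auto simp: hw_0 distrib_right intro: hw_add)

lemma hw_sign_mult: "a \<in> hw d \<Longrightarrow> (-1) ^ n * a \<in> hw d"
  by (auto simp: minus_one_power_iff hw_minus)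

lemma hw_mon_sign_mult: "a \<in> hw d \<Longrightarrow> mon_sign M N * a \<in> hw d"
  by (auto simp: mon_sign_alt hw_0 intro: hw_sign_mult)

lemma hg_linear_ext:
  assumes "x \<in> hg wt hw d"
    and "\<And>M c. reduced M \<Longrightarrow> c \<in> hw (d - wtm wt M) \<Longrightarrow> g M c \<in> hg wt' hw d'"
  shows "linear_ext g x \<in> hg wt' hw d'"
  unfolding linear_ext_def using assms hg_coef by (intro hg_sum) (blast intro: mons_reduced)

lemma hg_mult:
  assumes "x \<in> hg wt hw d" "y \<in> hg wt hw e"
  shows "x * y \<in> hg wt hw (d + e)"
proof -
  have "monom M (coef x M) * monom N (coef y N) \<in> hg wt hw (d + e)" if "M \<in> mons x" "N \<in> mons y" for M N
  proof -
    have "coef x M * coef y N \<in> hw ((d - wtm wt M) + (e - wtm wt N))"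
      using assms by (intro hw_mult hg_coef)
    then have "mon_sign M N * (coef x M * coef y N) \<in> hw (d + e - wtm wt (M + N))"
      by (intro hw_mon_sign_mult) (simp add: wtm_add algebra_simps)
    then show ?thesis
      using mons_reduced[OF that(1)] mons_reduced[OF that(2)] by (simp add: monom_mult hg_monom)
  qed
  then have "(\<Sum>M\<in>mons x. monom M (coef x M)) * (\<Sum>N\<in>mons y. monom N (coef y N)) \<in> hg wt hw (d + e)"
    unfolding sum_product by (intro hg_sum)
  then show ?thesis by (simp flip: monom_expansion)
qed

lemma hg_cst: "s \<in> hw d \<Longrightarrow> cst s \<in> hg wt hw d"
  by (simp add: cst_def hg_monom)

lemma hg_vr: "vr v \<in> hg wt hw (wt v)"
  by (simp add: vr_def hg_monom hw_1)

lemma hg_ep: "x \<in> hg wt hw d \<Longrightarrow> ep x \<in> hg wt hw d"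
  unfolding ep_def by (erule hg_linear_ext) (intro hg_monom hw_sign_mult)

lemma hg_dvar:
  assumes "x \<in> hg wt hw d"
  shows "dvar v x \<in> hg wt hw (d - wt v)"
  unfolding dvar_def
proof (rule hg_linear_ext[OF assms])
  fix M c assume "reduced M" and c: "c \<in> hw (d - wtm wt M)"
  show "(if v \<in> Poly_Mapping.keys M then monom (M - unit_mon v)
       (of_nat (Poly_Mapping.lookup M v) * (- 1) ^ below v M * c) else 0) \<in> hg wt hw (d - wt v)"
  proof (cases "v \<in> Poly_Mapping.keys M")
    case True
    have "wtm wt M = wtm wt (M - unit_mon v) + wt v"
      using wtm_add[of wt "M - unit_mon v" "unit_mon v"] True by (simp add: unit_mon_split)
    then have "c \<in> hw (d - wt v - wtm wt (M - unit_mon v))" using c by (simp add: algebra_simps)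
    then show ?thesis
      using True by (simp add: mult.assoc hg_monom hw_of_nat_mult hw_sign_mult)
  qed (simp add: hg_0)
qed

lemma hg_dcoef:
  assumes "x \<in> hg wt hw d" "\<And>e s. s \<in> hw e \<Longrightarrow> D s \<in> hw (e - w)"
  shows "dcoef D x \<in> hg wt hw (d - w)"
  unfolding dcoef_def
proof (rule hg_linear_ext[OF assms(1)])
  fix M c assume "c \<in> hw (d - wtm wt M)"
  then have "D c \<in> hw (d - w - wtm wt M)" using assms(2)[of c "d - wtm wt M"] by (simp add: algebra_simps)
  then show "monom M (D c) \<in> hg wt hw (d - w)" by (rule hg_monom)
qed

end

definition hw_eq :: "int \<Rightarrow> 's::comm_ring_1 set" where
  "hw_eq d = (if d = 0 then UNIV else {0})"

definition hw_ge :: "int \<Rightarrow> 's::comm_ring_1 set" where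
  "hw_ge d = (if d \<le> 0 then UNIV else {0})"

interpretation gr_eq: ring_grading hw_eq
  by unfold_locales (auto simp: hw_eq_def split: if_splits)

interpretation gr_ge: ring_grading hw_ge
  by unfold_locales (auto simp: hw_ge_def split: if_splits)

lemma hg_eq_iff: "x \<in> hg wt hw_eq d \<longleftrightarrow> (\<forall>M\<in>mons x. wtm wt M = d)"
  by (auto simp: hg_def hw_eq_def mons_iff)

lemma hg_ge_iff: "x \<in> hg wt hw_ge d \<longleftrightarrow> (\<forall>M\<in>mons x. wtm wt M \<ge> d)"
proof -
  have "coef x M \<in> hw_ge (d - wtm wt M) \<longleftrightarrow> (coef x M \<noteq> 0 \<longrightarrow> d \<le> wtm wt M)" for M
    by (auto simp: hw_ge_def)
  then show ?thesis by (auto simp: hg_def mons_iff)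
qed

lemma hg_ge_mono: "x \<in> hg wt hw_ge d \<Longrightarrow> e \<le> d \<Longrightarrow> x \<in> hg wt hw_ge e"
  by (auto simp: hg_ge_iff)

lemma hg_eq_ge: "x \<in> hg wt hw_eq d \<Longrightarrow> x \<in> hg wt hw_ge d"
  by (auto simp: hg_ge_iff hg_eq_iff)

lemma hg_eq_cst: "cst s \<in> hg wt hw_eq 0"
  by (rule gr_eq.hg_cst) (simp add: hw_eq_def)

definition restr :: "(gmon \<Rightarrow> bool) \<Rightarrow> 's::comm_ring_1 sp \<Rightarrow> 's sp" where
  "restr Q = linear_ext (\<lambda>M c. if Q M then monom M c else 0)"

lemma restr_add: "restr Q (x + y) = restr Q x + restr Q y"
  unfolding restr_def by (rule linear_ext_add) (simp_all add: monom_add)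

lemma restr_monom: "restr Q (monom M c) = (if Q M then monom M c else 0)"
proof (cases "reduced M")
  case True
  then show ?thesis unfolding restr_def by (subst linear_ext_monom) auto
next
  case False
  then show ?thesis using restr_add[of Q 0 0] by (simp add: monom_not_reduced)
qed

lemma coef_restr: "coef (restr Q x) M = (if Q M then coef x M else 0)"
  by (induction x rule: sp_induct) (auto simp: restr_monom restr_add coef_monom)

subsection \<open>Derivatives of ordinary polynomials\<close>

definition kconst :: "'k::comm_ring_1 \<Rightarrow> ('n, 'k) mpoly" where
  "kconst c = Poly_Mapping.single 0 c"

lemma pscale_eq: "pscale c s = kconst c * s"
  by (simp add: pscale_def kconst_def mult_map_scale_conv_mult)

lemma kconst_1: "kconst 1 = 1" by (simp add: kconst_def)

lemma pm_expansion: "s = (\<Sum>m\<in>Poly_Mapping.keys s. Poly_Mapping.single m (Poly_Mapping.lookup s m))"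
  by (rule poly_mapping_eqI) (auto simp: lookup_sum lookup_single when_def in_keys_iff)

lemma pm_induct [case_names single add]:
  assumes "\<And>m c. P (Poly_Mapping.single m c)" "\<And>x y. P x \<Longrightarrow> P y \<Longrightarrow> P (x + y)"
  shows "P (s :: 'a \<Rightarrow>\<^sub>0 'b::comm_monoid_add)"
proof -
  have "P (\<Sum>m\<in>A. Poly_Mapping.single m (Poly_Mapping.lookup s m))" if "finite A" for A
    using that assms(1)[of undefined 0] by (induction A) (simp_all add: assms)
  then have "P (\<Sum>m\<in>Poly_Mapping.keys s. Poly_Mapping.single m (Poly_Mapping.lookup s m))" by simp
  then show ?thesis by (simp flip: pm_expansion)
qed

lemma mpoly_induct [case_names const var add mult]:
  assumes const: "\<And>c. P (kconst c)" and var: "\<And>i. P (pvar i)"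
    and add: "\<And>x y. P x \<Longrightarrow> P y \<Longrightarrow> P (x + y)"
    and mult: "\<And>x y. P x \<Longrightarrow> P y \<Longrightarrow> P (x * y)"
  shows "P (s :: ('n, 'k::comm_ring_1) mpoly)"
proof (induction s rule: pm_induct)
  case (single m c)
  show ?case
  proof (induction "\<Sum>i\<in>Poly_Mapping.keys m. Poly_Mapping.lookup m i" arbitrary: m c rule: less_induct)
    case less
    show ?case
    proof (cases "m = 0")
      case True
      then show ?thesis using const by (simp add: kconst_def)
    next
      case False
      then obtain i where i: "i \<in> Poly_Mapping.keys m" by (metis ex_in_conv keys_eq_empty)
      define e where "e = Poly_Mapping.single i (1::nat)"
      define m' where "m' = m - e"
      have m: "m = m' + e"
        unfolding m'_def e_def by (rule poly_mapping_eqI) (use i in \<open>auto simp: lookup_add lookup_minus lookup_single when_def in_keys_iff\<close>)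
      have sum: "(\<Sum>j\<in>Poly_Mapping.keys m. Poly_Mapping.lookup K j) = (\<Sum>j\<in>Poly_Mapping.keys K. Poly_Mapping.lookup K j)"
        if "Poly_Mapping.keys K \<subseteq> Poly_Mapping.keys m" for K :: "'n \<Rightarrow>\<^sub>0 nat"
        using that by (intro sum.mono_neutral_right) (auto simp: in_keys_iff)
      have "Poly_Mapping.keys m' \<subseteq> Poly_Mapping.keys m" "Poly_Mapping.keys e \<subseteq> Poly_Mapping.keys m"
        by (auto simp: m keys_add_nat)
      then have "(\<Sum>j\<in>Poly_Mapping.keys m. Poly_Mapping.lookup m j)
        = (\<Sum>j\<in>Poly_Mapping.keys m'. Poly_Mapping.lookup m' j) + (\<Sum>j\<in>Poly_Mapping.keys e. Poly_Mapping.lookup e j)"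
        using sum[of m'] sum[of e] by (simp add: m lookup_add sum.distrib)
      then have "P (Poly_Mapping.single m' c)"
        by (intro less) (simp add: e_def)
      from mult[OF this var[of i]] show ?thesis
        by (simp add: pvar_def mult_single m e_def)
    qed
  qed
qed (rule add)

text \<open>Where the exponent of \<open>j\<close> is 0 the truncated subtraction is harmless, since
  the factor \<open>of_nat 0\<close> removes the term.\<close>

definition pd :: "'n \<Rightarrow> ('n, 'k::comm_ring_1) mpoly \<Rightarrow> ('n, 'k) mpoly" where
  "pd j s = (\<Sum>m\<in>Poly_Mapping.keys s. Poly_Mapping.single (m - Poly_Mapping.single j 1)
     (of_nat (Poly_Mapping.lookup m j) * Poly_Mapping.lookup s m))"

lemma pd_superset:
  assumes "finite A" "Poly_Mapping.keys s \<subseteq> A"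
  shows "pd j s = (\<Sum>m\<in>A. Poly_Mapping.single (m - Poly_Mapping.single j 1)
     (of_nat (Poly_Mapping.lookup m j) * Poly_Mapping.lookup s m))"
  unfolding pd_def using assms by (intro sum.mono_neutral_left) (auto simp: in_keys_iff)

lemma pd_add: "pd j (s + t) = pd j s + pd j t"
proof -
  let ?A = "Poly_Mapping.keys s \<union> Poly_Mapping.keys t"
  have "Poly_Mapping.keys (s + t) \<subseteq> ?A" by (rule Poly_Mapping.keys_add)
  then show ?thesis
    by (simp add: pd_superset[where A = ?A] lookup_add distrib_left single_add sum.distrib)
qed

lemma pd_single: "pd j (Poly_Mapping.single m c)
  = Poly_Mapping.single (m - Poly_Mapping.single j 1) (of_nat (Poly_Mapping.lookup m j) * c)"
  by (subst pd_superset[where A = "{m}"]) auto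

lemma pd_mult: "pd j (s * t) = s * pd j t + t * pd j s"
proof (induction s rule: pm_induct)
  case (single m a)
  show ?case
  proof (induction t rule: pm_induct)
    case (single n b)
    let ?e = "Poly_Mapping.single j (1::nat)"
    have "m + n - ?e = m + (n - ?e)" if "Poly_Mapping.lookup n j \<noteq> 0" for m n :: "'a \<Rightarrow>\<^sub>0 nat"
      by (rule poly_mapping_eqI) (use that in \<open>auto simp: lookup_add lookup_minus lookup_single when_def\<close>)
    from this[of n m] this[of m n] show ?case
      by (cases "Poly_Mapping.lookup m j = 0"; cases "Poly_Mapping.lookup n j = 0")
         (simp_all add: pd_single mult_single lookup_add single_add distrib_right distrib_left ac_simps)
  qed (simp add: pd_add algebra_simps)
qed (simp add: pd_add algebra_simps)

lemma derivation_pd: "derivation (pd j) TYPE(('n, 'k::comm_ring_1) mpoly)"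
  by (simp add: derivation_def pd_add pd_mult)

lemma pd_kconst [simp]: "pd j (kconst c) = 0"
  by (simp add: kconst_def pd_single)

lemma pd_pvar: "pd j (pvar i) = (if i = j then 1 else 0)"
  by (auto simp: pvar_def pd_single lookup_single when_def)

lemma pd_0 [simp]: "pd j 0 = 0" and pd_1 [simp]: "pd j 1 = 0"
  by (rule derivationD(3)[OF derivation_pd], rule derivationD(5)[OF derivation_pd])

lemma pd_commute: "pd i (pd j s) = pd j (pd i s)"
  by (induction s rule: mpoly_induct) (auto simp: pd_pvar pd_add pd_mult algebra_simps)

lemma derivation_expand:
  assumes d: "derivation d TYPE(('n::finite, 'k::comm_ring_1) mpoly)" and "\<And>c. d (kconst c) = 0"
  shows "d s = (\<Sum>i\<in>UNIV. d (pvar i) * pd i s)"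
proof (induction s rule: mpoly_induct)
  case (var i)
  have "(\<Sum>j\<in>UNIV. d (pvar j) * pd j (pvar i)) = (\<Sum>j\<in>UNIV. if j = i then d (pvar i) else 0)"
    by (intro sum.cong) (auto simp: pd_pvar)
  then show ?case by simp
next
  case (mult x y)
  then show ?case
    by (simp add: derivationD[OF d] pd_mult sum_distrib_left sum.distrib algebra_simps)
qed (simp_all add: assms derivationD[OF d] pd_add distrib_left sum.distrib)

lemma poly_weight_grading: "ring_grading (poly_weight w :: int \<Rightarrow> ('n::finite, 'k::comm_ring_1) mpoly set)"
proof
  fix a b :: "('n, 'k) mpoly" and d e :: int
  show "0 \<in> poly_weight w d" by (simp add: poly_weight_def)
  show "a \<in> poly_weight w d \<Longrightarrow> b \<in> poly_weight w d \<Longrightarrow> a + b \<in> poly_weight w d"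
    using Poly_Mapping.keys_add[of a b] by (auto simp: poly_weight_def)
  show "a \<in> poly_weight w d \<Longrightarrow> - a \<in> poly_weight w d"
    by (auto simp: poly_weight_def in_keys_iff)
  show "1 \<in> poly_weight w 0" by (simp add: poly_weight_def)
  assume a: "a \<in> poly_weight w d" and b: "b \<in> poly_weight w e"
  show "a * b \<in> poly_weight w (d + e)"
    unfolding poly_weight_def
  proof safe
    fix m assume "m \<in> Poly_Mapping.keys (a * b)"
    then obtain m1 m2 where m: "m = m1 + m2" "m1 \<in> Poly_Mapping.keys a" "m2 \<in> Poly_Mapping.keys b"
      using keys_mult[of a b] by blast
    then have "int (\<Sum>i\<in>UNIV. w i * Poly_Mapping.lookup m1 i) = d" "int (\<Sum>i\<in>UNIV. w i * Poly_Mapping.lookup m2 i) = e"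
      using a b by (auto simp: poly_weight_def)
    then show "int (\<Sum>i\<in>UNIV. w i * Poly_Mapping.lookup m i) = d + e"
      by (simp add: m lookup_add distrib_left sum.distrib)
  qed
qed

lemma poly_weight_pvar: "pvar j \<in> poly_weight w (int (w j))"
proof -
  have "(\<Sum>i\<in>UNIV. w i * Poly_Mapping.lookup (Poly_Mapping.single j 1) i) = (\<Sum>i\<in>UNIV. if i = j then w j else 0)"
    by (intro sum.cong) (auto simp: lookup_single)
  also have "\<dots> = w j" by simp
  finally have "int (\<Sum>i\<in>UNIV. w i * Poly_Mapping.lookup (Poly_Mapping.single j 1) i) = int (w j)"
    by (rule arg_cong)
  then show ?thesis
    unfolding poly_weight_def pvar_def by (simp del: of_nat_sum of_nat_mult)
qed

lemma poly_weight_kconst: "kconst c \<in> poly_weight w 0"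
  by (simp add: poly_weight_def kconst_def)

lemma poly_weight_pd:
  fixes s :: "('n::finite, 'k::comm_ring_1) mpoly"
  assumes "s \<in> poly_weight w d"
  shows "pd j s \<in> poly_weight w (d - int (w j))"
proof -
  interpret ring_grading "poly_weight w :: int \<Rightarrow> ('n, 'k) mpoly set" by (rule poly_weight_grading)
  have sum: "sum f A \<in> poly_weight w e" if "\<And>i. i \<in> A \<Longrightarrow> f i \<in> poly_weight w e"
    for f :: "_ \<Rightarrow> ('n, 'k) mpoly" and A e
    using that by (induction A rule: infinite_finite_induct) (auto intro: hw_0 hw_add)
  show ?thesis
    unfolding pd_def
  proof (rule sum)
    fix m assume m: "m \<in> Poly_Mapping.keys s"
    show "Poly_Mapping.single (m - Poly_Mapping.single j 1) (of_nat (Poly_Mapping.lookup m j) * Poly_Mapping.lookup s m)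
      \<in> poly_weight w (d - int (w j))"
    proof (cases "Poly_Mapping.lookup m j = 0")
      case False
      let ?m = "m - Poly_Mapping.single j 1"
      have "m = ?m + Poly_Mapping.single j 1"
        by (rule poly_mapping_eqI) (use False in \<open>auto simp: lookup_add lookup_minus lookup_single when_def\<close>)
      then have "(\<Sum>i\<in>UNIV. w i * Poly_Mapping.lookup m i)
        = (\<Sum>i\<in>UNIV. w i * Poly_Mapping.lookup ?m i + w i * Poly_Mapping.lookup (Poly_Mapping.single j 1) i)"
        by (metis distrib_left lookup_add)
      also have "\<dots> = (\<Sum>i\<in>UNIV. w i * Poly_Mapping.lookup ?m i) + (\<Sum>i\<in>UNIV. if i = j then w j else 0)"
        unfolding sum.distrib by (intro arg_cong2[of _ _ _ _ "(+)"] sum.cong) (auto simp: lookup_single)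
      finally have "(\<Sum>i\<in>UNIV. w i * Poly_Mapping.lookup m i) = (\<Sum>i\<in>UNIV. w i * Poly_Mapping.lookup ?m i) + w j"
        by simp
      then have "int (\<Sum>i\<in>UNIV. w i * Poly_Mapping.lookup m i) = int (\<Sum>i\<in>UNIV. w i * Poly_Mapping.lookup ?m i) + int (w j)"
        by (simp only: of_nat_add)
      moreover have "int (\<Sum>i\<in>UNIV. w i * Poly_Mapping.lookup m i) = d"
        using assms m unfolding poly_weight_def by blast
      ultimately have "int (\<Sum>i\<in>UNIV. w i * Poly_Mapping.lookup ?m i) = d - int (w j)" by simp
      then show ?thesis unfolding poly_weight_def by (simp del: of_nat_sum of_nat_mult)
    qed (simp add: hw_0)
  qed
qed

lemma dvar_notin: "(\<And>M. M \<in> mons x \<Longrightarrow> v \<notin> Poly_Mapping.keys M) \<Longrightarrow> dvar v x = 0"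
  by (simp add: dvar_def linear_ext_def)

lemma sp_eq_0I: "(\<And>M. M \<in> mons x \<Longrightarrow> False) \<Longrightarrow> x = 0"
  by (rule sp_eqI) (auto simp: mons_iff)

lemma mpoly_double_eq_0: "c + c = 0 \<Longrightarrow> c = 0" for c :: "('n, 'k::field_char_0) mpoly"
proof (rule poly_mapping_eqI)
  fix m assume "c + c = 0"
  then have "Poly_Mapping.lookup c m + Poly_Mapping.lookup c m = 0" by (metis lookup_add lookup_zero)
  then show "Poly_Mapping.lookup c m = Poly_Mapping.lookup 0 m" by simp
qed

section \<open>The cotangent bundle of the resolvent\<close>

locale poisson_resolvent =
  fixes P :: "('n::finite, 'k::field_char_0) mpoly \<Rightarrow> ('n, 'k) mpoly \<Rightarrow> ('n, 'k) mpoly"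
    and k :: nat
    and f :: "nat \<Rightarrow> ('n, 'k) mpoly"
    and J :: "nat \<Rightarrow> nat set"
    and \<delta> :: "('n, 'k) mpoly gpoly \<Rightarrow> ('n, 'k) mpoly gpoly"
  assumes poisson: "poisson_bracket pscale P"
    and poisson_I: "poisson_ideal P (generated_ideal k f)"
    and resolvent: "resolvent_on_generators J \<delta> k f"
begin

definition V :: "gvar set" where "V = graded_vars J"

lemma semifree: "semifree_dg J \<delta>"
  using resolvent by (simp add: resolvent_on_generators_def resolvent_def)

lemma finite_J: "m \<ge> 1 \<Longrightarrow> finite (J m)"
  using semifree by (simp add: semifree_dg_def Let_def)

lemma V_iff: "(m, i) \<in> V \<longleftrightarrow> m \<ge> 1 \<and> i \<in> J m"
  by (simp add: V_def graded_vars_def)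

lemma V_fst: "v \<in> V \<Longrightarrow> fst v \<ge> 1"
  by (cases v) (simp add: V_iff)

text \<open>
  The coordinates of the cotangent bundle: \<open>Inl j\<close> is the variable \<open>x\<^sub>j\<close> of \<open>S\<close> and \<open>Inr v\<close> a
  variable of the resolvent.  The conjugate momentum \<open>xi c\<close> is an unused super variable of
  degree one more.
\<close>

definition off :: "nat \<Rightarrow> nat" where
  "off m = Suc (Max (insert 0 (J m)))"

definition nidx :: "'n \<Rightarrow> nat" where
  "nidx = (SOME g. inj g)"

definition cdeg :: "'n + gvar \<Rightarrow> nat" where
  "cdeg c = (case c of Inl j \<Rightarrow> 0 | Inr v \<Rightarrow> fst v)"

definition xi :: "'n + gvar \<Rightarrow> gvar" where
  "xi c = (Suc (cdeg c), off (Suc (cdeg c)) + (case c of Inl j \<Rightarrow> nidx j | Inr v \<Rightarrow> snd v))"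

definition C :: "('n + gvar) set" where
  "C = range Inl \<union> Inr ` V"

text \<open>\<open>C\<close> may be infinite; Schouten brackets are formed only over these finite
  truncations.\<close>

definition CN :: "nat \<Rightarrow> ('n + gvar) set" where
  "CN N = {c \<in> C. cdeg c \<le> N}"

definition cpar :: "'n + gvar \<Rightarrow> bool" where
  "cpar c = odd (cdeg c)"

definition dz :: "'n + gvar \<Rightarrow> ('n, 'k) mpoly sp \<Rightarrow> ('n, 'k) mpoly sp" where
  "dz c = (case c of Inl j \<Rightarrow> dcoef (pd j) | Inr v \<Rightarrow> dvar v)"

definition dx :: "'n + gvar \<Rightarrow> ('n, 'k) mpoly sp \<Rightarrow> ('n, 'k) mpoly sp" where
  "dx c = dvar (xi c)"

lemma fst_xi [simp]: "fst (xi c) = Suc (cdeg c)"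
  by (simp add: xi_def)

lemma nidx_inj: "inj nidx"
  unfolding nidx_def using finite_imp_inj_to_nat_seg[of "UNIV :: 'n set"]
  by (intro someI_ex[of inj]) auto

lemma xi_notin_V: "xi c \<notin> V"
proof
  assume "xi c \<in> V"
  then have "off (Suc (cdeg c)) + (case c of Inl j \<Rightarrow> nidx j | Inr v \<Rightarrow> snd v) \<in> J (Suc (cdeg c))"
    by (simp add: xi_def V_iff)
  then have "off (Suc (cdeg c)) + (case c of Inl j \<Rightarrow> nidx j | Inr v \<Rightarrow> snd v)
    \<le> Max (insert 0 (J (Suc (cdeg c))))"
    using finite_J[of "Suc (cdeg c)"] by (intro Max_ge) auto
  then show False by (simp add: off_def)
qed

lemma xi_inj: "inj_on xi C"
proof (rule inj_onI)
  fix b c assume bc: "b \<in> C" "c \<in> C" "xi b = xi c"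
  then have 1: "cdeg b = cdeg c"
    "(case b of Inl j \<Rightarrow> nidx j | Inr v \<Rightarrow> snd v) = (case c of Inl j \<Rightarrow> nidx j | Inr v \<Rightarrow> snd v)"
    by (auto simp: xi_def)
  show "b = c"
    using 1 bc(1,2) V_fst nidx_inj
    by (cases b; cases c) (fastforce simp: cdeg_def C_def dest: injD intro: prod_eqI)+
qed

lemma finite_CN: "finite (CN N)"
proof -
  have "CN N \<subseteq> range Inl \<union> Inr ` (SIGMA m:{1..N}. J m)"
    by (force simp: CN_def C_def cdeg_def V_iff image_iff)
  moreover have "finite \<dots>" using finite_J by (auto intro!: finite_imageI finite_SigmaI)
  ultimately show ?thesis by (rule finite_subset)
qed

lemma CN_subset: "CN N \<subseteq> C" and CN_mono: "N \<le> N' \<Longrightarrow> CN N \<subseteq> CN N'"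
  by (auto simp: CN_def)

lemma pd_derivation: "derivation (pd j) TYPE(('n, 'k) mpoly)"
  by (rule derivation_pd)

sublocale conjugate_derivations ep cpar dz dx
proof
  fix x y :: "('n, 'k) mpoly sp" and p q and b c :: "'n + gvar"
  show "ep (x + y) = ep x + ep y" "ep (x * y) = ep x * ep y" "ep (ep x) = x"
    by (simp_all add: ep_add ep_mult)
  show "x * y = sg (p \<and> q) (y * x)" if "ep x = sg p x" "ep y = sg q y"
    using that mpoly_double_eq_0 by (rule sp_super_commute)
  show "x = 0" if "x + x = 0"
  proof (rule sp_eqI)
    fix M
    have "coef x M + coef x M = 0" using that by (metis coef_simps(1,4))
    then have "coef x M = 0" by (rule mpoly_double_eq_0)
    then show "coef x M = coef 0 M" by simp
  qed
  show "dz c (x + y) = dz c x + dz c y" "dx c (x + y) = dx c x + dx c y"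
    by (simp_all add: dz_def dx_def dvar_add dcoef_add[OF pd_derivation] split: sum.split)
  show "dz c (x * y) = dz c x * y + (if cpar c then ep x else x) * dz c y"
    by (simp add: dz_def cpar_def cdeg_def dvar_mult dcoef_mult[OF pd_derivation] split: sum.split)
  show "dx c (x * y) = dx c x * y + (if cpar c then x else ep x) * dx c y"
    by (simp add: dx_def cpar_def dvar_mult)
  show "dz c (ep x) = sg (cpar c) (ep (dz c x))"
    by (simp add: dz_def cpar_def cdeg_def dvar_ep dcoef_ep[OF pd_derivation] split: sum.split)
  show "dx c (ep x) = sg (\<not> cpar c) (ep (dx c x))"
    by (simp add: dx_def cpar_def dvar_ep)
  have 1: "dcoef (pd i) (dcoef (pd j) x) = dcoef (pd j) (dcoef (pd i) x)" for i j
    using pd_derivation pd_derivation pd_commute by (rule dcoef_dcoef)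
  show "dz b (dz c x) = sg (cpar b \<and> cpar c) (dz c (dz b x))"
  proof (cases b; cases c)
    fix i j assume "b = Inl i" "c = Inl j"
    then show ?thesis using 1[of i j] by (simp add: dz_def cpar_def cdeg_def)
  next
    fix u v assume "b = Inr u" "c = Inr v"
    then show ?thesis using dvar_dvar[of u v x] by (simp add: dz_def cpar_def cdeg_def)
  qed (simp_all add: dz_def cpar_def cdeg_def dvar_dcoef[OF pd_derivation])
  show "dx b (dx c x) = sg (\<not> cpar b \<and> \<not> cpar c) (dx c (dx b x))"
    using dvar_dvar[of "xi b" "xi c" x] by (simp add: dx_def cpar_def)
  show "dx b (dz c x) = sg (\<not> cpar b \<and> cpar c) (dz c (dx b x))"
    using dvar_dvar[of "xi b" _ x]
    by (simp add: dz_def dx_def cpar_def cdeg_def dvar_dcoef[OF pd_derivation] split: sum.split)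
qed

subsection \<open>Weights\<close>

text \<open>
  Three weights: \<open>wdeg\<close> is the total degree, in which a momentum has positive degree; \<open>wz\<close> counts
  only the variables of the resolvent, with \<open>x\<^sub>i\<^bsup>(m)\<^esup>\<close> of weight \<open>m\<close>; \<open>wc\<close> counts the momenta.  The
  indices \<open>(0, i)\<close> never occur as variables or momenta; their degree 2 is even, as parity demands,
  and makes \<open>wc \<le> wdeg + wz\<close> hold for every monomial.
\<close>

definition wdeg :: "gvar \<Rightarrow> int" where
  "wdeg v = (if v \<in> V then - int (fst v) else if fst v = 0 then 2 else int (fst v))"

definition wz :: "gvar \<Rightarrow> int" where
  "wz v = (if v \<in> V then int (fst v) else 0)"

definition wc :: "gvar \<Rightarrow> int" where
  "wc v = (if v \<in> V then 0 else 1)"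

text \<open>Differentiation along the coordinate \<open>c\<close> lowers degrees by
  \<open>zw c\<close>. Stated abstractly so that the degree of a bracket is computed once for all
  weights and filtrations in use.\<close>

definition shifts :: "(gvar \<Rightarrow> int) \<Rightarrow> (int \<Rightarrow> ('n, 'k) mpoly set) \<Rightarrow> ('n + gvar \<Rightarrow> int) \<Rightarrow> bool" where
  "shifts wt hw zw \<longleftrightarrow> ring_grading hw \<and> (\<forall>j e s. s \<in> hw e \<longrightarrow> pd j s \<in> hw (e - zw (Inl j)))
     \<and> (\<forall>v. zw (Inr v) = wt v)"

definition vwt :: "(gvar \<Rightarrow> int) \<Rightarrow> 'n + gvar \<Rightarrow> int" where
  "vwt wt c = (case c of Inl j \<Rightarrow> 0 | Inr v \<Rightarrow> wt v)"

lemma shifts_eq: "shifts wt hw_eq (vwt wt)" and shifts_ge: "shifts wt hw_ge (vwt wt)"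
  by (auto simp: shifts_def vwt_def gr_eq.ring_grading_axioms gr_ge.ring_grading_axioms hw_eq_def hw_ge_def
      split: if_splits)

lemma rd_hg:
  assumes "shifts wt hw zw" "x \<in> hg wt hw d"
  shows "rd c x \<in> hg wt hw (d - zw c)"
proof -
  interpret ring_grading hw using assms by (simp add: shifts_def)
  have "epsp (cpar c) x \<in> hg wt hw d" using assms by (simp add: epsp_def hg_ep)
  then have "dz c (epsp (cpar c) x) \<in> hg wt hw (d - zw c)"
    using assms(1) unfolding dz_def shifts_def
    by (cases c) (auto intro!: hg_dvar hg_dcoef)
  then show ?thesis unfolding rd_def by (rule hg_sg)
qed

lemma dx_hg:
  assumes "shifts wt hw zw" "x \<in> hg wt hw d"
  shows "dx c x \<in> hg wt hw (d - wt (xi c))"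
proof -
  interpret ring_grading hw using assms by (simp add: shifts_def)
  show ?thesis unfolding dx_def using assms by (intro hg_dvar)
qed

text \<open>\<open>q\<close> is the joint weight of a coordinate and its momentum; the bracket
  removes one such pair, so its weight is determined once \<open>q\<close> is the same for all
  pairs.\<close>

lemma DD_hg:
  assumes "shifts wt hw zw" "x \<in> hg wt hw d" "y \<in> hg wt hw e" "\<And>c. c \<in> B \<Longrightarrow> zw c + wt (xi c) = q"
  shows "DD B x y \<in> hg wt hw (d + e - q)"
proof -
  interpret ring_grading hw using assms by (simp add: shifts_def)
  have "rd c x * dx c y \<in> hg wt hw (d + e - q)" if "c \<in> B" for c
  proof -
    have "rd c x * dx c y \<in> hg wt hw ((d - zw c) + (e - wt (xi c)))"
      using assms by (intro hg_mult rd_hg dx_hg)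
    then show ?thesis using assms(4)[OF that] by (simp add: algebra_simps)
  qed
  then show ?thesis unfolding DD_def by (rule hg_sum)
qed

lemma C_V: "Inr v \<in> C \<longleftrightarrow> v \<in> V"
  by (auto simp: C_def)

lemma vwt_simps:
  assumes "c \<in> C"
  shows "vwt wdeg c = - int (cdeg c)" "vwt wz c = int (cdeg c)" "vwt wc c = 0"
    "wdeg (xi c) = int (cdeg c) + 1" "wz (xi c) = 0" "wc (xi c) = 1"
  using assms by (cases c; simp add: vwt_def wdeg_def wz_def wc_def xi_notin_V C_V cdeg_def)+

lemma wc_nonneg: "wtm wc M \<ge> 0" and wz_nonneg: "wtm wz M \<ge> 0"
  by (auto intro!: wtm_nonneg simp: wc_def wz_def)

lemma wc_eq_0_iff: "wtm wc M = 0 \<longleftrightarrow> Poly_Mapping.keys M \<subseteq> V"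
proof -
  have "wtm wc M = 0 \<longleftrightarrow> (\<forall>v\<in>Poly_Mapping.keys M. wc v * int (Poly_Mapping.lookup M v) = 0)"
    unfolding wtm_def by (rule sum_nonneg_eq_0_iff) (auto simp: wc_def)
  then show ?thesis by (auto simp: wc_def in_keys_iff)
qed

text \<open>\<open>RR\<close> is the resolvent as a subring; \<open>rho\<close> sets the momenta to zero.\<close>

definition RR :: "('n, 'k) mpoly sp set" where
  "RR = hg wc hw_eq 0"

definition rho :: "('n, 'k) mpoly sp \<Rightarrow> ('n, 'k) mpoly sp" where
  "rho = restr (\<lambda>M. Poly_Mapping.keys M \<subseteq> V)"

lemma RR_iff: "x \<in> RR \<longleftrightarrow> mons x \<subseteq> {M. Poly_Mapping.keys M \<subseteq> V}"
  by (auto simp: RR_def hg_eq_iff wc_eq_0_iff)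

lemma RR_add: "x \<in> RR \<Longrightarrow> y \<in> RR \<Longrightarrow> x + y \<in> RR"
  and RR_mult: "x \<in> RR \<Longrightarrow> y \<in> RR \<Longrightarrow> x * y \<in> RR"
  and RR_sg: "x \<in> RR \<Longrightarrow> sg b x \<in> RR"
  and RR_ep: "x \<in> RR \<Longrightarrow> ep x \<in> RR"
  and RR_cst: "cst s \<in> RR" and RR_0: "0 \<in> RR"
  and RR_minus: "x \<in> RR \<Longrightarrow> - x \<in> RR"
  using gr_eq.hg_mult[of x wc 0 y 0] hg_eq_cst[of s wc]
  by (auto simp: RR_def intro: gr_eq.hg_add gr_eq.hg_sg gr_eq.hg_ep gr_eq.hg_0 gr_eq.hg_minus)

lemma RR_sum: "(\<And>i. i \<in> A \<Longrightarrow> g i \<in> RR) \<Longrightarrow> sum g A \<in> RR"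
  unfolding RR_def by (rule gr_eq.hg_sum)

lemma RR_vr: "v \<in> V \<Longrightarrow> vr v \<in> RR"
  using gr_eq.hg_vr[of v wc] by (simp add: RR_def wc_def)

lemma RR_rd: "c \<in> C \<Longrightarrow> x \<in> RR \<Longrightarrow> rd c x \<in> RR"
  using rd_hg[OF shifts_eq, of x wc 0 c] by (simp add: RR_def vwt_simps)

lemma hg_wc_neg: "x \<in> hg wc hw_eq d \<Longrightarrow> d < 0 \<Longrightarrow> x = 0"
proof (rule sp_eq_0I)
  fix M assume "x \<in> hg wc hw_eq d" "d < 0" "M \<in> mons x"
  then show False using wc_nonneg[of M] by (auto simp: hg_eq_iff)
qed

lemma RR_dx: "x \<in> RR \<Longrightarrow> dx c x = 0"
  unfolding dx_def using xi_notin_V by (intro dvar_notin) (auto simp: RR_iff)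

lemma RR_dx_rd: "x \<in> RR \<Longrightarrow> dx d (rd c x) = 0"
  by (simp add: dx_rd RR_dx)

lemma rho_add: "rho (x + y) = rho x + rho y"
  unfolding rho_def by (rule restr_add)

lemma rho_0 [simp]: "rho 0 = 0"
  using rho_add[of 0 0] by simp

lemma rho_minus: "rho (- x) = - rho x"
  using rho_add[of x "- x"] by (simp add: eq_neg_iff_add_eq_0 add.commute)

lemma rho_diff: "rho (x - y) = rho x - rho y"
  using rho_add[of x "- y"] by (simp add: rho_minus)

lemma rho_sg: "rho (sg b x) = sg b (rho x)"
  by (simp add: sg_def rho_minus)

lemma rho_sum: "rho (sum g A) = (\<Sum>i\<in>A. rho (g i))"
  by (induction A rule: infinite_finite_induct) (auto simp: rho_add)

lemma rho_mult: "rho (x * y) = rho x * rho y"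
proof (induction x rule: sp_induct)
  case (monom M a)
  show ?case
  proof (induction y rule: sp_induct)
    case (monom N b)
    then show ?case
      using \<open>reduced M\<close> by (simp add: rho_def restr_monom monom_mult keys_add_nat)
  qed (simp add: rho_add distrib_left)
qed (simp add: rho_add distrib_right)

lemma rho_RR: "x \<in> RR \<Longrightarrow> rho x = x"
  unfolding rho_def by (rule sp_eqI) (auto simp: coef_restr RR_iff mons_iff)

lemma RR_rho: "rho x \<in> RR"
  by (auto simp: rho_def RR_iff mons_iff coef_restr split: if_splits)

lemma rho_eq_0: "x \<in> hg wc hw_ge 1 \<Longrightarrow> rho x = 0"
proof (rule sp_eq_0I)
  fix M assume "x \<in> hg wc hw_ge 1" "M \<in> mons (rho x)"
  then have "wtm wc M = 0" "1 \<le> wtm wc M"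
    by (auto simp: rho_def coef_restr mons_iff hg_ge_iff wc_eq_0_iff split: if_splits)
  then show False by simp
qed

lemma diff_rho: "x - rho x \<in> hg wc hw_ge 1"
proof -
  have "wtm wc M \<ge> 1" if "M \<in> mons (x - rho x)" for M
  proof -
    have "\<not> Poly_Mapping.keys M \<subseteq> V" using that by (auto simp: mons_iff rho_def coef_restr)
    then show ?thesis using wc_nonneg[of M] by (simp flip: wc_eq_0_iff)
  qed
  then show ?thesis by (simp add: hg_ge_iff)
qed

lemma rho_rd:
  assumes "c \<in> C"
  shows "rho (rd c x) = rd c (rho x)"
proof -
  have "rd c (x - rho x) \<in> hg wc hw_ge (1 - vwt wc c)"
    using shifts_ge diff_rho by (rule rd_hg)
  then have "rho (rd c (x - rho x)) = 0" using assms by (simp add: vwt_simps rho_eq_0)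
  then show ?thesis using assms by (simp add: rd_diff rho_diff rho_RR RR_rd RR_rho)
qed

lemma rho_hg:
  assumes "ring_grading hw" "x \<in> hg wt hw d"
  shows "rho x \<in> hg wt hw d"
  using assms ring_grading.hw_0[OF assms(1)] by (simp add: hg_def rho_def coef_restr)

text \<open>\<open>rho\<close> is multiplicative and commutes with derivatives along coordinates,
  but not with those along momenta; hence only the first argument may be replaced.\<close>

lemma rho_DD:
  assumes "B \<subseteq> C"
  shows "rho (DD B F G) = rho (DD B (rho F) G)"
  unfolding DD_def rho_sum using assms
  by (intro sum.cong) (auto simp: rho_mult rho_rd rho_RR RR_rd RR_rho)

text \<open>\<open>wdeg v\<close> has the parity of \<open>fst v\<close> for every variable, and in
  a reduced monomial an odd variable occurs just once. Thus the total degree determines the parity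
  \<open>ep\<close>.\<close>

lemma even_wdeg: "reduced M \<Longrightarrow> odd (wtm wdeg M) \<longleftrightarrow> odd (card (odd_keys M))"
proof -
  assume M: "reduced M"
  let ?g = "\<lambda>v. wdeg v * int (Poly_Mapping.lookup M v)"
  have "odd (?g v) \<longleftrightarrow> odd (fst v)" if "v \<in> Poly_Mapping.keys M" for v
    using that M by (auto simp: wdeg_def reduced_def)
  then have "{v \<in> Poly_Mapping.keys M. odd (?g v)} = odd_keys M"
    by (auto simp: odd_keys_def)
  then show ?thesis
    unfolding wtm_def by (simp add: even_sum_iff)
qed

lemma hom_wdeg:
  assumes "x \<in> hg wdeg hw_eq d"
  shows "hom (odd d) x"
proof -
  have "(-1) ^ card (odd_keys M) * coef x M = coef (sg (odd d) x) M" for M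
  proof (cases "M \<in> mons x")
    case True
    then have "odd d = odd (card (odd_keys M))"
      using assms even_wdeg[OF mons_reduced[OF True]] by (auto simp: hg_eq_iff)
    then show ?thesis by (auto simp: sg_def minus_one_power_iff)
  qed (simp add: mons_iff sg_def)
  then show ?thesis unfolding hom_def by (intro sp_eqI) (simp add: coef_ep)
qed

lemma hom_move:
  assumes "hom (\<not> c) z"
  shows "epsp c y * z = z * ep y"
proof (induction y rule: sp_induct)
  case (monom M a)
  let ?q = "odd (card (odd_keys M))"
  have y: "hom ?q (monom M a)" by (auto simp: hom_def ep_monom sg_def monom_minus minus_one_power_iff)
  show ?case
    using epsp_hom[OF y, of c] hom_commute[OF y assms] y
    by (cases c; cases ?q) (simp_all add: hom_def)
qed (simp add: epsp_add ep_add distrib_left distrib_right)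

end

section \<open>Transfer of the differential to super polynomials\<close>

lemma Rep_sp_carrier: "Rep_sp x \<in> gpoly_carrier UNIV"
  by (rule Rep_sp)

lemma Rep_cst: "Rep_sp (cst s) = gconst s"
  by (simp add: cst_def gconst_def monom.rep_eq)

lemma Rep_vr: "Rep_sp (vr v) = gvar_elem v"
  by (simp add: vr_def gvar_elem_def monom.rep_eq reduced_unit unit_mon_def[symmetric] del: One_nat_def)

lemma Rep_mons: "Poly_Mapping.keys (Rep_sp x) = mons x"
  by (simp add: mons.rep_eq)

lemma Rep_coef: "Poly_Mapping.lookup (Rep_sp x) M = coef x M"
  by (simp add: coef.rep_eq)

lemma carrier_mono: "a \<in> gpoly_carrier V \<Longrightarrow> a \<in> gpoly_carrier UNIV"
  by (auto simp: in_gpoly_carrier_iff)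

lemma Rep_Abs_sp: "a \<in> gpoly_carrier V \<Longrightarrow> Rep_sp (Abs_sp a) = a"
  by (intro Abs_sp_inverse carrier_mono)

lemma Rep_in_carrier: "Rep_sp x \<in> gpoly_carrier V \<longleftrightarrow> mons x \<subseteq> {M. Poly_Mapping.keys M \<subseteq> V}"
  using Rep_sp_carrier[of x] by (auto simp: in_gpoly_carrier_iff Rep_mons)

lemma sp_sum_induct:
  assumes "\<And>M c. M \<in> mons x \<Longrightarrow> Q (monom M c)" "Q 0" "\<And>y z. Q y \<Longrightarrow> Q z \<Longrightarrow> Q (y + z)"
  shows "Q x"
proof -
  have "Q (\<Sum>M\<in>A. monom M (coef x M))" if "finite A" "A \<subseteq> mons x" for A
    using that by (induction A) (simp_all add: assms)
  from this[of "mons x"] show ?thesis by (simp flip: monom_expansion)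
qed

definition vpart :: "gvar set \<Rightarrow> gmon \<Rightarrow> gmon" where
  "vpart U M = Poly_Mapping.mapp (\<lambda>v n. if v \<in> U then n else 0) M"

lemma lookup_vpart: "Poly_Mapping.lookup (vpart U M) v = (if v \<in> U then Poly_Mapping.lookup M v else 0)"
  by (auto simp: vpart_def lookup_mapp in_keys_iff when_def)

lemma keys_vpart: "Poly_Mapping.keys (vpart U M) = Poly_Mapping.keys M \<inter> U"
  by (auto simp: in_keys_iff lookup_vpart split: if_splits)

lemma vpart_split: "vpart U M + vpart (- U) M = M"
  by (rule poly_mapping_eqI) (auto simp: lookup_add lookup_vpart)

lemma vpart_add: "vpart U (M + N) = vpart U M + vpart U N"
  by (rule poly_mapping_eqI) (auto simp: lookup_add lookup_vpart)

lemma vpart_id: "Poly_Mapping.keys M \<subseteq> U \<Longrightarrow> vpart U M = M"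
  by (rule poly_mapping_eqI) (auto simp: lookup_vpart in_keys_iff)

lemma vpart_disj: "Poly_Mapping.keys M \<inter> U = {} \<Longrightarrow> vpart U M = 0"
  by (rule poly_mapping_eqI) (auto simp: lookup_vpart in_keys_iff)

lemma odd_keys_disj: "Poly_Mapping.keys M \<inter> Poly_Mapping.keys N = {} \<Longrightarrow> odd_keys M \<inter> odd_keys N = {}"
  by (auto simp: odd_keys_def)

lemma vpart_reduced: "reduced M \<Longrightarrow> reduced (vpart U M)"
  by (simp add: reduced_iff lookup_vpart)

context poisson_resolvent
begin

abbreviation I where "I \<equiv> generated_ideal k f"

lemma RR_Rep: "x \<in> RR \<longleftrightarrow> Rep_sp x \<in> gpoly_carrier V"
  by (simp add: RR_iff Rep_in_carrier)

lemma monom_RR: "Poly_Mapping.keys M \<subseteq> V \<Longrightarrow> monom M c \<in> RR"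
  by (auto simp: RR_iff mons_iff coef_monom split: if_splits)

lemma RR_induct [consumes 1, case_names monom add]:
  assumes "x \<in> RR" "\<And>M c. reduced M \<Longrightarrow> Poly_Mapping.keys M \<subseteq> V \<Longrightarrow> Q (monom M c)"
    "\<And>y z. y \<in> RR \<Longrightarrow> z \<in> RR \<Longrightarrow> Q y \<Longrightarrow> Q z \<Longrightarrow> Q (y + z)"
  shows "Q x"
proof -
  have "x \<in> RR \<and> Q x"
  proof (rule sp_sum_induct[where x = x])
    show "monom M c \<in> RR \<and> Q (monom M c)" if "M \<in> mons x" for M c
      using that assms(1,2) monom_RR mons_reduced[OF that] unfolding RR_iff[of x] by blast
    show "0 \<in> RR \<and> Q 0" using assms(2)[of 0 0] by (simp add: RR_0)
  qed (auto intro: RR_add assms(3))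
  then show ?thesis by simp
qed

lemma mon_degree_wdeg: "Poly_Mapping.keys M \<subseteq> V \<Longrightarrow> mon_degree M = wtm wdeg M"
  unfolding mon_degree_def wtm_def by (simp add: wdeg_def sum_negf subset_iff flip: sum_negf)

lemma gr_iff: "Rep_sp x \<in> gpoly_gr V d \<longleftrightarrow> x \<in> RR \<and> x \<in> hg wdeg hw_eq d"
proof -
  have "mon_degree M = wtm wdeg M" if "M \<in> mons x" "x \<in> RR" for M
    using that by (intro mon_degree_wdeg) (auto simp: RR_iff)
  then show ?thesis
    by (auto simp: gpoly_gr_def RR_Rep hg_eq_iff Rep_mons)
qed

lemma monom_hg: "monom M c \<in> hg wt hw_eq (wtm wt M)"
  by (simp add: gr_eq.hg_monom hw_eq_def)

definition D0 :: "('n, 'k) mpoly sp \<Rightarrow> ('n, 'k) mpoly sp" where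
  "D0 x = Abs_sp (\<delta> (Rep_sp x))"

lemma delta:
  shows delta_gr: "a \<in> gpoly_gr V d \<Longrightarrow> \<delta> a \<in> gpoly_gr V (d + 1)"
    and delta_lin: "a \<in> gpoly_carrier V \<Longrightarrow> b \<in> gpoly_carrier V \<Longrightarrow>
      \<delta> (gconst s \<star> a + b) = gconst s \<star> \<delta> a + \<delta> b"
    and delta_mult: "a \<in> gpoly_gr V d \<Longrightarrow> b \<in> gpoly_carrier V \<Longrightarrow>
      \<delta> (a \<star> b) = \<delta> a \<star> b + (if even d then a \<star> \<delta> b else - (a \<star> \<delta> b))"
    and delta_delta: "a \<in> gpoly_carrier V \<Longrightarrow> \<delta> (\<delta> a) = 0"
    and delta_var: "(m, i) \<in> V \<Longrightarrow> \<delta> (gvar_elem (m, i)) \<in> gpoly_carrier (vars_upto J (m - 1))"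
  using semifree unfolding semifree_dg_def Let_def V_def by blast+

lemma gconst_1_mult: "a \<in> gpoly_carrier V \<Longrightarrow> gconst 1 \<star> a = a"
  using Rep_Abs_sp[of a V] times_sp.rep_eq[of 1 "Abs_sp a"] Rep_cst[of 1]
  by (metis cst_1 mult_1)

text \<open>The last premise holds as soon as \<delta> a is known to lie in the carrier. That fact
  is itself proved from additivity, by induction over monomials, so it cannot be used here.\<close>

lemma delta_add: "a \<in> gpoly_carrier V \<Longrightarrow> b \<in> gpoly_carrier V \<Longrightarrow> gconst 1 \<star> \<delta> a = \<delta> a \<Longrightarrow>
    \<delta> (a + b) = \<delta> a + \<delta> b"
  using delta_lin[of a b 1] by (simp add: gconst_1_mult)

lemma gr_carrier: "a \<in> gpoly_gr V d \<Longrightarrow> a \<in> gpoly_carrier V"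
  by (simp add: gpoly_gr_def)

lemma delta_carrier: "x \<in> RR \<Longrightarrow> \<delta> (Rep_sp x) \<in> gpoly_carrier V"
proof (induction x rule: RR_induct)
  case (monom M c)
  have "Rep_sp (monom M c) \<in> gpoly_gr V (wtm wdeg M)"
    unfolding gr_iff using monom by (simp add: monom_RR monom_hg)
  from gr_carrier[OF delta_gr[OF this]] show ?case .
next
  case (add y z)
  then show ?case
    using delta_add[of "Rep_sp y" "Rep_sp z"]
    by (simp add: plus_sp.rep_eq gconst_1_mult RR_Rep carrier_add)
qed

lemma Rep_D0: "x \<in> RR \<Longrightarrow> Rep_sp (D0 x) = \<delta> (Rep_sp x)"
  unfolding D0_def by (rule Rep_Abs_sp[OF delta_carrier])

lemma D0_RR: "x \<in> RR \<Longrightarrow> D0 x \<in> RR"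
  by (simp add: RR_Rep[of "D0 x"] Rep_D0 delta_carrier)

lemma D0_add: "x \<in> RR \<Longrightarrow> y \<in> RR \<Longrightarrow> D0 (x + y) = D0 x + D0 y"
  using delta_add[of "Rep_sp x" "Rep_sp y"] delta_carrier[of x]
  by (simp add: Rep_sp_inject[symmetric] plus_sp.rep_eq Rep_D0 RR_add gconst_1_mult RR_Rep[symmetric])

lemma D0_0 [simp]: "D0 0 = 0"
  using D0_add[of 0 0] by (simp add: RR_0)

lemma D0_minus: "x \<in> RR \<Longrightarrow> D0 (- x) = - D0 x"
  using D0_add[of x "- x"] by (simp add: RR_minus eq_neg_iff_add_eq_0 add.commute)

lemma D0_sg: "x \<in> RR \<Longrightarrow> D0 (sg b x) = sg b (D0 x)"
  by (simp add: sg_def D0_minus)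

lemma D0_sum: "(\<And>i. i \<in> A \<Longrightarrow> g i \<in> RR) \<Longrightarrow> D0 (sum g A) = (\<Sum>i\<in>A. D0 (g i))"
  by (induction A rule: infinite_finite_induct) (auto simp: D0_add RR_sum)

lemma D0_mult: "x \<in> RR \<Longrightarrow> y \<in> RR \<Longrightarrow> D0 (x * y) = D0 x * y + ep x * D0 y"
proof (induction x rule: RR_induct)
  case (monom M c)
  have m: "Rep_sp (monom M c) \<in> gpoly_gr V (wtm wdeg M)"
    unfolding gr_iff using monom by (simp add: monom_RR monom_hg)
  have "ep (monom M c) = sg (odd (wtm wdeg M)) (monom M c)"
    using hom_wdeg[OF monom_hg] by (simp add: hom_def)
  moreover have "Rep_sp (D0 (monom M c * y)) = Rep_sp (D0 (monom M c) * y + sg (odd (wtm wdeg M)) (monom M c * D0 y))"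
    using delta_mult[OF m, of "Rep_sp y"] monom
    by (simp add: Rep_D0 RR_mult monom_RR times_sp.rep_eq plus_sp.rep_eq RR_Rep[symmetric] sg_def uminus_sp.rep_eq)
  ultimately show ?case by (simp add: Rep_sp_inject sg_mult_left)
next
  case (add x z)
  then show ?case by (simp add: distrib_right D0_add RR_mult ep_add add_ac)
qed

lemma D0_D0: "x \<in> RR \<Longrightarrow> D0 (D0 x) = 0"
  using delta_delta[of "Rep_sp x"]
  by (simp add: Rep_sp_inject[symmetric] Rep_D0 D0_RR RR_Rep[symmetric] zero_sp.rep_eq)

lemma D0_hg: "x \<in> RR \<Longrightarrow> x \<in> hg wdeg hw_eq d \<Longrightarrow> D0 x \<in> hg wdeg hw_eq (d + 1)"
  using gr_iff[of x d] gr_iff[of "D0 x" "d + 1"] delta_gr Rep_D0[of x] by auto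

lemma D0_cst [simp]: "D0 (cst s) = 0"
proof -
  have "ep 1 = (1 :: ('n, 'k) mpoly sp)" using ep_cst[of 1] by (simp only: cst_1)
  then have "D0 1 = 0" using D0_mult[of 1 1] RR_cst[of 1] by (simp add: cst_1)
  moreover have "Rep_sp (D0 (cst s * 1 + 0)) = Rep_sp (cst s * D0 1 + D0 0)"
    using delta_lin[of "Rep_sp 1" "Rep_sp 0" s] RR_cst[of 1] RR_0 Rep_D0[OF RR_0]
    by (simp add: cst_1 Rep_D0 RR_mult RR_add RR_cst times_sp.rep_eq plus_sp.rep_eq Rep_cst RR_Rep[symmetric] del: mult_1_right add_0_right)
  ultimately show ?thesis by (simp add: Rep_sp_inject)
qed

text \<open>The components of \<delta> as a vector field; those along the variables of
  \<open>S\<close> vanish because \<delta> is \<open>S\<close>-linear.\<close>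

definition dl :: "'n + gvar \<Rightarrow> ('n, 'k) mpoly sp" where
  "dl c = (case c of Inl j \<Rightarrow> 0 | Inr v \<Rightarrow> D0 (vr v))"

lemma dl_RR: "c \<in> C \<Longrightarrow> dl c \<in> RR"
  by (cases c) (auto simp: dl_def RR_0 C_V intro: D0_RR RR_vr)

lemma dl_wdeg: "c \<in> C \<Longrightarrow> dl c \<in> hg wdeg hw_eq (1 - int (cdeg c))"
  using D0_hg[OF RR_vr gr_eq.hg_vr]
  by (cases c) (auto simp: dl_def C_V cdeg_def gr_eq.hg_0 wdeg_def add.commute[of _ "1::int"])

lemma dl_hom: "c \<in> C \<Longrightarrow> hom (\<not> cpar c) (dl c)"
  using hom_wdeg[OF dl_wdeg] by (simp add: cpar_def)

definition RN :: "nat \<Rightarrow> ('n, 'k) mpoly sp set" where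
  "RN N = {x. mons x \<subseteq> {M. Poly_Mapping.keys M \<subseteq> vars_upto J N}}"

lemma vars_upto_V: "vars_upto J N = {v \<in> V. fst v \<le> N}"
  by (simp add: vars_upto_def V_def)

lemma RN_RR: "x \<in> RN N \<Longrightarrow> x \<in> RR"
  by (auto simp: RN_def RR_iff vars_upto_V)

lemma dl_RN: "c \<in> C \<Longrightarrow> dl c \<in> RN (cdeg c - 1)"
proof (cases c)
  case (Inr v)
  moreover assume "c \<in> C"
  ultimately have "\<delta> (gvar_elem v) \<in> gpoly_carrier (vars_upto J (fst v - 1))"
    using delta_var[of "fst v" "snd v"] by (simp add: C_V)
  then show ?thesis
    using \<open>c \<in> C\<close> Inr by (simp add: dl_def cdeg_def RN_def Rep_in_carrier[symmetric] Rep_D0 RR_vr C_V Rep_vr)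
qed (auto simp: dl_def RN_def mons_iff)

text \<open>All variables of the resolvent have negative degree, so degrees cannot cancel and a
  variable of degree below \<open>- int n\<close> cannot occur.\<close>

lemma RN_deg:
  assumes "x \<in> RR" "x \<in> hg wdeg hw_eq (- int n)"
  shows "x \<in> RN n"
proof -
  have "fst v \<le> n" if "M \<in> mons x" "v \<in> Poly_Mapping.keys M" for M v
  proof -
    have sub: "Poly_Mapping.keys M \<subseteq> V" using assms(1) that by (auto simp: RR_iff)
    have "int (fst v) * 1 \<le> int (fst v) * int (Poly_Mapping.lookup M v)"
      using that(2) by (intro mult_left_mono) (auto simp: in_keys_iff)
    also have "\<dots> \<le> (\<Sum>u\<in>Poly_Mapping.keys M. int (fst u) * int (Poly_Mapping.lookup M u))"
      using that(2) by (intro member_le_sum) auto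
    also have "\<dots> = - wtm wdeg M" using mon_degree_wdeg[OF sub] by (simp add: mon_degree_def)
    also have "\<dots> = int n" using assms(2) that(1) by (auto simp: hg_eq_iff)
    finally show ?thesis by simp
  qed
  then show ?thesis using assms(1) by (auto simp: RN_def RR_iff vars_upto_V)
qed

text \<open>
  On the resolvent \<open>dp\<close> is \<open>\<delta>\<close> up to the parity involution; it is extended linearly over the momenta.
\<close>

definition dp :: "nat \<Rightarrow> ('n, 'k) mpoly sp \<Rightarrow> ('n, 'k) mpoly sp" where
  "dp N x = (\<Sum>c\<in>CN N. rd c x * sg (cpar c) (dl c))"

lemma dp_add: "dp N (x + y) = dp N x + dp N y"
  by (simp add: dp_def rd_add distrib_right sum.distrib)

lemma dp_0 [simp]: "dp N 0 = 0"
  by (simp add: dp_def)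

lemma dp_minus: "dp N (- x) = - dp N x"
  using dp_add[of N x "- x"] by (simp add: eq_neg_iff_add_eq_0 add.commute)

lemma dp_diff: "dp N (x - y) = dp N x - dp N y"
  using dp_add[of N x "- y"] by (simp add: dp_minus)

lemma dp_sum: "dp N (sum g A) = (\<Sum>i\<in>A. dp N (g i))"
  by (induction A rule: infinite_finite_induct) (auto simp: dp_add)

lemma dp_mult: "dp N (x * y) = x * dp N y + dp N x * ep y"
proof -
  have "rd c (x * y) * sg (cpar c) (dl c)
    = x * (rd c y * sg (cpar c) (dl c)) + rd c x * sg (cpar c) (dl c) * ep y" if "c \<in> CN N" for c
  proof -
    have "c \<in> C" using that CN_subset by blast
    then have "epsp (cpar c) y * dl c = dl c * ep y" by (intro hom_move dl_hom)
    then show ?thesis by (simp add: rd_mult distrib_right mult.assoc sg_mult_left sg_mult_right sg_add)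
  qed
  then show ?thesis
    by (simp add: dp_def sum.distrib sum_distrib_left sum_distrib_right)
qed

lemma rd_vr: "rd c (vr v) = (if c = Inr v then 1 else 0)"
  by (cases c) (auto simp: rd_def dz_def cpar_def cdeg_def dcoef_vr[OF pd_derivation] dvar_vr ep_vr
      dvar_minus dcoef_add[OF pd_derivation] epsp_def sg_def)

lemma rd_cst: "rd c (cst s) = (case c of Inl j \<Rightarrow> cst (pd j s) | Inr v \<Rightarrow> 0)"
  by (cases c) (auto simp: rd_def dz_def cpar_def cdeg_def dcoef_cst[OF pd_derivation] epsp_def)

lemma dp_cst [simp]: "dp N (cst s) = 0"
  unfolding dp_def by (rule sum.neutral) (auto simp: rd_cst dl_def split: sum.split)

text \<open>The involution turns the left derivation \<open>D0\<close> into a right derivation. Both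
  sides then obey the Leibniz rule \<open>dp_mult\<close> and are compared on generators.\<close>

lemma dp_eq:
  assumes "x \<in> RN N"
  shows "dp N x = D0 (ep x)"
proof -
  have "x \<in> RN N \<and> dp N x = D0 (ep x)"
    using assms[unfolded RN_def mem_Collect_eq]
  proof (induction x rule: sp_gen_induct)
    case (cst s)
    have "mons (cst s) \<subseteq> {0}" by (auto simp: mons_iff cst_def coef_monom split: if_splits)
    then show ?case by (auto simp: RN_def)
  next
    case (vr v)
    have "mons (vr v) \<subseteq> {unit_mon v}" by (auto simp: mons_iff vr_def coef_monom split: if_splits)
    moreover have "dp N (vr v) = (\<Sum>c\<in>CN N. if c = Inr v then sg (cpar c) (dl c) else 0)"
      unfolding dp_def by (intro sum.cong) (auto simp: rd_vr)
    moreover have "Inr v \<in> CN N" using vr by (auto simp: CN_def C_V vars_upto_V cdeg_def)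
    moreover have "vr v \<in> RR" using vr by (intro RR_vr) (simp add: vars_upto_V)
    ultimately show ?case
      using vr by (auto simp: RN_def finite_CN dl_def cpar_def cdeg_def ep_vr D0_sg)
  next
    case (add x y)
    have "mons (x + y) \<subseteq> mons x \<union> mons y" by (auto simp: mons_iff)
    then have "x + y \<in> RN N" using add by (auto simp: RN_def)
    moreover have "x \<in> RR" "y \<in> RR" using add RN_RR by blast+
    ultimately show ?case
      using add by (simp add: dp_add ep_add D0_add RR_ep)
  next
    case (mult x y)
    have "x * y \<in> RN N"
      using mult gmult_carrier[of "Rep_sp x" "vars_upto J N" "Rep_sp y"]
      by (simp add: RN_def Rep_in_carrier[symmetric] times_sp.rep_eq)
    moreover have "x \<in> RR" "y \<in> RR" using mult RN_RR by blast+
    ultimately show ?case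
      using mult by (simp add: dp_mult ep_mult D0_mult RR_ep add.commute)
  qed
  then show ?thesis ..
qed

end

section \<open>Internal degrees and exactness of the resolvent\<close>

lemma poly_weight_disjoint:
  assumes "m \<in> Poly_Mapping.keys s" "s \<in> poly_weight w d"
  shows "int (\<Sum>i\<in>UNIV. w i * Poly_Mapping.lookup m i) = d"
  using assms unfolding poly_weight_def by blast

locale weighted_resolvent = poisson_resolvent P k f J \<delta>
  for P :: "('n::finite, 'k::field_char_0) mpoly \<Rightarrow> ('n, 'k) mpoly \<Rightarrow> ('n, 'k) mpoly"
    and k f J \<delta> +
  fixes w :: "'n \<Rightarrow> nat" and wv :: "gvar \<Rightarrow> int" and p :: int
begin

text \<open>
  The internal degree of a momentum is chosen such that the Schouten bracket has internal degree \<open>p\<close>,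
  so that a Hamiltonian of internal degree \<open>- p\<close> gives an \<open>m\<close>-ary bracket of degree \<open>(m - 1) p\<close>.
\<close>

definition cw :: "'n + gvar \<Rightarrow> int" where
  "cw c = (case c of Inl j \<Rightarrow> int (w j) | Inr v \<Rightarrow> wv v)"

definition ww :: "gvar \<Rightarrow> int" where
  "ww v = (if v \<in> V then wv v else - cw (inv_into C xi v) - p)"

definition zw :: "'n + gvar \<Rightarrow> int" where
  "zw c = (case c of Inl j \<Rightarrow> int (w j) | Inr v \<Rightarrow> ww v)"

abbreviation W :: "int \<Rightarrow> ('n, 'k) mpoly sp set" where
  "W \<equiv> hg ww (poly_weight w)"

abbreviation GC :: bool where
  "GC \<equiv> graded_case w wv p P k f J \<delta>"

sublocale pw: ring_grading "poly_weight w :: int \<Rightarrow> ('n, 'k) mpoly set"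
  by (rule poly_weight_grading)

lemma shifts_W: "shifts ww (poly_weight w) zw"
  by (simp add: shifts_def zw_def poly_weight_grading poly_weight_pd)

lemma zw_xi: "c \<in> C \<Longrightarrow> zw c + ww (xi c) = - p"
  by (cases c) (auto simp: zw_def ww_def cw_def xi_notin_V inv_into_f_f[OF xi_inj] C_V)

lemma RN_mono: "N \<le> N' \<Longrightarrow> RN N \<subseteq> RN N'"
  unfolding RN_def vars_upto_V by fastforce

lemma W_iff: "x \<in> RR \<Longrightarrow> x \<in> W d \<longleftrightarrow> Rep_sp x \<in> gpoly_weight w wv d"
proof -
  assume x: "x \<in> RR"
  have "wtm ww M = (\<Sum>v\<in>Poly_Mapping.keys M. wv v * int (Poly_Mapping.lookup M v))" if "M \<in> mons x" for M
    using that x unfolding wtm_def by (intro sum.cong) (auto simp: RR_iff ww_def)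
  moreover have "x \<in> W d \<longleftrightarrow> (\<forall>M\<in>mons x. coef x M \<in> poly_weight w (d - wtm ww M))"
    unfolding hg_def mem_Collect_eq using pw.hw_0 mons_iff by metis
  ultimately show ?thesis
    by (simp add: gpoly_weight_def Rep_coef Rep_mons)
qed

lemma D0_W: "GC \<Longrightarrow> x \<in> RR \<Longrightarrow> x \<in> W d \<Longrightarrow> D0 x \<in> W d"
  using W_iff[of x d] W_iff[of "D0 x" d] D0_RR[of x] Rep_D0[of x] RR_Rep[of x]
  unfolding graded_case_def V_def by auto

text \<open>In negative degrees the quotient complex is a single point, so injectivity on cohomology
  identifies the class of \<open>x\<close> with that of 0.\<close>

lemma exact_neg:
  assumes "x \<in> RR" "x \<in> hg wdeg hw_eq (- int n)" "n \<ge> 1" "D0 x = 0"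
  shows "\<exists>y\<in>RR. y \<in> hg wdeg hw_eq (- int n - 1) \<and> D0 y = x"
proof -
  let ?gr = "gpoly_gr V :: int \<Rightarrow> ('n, 'k) mpoly gpoly set" and ?d = "- int n"
  let ?r = "{(a, b). a \<in> cocycles ?gr \<delta> ?d \<and> b \<in> cocycles ?gr \<delta> ?d \<and> a - b \<in> coboundaries ?gr \<delta> ?d}"
  let ?F = "\<lambda>K. the_elem (augmentation I ` K)"
  have bij: "bij_betw ?F (cohomology ?gr \<delta> ?d) (quotient_complex I ?d)"
    using resolvent unfolding resolvent_on_generators_def resolvent_def V_def by blast
  have d0: "\<delta> 0 = 0" using Rep_D0[OF RR_0] by (simp add: zero_sp.rep_eq)
  have gr0: "0 \<in> ?gr d" for d by (simp add: gpoly_gr_def in_gpoly_carrier_iff)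
  have x: "Rep_sp x \<in> cocycles ?gr \<delta> ?d" and z: "0 \<in> cocycles ?gr \<delta> ?d"
    using assms Rep_D0[of x] gr_iff[of x ?d] gr0 d0 by (simp_all add: cocycles_def zero_sp.rep_eq)
  have cb: "0 \<in> coboundaries ?gr \<delta> ?d" unfolding coboundaries_def using gr0 d0 by (metis image_eqI)
  have "?r `` {Rep_sp x} \<in> cohomology ?gr \<delta> ?d" "?r `` {0} \<in> cohomology ?gr \<delta> ?d"
    unfolding cohomology_def by (rule quotientI[OF x], rule quotientI[OF z])
  moreover have "?F K = coset I 0" if "K \<in> cohomology ?gr \<delta> ?d" for K
  proof -
    have "?F K \<in> quotient_complex I ?d" using that bij by (auto simp: bij_betw_def)
    then show ?thesis using assms(3) by (simp add: quotient_complex_def)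
  qed
  moreover have "inj_on ?F (cohomology ?gr \<delta> ?d)" using bij by (simp add: bij_betw_def)
  ultimately have "?r `` {Rep_sp x} = ?r `` {0}" by (metis (no_types, lifting) inj_onD)
  moreover have "0 \<in> ?r `` {0}" using z cb by simp
  ultimately have "Rep_sp x - 0 \<in> coboundaries ?gr \<delta> ?d" by blast
  then obtain b where b: "b \<in> ?gr (?d - 1)" "Rep_sp x = \<delta> b" by (auto simp: coboundaries_def)
  define y where "y = Abs_sp b"
  have Ry: "Rep_sp y = b" unfolding y_def using b by (intro Rep_Abs_sp[of _ V]) (simp add: gpoly_gr_def)
  then have "y \<in> RR" "y \<in> hg wdeg hw_eq (?d - 1)" using b gr_iff[of y "?d - 1"] by simp_all
  moreover have "D0 y = x" using b Ry by (simp add: D0_def Rep_sp_inverse flip: b(2))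
  ultimately show ?thesis by blast
qed

lemma V_1: "(1, i) \<in> V \<longleftrightarrow> i \<in> {1..k}"
  using resolvent by (simp add: V_iff resolvent_on_generators_def)

lemma D0_gen: "\<mu> \<in> {1..k} \<Longrightarrow> D0 (vr (1, \<mu>)) = cst (f \<mu>)"
  using resolvent unfolding resolvent_on_generators_def
  by (simp add: D0_def Rep_vr flip: Rep_cst) (simp add: Rep_sp_inverse)

text \<open>In degree 0 a primitive is written down directly: coefficients expressing
  \<open>s\<close> through the generators become coefficients of the variables of degree -1.\<close>

lemma exact_0:
  assumes "s \<in> I"
  shows "\<exists>y\<in>RR. y \<in> hg wdeg hw_eq (-1) \<and> D0 y = cst s"
proof -
  obtain g where g: "s = (\<Sum>\<mu>=1..k. g \<mu> * f \<mu>)" using assms by (auto simp: generated_ideal_def)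
  let ?y = "\<Sum>\<mu>=1..k. cst (g \<mu>) * vr (1, \<mu>)"
  have RR: "cst (g \<mu>) * vr (1, \<mu>) \<in> RR" "vr (1, \<mu>) \<in> RR" if "\<mu> \<in> {1..k}" for \<mu>
    using that V_1[of \<mu>] by (auto intro!: RR_mult RR_cst RR_vr simp del: One_nat_def)
  have "cst (g \<mu>) * vr (1, \<mu>) \<in> hg wdeg hw_eq (-1)" if "\<mu> \<in> {1..k}" for \<mu>
    using gr_eq.hg_mult[OF hg_eq_cst[of "g \<mu>" wdeg] gr_eq.hg_vr[of "(1, \<mu>)" wdeg]] that V_1[of \<mu>]
    by (simp add: wdeg_def)
  then have "?y \<in> hg wdeg hw_eq (-1)" by (rule gr_eq.hg_sum)
  moreover have "?y \<in> RR" using RR by (intro RR_sum)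
  moreover have "D0 ?y = (\<Sum>\<mu>=1..k. D0 (cst (g \<mu>) * vr (1, \<mu>)))"
    using RR by (intro D0_sum)
  then have "D0 ?y = cst s"
    using RR by (simp add: D0_mult RR_cst D0_gen g cst_sum cst_mult del: One_nat_def)
  ultimately show ?thesis by blast
qed

text \<open>
  A solution of \<open>\<delta> y = x\<close> for homogeneous \<open>x\<close> may be replaced by its homogeneous component;
  \<open>off_weight e\<close> collects the remaining components.
\<close>

definition off_weight :: "int \<Rightarrow> ('n, 'k) mpoly sp set" where
  "off_weight e = {x. \<forall>M. \<forall>m\<in>Poly_Mapping.keys (coef x M).
     int (\<Sum>i\<in>UNIV. w i * Poly_Mapping.lookup m i) \<noteq> e - wtm ww M}"

lemma off_weight_add: "x \<in> off_weight e \<Longrightarrow> y \<in> off_weight e \<Longrightarrow> x + y \<in> off_weight e"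
  unfolding off_weight_def using Poly_Mapping.keys_add by fastforce

lemma W_off_weight: "x \<in> W e' \<Longrightarrow> e' \<noteq> e \<Longrightarrow> x \<in> off_weight e"
  unfolding off_weight_def using pw.hg_coef poly_weight_disjoint by fastforce

lemma W_inter_off_weight: "x \<in> W e \<Longrightarrow> x \<in> off_weight e \<Longrightarrow> x = 0"
proof (rule sp_eqI)
  fix M assume x: "x \<in> W e" "x \<in> off_weight e"
  have "Poly_Mapping.keys (coef x M) = {}"
    using x poly_weight_disjoint[OF _ pw.hg_coef[OF x(1)]] unfolding off_weight_def by blast
  then show "coef x M = coef 0 M" by simp
qed

text \<open>Each term of \<open>y\<close> is an eigenvector for the internal degree. Those of degree
  \<open>e\<close> form \<open>a\<close>; the others form \<open>b\<close>, and \<delta> preserves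
  their degrees.\<close>

lemma weight_component:
  assumes GC "y \<in> RR" "y \<in> hg wdeg hw_eq d"
  shows "\<exists>a b. y = a + b \<and> a \<in> RR \<and> b \<in> RR \<and> a \<in> hg wdeg hw_eq d \<and> a \<in> W e \<and> D0 b \<in> off_weight e"
    (is "?Q y")
proof (rule sp_sum_induct[where Q = ?Q])
  have Q0: "?Q 0"
    by (intro exI[of _ 0] conjI) (auto simp: RR_0 gr_eq.hg_0 pw.hg_0 off_weight_def)
  then show "?Q 0" .
  show Q_add: "?Q (u + v)" if u: "?Q u" and v: "?Q v" for u v
  proof -
    obtain a b where 1: "u = a + b" "a \<in> RR" "b \<in> RR" "a \<in> hg wdeg hw_eq d" "a \<in> W e" "D0 b \<in> off_weight e"
      using u by blast
    obtain a' b' where 2: "v = a' + b'" "a' \<in> RR" "b' \<in> RR" "a' \<in> hg wdeg hw_eq d" "a' \<in> W e" "D0 b' \<in> off_weight e"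
      using v by blast
    show ?thesis
      using 1 2 by (intro exI[of _ "a + a'"] exI[of _ "b + b'"] conjI)
        (auto simp: add_ac D0_add intro: RR_add gr_eq.hg_add pw.hg_add off_weight_add)
  qed
  fix M c assume M: "M \<in> mons y"
  have MV: "Poly_Mapping.keys M \<subseteq> V" "wtm wdeg M = d"
    using assms M by (auto simp: RR_iff hg_eq_iff)
  show "?Q (monom M c)"
  proof (induction c rule: pm_induct)
    case (single m c)
    let ?x = "monom M (Poly_Mapping.single m c)"
    let ?e = "int (\<Sum>i\<in>UNIV. w i * Poly_Mapping.lookup m i) + wtm ww M"
    have x: "?x \<in> RR" "?x \<in> hg wdeg hw_eq d" "?x \<in> W ?e"
      using MV monom_hg[of M _ wdeg] by (auto simp: monom_RR intro!: pw.hg_monom) (auto simp: poly_weight_def)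
    show ?case
    proof (cases "?e = e")
      case True
      then show ?thesis
        using x by (intro exI[of _ ?x] exI[of _ 0] conjI) (auto simp: RR_0 off_weight_def)
    next
      case False
      then show ?thesis
        using x W_off_weight[OF D0_W[OF assms(1) x(1,3)] False]
        by (intro exI[of _ 0] exI[of _ ?x] conjI) (auto simp: RR_0 gr_eq.hg_0 pw.hg_0)
    qed
  next
    case (add c c')
    then show ?case using Q_add[of "monom M c" "monom M c'"] by (simp add: monom_add)
  qed
qed

lemma resolvent_exact:
  assumes "x \<in> RR" "x \<in> hg wdeg hw_eq (- int n)" "D0 x = 0" "n = 0 \<Longrightarrow> coef x 0 \<in> I"
  shows "\<exists>y\<in>RR. y \<in> hg wdeg hw_eq (- int n - 1) \<and> D0 y = x \<and> (GC \<and> x \<in> W e \<longrightarrow> y \<in> W e)"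
proof -
  have "\<exists>y\<in>RR. y \<in> hg wdeg hw_eq (- int n - 1) \<and> D0 y = x"
  proof (cases "n = 0")
    case True
    \<comment> \<open>An element of degree 0 involves no variables at all.\<close>
    have "x = cst (coef x 0)"
    proof (rule sp_eqI)
      fix M
      have "M = 0" if "M \<in> mons x"
      proof -
        have "Poly_Mapping.keys M \<subseteq> vars_upto J 0"
          using RN_deg[OF assms(1,2)] True that by (auto simp: RN_def)
        moreover have "vars_upto J 0 = {}" using V_fst by (fastforce simp: vars_upto_V)
        ultimately show ?thesis by simp
      qed
      then show "coef x M = coef (cst (coef x 0)) M"
        by (auto simp: cst_def coef_monom mons_iff)
    qed
    then show ?thesis using exact_0[OF assms(4)[OF True]] True by simp
  next
    case False
    then show ?thesis using exact_neg[OF assms(1,2) _ assms(3)] by simp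
  qed
  then obtain y where y: "y \<in> RR" "y \<in> hg wdeg hw_eq (- int n - 1)" "D0 y = x" by blast
  show ?thesis
  proof (cases "GC \<and> x \<in> W e")
    case True
    then obtain a b where ab: "y = a + b" "a \<in> RR" "b \<in> RR" "a \<in> hg wdeg hw_eq (- int n - 1)" "a \<in> W e"
      "D0 b \<in> off_weight e"
      using weight_component[of y _ e] y by blast
    \<comment> \<open>This difference is homogeneous of degree \<open>e\<close> and at the same time
      has no component of degree \<open>e\<close>, hence it is zero and \<open>a\<close> alone is a
      primitive.\<close>
    have "D0 b = x - D0 a" using ab y by (simp add: D0_add algebra_simps flip: y(3))
    then have "D0 b \<in> W e" using True ab D0_W by (simp add: pw.hg_diff)
    then have "D0 b = 0" using ab(6) by (rule W_inter_off_weight)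
    then have "D0 a = x" using ab y by (simp add: D0_add)
    then show ?thesis using ab by blast
  next
    case False
    then show ?thesis using y by blast
  qed
qed

subsection \<open>Coefficients with respect to the momenta\<close>

text \<open>The sign is that of splitting off the momenta \<open>N\<close> to the right, as needed
  for \<open>cf_expansion\<close>.\<close>

definition cf :: "gmon \<Rightarrow> ('n, 'k) mpoly sp \<Rightarrow> ('n, 'k) mpoly sp" where
  "cf N = linear_ext (\<lambda>M c. if vpart (- V) M = N then monom (vpart V M) (mon_sign (vpart V M) N * c) else 0)"

lemma cf_add: "cf N (x + y) = cf N x + cf N y"
  unfolding cf_def by (rule linear_ext_add) (simp_all add: monom_add distrib_left)

lemma cf_sum: "cf N (sum g A) = (\<Sum>i\<in>A. cf N (g i))"
proof -
  have "cf N 0 = 0" using cf_add[of N 0 0] by simp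
  then show ?thesis by (induction A rule: infinite_finite_induct) (auto simp: cf_add)
qed

lemma cf_monom: "reduced M \<Longrightarrow> cf N (monom M c)
    = (if vpart (- V) M = N then monom (vpart V M) (mon_sign (vpart V M) N * c) else 0)"
  unfolding cf_def by (subst linear_ext_monom) auto

lemma cf_RR: "cf N x \<in> RR"
  unfolding cf_def linear_ext_def by (intro RR_sum) (auto intro: monom_RR RR_0 simp: keys_vpart)

lemma wtm_vpart: "wtm wt M = wtm wt (vpart V M) + wtm wt (vpart (- V) M)"
  by (subst vpart_split[symmetric, of M V]) (rule wtm_add)

lemma cf_hg:
  assumes "ring_grading hw" "x \<in> hg wt hw d"
  shows "cf N x \<in> hg wt hw (d - wtm wt N)"
proof -
  interpret ring_grading hw by fact
  show ?thesis
    unfolding cf_def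
  proof (rule hg_linear_ext[OF assms(2)])
    fix M c assume c: "c \<in> hw (d - wtm wt M)"
    show "(if vpart (- V) M = N then monom (vpart V M) (mon_sign (vpart V M) N * c) else 0)
      \<in> hg wt hw (d - wtm wt N)"
    proof (cases "vpart (- V) M = N")
      case True
      then have "c \<in> hw (d - wtm wt N - wtm wt (vpart V M))"
        using c wtm_vpart[of wt M] by (simp add: algebra_simps)
      then show ?thesis using True by (simp add: hg_monom hw_mon_sign_mult)
    qed (simp add: hg_0)
  qed
qed

lemma vpart_odd_disj: "odd_keys (vpart V M) \<inter> odd_keys (vpart (- V) M) = {}"
  by (rule odd_keys_disj) (auto simp: keys_vpart)

lemma cf_expansion:
  "x = (\<Sum>N\<in>vpart (- V) ` mons x. cf N x * monom N 1)"
proof -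
  define X where "X = vpart (- V) ` mons x"
  have "x = (\<Sum>N\<in>X. cf N x * monom N 1)"
  proof (rule sp_sum_induct[where x = x])
    fix M c assume M: "M \<in> mons x"
    let ?N = "vpart (- V) M"
    have red: "reduced M" "reduced ?N" "reduced (vpart V M)"
      using mons_reduced[OF M] by (auto intro: vpart_reduced)
    have "(\<Sum>N\<in>X. cf N (monom M c) * monom N 1)
      = (\<Sum>N\<in>X. if N = ?N then monom (vpart V M) (mon_sign (vpart V M) ?N * c) * monom ?N 1 else 0)"
      using red by (intro sum.cong) (auto simp: cf_monom)
    also have "\<dots> = monom (vpart V M) (mon_sign (vpart V M) ?N * c) * monom ?N 1"
      using M by (simp add: X_def)
    also have "\<dots> = monom M ((mon_sign (vpart V M) ?N * mon_sign (vpart V M) ?N) * c)"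
      using red by (simp add: monom_mult vpart_split mult.assoc)
    also have "\<dots> = monom M c" by (simp add: mon_sign_square vpart_odd_disj)
    finally show "monom M c = (\<Sum>N\<in>X. cf N (monom M c) * monom N 1)" by simp
  qed (auto simp: cf_add distrib_right sum.distrib cf_sum[of _ _ "{}", simplified])
  then show ?thesis by (simp add: X_def)
qed

lemma cf_mult_monom:
  assumes "r \<in> RR" "reduced N" "Poly_Mapping.keys N \<inter> V = {}"
  shows "cf N' (r * monom N 1) = (if N' = N then r else 0)"
  using assms(1)
proof (induction r rule: RR_induct)
  case (monom M a)
  have dj: "odd_keys M \<inter> odd_keys N = {}" using monom(2) assms(3) by (intro odd_keys_disj) auto
  have parts: "vpart V (M + N) = M" "vpart (- V) (M + N) = N"
  proof -
    have "vpart V M = M" "vpart (- V) M = 0" using monom(2) by (auto intro: vpart_id vpart_disj)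
    moreover have "vpart V N = 0" using assms(3) by (rule vpart_disj)
    moreover have "vpart (- V) N = N" using assms(3) by (intro vpart_id) blast
    ultimately show "vpart V (M + N) = M" "vpart (- V) (M + N) = N" by (simp_all add: vpart_add)
  qed
  have "reduced (M + N)" using monom assms(2) dj by (simp add: reduced_add_iff)
  then have "cf N' (monom M a * monom N 1)
    = (if N = N' then monom M ((mon_sign M N * mon_sign M N) * a) else 0)"
    using monom assms(2) by (cases "N' = N") (simp_all add: monom_mult cf_monom parts mult.assoc)
  then show ?case by (simp add: mon_sign_square[OF dj])
qed (auto simp: distrib_right cf_add)

lemma rd_momenta:
  assumes "c \<in> C" "Poly_Mapping.keys N \<inter> V = {}"
  shows "rd c (monom N 1) = 0"
proof (cases c)
  case (Inl j)
  then show ?thesis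
    by (simp add: rd_def dz_def cpar_def cdeg_def dcoef_monom[OF pd_derivation])
next
  case (Inr v)
  then have "v \<notin> Poly_Mapping.keys N" using assms by (auto simp: C_V)
  then show ?thesis
    using Inr by (simp add: rd_def dz_def epsp_def ep_monom dvar_monom_notin)
qed

lemma ep_monom_sg: "ep (monom N c) = sg (odd (card (odd_keys N))) (monom N c)"
  by (auto simp: ep_monom sg_def monom_minus)

text \<open>Momenta are constants for derivatives along coordinates, so only the parity sign of
  \<open>N\<close> appears. This permits treating cocycles coefficient by coefficient.\<close>

lemma dp_mult_monom:
  assumes "Poly_Mapping.keys N \<inter> V = {}"
  shows "dp K (r * monom N 1) = sg (odd (card (odd_keys N))) (dp K r * monom N 1)"
proof -
  have "dp K (monom N 1) = 0"
    unfolding dp_def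
    by (intro sum.neutral ballI) (simp add: rd_momenta[OF subsetD[OF CN_subset] assms])
  then show ?thesis by (simp add: dp_mult ep_monom_sg sg_mult_right)
qed

lemma generated_ideal_closed:
  shows "0 \<in> I" "a \<in> I \<Longrightarrow> b \<in> I \<Longrightarrow> a + b \<in> I" "a \<in> I \<Longrightarrow> c * a \<in> I" "a \<in> I \<Longrightarrow> - a \<in> I"
proof -
  show "0 \<in> I" unfolding generated_ideal_def by (rule range_eqI[of _ _ "\<lambda>_. 0"]) simp
  show "a + b \<in> I" if "a \<in> I" "b \<in> I"
  proof -
    obtain g h where "a = (\<Sum>\<mu>=1..k. g \<mu> * f \<mu>)" "b = (\<Sum>\<mu>=1..k. h \<mu> * f \<mu>)"
      using \<open>a \<in> I\<close> \<open>b \<in> I\<close> by (auto simp: generated_ideal_def)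
    then show ?thesis
      unfolding generated_ideal_def
      by (intro range_eqI[of _ _ "\<lambda>\<mu>. g \<mu> + h \<mu>"]) (simp add: distrib_right sum.distrib)
  qed
  show mult: "c * a \<in> I" if "a \<in> I" for a c
  proof -
    obtain g where "a = (\<Sum>\<mu>=1..k. g \<mu> * f \<mu>)"
      using \<open>a \<in> I\<close> by (auto simp: generated_ideal_def)
    then show ?thesis
      unfolding generated_ideal_def
      by (intro range_eqI[of _ _ "\<lambda>\<mu>. c * g \<mu>"]) (simp add: sum_distrib_left mult.assoc)
  qed
  show "- a \<in> I" if "a \<in> I" using mult[OF that, of "- 1"] by simp
qed

lemma cf_ideal:
  assumes "\<And>M. coef x M \<in> I"
  shows "coef (cf N x) K \<in> I"
proof -
  have "coef (if vpart (- V) M = N then monom (vpart V M) (mon_sign (vpart V M) N * coef x M) else 0) K \<in> I" for M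
    using assms[of M] generated_ideal_closed by (auto simp: coef_monom)
  then have "coef (\<Sum>M\<in>A. if vpart (- V) M = N then monom (vpart V M) (mon_sign (vpart V M) N * coef x M) else 0) K \<in> I"
    for A
    by (induction A rule: infinite_finite_induct) (simp_all add: generated_ideal_closed)
  then show ?thesis unfolding cf_def linear_ext_def .
qed

text \<open>The coefficient of each momentum monomial in \<open>G\<close> is a \<delta>-cocycle of
  degree \<open>- int n\<close>. Primitives of these, taken from exactness of the resolvent, are
  multiplied back by the monomials. They have degree \<open>- int n - 1\<close>, hence involve only
  variables seen by \<open>dp (n + 1)\<close>.\<close>

lemma dp_primitive:
  assumes G: "G \<in> hg wz hw_eq (int n)" "G \<in> hg wc hw_ge 2" "G \<in> hg wdeg hw_eq 3"
    and dG: "dp (n + 1) G = 0" and GI: "n = 0 \<Longrightarrow> \<forall>M. coef G M \<in> I"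
  shows "\<exists>\<rho>. \<rho> \<in> hg wz hw_eq (int n + 1) \<and> \<rho> \<in> hg wc hw_ge 2 \<and> \<rho> \<in> hg wdeg hw_eq 2
    \<and> dp (n + 1) \<rho> = - G \<and> (GC \<and> G \<in> W (- p) \<longrightarrow> \<rho> \<in> W (- p))"
proof -
  define X where "X = vpart (- V) ` mons G"
  \<comment> \<open>On \<open>X'\<close> the degree and the number of momenta of \<open>N\<close>
    can be read off from a monomial of the nonzero coefficient.\<close>
  define X' where "X' = {N \<in> X. cf N G \<noteq> 0}"
  have finX: "finite X" by (simp add: X_def)
  have X: "reduced N" "Poly_Mapping.keys N \<inter> V = {}" if "N \<in> X" for N
    using that by (auto simp: X_def keys_vpart mons_reduced intro: vpart_reduced)
  define s where "s N = odd (card (odd_keys N))" for N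
  have wzN: "wtm wz N = 0" if "N \<in> X" for N
    using X[OF that] unfolding wtm_def by (intro sum.neutral) (auto simp: wz_def)
  have cf_wdeg: "cf N G \<in> hg wdeg hw_eq (- int n)" if "N \<in> X" for N
  proof -
    have "cf N G \<in> hg wz hw_eq (int n)"
      using cf_hg[OF gr_eq.ring_grading_axioms G(1), of N] wzN[OF that] by simp
    moreover have "wtm wdeg M = - wtm wz M" if "M \<in> mons (cf N G)" for M
      using that cf_RR[of N G] unfolding wtm_def
      by (auto simp: RR_iff wz_def wdeg_def subset_iff sum_negf simp flip: sum_negf)
    ultimately show ?thesis by (auto simp: hg_eq_iff)
  qed
  have Gexp: "G = (\<Sum>N\<in>X. cf N G * monom N 1)" unfolding X_def by (rule cf_expansion)
  \<comment> \<open>The coefficient of \<open>N\<close> is extracted from the vanishing of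
    \<open>dp (n + 1) G\<close>.\<close>
  have closed: "D0 (cf N G) = 0" if N: "N \<in> X" for N
  proof -
    have "0 = cf N (\<Sum>N'\<in>X. sg (s N') (dp (n + 1) (cf N' G) * monom N' 1))"
      using dG cf_sum[of N "\<lambda>_. 0" "{}"] unfolding s_def
      by (subst (asm) Gexp) (simp add: dp_sum dp_mult_monom X)
    also have "\<dots> = (\<Sum>N'\<in>X. if N = N' then sg (s N') (dp (n + 1) (cf N' G)) else 0)"
      unfolding cf_sum
    proof (intro sum.cong refl)
      fix N' assume "N' \<in> X"
      have "dp (n + 1) (cf N' G) \<in> RR"
        unfolding dp_def using CN_subset by (intro RR_sum RR_mult RR_rd RR_sg dl_RR cf_RR) auto
      then have "sg (s N') (dp (n + 1) (cf N' G)) \<in> RR" by (rule RR_sg)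
      then show "cf N (sg (s N') (dp (n + 1) (cf N' G) * monom N' 1))
        = (if N = N' then sg (s N') (dp (n + 1) (cf N' G)) else 0)"
        using cf_mult_monom X[OF \<open>N' \<in> X\<close>] by (simp flip: sg_mult_left)
    qed
    also have "\<dots> = sg (s N) (dp (n + 1) (cf N G))" using N finX by simp
    finally have "dp (n + 1) (cf N G) = 0" by (cases "s N") simp_all
    moreover have "cf N G \<in> RN (n + 1)"
      using RN_deg[OF cf_RR cf_wdeg[OF N]] RN_mono[of n "n + 1"] by auto
    ultimately have "D0 (ep (cf N G)) = 0" using dp_eq by simp
    then show ?thesis
      using hom_wdeg[OF cf_wdeg[OF N]] by (simp add: hom_def D0_sg cf_RR) (cases "odd n"; simp)
  qed
  have "\<exists>y. y \<in> RR \<and> y \<in> hg wdeg hw_eq (- int n - 1) \<and> D0 y = cf N G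
      \<and> (GC \<and> cf N G \<in> W (- p - wtm ww N) \<longrightarrow> y \<in> W (- p - wtm ww N))" if "N \<in> X" for N
    using resolvent_exact[OF cf_RR cf_wdeg[OF that] closed[OF that]] cf_ideal GI by blast
  then obtain y where y: "\<And>N. N \<in> X \<Longrightarrow> y N \<in> RR" "\<And>N. N \<in> X \<Longrightarrow> y N \<in> hg wdeg hw_eq (- int n - 1)"
    "\<And>N. N \<in> X \<Longrightarrow> D0 (y N) = cf N G"
    "\<And>N. N \<in> X \<Longrightarrow> GC \<and> cf N G \<in> W (- p - wtm ww N) \<longrightarrow> y N \<in> W (- p - wtm ww N)"
    by metis
  \<comment> \<open>The involution converts \<open>D0\<close> into \<open>dp\<close>, the sign
    \<open>s N\<close> offsets the one picked up at \<open>monom N 1\<close>, and the minus sign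
    leads to \<open>- G\<close>.\<close>
  define r where "r N = - sg (s N) (ep (y N))" for N
  have r: "r N \<in> RR" "r N \<in> hg wdeg hw_eq (- int n - 1)" if "N \<in> X" for N
    using y(1,2)[OF that] unfolding r_def
    by (auto intro: RR_minus RR_sg RR_ep gr_eq.hg_minus gr_eq.hg_sg gr_eq.hg_ep)
  have dr: "dp (n + 1) (r N) = - sg (s N) (cf N G)" if "N \<in> X" for N
  proof -
    have "- int (n + 1) = - int n - 1" by simp
    then have "r N \<in> RN (n + 1)" using r[OF that] RN_deg[of "r N" "n + 1"] by metis
    then have "dp (n + 1) (r N) = D0 (- sg (s N) (y N))"
      by (simp add: dp_eq r_def ep_minus eps_sg)
    also have "\<dots> = - sg (s N) (D0 (y N))"
      using y(1)[OF that] by (simp add: D0_minus D0_sg RR_sg)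
    finally show ?thesis using y(3)[OF that] by simp
  qed
  define \<rho> where "\<rho> = (\<Sum>N\<in>X'. r N * monom N 1)"
  have X'X: "N \<in> X" "cf N G \<noteq> 0" if "N \<in> X'" for N using that by (auto simp: X'_def)
  have "dp (n + 1) \<rho> = (\<Sum>N\<in>X'. - (cf N G * monom N 1))"
    unfolding \<rho>_def dp_sum
  proof (intro sum.cong refl)
    fix N assume "N \<in> X'"
    then have N: "N \<in> X" by (rule X'X)
    have "dp (n + 1) (r N * monom N 1) = sg (s N) (- sg (s N) (cf N G) * monom N 1)"
      using dp_mult_monom[OF X(2)[OF N], of "n + 1" "r N"] unfolding dr[OF N] s_def .
    then show "dp (n + 1) (r N * monom N 1) = - (cf N G * monom N 1)" by (cases "s N") simp_all
  qed
  also have "\<dots> = (\<Sum>N\<in>X. - (cf N G * monom N 1))"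
    using finX by (intro sum.mono_neutral_left) (auto simp: X'_def)
  finally have d\<rho>: "dp (n + 1) \<rho> = - G" using Gexp by (simp add: sum_negf)
  have mN: "monom N 1 \<in> hg wt hw_eq (wtm wt N)" for wt N by (rule monom_hg)
  have nz: "\<exists>M. M \<in> mons (cf N G)" if "N \<in> X'" for N using X'X(2)[OF that] sp_eq_0I by blast
  have "r N * monom N 1 \<in> hg wdeg hw_eq 2 \<and> r N * monom N 1 \<in> hg wz hw_eq (int n + 1)
    \<and> r N * monom N 1 \<in> hg wc hw_ge 2 \<and> (GC \<and> G \<in> W (- p) \<longrightarrow> r N * monom N 1 \<in> W (- p))"
    if N: "N \<in> X'" for N
  proof (intro conjI impI)
    note NX = X'X(1)[OF N]
    obtain M where M: "M \<in> mons (cf N G)" using nz[OF N] by blast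
    have "wtm wdeg M = 3 - wtm wdeg N"
      using cf_hg[OF gr_eq.ring_grading_axioms G(3), of N] M by (auto simp: hg_eq_iff)
    moreover have "wtm wdeg M = - int n" using cf_wdeg[OF NX] M by (auto simp: hg_eq_iff)
    ultimately have "wtm wdeg N = int n + 3" by simp
    then show "r N * monom N 1 \<in> hg wdeg hw_eq 2"
      using gr_eq.hg_mult[OF r(2)[OF NX] mN[of N wdeg]] by simp
    have "r N \<in> hg wz hw_eq (int n + 1)"
      using r[OF NX] mon_degree_wdeg
    proof -
      have "wtm wz M = - wtm wdeg M" if "M \<in> mons (r N)" for M
        using that r(1)[OF NX] unfolding wtm_def
        by (auto simp: RR_iff wz_def wdeg_def subset_iff sum_negf simp flip: sum_negf)
      then show ?thesis using r(2)[OF NX] by (auto simp: hg_eq_iff)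
    qed
    then show "r N * monom N 1 \<in> hg wz hw_eq (int n + 1)"
      using gr_eq.hg_mult[OF _ mN[of N wz]] wzN[OF NX] by fastforce
    have "wtm wc M \<ge> 2 - wtm wc N"
      using cf_hg[OF gr_ge.ring_grading_axioms G(2), of N] M by (auto simp: hg_ge_iff)
    moreover have "wtm wc M = 0" using cf_RR[of N G] M by (auto simp: RR_def hg_eq_iff)
    ultimately have "monom N 1 \<in> hg wc hw_ge 2" using hg_eq_ge[OF mN[of N wc]] by (auto intro: hg_ge_mono)
    moreover have "r N \<in> hg wc hw_ge 0" using r(1)[OF NX] unfolding RR_def by (rule hg_eq_ge)
    ultimately show "r N * monom N 1 \<in> hg wc hw_ge 2" using gr_ge.hg_mult by fastforce
    assume GW: "GC \<and> G \<in> W (- p)"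
    then have "cf N G \<in> W (- p - wtm ww N)" by (intro cf_hg poly_weight_grading) simp
    then have "y N \<in> W (- p - wtm ww N)" using y(4)[OF NX] GW by blast
    then have "r N \<in> W (- p - wtm ww N)" unfolding r_def by (intro pw.hg_minus pw.hg_sg pw.hg_ep)
    moreover have "monom N 1 \<in> W (wtm ww N)" by (rule pw.hg_monom) (simp add: pw.hw_1)
    ultimately show "r N * monom N 1 \<in> W (- p)" using pw.hg_mult by fastforce
  qed
  then have "\<rho> \<in> hg wdeg hw_eq 2" "\<rho> \<in> hg wz hw_eq (int n + 1)" "\<rho> \<in> hg wc hw_ge 2"
    "GC \<and> G \<in> W (- p) \<longrightarrow> \<rho> \<in> W (- p)"
    unfolding \<rho>_def by (auto intro!: gr_eq.hg_sum gr_ge.hg_sum pw.hg_sum)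
  then show ?thesis using d\<rho> by blast
qed

end

section \<open>The Poisson bracket in coordinates\<close>

lemma kconst_mult: "kconst (a * b) = kconst a * kconst b"
  by (simp add: kconst_def mult_single)

lemma kconst_add: "kconst (a + b) = kconst a + kconst b"
  by (simp add: kconst_def single_add)

lemma kconst_half: "kconst (1/2) * x + kconst (1/2) * x = (x :: ('n, 'k::field_char_0) mpoly)"
proof -
  have "kconst (1/2) + kconst (1/2) = (1 :: ('n, 'k) mpoly)"
    by (simp add: kconst_1 flip: kconst_add)
  then have "(kconst (1/2) + kconst (1/2)) * x = x" by simp
  then show ?thesis by (simp only: distrib_right)
qed

lemma cst_diff: "cst (a - b) = cst a - cst b"
  by (simp add: cst_def monom_diff)

lemma coef_cst_mult: "coef (cst s * x) M = s * coef x M"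
proof (induction x rule: sp_induct)
  case (monom N c)
  then show ?case by (simp add: cst_def monom_mult coef_monom)
qed (simp add: distrib_left)

lemma restr_hg: "ring_grading hw \<Longrightarrow> x \<in> hg wt hw d \<Longrightarrow> restr Q x \<in> hg wt hw d"
  using ring_grading.hw_0 by (fastforce simp: hg_def coef_restr)

lemma cst_central: "x * cst s = cst s * x"
proof (induction x rule: sp_induct)
  case (monom M c)
  then show ?case by (simp add: cst_def monom_mult mult.commute)
qed (simp_all add: distrib_left distrib_right)

context poisson_resolvent
begin

lemma P_add_left: "P (a + b) c = P a c + P b c" and P_add_right: "P c (a + b) = P c a + P c b"
  and P_self: "P a a = 0"
  and P_jacobi: "P a (P b c) + P b (P c a) + P c (P a b) = 0"
  and P_mult_left: "P (a * b) c = a * P b c + b * P a c"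
  and P_scale_left: "P (pscale s a) c = pscale s (P a c)"
proof -
  note * = poisson[unfolded poisson_bracket_def]
  have 1: "pscale 1 a = a" for a :: "('n, 'k) mpoly" by (simp add: pscale_eq kconst_1)
  show add: "P (a + b) c = P a c + P b c" for a b c using * 1 by metis
  show "P c (a + b) = P c a + P c b" using * 1 by metis
  show "P a a = 0" "P a (P b c) + P b (P c a) + P c (P a b) = 0" "P (a * b) c = a * P b c + b * P a c"
    using * by blast+
  have "P 0 c = 0" using add[of 0 0 c] by simp
  then show "P (pscale s a) c = pscale s (P a c)" using * by (metis add_0_right)
qed

lemma P_skew: "P a b = - P b a"
  using P_self[of "a + b"] P_self[of a] P_self[of b]
  by (simp add: P_add_left P_add_right eq_neg_iff_add_eq_0 add.commute)

lemma P_derivation: "derivation (\<lambda>s. P s t) TYPE(('n, 'k) mpoly)"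
  by (simp add: derivation_def P_add_left P_mult_left)

lemma P_expand_left: "P s t = (\<Sum>i\<in>UNIV. pd i s * P (pvar i) t)"
proof -
  have "P (kconst c) t = 0" for c
    using P_scale_left[of c 1 t] derivationD(5)[OF P_derivation, of t] by (simp add: pscale_eq)
  then show ?thesis
    using derivation_expand[OF P_derivation, of t s] by (simp add: mult.commute)
qed

lemma P_expand: "P s t = (\<Sum>i\<in>UNIV. \<Sum>j\<in>UNIV. pd i s * pd j t * P (pvar i) (pvar j))"
proof -
  have "P (pvar i) t = (\<Sum>j\<in>UNIV. pd j t * P (pvar i) (pvar j))" for i
    using P_expand_left[of t "pvar i"] P_skew[of "pvar i"] by (simp add: sum_negf)
  then show ?thesis
    by (simp add: P_expand_left[of s t] sum_distrib_left mult.assoc)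
qed

lemma P_I: "a \<in> I \<Longrightarrow> P a s \<in> I"
  using poisson_I by (simp add: poisson_ideal_def)

subsection \<open>The leading terms of the Hamiltonian\<close>

definition xv :: "'n + gvar \<Rightarrow> ('n, 'k) mpoly sp" where
  "xv c = vr (xi c)"

text \<open>
  The Hamiltonians of \<open>\<delta>\<close> and of the Poisson bracket.  The former is an infinite sum, truncated here
  to the coordinates of degree at most \<open>N\<close>.
\<close>

definition dpart :: "nat \<Rightarrow> ('n, 'k) mpoly sp" where
  "dpart N = - (\<Sum>c\<in>CN N. dl c * xv c)"

abbreviation Pij :: "'n \<Rightarrow> 'n \<Rightarrow> ('n, 'k) mpoly" where
  "Pij i j \<equiv> P (pvar i) (pvar j)"

text \<open>The half compensates for each pair of indices occurring twice. With this overall sign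
  the nested bracket of two elements of \<open>S\<close> with \<open>Pi0\<close> is their Poisson
  bracket.\<close>

definition Pi0 :: "('n, 'k) mpoly sp" where
  "Pi0 = (\<Sum>a\<in>UNIV. \<Sum>b\<in>UNIV. cst (- (kconst (1/2) * Pij a b)) * (xv (Inl a) * xv (Inl b)))"

lemma dx_xv: "b \<in> C \<Longrightarrow> c \<in> C \<Longrightarrow> dx c (xv b) = (if b = c then 1 else 0)"
  using xi_inj by (auto simp: dx_def xv_def dvar_vr dest: inj_onD)

lemma dx_cst [simp]: "dx c (cst s) = 0"
  by (simp add: dx_def)

lemma ep_xv: "ep (xv c) = sg (\<not> cpar c) (xv c)"
  by (simp add: xv_def ep_vr cpar_def)

lemma hom_xv: "hom (\<not> cpar c) (xv c)"
  by (simp add: hom_def ep_xv)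

lemma rd_xv [simp]: "c \<in> C \<Longrightarrow> rd c (xv b) = 0"
  using xi_notin_V[of b] by (auto simp: xv_def rd_vr C_V)

lemma dp_xv [simp]: "dp N (xv b) = 0"
  unfolding dp_def by (intro sum.neutral ballI) (simp add: rd_xv[OF subsetD[OF CN_subset]])

lemma dx_dpart:
  assumes "c \<in> C"
  shows "dx c (dpart N) = (if cdeg c \<le> N then sg (cpar c) (dl c) else 0)"
proof -
  have "dx c (dl b * xv b) = (if b = c then - sg (cpar c) (dl c) else 0)" if "b \<in> CN N" for b
  proof -
    have b: "b \<in> C" using that CN_subset by blast
    then have "epsp (\<not> cpar b) (dl b) = sg (\<not> cpar b) (dl b)"
      using epsp_hom[OF dl_hom, of b "\<not> cpar b"] by simp
    then show ?thesis
      using b assms by (auto simp: dx_mult dx_xv RR_dx dl_RR sg_def)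
  qed
  then have "dx c (\<Sum>b\<in>CN N. dl b * xv b) = (\<Sum>b\<in>CN N. if b = c then - sg (cpar c) (dl c) else 0)"
    unfolding dx_sum by (intro sum.cong) auto
  then show ?thesis
    using assms by (simp add: dpart_def dx_minus finite_CN) (simp add: CN_def)
qed

lemma DD_dpart:
  assumes "M \<le> N \<or> N \<le> M" "K = min M N"
  shows "DD (CN M) x (dpart N) = dp K x"
proof -
  have "DD (CN M) x (dpart N) = (\<Sum>c\<in>CN M. if c \<in> CN K then rd c x * sg (cpar c) (dl c) else 0)"
    unfolding DD_def using assms by (intro sum.cong refl) (auto simp: dx_dpart CN_def)
  also have "\<dots> = dp K x"
    unfolding dp_def using assms finite_CN by (subst sum.inter_restrict[symmetric])
      (auto intro!: sum.cong simp: CN_def)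
  finally show ?thesis .
qed

text \<open>This is \<delta> \<delta> = 0 on a generator. Since \<delta> of a variable of degree
  \<open>N + 1\<close> involves only variables of degree at most \<open>N\<close>, the truncation at
  \<open>N\<close> already suffices for it.\<close>

lemma dp_dl: "c \<in> C \<Longrightarrow> cdeg c \<le> N + 1 \<Longrightarrow> dp N (dl c) = 0"
proof -
  assume c: "c \<in> C" "cdeg c \<le> N + 1"
  have "dl c \<in> RN N"
    using dl_RN[OF c(1)] c(2) unfolding RN_def vars_upto_V by fastforce
  then have "dp N (dl c) = D0 (sg (\<not> cpar c) (dl c))"
    using dl_hom[OF c(1)] by (simp add: dp_eq hom_def)
  also have "\<dots> = 0"
    using c(1) by (cases c) (auto simp: D0_sg D0_RR dl_def C_V D0_D0 RR_vr)
  finally show ?thesis .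
qed

text \<open>The vector field of \<delta> commutes with itself. The gain of one degree over the index
  of \<open>dp\<close> is used when the next stage is opened.\<close>

lemma dp_dpart: "M \<le> N + 1 \<Longrightarrow> dp N (dpart M) = 0"
proof -
  assume M: "M \<le> N + 1"
  have "dp N (dl c * xv c) = 0" if "c \<in> CN M" for c
    using that M by (simp add: dp_mult dp_dl CN_def)
  then show ?thesis by (simp add: dpart_def dp_minus dp_sum)
qed

lemma dx_Pi0:
  shows "dx (Inl j) Pi0 = - (\<Sum>b\<in>UNIV. cst (Pij j b) * xv (Inl b))"
    and "v \<in> V \<Longrightarrow> dx (Inr v) Pi0 = 0"
proof -
  define h where "h a b = - (kconst (1/2) * Pij a b)" for a b
  have Inl: "Inl i \<in> C" for i by (simp add: C_def)
  have par: "cpar (Inl i) = False" for i by (simp add: cpar_def cdeg_def)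
  have eps: "epsp True (xv (Inl a)) = - xv (Inl a)" for a by (simp add: ep_xv par)
  have hh: "h j b - h b j = - Pij j b" for j b
  proof -
    have "h b j = kconst (1/2) * Pij j b"
      using P_skew[of "pvar b" "pvar j"] by (simp only: h_def mult_minus_right minus_minus)
    then have "h j b - h b j = - (kconst (1/2) * Pij j b + kconst (1/2) * Pij j b)"
      by (simp only: h_def minus_add_distrib diff_conv_add_uminus)
    then show ?thesis by (simp only: kconst_half)
  qed
  have "dx (Inl j) (cst (h a b) * (xv (Inl a) * xv (Inl b)))
    = (if a = j then cst (h j b) * xv (Inl b) else 0) - (if b = j then cst (h a j) * xv (Inl a) else 0)" for a b
    by (simp add: dx_mult dx_xv Inl par eps eps_mult epsp_eps ep_xv)
  then have "dx (Inl j) Pi0 = (\<Sum>a\<in>UNIV. \<Sum>b\<in>UNIV. if a = j then cst (h j b) * xv (Inl b) else 0)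
      - (\<Sum>a\<in>UNIV. \<Sum>b\<in>UNIV. if b = j then cst (h a j) * xv (Inl a) else 0)"
    by (simp add: Pi0_def dx_sum sum_subtractf flip: h_def)
  also have "(\<Sum>a\<in>UNIV. \<Sum>b\<in>UNIV. if a = j then cst (h j b) * xv (Inl b) else 0)
    = (\<Sum>b\<in>UNIV. cst (h j b) * xv (Inl b))"
    by (subst sum.swap) simp
  also have "(\<Sum>a\<in>UNIV. \<Sum>b\<in>UNIV. if b = j then cst (h a j) * xv (Inl a) else 0)
    = (\<Sum>a\<in>UNIV. cst (h a j) * xv (Inl a))" by simp
  finally have "dx (Inl j) Pi0 = (\<Sum>b\<in>UNIV. cst (h j b - h b j) * xv (Inl b))"
    by (simp add: cst_diff left_diff_distrib sum_subtractf)
  then show "dx (Inl j) Pi0 = - (\<Sum>b\<in>UNIV. cst (Pij j b) * xv (Inl b))"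
    by (simp add: hh cst_minus sum_negf)
  assume "v \<in> V"
  then have "Inr v \<in> C" by (simp add: C_V)
  then show "dx (Inr v) Pi0 = 0"
    by (simp add: Pi0_def dx_sum dx_mult dx_xv Inl)
qed

lemma rd_Pi0:
  shows "rd (Inl j) Pi0 = (\<Sum>a\<in>UNIV. \<Sum>b\<in>UNIV. cst (- (kconst (1/2) * pd j (Pij a b))) * (xv (Inl a) * xv (Inl b)))"
    and "v \<in> V \<Longrightarrow> rd (Inr v) Pi0 = 0"
proof -
  have C: "Inl j \<in> C" by (simp add: C_def)
  have "pd j (- (kconst (1/2) * s)) = - (kconst (1/2) * pd j s)" for s :: "('n, 'k) mpoly"
    using derivationD(4)[OF pd_derivation] by (simp add: pd_mult)
  then show "rd (Inl j) Pi0 = (\<Sum>a\<in>UNIV. \<Sum>b\<in>UNIV. cst (- (kconst (1/2) * pd j (Pij a b))) * (xv (Inl a) * xv (Inl b)))"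
    using C by (simp add: Pi0_def rd_sum rd_mult rd_cst cpar_def cdeg_def)
  assume "v \<in> V"
  then have "Inr v \<in> C" by (simp add: C_V)
  then show "rd (Inr v) Pi0 = 0"
    by (simp add: Pi0_def rd_sum rd_mult rd_cst)
qed

lemma triple_eq_0: "x + x + x = 0 \<Longrightarrow> x = 0" for x :: "('n, 'k) mpoly sp"
proof (rule sp_eqI)
  fix M assume "x + x + x = 0"
  then have 0: "coef x M + coef x M + coef x M = 0" by (metis coef_simps(1,4))
  have "coef x M = 0"
  proof (rule poly_mapping_eqI)
    fix m
    have "Poly_Mapping.lookup (coef x M) m + Poly_Mapping.lookup (coef x M) m + Poly_Mapping.lookup (coef x M) m = 0"
      using arg_cong[OF 0, of "\<lambda>s. Poly_Mapping.lookup s m"] by (simp only: lookup_add lookup_zero)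
    then have "3 * Poly_Mapping.lookup (coef x M) m = 0" by simp
    then show "Poly_Mapping.lookup (coef x M) m = Poly_Mapping.lookup 0 m" by (simp del: distrib_left_numeral)
  qed
  then show "coef x M = coef 0 M" by simp
qed

text \<open>The self-bracket of the bivector is half the trivector \<open>Y\<close>. Cyclic rotation
  of indices does not change \<open>Y\<close>, and the sum of its three rotations contains the
  Jacobi identity on generators, so \<open>Y + Y + Y = 0\<close>.\<close>

lemma DD_Pi0: "DD (CN N) Pi0 Pi0 = 0"
proof -
  define X where "X i = xv (Inl i)" for i
  have XX: "X a * X b = - (X b * X a)" for a b
    using hom_commute[OF hom_xv hom_xv, of "Inl a" "Inl b"] by (simp add: X_def cpar_def cdeg_def)
  define Y where "Y = (\<Sum>a\<in>UNIV. \<Sum>b\<in>UNIV. \<Sum>c\<in>UNIV. cst (P (Pij a b) (pvar c)) * (X a * X b * X c))"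
  \<comment> \<open>The momenta of the variables of \<open>S\<close> anticommute, and a cyclic
    permutation of three of them is even.\<close>
  have cyc: "X b * X c * X a = X a * X b * X c" for a b c
  proof -
    have "X b * X c * X a = X b * (- (X a * X c))" by (subst XX[symmetric]) (rule mult.assoc)
    also have "\<dots> = - (X b * X a) * X c" by (simp add: mult.assoc)
    also have "\<dots> = X a * X b * X c" by (subst XX[symmetric]) simp
    finally show ?thesis .
  qed
  have rot: "(\<Sum>a\<in>UNIV. \<Sum>b\<in>UNIV. \<Sum>c\<in>UNIV. g a b c) = (\<Sum>a\<in>UNIV. \<Sum>b\<in>UNIV. \<Sum>c\<in>UNIV. g b c a)"
    for g :: "'n \<Rightarrow> 'n \<Rightarrow> 'n \<Rightarrow> ('n, 'k) mpoly sp"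
  proof -
    have "(\<Sum>a\<in>UNIV. \<Sum>b\<in>UNIV. \<Sum>c\<in>UNIV. g b c a) = (\<Sum>b\<in>UNIV. \<Sum>a\<in>UNIV. \<Sum>c\<in>UNIV. g b c a)"
      by (rule sum.swap)
    also have "\<dots> = (\<Sum>b\<in>UNIV. \<Sum>c\<in>UNIV. \<Sum>a\<in>UNIV. g b c a)"
      by (intro sum.cong refl sum.swap)
    finally show ?thesis by simp
  qed
  have Y1: "Y = (\<Sum>a\<in>UNIV. \<Sum>b\<in>UNIV. \<Sum>c\<in>UNIV. cst (P (Pij b c) (pvar a)) * (X a * X b * X c))"
    unfolding Y_def rot[of "\<lambda>a b c. cst (P (Pij a b) (pvar c)) * (X a * X b * X c)"]
    by (intro sum.cong refl arg_cong2[of _ _ _ _ "(*)"] cyc)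
  have Y2: "Y = (\<Sum>a\<in>UNIV. \<Sum>b\<in>UNIV. \<Sum>c\<in>UNIV. cst (P (Pij c a) (pvar b)) * (X a * X b * X c))"
    unfolding Y1 rot[of "\<lambda>a b c. cst (P (Pij b c) (pvar a)) * (X a * X b * X c)"]
    by (intro sum.cong refl arg_cong2[of _ _ _ _ "(*)"] cyc)
  have jac: "P (Pij a b) (pvar c) + P (Pij b c) (pvar a) + P (Pij c a) (pvar b) = 0" for a b c
  proof -
    have "P (Pij a b) (pvar c) + P (Pij b c) (pvar a) + P (Pij c a) (pvar b)
      = - (P (pvar a) (Pij b c) + P (pvar b) (Pij c a) + P (pvar c) (Pij a b))"
      unfolding P_skew[of "Pij a b"] P_skew[of "Pij b c"] P_skew[of "Pij c a"] by simp
    then show ?thesis by (simp only: P_jacobi minus_zero)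
  qed
  have "Y + Y + Y = (\<Sum>a\<in>UNIV. \<Sum>b\<in>UNIV. \<Sum>c\<in>UNIV.
    cst (P (Pij a b) (pvar c) + P (Pij b c) (pvar a) + P (Pij c a) (pvar b)) * (X a * X b * X c))"
    by (simp only: cst_add distrib_right sum.distrib Y_def[symmetric] Y1[symmetric] Y2[symmetric])
  then have "Y + Y + Y = 0"
    by (simp only: jac cst_0 mult_zero_left sum.neutral_const)
  then have Y0: "Y = 0" by (rule triple_eq_0)
  have "DD (CN N) Pi0 Pi0 = (\<Sum>j\<in>UNIV. rd (Inl j) Pi0 * dx (Inl j) Pi0)"
  proof -
    have sub: "range Inl \<subseteq> CN N" by (auto simp: CN_def C_def cdeg_def)
    have "DD (CN N) Pi0 Pi0 = (\<Sum>c\<in>range Inl. rd c Pi0 * dx c Pi0)"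
      unfolding DD_def using sub finite_CN
      by (intro sum.mono_neutral_right) (auto simp: CN_def C_def dx_Pi0(2))
    then show ?thesis by (simp add: sum.reindex)
  qed
  also have "\<dots> = (\<Sum>j\<in>UNIV. \<Sum>a\<in>UNIV. \<Sum>b\<in>UNIV. \<Sum>c\<in>UNIV.
      cst (kconst (1/2)) * (cst (pd j (Pij a b) * Pij j c) * (X a * X b * X c)))"
  proof -
    have t: "cst (- (kconst (1/2) * s)) * (X a * X b) * - (cst t * X c)
      = cst (kconst (1/2)) * (cst (s * t) * (X a * X b * X c))" for s t a b c
    proof -
      have "X a * X b * (cst t * X c) = cst t * (X a * X b * X c)"
        by (metis cst_central mult.assoc)
      then show ?thesis by (simp add: cst_minus cst_mult mult.assoc)
    qed
    show ?thesis
      unfolding rd_Pi0(1) dx_Pi0(1) X_def[symmetric] sum_negf[symmetric] sum_distrib_right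
      unfolding sum_distrib_left t ..
  qed
  also have "\<dots> = cst (kconst (1/2)) * Y"
  proof -
    have "P (Pij a b) (pvar c) = (\<Sum>j\<in>UNIV. pd j (Pij a b) * Pij j c)" for a b c
      by (rule P_expand_left)
    then have "Y = (\<Sum>a\<in>UNIV. \<Sum>b\<in>UNIV. \<Sum>c\<in>UNIV. \<Sum>j\<in>UNIV. cst (pd j (Pij a b) * Pij j c) * (X a * X b * X c))"
      by (simp add: Y_def cst_sum sum_distrib_right)
    also have "\<dots> = (\<Sum>a\<in>UNIV. \<Sum>b\<in>UNIV. \<Sum>j\<in>UNIV. \<Sum>c\<in>UNIV. cst (pd j (Pij a b) * Pij j c) * (X a * X b * X c))"
      by (intro sum.cong refl sum.swap)
    also have "\<dots> = (\<Sum>a\<in>UNIV. \<Sum>j\<in>UNIV. \<Sum>b\<in>UNIV. \<Sum>c\<in>UNIV. cst (pd j (Pij a b) * Pij j c) * (X a * X b * X c))"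
      by (intro sum.cong refl sum.swap)
    also have "\<dots> = (\<Sum>j\<in>UNIV. \<Sum>a\<in>UNIV. \<Sum>b\<in>UNIV. \<Sum>c\<in>UNIV. cst (pd j (Pij a b) * Pij j c) * (X a * X b * X c))"
      by (rule sum.swap)
    finally show ?thesis by (simp add: sum_distrib_left)
  qed
  finally show ?thesis by (simp add: Y0)
qed

end

section \<open>Obstruction theory for the Hamiltonian\<close>

context weighted_resolvent
begin

lemma wc_le: "wtm wc M \<le> wtm wdeg M + wtm wz M"
proof -
  have "wc v * n \<le> wdeg v * n + wz v * n" if "n \<ge> 0" for v n
    using that mult_right_mono[of "wc v" "wdeg v + wz v" n]
    by (auto simp: wc_def wdeg_def wz_def distrib_right)
  then show ?thesis
    unfolding wtm_def by (simp add: sum_mono flip: sum.distrib)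
qed

lemma hg_wz_0: "x \<in> hg wz hw_ge 0"
  by (simp add: hg_ge_iff wz_nonneg)

lemma rd_wz:
  assumes "c \<in> C" "x \<in> hg wz hw_ge e"
  shows "rd c x \<in> hg wz hw_ge (e - int (cdeg c))"
  using rd_hg[OF shifts_ge assms(2)] vwt_simps(2)[OF assms(1)] by metis

text \<open>The space of admissible corrections. With at least two momenta they cannot alter the
  unary bracket.\<close>

definition TT :: "('n, 'k) mpoly sp set" where
  "TT = hg wc hw_ge 2 \<inter> hg wdeg hw_eq 2"

text \<open>One momentum is left and the degree is \<open>1 - int (cdeg c)\<close>, so the
  inequality \<open>wc_le\<close> leaves no room for a smaller weight.\<close>

lemma TT_dx:
  assumes "y \<in> TT" "c \<in> C"
  shows "dx c y \<in> hg wz hw_ge (int (cdeg c))"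
proof -
  have 1: "dx c y \<in> hg wc hw_ge (2 - 1)"
    using dx_hg[OF shifts_ge, of y wc 2 c] assms vwt_simps(6)[OF assms(2)] by (simp add: TT_def)
  have "dx c y \<in> hg wdeg hw_eq (2 - (int (cdeg c) + 1))"
    using dx_hg[OF shifts_eq, of y wdeg 2 c] assms vwt_simps(4)[OF assms(2)] by (simp add: TT_def)
  then have "wtm wz M \<ge> int (cdeg c)" if "M \<in> mons (dx c y)" for M
    using that 1 wc_le[of M] by (fastforce simp: hg_ge_iff hg_eq_iff)
  then show ?thesis by (simp add: hg_ge_iff)
qed

text \<open>The weight \<open>cdeg c\<close> lost in the derivative along \<open>c\<close> is
  regained in the derivative of \<open>y\<close> along its momentum.\<close>

lemma DD_TT:
  assumes "B \<subseteq> C" "x \<in> hg wz hw_ge e" "y \<in> TT"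
  shows "DD B x y \<in> hg wz hw_ge e"
  unfolding DD_def
proof (rule gr_ge.hg_sum)
  fix c assume "c \<in> B"
  then have c: "c \<in> C" using assms by blast
  have "rd c x * dx c y \<in> hg wz hw_ge ((e - int (cdeg c)) + int (cdeg c))"
    by (intro gr_ge.hg_mult rd_wz TT_dx assms c)
  then show "rd c x * dx c y \<in> hg wz hw_ge e" by simp
qed

lemma DD_dx_ge:
  assumes "B \<subseteq> C" "\<And>c. c \<in> B \<Longrightarrow> dx c y \<in> hg wz hw_ge e"
  shows "DD B x y \<in> hg wz hw_ge e"
  unfolding DD_def
proof (rule gr_ge.hg_sum)
  fix c assume "c \<in> B"
  have "rd c x * dx c y \<in> hg wz hw_ge (0 + e)"
    using assms \<open>c \<in> B\<close> by (intro gr_ge.hg_mult hg_wz_0)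
  then show "rd c x * dx c y \<in> hg wz hw_ge e" by simp
qed

lemma RR_wz: "x \<in> RR \<Longrightarrow> x \<in> hg wdeg hw_eq d \<Longrightarrow> x \<in> hg wz hw_eq (- d)"
proof -
  assume x: "x \<in> RR" "x \<in> hg wdeg hw_eq d"
  have "wtm wz M = - wtm wdeg M" if "M \<in> mons x" for M
    using that x(1) unfolding wtm_def
    by (auto simp: RR_iff wz_def wdeg_def subset_iff sum_negf simp flip: sum_negf)
  then show ?thesis using x(2) by (auto simp: hg_eq_iff)
qed

lemma dl_wz: "c \<in> C \<Longrightarrow> dl c \<in> hg wz hw_eq (int (cdeg c) - 1)"
  using RR_wz[OF dl_RR dl_wdeg] by simp

text \<open>The derivative along \<open>c\<close> removes \<open>cdeg c\<close> from the weight, and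
  multiplication by \<open>dl c\<close> restores all of it but one.\<close>

lemma dp_wz_ge: "x \<in> hg wz hw_ge e \<Longrightarrow> dp N x \<in> hg wz hw_ge (e - 1)"
  unfolding dp_def
proof (rule gr_ge.hg_sum)
  fix c assume x: "x \<in> hg wz hw_ge e" and "c \<in> CN N"
  then have c: "c \<in> C" using CN_subset by blast
  have "rd c x * sg (cpar c) (dl c) \<in> hg wz hw_ge ((e - int (cdeg c)) + (int (cdeg c) - 1))"
    using x c by (intro gr_ge.hg_mult rd_wz gr_ge.hg_sg hg_eq_ge[OF dl_wz])
  then show "rd c x * sg (cpar c) (dl c) \<in> hg wz hw_ge (e - 1)" by simp
qed

lemma dp_wz_eq: "x \<in> hg wz hw_eq e \<Longrightarrow> dp N x \<in> hg wz hw_eq (e - 1)"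
  unfolding dp_def
proof (rule gr_eq.hg_sum)
  fix c assume x: "x \<in> hg wz hw_eq e" and "c \<in> CN N"
  then have c: "c \<in> C" using CN_subset by blast
  have "rd c x \<in> hg wz hw_eq (e - int (cdeg c))"
    using rd_hg[OF shifts_eq x] vwt_simps(2)[OF c] by metis
  then have "rd c x * sg (cpar c) (dl c) \<in> hg wz hw_eq ((e - int (cdeg c)) + (int (cdeg c) - 1))"
    using c by (intro gr_eq.hg_mult gr_eq.hg_sg dl_wz)
  then show "rd c x * sg (cpar c) (dl c) \<in> hg wz hw_eq (e - 1)" by simp
qed

lemma dp_wc: "x \<in> hg wc hw_ge e \<Longrightarrow> dp N x \<in> hg wc hw_ge e"
  unfolding dp_def
proof (rule gr_ge.hg_sum)
  fix c assume x: "x \<in> hg wc hw_ge e" and "c \<in> CN N"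
  then have c: "c \<in> C" using CN_subset by blast
  have "rd c x \<in> hg wc hw_ge e"
    using rd_hg[OF shifts_ge x, of c] vwt_simps(3)[OF c] by simp
  moreover have "dl c \<in> hg wc hw_ge 0" using dl_RR[OF c] unfolding RR_def by (rule hg_eq_ge)
  ultimately have "rd c x * sg (cpar c) (dl c) \<in> hg wc hw_ge (e + 0)"
    by (intro gr_ge.hg_mult gr_ge.hg_sg)
  then show "rd c x * sg (cpar c) (dl c) \<in> hg wc hw_ge e" by simp
qed

lemma xv_hg:
  assumes "ring_grading hw"
  shows "xv c \<in> hg wt hw (wt (xi c))"
  unfolding xv_def using assms by (rule ring_grading.hg_vr)

lemma dl_W: "GC \<Longrightarrow> c \<in> C \<Longrightarrow> dl c \<in> W (zw c)"
  by (cases c) (auto simp: dl_def zw_def C_V pw.hg_0 intro!: D0_W RR_vr pw.hg_vr)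

lemma dl_xv:
  assumes "c \<in> C"
  shows "dl c * xv c \<in> hg wc hw_ge 1" "dl c * xv c \<in> hg wdeg hw_eq 2"
    "dl c * xv c \<in> hg wz hw_eq (int (cdeg c) - 1)" "GC \<Longrightarrow> dl c * xv c \<in> W (- p)"
    "dl c * xv c \<in> hg wc hw_eq 1"
proof -
  note xe = xv_hg[OF gr_eq.ring_grading_axioms, of c]
  have "dl c * xv c \<in> hg wc hw_eq (0 + 1)"
    using xe[of wc] dl_RR[OF assms] vwt_simps(6)[OF assms] unfolding RR_def
    by (intro gr_eq.hg_mult) auto
  then show 1: "dl c * xv c \<in> hg wc hw_eq 1" by simp
  from hg_eq_ge[OF this] show "dl c * xv c \<in> hg wc hw_ge 1" .
  show "dl c * xv c \<in> hg wdeg hw_eq 2"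
    using gr_eq.hg_mult[OF dl_wdeg[OF assms] xe[of wdeg]] vwt_simps(4)[OF assms] by simp
  show "dl c * xv c \<in> hg wz hw_eq (int (cdeg c) - 1)"
    using gr_eq.hg_mult[OF dl_wz[OF assms] xe[of wz]] vwt_simps(5)[OF assms] by simp
  assume GC
  then show "dl c * xv c \<in> W (- p)"
    using pw.hg_mult[OF dl_W[OF _ assms] xv_hg[OF poly_weight_grading]] zw_xi[OF assms] by metis
qed

lemma CN_C: "c \<in> CN N \<Longrightarrow> c \<in> C"
  using CN_subset by blast

lemma dpart_hg:
  shows "dpart N \<in> hg wc hw_eq 1" "dpart N \<in> hg wdeg hw_eq 2" "GC \<Longrightarrow> dpart N \<in> W (- p)"
  unfolding dpart_def using dl_xv[OF CN_C]
  by (auto intro!: gr_eq.hg_minus gr_eq.hg_sum pw.hg_minus pw.hg_sum)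

lemma Pi0_hg:
  shows "Pi0 \<in> hg wc hw_eq 2" "Pi0 \<in> hg wdeg hw_eq 2" "GC \<Longrightarrow> Pi0 \<in> W (- p)"
proof -
  have Inl: "Inl j \<in> C" for j by (simp add: C_def)
  have *: "cst s * (xv (Inl a) * xv (Inl b)) \<in> hg wt hw_eq (0 + (wt (xi (Inl a)) + wt (xi (Inl b))))" for s a b wt
    by (intro gr_eq.hg_mult hg_eq_cst xv_hg gr_eq.ring_grading_axioms)
  show "Pi0 \<in> hg wc hw_eq 2" "Pi0 \<in> hg wdeg hw_eq 2"
    unfolding Pi0_def using *[of _ _ _ wc] *[of _ _ _ wdeg] vwt_simps(4,6)[OF Inl]
    by (auto intro!: gr_eq.hg_sum simp: cdeg_def)
  assume GC
  have "cst (- (kconst (1/2) * Pij a b)) * (xv (Inl a) * xv (Inl b)) \<in> W (- p)" for a b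
  proof -
    have "Pij a b \<in> poly_weight w (int (w a) + int (w b) + p)"
      using \<open>GC\<close> poly_weight_pvar unfolding graded_case_def by blast
    then have "- (kconst (1/2) * Pij a b) \<in> poly_weight w (0 + (int (w a) + int (w b) + p))"
      by (intro pw.hw_minus pw.hw_mult poly_weight_kconst)
    then have "cst (- (kconst (1/2) * Pij a b)) * (xv (Inl a) * xv (Inl b))
      \<in> W ((0 + (int (w a) + int (w b) + p)) + (ww (xi (Inl a)) + ww (xi (Inl b))))"
      by (intro pw.hg_mult pw.hg_cst xv_hg poly_weight_grading)
    moreover have "ww (xi (Inl j)) = - p - int (w j)" for j
      using zw_xi[OF Inl, of j] by (simp add: zw_def)
    ultimately show ?thesis by (simp add: algebra_simps)
  qed
  then show "Pi0 \<in> W (- p)" unfolding Pi0_def by (intro pw.hg_sum)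
qed

lemma Pi0_TT: "Pi0 \<in> TT"
  using Pi0_hg by (simp add: TT_def hg_eq_ge)

text \<open>The terms \<open>dl c * xv c\<close> left out have \<open>cdeg c \<ge> n + 2\<close>,
  hence weight at least \<open>n + 1\<close>, and do not matter at stage \<open>n\<close>.\<close>

definition Ham :: "nat \<Rightarrow> ('n, 'k) mpoly sp \<Rightarrow> ('n, 'k) mpoly sp" where
  "Ham n \<theta> = dpart (n + 1) + \<theta>"

text \<open>Half the Schouten bracket of the even element \<open>Ham n \<theta>\<close> with itself,
  hence the obstruction to the Maurer-Cartan equation.\<close>

definition KK :: "nat \<Rightarrow> ('n, 'k) mpoly sp \<Rightarrow> ('n, 'k) mpoly sp" where
  "KK n \<theta> = DD (CN (n + 1)) (Ham n \<theta>) (Ham n \<theta>)"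

lemma Ham_hom: "\<theta> \<in> TT \<Longrightarrow> hom False (Ham n \<theta>)"
  using hom_wdeg[of "Ham n \<theta>" 2] dpart_hg(2)
  by (simp add: Ham_def TT_def gr_eq.hg_add)

lemma DD_Ham: "DD (CN (n + 1)) x (Ham n \<theta>) = dp (n + 1) x + DD (CN (n + 1)) x \<theta>"
  by (simp add: Ham_def DD_add_right DD_dpart)

text \<open>The only contribution with a single momentum would be
  \<open>dp (n + 1) (dpart (n + 1))\<close>, which is zero.\<close>

lemma KK_hg:
  assumes "\<theta> \<in> TT"
  shows "KK n \<theta> \<in> hg wc hw_ge 2" "KK n \<theta> \<in> hg wdeg hw_eq 3" "GC \<Longrightarrow> \<theta> \<in> W (- p) \<Longrightarrow> KK n \<theta> \<in> W (- p)"
proof -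
  have "KK n \<theta> = dp (n + 1) \<theta> + DD (CN (n + 1)) (dpart (n + 1)) \<theta> + DD (CN (n + 1)) \<theta> \<theta>"
    unfolding KK_def DD_Ham by (simp add: Ham_def dp_add dp_dpart DD_add_left)
  moreover have q: "vwt wc c + wc (xi c) = 1" if "c \<in> CN (n + 1)" for c
    using that CN_subset vwt_simps by (metis add_0 subsetD)
  moreover have \<theta>: "\<theta> \<in> hg wc hw_ge 2" using assms by (simp add: TT_def)
  moreover have "DD (CN (n + 1)) \<theta> \<theta> \<in> hg wc hw_ge (2 + 2 - 1)"
    using shifts_ge \<theta> \<theta> q by (rule DD_hg)
  moreover have "DD (CN (n + 1)) (dpart (n + 1)) \<theta> \<in> hg wc hw_ge (1 + 2 - 1)"
    using shifts_ge hg_eq_ge[OF dpart_hg(1)] \<theta> q by (rule DD_hg)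
  moreover have "dp (n + 1) \<theta> \<in> hg wc hw_ge 2"
    using assms unfolding TT_def by (intro dp_wc) auto
  ultimately show "KK n \<theta> \<in> hg wc hw_ge 2"
    by (auto intro!: gr_ge.hg_add intro: hg_ge_mono)
  have "Ham n \<theta> \<in> hg wdeg hw_eq 2"
    using assms dpart_hg(2) by (simp add: Ham_def TT_def gr_eq.hg_add)
  moreover have "vwt wdeg c + wdeg (xi c) = 1" if "c \<in> CN (n + 1)" for c
  proof -
    have "c \<in> C" using that CN_subset by blast
    then show ?thesis using vwt_simps[of c] by simp
  qed
  ultimately have "KK n \<theta> \<in> hg wdeg hw_eq (2 + 2 - 1)"
    unfolding KK_def by (intro DD_hg[OF shifts_eq])
  then show "KK n \<theta> \<in> hg wdeg hw_eq 3" by simp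
  assume "GC" "\<theta> \<in> W (- p)"
  then have "Ham n \<theta> \<in> W (- p)" using dpart_hg(3) by (simp add: Ham_def pw.hg_add)
  moreover have "zw c + ww (xi c) = - p" if "c \<in> CN (n + 1)" for c
    using that CN_subset zw_xi by blast
  ultimately have "KK n \<theta> \<in> W (- p + - p - - p)"
    unfolding KK_def by (intro DD_hg[OF shifts_W])
  then show "KK n \<theta> \<in> W (- p)" by simp
qed

text \<open>At the lowest stage only the cross term between the vector field of \<delta> and the
  bivector survives. Its coefficients lie in \<open>I\<close> because \<open>I\<close> is a Poisson
  ideal, and they vanish when the \<open>f \<mu>\<close> are Casimirs.\<close>

lemma KK_Pi0:
  "KK 0 Pi0 = (\<Sum>\<mu>=1..k. \<Sum>b\<in>UNIV. cst (P (f \<mu>) (pvar b)) * (xv (Inr (1, \<mu>)) * xv (Inl b)))"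
proof -
  have C1: "CN 1 = range Inl \<union> (\<lambda>\<mu>. Inr (1, \<mu>)) ` {1..k}"
  proof -
    have "v \<in> V \<and> fst v \<le> 1 \<longleftrightarrow> v \<in> Pair 1 ` {1..k}" for v
      using V_fst[of v] V_1[of "snd v"] by (cases v) (auto simp del: One_nat_def)
    then have "{v \<in> V. fst v \<le> 1} = Pair 1 ` {1..k}" by blast
    moreover have "CN 1 = range Inl \<union> Inr ` {v \<in> V. fst v \<le> 1}"
      by (auto simp: CN_def C_def cdeg_def)
    ultimately show ?thesis by (simp add: image_image del: One_nat_def)
  qed
  have d1: "dpart 1 = - (\<Sum>\<mu>=1..k. cst (f \<mu>) * xv (Inr (1, \<mu>)))"
  proof -
    have "(\<Sum>c\<in>CN 1. dl c * xv c) = (\<Sum>c\<in>(\<lambda>\<mu>. Inr (1, \<mu>)) ` {1..k}. dl c * xv c)"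
      using finite_CN[of 1] by (intro sum.mono_neutral_right) (auto simp: C1 dl_def simp del: One_nat_def)
    also have "\<dots> = (\<Sum>\<mu>=1..k. cst (f \<mu>) * xv (Inr (1, \<mu>)))"
      by (subst sum.reindex) (auto simp: inj_on_def dl_def D0_gen simp del: One_nat_def)
    finally show ?thesis by (simp add: dpart_def)
  qed
  have rd1: "rd (Inl j) (dpart 1) = - (\<Sum>\<mu>=1..k. cst (pd j (f \<mu>)) * xv (Inr (1, \<mu>)))" for j
  proof -
    have "Inl j \<in> C" by (simp add: C_def)
    then show ?thesis
      by (simp add: d1 rd_minus rd_sum rd_mult rd_cst cpar_def cdeg_def del: One_nat_def)
  qed
  have "dp 1 Pi0 = 0"
    unfolding dp_def C1 by (rule sum.neutral) (auto simp: dl_def rd_Pi0(2) V_1 simp del: One_nat_def)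
  then have "KK 0 Pi0 = DD (CN 1) (dpart 1) Pi0"
    using DD_Ham[of 0 "Ham 0 Pi0" Pi0]
    by (simp add: KK_def Ham_def dp_add dp_dpart DD_add_left DD_Pi0)
  also have "\<dots> = (\<Sum>j\<in>UNIV. rd (Inl j) (dpart 1) * dx (Inl j) Pi0)"
  proof -
    have "DD (CN 1) (dpart 1) Pi0 = (\<Sum>c\<in>range Inl. rd c (dpart 1) * dx c Pi0)"
      unfolding DD_def using finite_CN[of 1]
      by (intro sum.mono_neutral_right) (auto simp: C1 dx_Pi0(2) V_1 simp del: One_nat_def)
    then show ?thesis by (simp add: sum.reindex)
  qed
  also have "\<dots> = (\<Sum>j\<in>UNIV. \<Sum>\<mu>=1..k. \<Sum>b\<in>UNIV.
      cst (pd j (f \<mu>) * Pij j b) * (xv (Inr (1, \<mu>)) * xv (Inl b)))"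
  proof -
    have t: "cst s * x * (cst t * y) = cst (s * t) * (x * y)" for s t and x y :: "('n, 'k) mpoly sp"
    proof -
      have "cst s * x * (cst t * y) = cst s * (x * cst t) * y" by (simp only: mult.assoc)
      then show ?thesis by (simp only: cst_central[of x t] cst_mult mult.assoc)
    qed
    show ?thesis
      unfolding rd1 dx_Pi0(1) minus_mult_minus sum_distrib_right
      unfolding sum_distrib_left t ..
  qed
  also have "\<dots> = (\<Sum>\<mu>=1..k. \<Sum>j\<in>UNIV. \<Sum>b\<in>UNIV. cst (pd j (f \<mu>) * Pij j b) * (xv (Inr (1, \<mu>)) * xv (Inl b)))"
    by (rule sum.swap)
  also have "\<dots> = (\<Sum>\<mu>=1..k. \<Sum>b\<in>UNIV. \<Sum>j\<in>UNIV. cst (pd j (f \<mu>) * Pij j b) * (xv (Inr (1, \<mu>)) * xv (Inl b)))"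
    by (intro sum.cong refl sum.swap)
  also have "\<dots> = (\<Sum>\<mu>=1..k. \<Sum>b\<in>UNIV. cst (P (f \<mu>) (pvar b)) * (xv (Inr (1, \<mu>)) * xv (Inl b)))"
    by (simp only: P_expand_left[of "f _"] cst_sum sum_distrib_right)
  finally show ?thesis .
qed

lemma f_in_I: "\<mu> \<in> {1..k} \<Longrightarrow> f \<mu> \<in> I"
proof -
  assume \<mu>: "\<mu> \<in> {1..k}"
  have "(\<Sum>\<nu>=1..k. (if \<nu> = \<mu> then 1 else 0) * f \<nu>) = (\<Sum>\<nu>=1..k. if \<nu> = \<mu> then f \<mu> else 0)"
    by (intro sum.cong) auto
  also have "\<dots> = f \<mu>" using \<mu> by simp
  finally show ?thesis unfolding generated_ideal_def
    by (intro range_eqI[of _ _ "\<lambda>\<nu>. if \<nu> = \<mu> then 1 else 0"]) simp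
qed

lemma KK_Pi0_ideal: "coef (KK 0 Pi0) M \<in> I"
proof -
  have sum: "sum g A \<in> I" if "\<And>i. i \<in> A \<Longrightarrow> g i \<in> I" for g :: "'z \<Rightarrow> _" and A
    using that by (induction A rule: infinite_finite_induct) (auto intro: generated_ideal_closed)
  have "P (f \<mu>) (pvar b) * s \<in> I" if "\<mu> \<in> {1..k}" for \<mu> b s
    using generated_ideal_closed(3)[OF P_I[OF f_in_I[OF that]]] by (metis mult.commute)
  then show ?thesis
    unfolding KK_Pi0 coef_sum coef_cst_mult by (intro sum)
qed

text \<open>The correction \<rho> cancels the component \<open>G\<close> of lowest weight in the
  obstruction. All other changes, including those from the coordinates of degree
  \<open>n + 2\<close> that now enter, have weight at least \<open>n + 1\<close>.\<close>

lemma maurer_cartan_step: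
  assumes \<theta>: "\<theta> \<in> TT" and K: "KK n \<theta> \<in> hg wz hw_ge (int n)" and n0: "n = 0 \<Longrightarrow> \<theta> = Pi0"
  shows "\<exists>\<rho>. \<rho> \<in> TT \<and> \<rho> \<in> hg wz hw_eq (int n + 1) \<and> (GC \<and> \<theta> \<in> W (- p) \<longrightarrow> \<rho> \<in> W (- p))
    \<and> KK (n + 1) (\<theta> + \<rho>) \<in> hg wz hw_ge (int n + 1)"
proof -
  define B where "B = CN (n + 1)"
  have BC: "B \<subseteq> C" unfolding B_def by (rule CN_subset)
  define \<pi> where "\<pi> = Ham n \<theta>"
  define K where "K = KK n \<theta>"
  have Kdef: "K = DD B \<pi> \<pi>" by (simp add: K_def KK_def B_def \<pi>_def)
  define G where "G = restr (\<lambda>M. wtm wz M = int n) K"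
  have G: "G \<in> hg wz hw_eq (int n)"
    by (auto simp: hg_eq_iff G_def mons_iff coef_restr split: if_splits)
  have KG: "K - G \<in> hg wz hw_ge (int n + 1)"
  proof -
    have "wtm wz M \<ge> int n + 1" if "M \<in> mons (K - G)" for M
    proof -
      have "wtm wz M \<noteq> int n" "coef K M \<noteq> 0" using that by (auto simp: mons_iff G_def coef_restr split: if_splits)
      moreover from this have "int n \<le> wtm wz M" using assms(2) by (auto simp: hg_ge_iff mons_iff K_def)
      ultimately show ?thesis by linarith
    qed
    then show ?thesis by (simp add: hg_ge_iff)
  qed
  note rest = restr_hg[where Q = "\<lambda>M. wtm wz M = int n" and x = K, folded G_def]
  have G2: "G \<in> hg wc hw_ge 2" "G \<in> hg wdeg hw_eq 3" "GC \<and> \<theta> \<in> W (- p) \<Longrightarrow> G \<in> W (- p)"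
    using KK_hg[OF \<theta>, of n] unfolding K_def[symmetric]
    by (auto intro!: rest gr_ge.ring_grading_axioms gr_eq.ring_grading_axioms poly_weight_grading)
  \<comment> \<open>By the Jacobi identity \<open>DD B \<pi> K\<close> equals
    \<open>DD B K \<pi> = dp (n + 1) K + DD B K \<theta>\<close>. Neither of the two half brackets
    \<open>DD B \<pi> K\<close> and \<open>DD B K \<theta>\<close> lowers the weight of
    \<open>K\<close>, and \<open>K - G\<close> has one unit of weight to spare.\<close>
  have "dp (n + 1) G \<in> hg wz hw_ge (int n)"
  proof -
    have "DD B \<pi> K = DD B K \<pi>" unfolding Kdef \<pi>_def by (rule DD_self_commute[OF Ham_hom[OF \<theta>]])
    also have "DD B K \<pi> = dp (n + 1) K + DD B K \<theta>" unfolding B_def \<pi>_def by (rule DD_Ham)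
    finally have "dp (n + 1) K = DD B \<pi> K - DD B K \<theta>" by simp
    moreover have "DD B K \<theta> \<in> hg wz hw_ge (int n)"
      using assms(2) \<theta> BC unfolding K_def[symmetric] by (intro DD_TT)
    moreover have "DD B \<pi> K \<in> hg wz hw_ge (int n)"
    proof (rule DD_dx_ge[OF BC])
      fix c assume "c \<in> B"
      then show "dx c K \<in> hg wz hw_ge (int n)"
        using dx_hg[OF shifts_ge assms(2)[folded K_def], of c] vwt_simps(5)[of c] BC by auto
    qed
    moreover have "dp (n + 1) (K - G) \<in> hg wz hw_ge (int n)"
      using dp_wz_ge[OF KG, of "n + 1"] by simp
    moreover have "dp (n + 1) G = dp (n + 1) K - dp (n + 1) (K - G)" by (simp add: dp_diff)
    ultimately show ?thesis by (simp add: gr_ge.hg_diff)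
  qed
  \<comment> \<open>\<open>dp\<close> lowers the weight by exactly one, so
    \<open>dp (n + 1) G\<close> would have weight \<open>n - 1\<close> as well.\<close>
  then have dG: "dp (n + 1) G = 0"
    using dp_wz_eq[OF G, of "n + 1"] by (intro sp_eq_0I) (fastforce simp: hg_ge_iff hg_eq_iff)
  have GI: "\<forall>M. coef G M \<in> I" if "n = 0"
    using KK_Pi0_ideal n0[OF that] that generated_ideal_closed(1) by (auto simp: G_def coef_restr K_def)
  obtain \<rho> where \<rho>: "\<rho> \<in> hg wz hw_eq (int n + 1)" "\<rho> \<in> TT" "dp (n + 1) \<rho> = - G"
    "GC \<and> G \<in> W (- p) \<longrightarrow> \<rho> \<in> W (- p)"
    using dp_primitive[OF G G2(1,2) dG GI] unfolding TT_def by blast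
  have "KK (n + 1) (\<theta> + \<rho>) \<in> hg wz hw_ge (int n + 1)"
  proof -
    define B' where "B' = CN (n + 2)"
    define \<pi>' where "\<pi>' = Ham (n + 1) (\<theta> + \<rho>)"
    define e where "e = \<pi>' - \<pi>"
    let ?T = "DD (B' - B) \<pi>' \<pi>'"
    have e: "e = dpart (n + 2) - dpart (n + 1) + \<rho>"
      by (simp add: e_def \<pi>'_def \<pi>_def Ham_def)
    have TT: "\<theta> + \<rho> \<in> TT" using \<theta> \<rho>(2) by (auto simp: TT_def intro: gr_ge.hg_add gr_eq.hg_add)
    have sub: "B \<subseteq> B'" "B' \<subseteq> C" "finite B'"
      unfolding B_def B'_def by (rule CN_mono, simp, rule CN_subset, rule finite_CN)
    have "DD B' \<pi>' \<pi>' = DD B \<pi>' \<pi>' + ?T"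
      unfolding DD_def sum.subset_diff[OF sub(1,3)] by (rule add.commute)
    then have K': "KK (n + 1) (\<theta> + \<rho>) = DD B \<pi>' \<pi>' + ?T"
      by (simp add: KK_def B'_def \<pi>'_def)
    have T: "?T \<in> hg wz hw_ge (int n + 1)"
    proof (rule DD_dx_ge)
      show "B' - B \<subseteq> C" using sub by blast
      fix c assume "c \<in> B' - B"
      then have c: "c \<in> C" "cdeg c = n + 2" using sub by (auto simp: B_def B'_def CN_def)
      \<comment> \<open>A new coordinate has degree \<open>n + 2\<close>, and its component of
        \<delta> has weight one less.\<close>
      have "dx c (dpart (n + 2)) \<in> hg wz hw_ge (int n + 1)"
      proof -
        have "int (cdeg c) - 1 = int n + 1" using c by simp
        then have "dl c \<in> hg wz hw_ge (int n + 1)" using hg_eq_ge[OF dl_wz[OF c(1)]] by metis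
        then show ?thesis using c by (simp add: dx_dpart gr_ge.hg_sg)
      qed
      moreover have "dx c (\<theta> + \<rho>) \<in> hg wz hw_ge (int n + 1)"
        using TT_dx[OF TT c(1)] c(2) by (auto intro: hg_ge_mono)
      ultimately show "dx c \<pi>' \<in> hg wz hw_ge (int n + 1)"
        by (simp add: \<pi>'_def Ham_def dx_add gr_ge.hg_add)
    qed
    have dd: "DD B x (dpart (n + 2)) = dp (n + 1) x" for x
      unfolding B_def by (rule DD_dpart) auto
    have DDB: "DD B x \<pi>' = dp (n + 1) x + DD B x (\<theta> + \<rho>)" for x
      by (simp add: \<pi>'_def Ham_def DD_add_right[of B x "dpart (Suc (Suc n))"] dd[simplified])
    have DDB0: "DD B x \<pi> = dp (n + 1) x + DD B x \<theta>" for x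
      unfolding B_def \<pi>_def by (rule DD_Ham)
    have "DD B \<pi>' \<pi>' = DD B \<pi> \<pi>' + DD B e \<pi>'"
      by (simp add: e_def DD_diff_left)
    also have "DD B \<pi> \<pi>' = K + DD B \<pi> \<rho>"
      unfolding Kdef DDB DDB0 by (simp add: DD_add_right add.assoc)
    \<comment> \<open>\<open>dp (n + 1)\<close> annihilates both truncations of the vector field,
      even the one up to \<open>n + 2\<close>, so only \<open>dp (n + 1) \<rho>\<close>
      remains.\<close>
    also have "DD B e \<pi>' = - G + DD B e (\<theta> + \<rho>)"
    proof -
      have "dp (n + 1) e = - G"
        unfolding e dp_add dp_diff using \<rho>(3) dp_dpart[of "n + 2" "n + 1"] dp_dpart[of "n + 1" "n + 1"] by simp
      then show ?thesis unfolding DDB by simp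
    qed
    finally have eq: "DD B \<pi>' \<pi>' = (K - G) + DD B \<pi> \<rho> + DD B e (\<theta> + \<rho>)" by simp
    have "DD B \<pi> \<rho> \<in> hg wz hw_ge (int n + 1)"
    proof (rule DD_dx_ge[OF BC])
      fix c assume "c \<in> B"
      then show "dx c \<rho> \<in> hg wz hw_ge (int n + 1)"
        using dx_hg[OF shifts_ge hg_eq_ge[OF \<rho>(1)], of c] vwt_simps(5)[of c] BC by auto
    qed
    moreover have "DD B e (\<theta> + \<rho>) \<in> hg wz hw_ge (int n + 1)"
    proof (rule DD_TT[OF BC _ TT])
      have "dpart (n + 2) - dpart (n + 1) = - (\<Sum>c\<in>B' - B. dl c * xv c)"
      proof -
        have "(\<Sum>c\<in>B'. dl c * xv c) = (\<Sum>c\<in>B' - B. dl c * xv c) + (\<Sum>c\<in>B. dl c * xv c)"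
          using sub by (intro sum.subset_diff)
        then show ?thesis by (simp add: dpart_def B_def B'_def)
      qed
      moreover have "dl c * xv c \<in> hg wz hw_ge (int n + 1)" if "c \<in> B' - B" for c
      proof -
        have c: "c \<in> C" "cdeg c = n + 2" using that sub by (auto simp: B_def B'_def CN_def)
        then have "int (cdeg c) - 1 = int n + 1" by simp
        then show ?thesis using hg_eq_ge[OF dl_xv(3)[OF c(1)]] by metis
      qed
      ultimately have "dpart (n + 2) - dpart (n + 1) \<in> hg wz hw_ge (int n + 1)"
        by (auto intro: gr_ge.hg_minus gr_ge.hg_sum)
      then show "e \<in> hg wz hw_ge (int n + 1)"
        unfolding e by (intro gr_ge.hg_add hg_eq_ge[OF \<rho>(1)])
    qed
    ultimately show ?thesis
      unfolding K' eq using KG T by (intro gr_ge.hg_add)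
  qed
  then show ?thesis using \<rho> G2(3) by blast
qed

abbreviation trivial_case :: bool where
  "trivial_case \<equiv> (\<forall>\<mu>\<in>{1..k}. casimir P (f \<mu>)) \<and> (\<forall>m\<ge>2. J m = {})"

lemma theta_exists:
  "\<exists>\<theta>. \<theta> 0 = Pi0 \<and> (\<forall>n. \<theta> n \<in> TT \<and> (GC \<longrightarrow> \<theta> n \<in> W (- p)) \<and> KK n (\<theta> n) \<in> hg wz hw_ge (int n)
      \<and> \<theta> (Suc n) - \<theta> n \<in> TT \<and> \<theta> (Suc n) - \<theta> n \<in> hg wz hw_ge (int n + 1)) \<and> (trivial_case \<longrightarrow> (\<forall>n. \<theta> n = Pi0))"
proof (cases trivial_case)
  case True
  \<comment> \<open>The general choice of primitives need not be zero even for a zero obstruction,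
    so the trivial case is separated. There \<open>Pi0\<close> solves the equation exactly, and all
    stages coincide since no coordinate has degree above 1.\<close>
  have "P (f \<mu>) (pvar b) = 0" if "\<mu> \<in> {1..k}" for \<mu> b
    using True that unfolding casimir_def by blast
  then have K0: "KK 0 Pi0 = 0"
    unfolding KK_Pi0 by (intro sum.neutral ballI) (simp del: One_nat_def)
  have "fst v = 1" if "v \<in> V" for v
  proof (rule ccontr)
    assume "fst v \<noteq> 1"
    then have "fst v \<ge> 2" using V_fst[OF that] by linarith
    then have "J (fst v) = {}" using True by blast
    then show False using that V_iff[of "fst v" "snd v"] by simp
  qed
  then have "cdeg c \<le> 1" if "c \<in> C" for c
    using that by (cases c) (auto simp: cdeg_def C_V)
  then have CN1: "CN (n + 1) = CN 1" for n
    unfolding CN_def by fastforce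
  have "KK n Pi0 = KK 0 Pi0" for n
    unfolding KK_def Ham_def dpart_def CN1 ..
  with K0 have "KK n Pi0 = 0" for n by simp
  then show ?thesis
    using Pi0_TT Pi0_hg(3)
    by (intro exI[of _ "\<lambda>_. Pi0"]) (auto simp: gr_ge.hg_0 TT_def gr_eq.hg_0)
next
  case False
  \<comment> \<open>The last conjunct fixes the starting point, for which the obstruction is known
    to have coefficients in \<open>I\<close>.\<close>
  define Q where "Q n \<theta> \<longleftrightarrow> \<theta> \<in> TT \<and> (GC \<longrightarrow> \<theta> \<in> W (- p)) \<and> KK n \<theta> \<in> hg wz hw_ge (int n)
    \<and> (n = 0 \<longrightarrow> \<theta> = Pi0)" for n \<theta>
  define S where "S n \<theta> \<theta>' \<longleftrightarrow> \<theta>' - \<theta> \<in> TT \<and> \<theta>' - \<theta> \<in> hg wz hw_ge (int n + 1)"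
    for n :: nat and \<theta> \<theta>' :: "('n, 'k) mpoly sp"
  have "\<exists>\<theta>. \<forall>n. Q n (\<theta> n) \<and> S n (\<theta> n) (\<theta> (Suc n))"
  proof (rule dependent_nat_choice)
    show "\<exists>x. Q 0 x"
      unfolding Q_def using Pi0_TT Pi0_hg(3) hg_wz_0 by auto
    fix \<theta> n assume Q: "Q n \<theta>"
    then obtain \<rho> where \<rho>: "\<rho> \<in> TT" "\<rho> \<in> hg wz hw_eq (int n + 1)" "GC \<and> \<theta> \<in> W (- p) \<longrightarrow> \<rho> \<in> W (- p)"
      "KK (n + 1) (\<theta> + \<rho>) \<in> hg wz hw_ge (int n + 1)"
      using maurer_cartan_step[of \<theta> n] unfolding Q_def by blast
    have "Q (Suc n) (\<theta> + \<rho>)"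
      using Q \<rho> by (auto simp: Q_def TT_def add.commute[of 1] intro: gr_ge.hg_add gr_eq.hg_add pw.hg_add)
    moreover have "S n \<theta> (\<theta> + \<rho>)" using \<rho> hg_eq_ge by (simp add: S_def)
    ultimately show "\<exists>\<theta>'. Q (Suc n) \<theta>' \<and> S n \<theta> \<theta>'" by blast
  qed
  then obtain \<theta> where "\<And>n. Q n (\<theta> n) \<and> S n (\<theta> n) (\<theta> (Suc n))" by blast
  then show ?thesis using False unfolding Q_def S_def by (intro exI[of _ \<theta>]) blast
qed

end

section \<open>Sign combinatorics of permutations and unshuffles\<close>

definition pm :: "int \<Rightarrow> 'a::ring_1" where
  "pm n = (if even n then 1 else - 1)"

lemma pm_add: "pm (m + n) = pm m * pm n"
  by (auto simp: pm_def)

lemma powi_pm: "(-1 :: 'a::field) powi n = pm n"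
  by (auto simp: pm_def power_int_minus_one_minus elim!: evenE oddE simp: power_int_add power_int_mult)

lemma pow_pm: "(-1 :: 'a::ring_1) ^ n = pm (int n)"
  by (simp add: pm_def minus_one_power_iff)

subsection \<open>Inversions of permutations\<close>

definition inversions :: "nat \<Rightarrow> (nat \<Rightarrow> nat) \<Rightarrow> (nat \<times> nat) set" where
  "inversions m \<sigma> = {(i, j). i < j \<and> j < m \<and> \<sigma> j < \<sigma> i}"

text \<open>A weighted count of inversions, by which the sign of a permutation and its Koszul sign
  are handled together.\<close>

definition iprod :: "nat \<Rightarrow> (nat \<Rightarrow> nat \<Rightarrow> 'a) \<Rightarrow> (nat \<Rightarrow> nat) \<Rightarrow> 'a::comm_ring_1" where
  "iprod m c \<sigma> = (\<Prod>(i, j)\<in>inversions m \<sigma>. c (\<sigma> i) (\<sigma> j))"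

lemma iprod_alt:
  "iprod m c \<sigma> = (\<Prod>(i, j)\<in>{(i, j). i < j \<and> j < m}. if \<sigma> j < \<sigma> i then c (\<sigma> i) (\<sigma> j) else 1)"
proof -
  have fin: "finite {(i, j). i < j \<and> j < m}"
    by (rule finite_subset[of _ "{..<m} \<times> {..<m}"]) auto
  show ?thesis
    unfolding iprod_def
    by (rule prod.mono_neutral_cong_left[OF fin]) (auto simp: inversions_def split: if_splits)
qed

text \<open>A pair is inverted by the composition iff exactly one of \<tau> on the pair and \<sigma>
  on its image inverts it; if both do, the two equal factors multiply to 1.\<close>

lemma iprod_comp:
  assumes \<sigma>: "\<sigma> permutes {..<m}" and \<tau>: "\<tau> permutes {..<m}"
    and sym: "\<And>i j. c i j = c j i" and sq: "\<And>i j. c i j * c i j = 1"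
  shows "iprod m c (\<sigma> \<circ> \<tau>) = iprod m c \<sigma> * iprod m (\<lambda>i j. c (\<sigma> i) (\<sigma> j)) \<tau>"
proof -
  define Q where "Q = {(i, j). i < j \<and> j < m}"
  \<comment> \<open>The factor contributed by \<sigma>, symmetrised in \<open>i\<close> and
    \<open>j\<close>, so that its product over all pairs is unchanged when \<tau> permutes
    them.\<close>
  define g where "g i j = (if (i < j) = (\<sigma> i < \<sigma> j) then 1 else c (\<sigma> i) (\<sigma> j))" for i j
  have inj: "\<sigma> i = \<sigma> j \<longleftrightarrow> i = j" "\<tau> i = \<tau> j \<longleftrightarrow> i = j" for i j
    using permutes_inj[OF \<sigma>] permutes_inj[OF \<tau>] by (auto dest: injD)
  have gsym: "g i j = g j i" if "i \<noteq> j" for i j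
    using sym[of "\<sigma> i" "\<sigma> j"] inj(1)[of i j] that by (auto simp: g_def)
  have "(\<Prod>(i, j)\<in>Q. g (\<tau> i) (\<tau> j)) = (\<Prod>(i, j)\<in>Q. g i j)"
  proof (rule prod.reindex_bij_witness[where
        i = "\<lambda>(a, b). (min (inv \<tau> a) (inv \<tau> b), max (inv \<tau> a) (inv \<tau> b))"
        and j = "\<lambda>(i, j). (min (\<tau> i) (\<tau> j), max (\<tau> i) (\<tau> j))"])
    have inv: "inv \<tau> (\<tau> i) = i" "\<tau> (inv \<tau> i) = i" for i
      using permutes_inverses[OF \<tau>] by auto
    have lt: "\<tau> i < m \<longleftrightarrow> i < m" "inv \<tau> i < m \<longleftrightarrow> i < m" for i
      using permutes_in_image[OF \<tau>, of i] permutes_in_image[OF permutes_inv[OF \<tau>], of i] by auto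
    have invj: "inv \<tau> a = inv \<tau> b \<longleftrightarrow> a = b" for a b by (metis inv(2))
    fix x assume "x \<in> Q"
    then obtain a b where x: "x = (a, b)" "a < b" "b < m" by (auto simp: Q_def)
    show "(case case x of (i, j) \<Rightarrow> (min (\<tau> i) (\<tau> j), max (\<tau> i) (\<tau> j)) of
        (a, b) \<Rightarrow> (min (inv \<tau> a) (inv \<tau> b), max (inv \<tau> a) (inv \<tau> b))) = x"
      using x by (auto simp: min_def max_def inv)
    show "(case case x of (a, b) \<Rightarrow> (min (inv \<tau> a) (inv \<tau> b), max (inv \<tau> a) (inv \<tau> b)) of
        (i, j) \<Rightarrow> (min (\<tau> i) (\<tau> j), max (\<tau> i) (\<tau> j))) = x"
      using x by (auto simp: min_def max_def inv)
    show "(case x of (i, j) \<Rightarrow> (min (\<tau> i) (\<tau> j), max (\<tau> i) (\<tau> j))) \<in> Q"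
      using x inj(2)[of a b] lt(1)[of a] lt(1)[of b] by (auto simp: Q_def min_def max_def)
    show "(case x of (a, b) \<Rightarrow> (min (inv \<tau> a) (inv \<tau> b), max (inv \<tau> a) (inv \<tau> b))) \<in> Q"
      using x invj[of a b] lt(2)[of a] lt(2)[of b] by (auto simp: Q_def min_def max_def)
    show "(case case x of (i, j) \<Rightarrow> (min (\<tau> i) (\<tau> j), max (\<tau> i) (\<tau> j)) of (i, j) \<Rightarrow> g i j)
      = (case x of (i, j) \<Rightarrow> g (\<tau> i) (\<tau> j))"
      using x inj(2)[of a b] gsym[of "\<tau> a" "\<tau> b"] by (auto simp: min_def max_def)
  qed
  moreover have "iprod m c \<sigma> = (\<Prod>(i, j)\<in>Q. g i j)"
    unfolding iprod_alt Q_def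
  proof (rule prod.cong[OF refl])
    fix x assume "x \<in> {(i, j). i < j \<and> j < m}"
    then obtain i j where x: "x = (i, j)" "i < j" by auto
    then have "\<sigma> i \<noteq> \<sigma> j" using inj(1) by auto
    with x show "(case x of (i, j) \<Rightarrow> if \<sigma> j < \<sigma> i then c (\<sigma> i) (\<sigma> j) else 1) = (case x of (i, j) \<Rightarrow> g i j)"
      by (auto simp: g_def)
  qed
  moreover have "iprod m c (\<sigma> \<circ> \<tau>) = (\<Prod>(i, j)\<in>Q. g (\<tau> i) (\<tau> j) *
      (if \<tau> j < \<tau> i then c (\<sigma> (\<tau> i)) (\<sigma> (\<tau> j)) else 1))"
    unfolding iprod_alt Q_def
  proof (rule prod.cong[OF refl])
    fix x assume "x \<in> {(i, j). i < j \<and> j < m}"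
    then obtain i j where x: "x = (i, j)" "i < j" by auto
    then have "\<tau> i \<noteq> \<tau> j" "\<sigma> (\<tau> i) \<noteq> \<sigma> (\<tau> j)" using inj by auto
    with x show "(case x of (i, j) \<Rightarrow> if (\<sigma> \<circ> \<tau>) j < (\<sigma> \<circ> \<tau>) i then c ((\<sigma> \<circ> \<tau>) i) ((\<sigma> \<circ> \<tau>) j) else 1)
      = (case x of (i, j) \<Rightarrow> g (\<tau> i) (\<tau> j) * (if \<tau> j < \<tau> i then c (\<sigma> (\<tau> i)) (\<sigma> (\<tau> j)) else 1))"
      by (auto simp: g_def sq)
  qed
  ultimately show ?thesis
    unfolding iprod_alt[of m _ \<tau>] Q_def by (simp add: prod.distrib case_prod_unfold)
qed

lemma perm_adj_induct [consumes 1, case_names id swap]: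
  assumes "\<sigma> permutes {..<m}" "Q id"
    and swap: "\<And>\<sigma> i. \<sigma> permutes {..<m} \<Longrightarrow> Suc i < m \<Longrightarrow> Q \<sigma> \<Longrightarrow> Q (transpose i (Suc i) \<circ> \<sigma>)"
  shows "Q \<sigma>"
proof -
  have adj: "apply_adj_transps xs \<circ> \<sigma> permutes {..<m} \<and> Q (apply_adj_transps xs \<circ> \<sigma>)"
    if "\<sigma> permutes {..<m}" "Q \<sigma>" "\<forall>x\<in>set xs. Suc x < m" for xs \<sigma>
    using that
  proof (induction xs)
    case (Cons x xs)
    have "\<forall>x\<in>set xs. Suc x < m" and x: "Suc x < m" using Cons.prems(3) by simp_all
    note 1 = conjunct1[OF Cons.IH[OF Cons.prems(1,2) this(1)]] conjunct2[OF Cons.IH[OF Cons.prems(1,2) this(1)]] x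
    have "transpose x (Suc x) \<circ> (apply_adj_transps xs \<circ> \<sigma>) permutes {..<m}"
      by (rule permutes_compose[OF 1(1)], intro permutes_swap_id) (use 1(3) in simp_all)
    moreover have "Q (transpose x (Suc x) \<circ> (apply_adj_transps xs \<circ> \<sigma>))" using 1 by (intro swap)
    ultimately show ?case by (simp only: apply_adj_transps_Cons comp_assoc Suc_eq_plus1 simp_thms)
  qed simp
  have tr: "transpose a b \<circ> \<tau> permutes {..<m} \<and> Q (transpose a b \<circ> \<tau>)"
    if "a < b" "b < m" "\<tau> permutes {..<m}" "Q \<tau>" for a b \<tau>
    using adj[OF that(3,4), of "adj_transp_seq a b"] that set_adj_transp_seq[of a b]
    by (auto simp: adj_transp_seq_correct)
  have "\<sigma> permutes {..<m} \<and> Q \<sigma>"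
    using assms(1) finite_lessThan
  proof (induction rule: permutes_induct)
    case id
    then show ?case using assms(2) permutes_id by blast
  next
    case (swap a b \<tau>)
    have "transpose a b \<circ> \<tau> permutes {..<m} \<and> Q (transpose a b \<circ> \<tau>)"
    proof (cases "a < b")
      case True
      then show ?thesis using swap by (intro tr) auto
    next
      case False
      then have "transpose b a \<circ> \<tau> permutes {..<m} \<and> Q (transpose b a \<circ> \<tau>)"
        using swap by (intro tr) auto
      then show ?thesis unfolding transpose_commute[of a b] .
    qed
    then show ?case .
  qed
  then show ?thesis by simp
qed

lemma inversions_adj: "Suc i < m \<Longrightarrow> inversions m (transpose i (Suc i)) = {(i, Suc i)}"
  by (auto simp: inversions_def transpose_def split: if_splits)

lemma sign_iprod: "\<sigma> permutes {..<m} \<Longrightarrow> sign \<sigma> = iprod m (\<lambda>_ _. -1) \<sigma>"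
proof (induction rule: perm_adj_induct)
  case id
  have "inversions m id = {}" by (auto simp: inversions_def)
  then show ?case by (simp only: iprod_def prod.empty sign_id)
next
  case (swap \<sigma> i)
  have t: "transpose i (Suc i) permutes {..<m}" using swap by (intro permutes_swap_id) auto
  have "iprod m (\<lambda>_ _. -1 :: int) (transpose i (Suc i) \<circ> \<sigma>)
    = iprod m (\<lambda>_ _. -1) (transpose i (Suc i)) * iprod m (\<lambda>_ _. -1) \<sigma>"
    using t swap(1) by (rule iprod_comp) auto
  also have "iprod m (\<lambda>_ _. -1 :: int) (transpose i (Suc i)) = -1"
    using swap(2) by (simp add: iprod_def inversions_adj)
  also have "-1 * iprod m (\<lambda>_ _. -1) \<sigma> = sign (transpose i (Suc i) \<circ> \<sigma>)"
    using swap t by (subst sign_compose) (auto simp: sign_swap_id intro: permutes_imp_permutation)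
  finally show ?case by (rule sym)
qed

definition lsign :: "(nat \<Rightarrow> nat) \<Rightarrow> int list \<Rightarrow> 'k::field" where
  "lsign \<sigma> ds = of_int (sign \<sigma>) * koszul_sign \<sigma> ds"

lemma lsign_iprod:
  assumes "\<sigma> permutes {..<length ds}"
  shows "(lsign \<sigma> ds :: 'a::field) = iprod (length ds) (\<lambda>i j. pm (ds ! i * ds ! j + 1)) \<sigma>"
proof -
  have "of_int (sign \<sigma>) = (\<Prod>(i, j)\<in>inversions (length ds) \<sigma>. - 1 :: 'a)"
    by (simp add: sign_iprod[OF assms] iprod_def of_int_prod case_prod_unfold)
  moreover have "koszul_sign \<sigma> ds = (\<Prod>(i, j)\<in>inversions (length ds) \<sigma>. pm (ds ! \<sigma> i * ds ! \<sigma> j) :: 'a)"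
    unfolding koszul_sign_def inversions_def powi_pm ..
  ultimately have "lsign \<sigma> ds = (\<Prod>x\<in>inversions (length ds) \<sigma>.
      (case x of (i, j) \<Rightarrow> - 1) * (case x of (i, j) \<Rightarrow> pm (ds ! \<sigma> i * ds ! \<sigma> j)) :: 'a)"
    by (simp only: lsign_def prod.distrib)
  also have "\<dots> = iprod (length ds) (\<lambda>i j. pm (ds ! i * ds ! j + 1)) \<sigma>"
    unfolding iprod_def by (intro prod.cong refl) (auto simp: pm_def)
  finally show ?thesis .
qed

lemma lsign_comp:
  assumes "\<sigma> permutes {..<length ds}" "\<tau> permutes {..<length ds}"
  shows "(lsign (\<sigma> \<circ> \<tau>) ds :: 'a::field) = lsign \<sigma> ds * lsign \<tau> (permute_list \<sigma> ds)"
proof -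
  have "(lsign \<tau> (permute_list \<sigma> ds) :: 'a) = iprod (length ds) (\<lambda>i j. pm (ds ! \<sigma> i * ds ! \<sigma> j + 1)) \<tau>"
  proof -
    have "iprod (length ds) (\<lambda>i j. pm (permute_list \<sigma> ds ! i * permute_list \<sigma> ds ! j + 1)) \<tau>
      = iprod (length ds) (\<lambda>i j. pm (ds ! \<sigma> i * ds ! \<sigma> j + 1) :: 'a) \<tau>"
      unfolding iprod_def
    proof (intro prod.cong refl, clarify)
      fix i j assume "(i, j) \<in> inversions (length ds) \<tau>"
      then have "\<tau> i < length ds" "\<tau> j < length ds"
        using permutes_in_image[OF assms(2), of i] permutes_in_image[OF assms(2), of j]
        by (auto simp: inversions_def)
      then show "pm (permute_list \<sigma> ds ! \<tau> i * permute_list \<sigma> ds ! \<tau> j + 1)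
        = (pm (ds ! \<sigma> (\<tau> i) * ds ! \<sigma> (\<tau> j) + 1) :: 'a)"
        using assms(1) by (simp add: permute_list_nth)
    qed
    then show ?thesis using assms by (subst lsign_iprod) auto
  qed
  moreover have "\<sigma> \<circ> \<tau> permutes {..<length ds}" using assms by (intro permutes_compose)
  ultimately show ?thesis
    using assms by (simp add: lsign_iprod, subst iprod_comp) (auto simp: pm_def mult.commute)
qed

lemma lsign_adj:
  assumes "Suc i < length ds"
  shows "lsign (transpose i (Suc i)) ds = pm (ds ! i * ds ! Suc i + 1)"
proof -
  have "transpose i (Suc i) permutes {..<length ds}" using assms by (intro permutes_swap_id) auto
  then show ?thesis
    using assms by (simp add: lsign_iprod iprod_def inversions_adj mult.commute)
qed

subsection \<open>Unshuffles and subsets\<close>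

text \<open>The pairs whose order is reversed when the positions in \<open>A\<close> are moved in
  front of the others.\<close>

definition Inv :: "nat \<Rightarrow> nat set \<Rightarrow> (nat \<times> nat) set" where
  "Inv m A = {(b, a). b < a \<and> a < m \<and> b \<notin> A \<and> a \<in> A}"

definition ksum :: "(nat \<Rightarrow> nat \<Rightarrow> int) \<Rightarrow> nat \<Rightarrow> nat set \<Rightarrow> int" where
  "ksum g m A = (\<Sum>(b, a)\<in>Inv m A. g b a)"

lemma finite_Inv [simp]: "finite (Inv m A)"
  by (rule finite_subset[of _ "{..<m} \<times> {..<m}"]) (auto simp: Inv_def)

lemma ksum_Suc: "ksum g (Suc m) A = ksum g m A + (if m \<in> A then \<Sum>b\<in>{..<m} - A. g b m else 0)"
proof -
  have "Inv (Suc m) A = Inv m A \<union> (if m \<in> A then (\<lambda>b. (b, m)) ` ({..<m} - A) else {})"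
    by (auto simp: Inv_def less_Suc_eq)
  moreover have "Inv m A \<inter> (\<lambda>b. (b, m)) ` ({..<m} - A) = {}" by (auto simp: Inv_def)
  ultimately show ?thesis
    by (auto simp: ksum_def sum.union_disjoint sum.reindex inj_on_def)
qed

lemma unshuffleD:
  assumes "\<sigma> \<in> unshuffles q m" "q \<le> m"
  shows "\<sigma> permutes {..<m}" "\<sigma> ` {..<q} \<subseteq> {..<m}" "card (\<sigma> ` {..<q}) = q"
    "map \<sigma> [0..<q] = filter (\<lambda>i. i \<in> \<sigma> ` {..<q}) [0..<m]"
    "map \<sigma> [q..<m] = filter (\<lambda>i. i \<notin> \<sigma> ` {..<q}) [0..<m]"
proof -
  let ?A = "\<sigma> ` {..<q}"
  show p: "\<sigma> permutes {..<m}" using assms by (simp add: unshuffles_def)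
  have mono: "strict_mono_on {..<q} \<sigma>" "strict_mono_on {q..<m} \<sigma>" using assms by (auto simp: unshuffles_def)
  have inj: "inj_on \<sigma> S" for S by (rule inj_on_subset[OF permutes_inj[OF p] subset_UNIV])
  have "\<sigma> i < m" if "i < q" for i using permutes_in_image[OF p, of i] that assms(2) by simp
  then show sub: "?A \<subseteq> {..<m}" by blast
  have "card ?A = card {..<q}" by (rule card_image[OF inj])
  then show "card ?A = q" by simp
  have "\<sigma> ` {q..<m} = {..<m} - ?A"
  proof -
    have "\<sigma> ` ({..<m} - {..<q}) = \<sigma> ` {..<m} - ?A" using permutes_inj[OF p] by (rule image_set_diff)
    moreover have "{..<m} - {..<q} = {q..<m}" by auto
    ultimately show ?thesis using permutes_image[OF p] by simp
  qed
  then have s2: "set (map \<sigma> [q..<m]) = set (filter (\<lambda>i. i \<notin> ?A) [0..<m])" by auto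
  have "{x \<in> {0..<m}. x \<in> ?A} = ?A" using sub by (simp add: atLeast0LessThan) blast
  then have s1: "set (map \<sigma> [0..<q]) = set (filter (\<lambda>i. i \<in> ?A) [0..<m])"
    by (simp only: set_map set_filter set_upt atLeast0LessThan)
  have "sorted_wrt (<) (map \<sigma> [0..<q])"
    using mono by (auto simp: sorted_wrt_map sorted_wrt_iff_nth_less strict_mono_on_def)
  moreover have "\<sigma> (q + i) < \<sigma> (q + j)" if "i < j" "j < m - q" for i j
    using strict_mono_onD[OF mono(2), of "q + i" "q + j"] that by simp
  then have "sorted_wrt (<) (map \<sigma> [q..<m])"
    by (simp add: sorted_wrt_map sorted_wrt_iff_nth_less)
  ultimately have "sorted (map \<sigma> [0..<q])" "distinct (map \<sigma> [0..<q])" "sorted (map \<sigma> [q..<m])" "distinct (map \<sigma> [q..<m])"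
    by (simp_all add: strict_sorted_iff)
  moreover have "sorted (filter Q [0..<m])" "distinct (filter Q [0..<m])" for Q
    by (auto intro: sorted_wrt_filter)
  ultimately show "map \<sigma> [0..<q] = filter (\<lambda>i. i \<in> ?A) [0..<m]" "map \<sigma> [q..<m] = filter (\<lambda>i. i \<notin> ?A) [0..<m]"
    using s1 s2 by (auto intro!: sorted_distinct_set_unique)
qed

lemma nths_filter: "nths xs A = map ((!) xs) (filter (\<lambda>i. i \<in> A) [0..<length xs])"
  by (induction xs rule: rev_induct) (auto simp: nths_append nth_append)

lemma unshuffle_nths:
  assumes "\<sigma> \<in> unshuffles q (length xs)" "q \<le> length xs"
  shows "take q (permute_list \<sigma> xs) = nths xs (\<sigma> ` {..<q})"
    "drop q (permute_list \<sigma> xs) = nths xs (- (\<sigma> ` {..<q}))"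
proof -
  note u = unshuffleD[OF assms]
  have "take q (permute_list \<sigma> xs) = map ((!) xs) (map \<sigma> [0..<q])"
    using assms(2) by (simp add: permute_list_def take_map)
  then show "take q (permute_list \<sigma> xs) = nths xs (\<sigma> ` {..<q})" by (simp only: u(4) nths_filter)
  have "drop q (permute_list \<sigma> xs) = map ((!) xs) (map \<sigma> [q..<length xs])"
    using assms(2) by (simp add: permute_list_def drop_map)
  then show "drop q (permute_list \<sigma> xs) = nths xs (- (\<sigma> ` {..<q}))"
    unfolding u(5) nths_filter by simp
qed

lemma unshuffle_bij:
  assumes "q \<le> m"
  shows "bij_betw (\<lambda>\<sigma>. \<sigma> ` {..<q}) (unshuffles q m) {A. A \<subseteq> {..<m} \<and> card A = q}"
proof (rule bij_betw_imageI)
  show "inj_on (\<lambda>\<sigma>. \<sigma> ` {..<q}) (unshuffles q m)"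
  proof (rule inj_onI)
    fix \<sigma> \<tau> assume a: "\<sigma> \<in> unshuffles q m" "\<tau> \<in> unshuffles q m" "\<sigma> ` {..<q} = \<tau> ` {..<q}"
    have "map \<sigma> [0..<q] @ map \<sigma> [q..<m] = map \<tau> [0..<q] @ map \<tau> [q..<m]"
      using unshuffleD(4,5)[OF a(1) assms] unshuffleD(4,5)[OF a(2) assms] a(3) by simp
    then have "map \<sigma> [0..<m] = map \<tau> [0..<m]"
      using assms by (metis le_add_diff_inverse map_append upt_add_eq_append zero_le)
    then have "\<sigma> i = \<tau> i" if "i < m" for i using that by simp
    moreover have "\<sigma> i = \<tau> i" if "\<not> i < m" for i
      using that permutes_not_in[OF unshuffleD(1)[OF a(1) assms]] permutes_not_in[OF unshuffleD(1)[OF a(2) assms]]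
      by simp
    ultimately show "\<sigma> = \<tau>" by blast
  qed
  show "(\<lambda>\<sigma>. \<sigma> ` {..<q}) ` unshuffles q m = {A. A \<subseteq> {..<m} \<and> card A = q}"
  proof (rule set_eqI, rule iffI)
    fix A assume "A \<in> (\<lambda>\<sigma>. \<sigma> ` {..<q}) ` unshuffles q m"
    then obtain \<sigma> where "\<sigma> \<in> unshuffles q m" "A = \<sigma> ` {..<q}" by blast
    then show "A \<in> {A. A \<subseteq> {..<m} \<and> card A = q}" using unshuffleD(2,3)[OF _ assms] by simp
  next
    fix A assume "A \<in> {A. A \<subseteq> {..<m} \<and> card A = q}"
    then have A: "A \<subseteq> {..<m}" "card A = q" by auto
    \<comment> \<open>The values of the unshuffle in order: \<open>A\<close> increasingly, then its
      complement increasingly.\<close>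
    define L where "L = filter (\<lambda>i. i \<in> A) [0..<m] @ filter (\<lambda>i. i \<notin> A) [0..<m]"
    define \<sigma> where "\<sigma> i = (if i < m then L ! i else i)" for i
    have len1: "length (filter (\<lambda>i. i \<in> A) [0..<m]) = q"
    proof -
      have "length (filter (\<lambda>i. i \<in> A) [0..<m]) = card (set (filter (\<lambda>i. i \<in> A) [0..<m]))"
        by (rule distinct_card[symmetric]) simp
      also have "set (filter (\<lambda>i. i \<in> A) [0..<m]) = A" using A by auto
      finally show ?thesis using A by simp
    qed
    have dist: "distinct L" and setL: "set L = {..<m}" by (auto simp: L_def)
    then have lenL: "length L = m" by (metis card_lessThan distinct_card)
    have "bij_betw (\<lambda>i. L ! i) {..<m} {..<m}"
      using bij_betw_nth[OF dist] lenL setL by simp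
    moreover have "bij_betw \<sigma> {..<m} {..<m} \<longleftrightarrow> bij_betw (\<lambda>i. L ! i) {..<m} {..<m}"
      by (rule bij_betw_cong) (simp add: \<sigma>_def)
    ultimately have "\<sigma> permutes {..<m}"
      by (intro bij_imp_permutes) (simp_all add: \<sigma>_def)
    moreover have sorted: "sorted_wrt (<) (filter Q [0..<m])" for Q by (intro sorted_wrt_filter) simp
    have s1: "\<sigma> i = filter (\<lambda>i. i \<in> A) [0..<m] ! i" if "i < q" for i
      using that len1 assms by (simp add: \<sigma>_def L_def nth_append)
    have s2: "\<sigma> i = filter (\<lambda>i. i \<notin> A) [0..<m] ! (i - q)" if "q \<le> i" "i < m" for i
      using that len1 by (simp add: \<sigma>_def L_def nth_append)
    have len2: "length (filter (\<lambda>i. i \<notin> A) [0..<m]) = m - q"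
      using lenL len1 by (simp add: L_def)
    have "strict_mono_on {..<q} \<sigma>"
      using sorted[of "\<lambda>i. i \<in> A"] len1 by (auto simp: strict_mono_on_def s1 sorted_wrt_iff_nth_less)
    moreover have "strict_mono_on {q..<m} \<sigma>"
      using sorted[of "\<lambda>i. i \<notin> A"] len2 by (auto simp: strict_mono_on_def s2 sorted_wrt_iff_nth_less diff_less_mono)
    ultimately have "\<sigma> \<in> unshuffles q m" by (simp add: unshuffles_def)
    moreover have "\<sigma> ` {..<q} = A"
    proof -
      have "\<sigma> ` {..<q} = (\<lambda>i. filter (\<lambda>i. i \<in> A) [0..<m] ! i) ` {..<q}"
        by (intro image_cong refl) (simp add: s1)
      also have "\<dots> = set (filter (\<lambda>i. i \<in> A) [0..<m])"
        using len1 by (metis atLeast0LessThan atLeast_upt list.set_map map_nth set_upt)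
      also have "\<dots> = A" using A by auto
      finally show ?thesis .
    qed
    ultimately show "A \<in> (\<lambda>\<sigma>. \<sigma> ` {..<q}) ` unshuffles q m" by blast
  qed
qed

text \<open>An unshuffle is increasing on both blocks, so each inversion joins a position of the
  first block to one of the second.\<close>

lemma lsign_unshuffle:
  assumes "\<sigma> \<in> unshuffles q (length ds)" "q \<le> length ds"
  shows "lsign \<sigma> ds = pm (ksum (\<lambda>b a. ds ! a * ds ! b + 1) (length ds) (\<sigma> ` {..<q}))"
proof -
  let ?m = "length ds" and ?A = "\<sigma> ` {..<q}"
  note u = unshuffleD[OF assms]
  have mono: "strict_mono_on {..<q} \<sigma>" "strict_mono_on {q..<?m} \<sigma>" using assms by (auto simp: unshuffles_def)
  have inv: "inv \<sigma> (\<sigma> i) = i" "\<sigma> (inv \<sigma> i) = i" for i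
    using permutes_inverses[OF u(1)] by auto
  have lt: "\<sigma> i < ?m \<longleftrightarrow> i < ?m" "inv \<sigma> i < ?m \<longleftrightarrow> i < ?m" for i
    using permutes_in_image[OF u(1), of i] permutes_in_image[OF permutes_inv[OF u(1)], of i] by auto
  have mem: "\<sigma> i \<in> ?A \<longleftrightarrow> i < q" for i
    using permutes_inj[OF u(1)] by (auto dest: injD)
  have mem': "a \<in> ?A \<longleftrightarrow> inv \<sigma> a < q" for a using mem[of "inv \<sigma> a"] by (simp add: inv)
  have "iprod ?m (\<lambda>i j. pm (ds ! i * ds ! j + 1)) \<sigma> = (\<Prod>(b, a)\<in>Inv ?m ?A. pm (ds ! a * ds ! b + 1) :: 'a)"
    unfolding iprod_def
  proof (rule prod.reindex_bij_witness[where i = "\<lambda>(b, a). (inv \<sigma> a, inv \<sigma> b)" and j = "\<lambda>(i, j). (\<sigma> j, \<sigma> i)"])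
    fix x assume "x \<in> inversions ?m \<sigma>"
    then obtain i j where x: "x = (i, j)" "i < j" "j < ?m" "\<sigma> j < \<sigma> i" by (auto simp: inversions_def)
    have "i < q \<and> q \<le> j"
    proof (rule ccontr)
      assume "\<not> (i < q \<and> q \<le> j)"
      then have "i \<in> {..<q} \<and> j \<in> {..<q} \<or> i \<in> {q..<?m} \<and> j \<in> {q..<?m}" using x by auto
      then have "\<sigma> i < \<sigma> j" using mono x(2) by (auto simp: strict_mono_on_def)
      then show False using x by simp
    qed
    then show "(case x of (i, j) \<Rightarrow> (\<sigma> j, \<sigma> i)) \<in> Inv ?m ?A"
      using x lt(1)[of i] mem by (simp add: Inv_def)
  next
    fix x assume "x \<in> Inv ?m ?A"
    then obtain a b where x: "x = (b, a)" "b < a" "a < ?m" "b \<notin> ?A" "a \<in> ?A" by (auto simp: Inv_def)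
    have "inv \<sigma> a < q" "\<not> inv \<sigma> b < q" using x mem' by blast+
    then show "(case x of (b, a) \<Rightarrow> (inv \<sigma> a, inv \<sigma> b)) \<in> inversions ?m \<sigma>"
      using x lt(2)[of b] by (simp add: inversions_def inv)
  qed (auto simp: inv split: prod.splits)
  also have "\<dots> = pm (ksum (\<lambda>b a. ds ! a * ds ! b + 1) ?m ?A)"
  proof -
    have "(\<Prod>x\<in>S. pm (h x)) = (pm (sum h S) :: 'a)" if "finite S" for S :: "(nat \<times> nat) set" and h
      using that by (induction S) (auto simp: pm_add, simp add: pm_def)
    then show ?thesis by (simp add: ksum_def case_prod_unfold)
  qed
  finally show ?thesis using u(1) by (simp add: lsign_iprod)
qed

text \<open>An unshuffle is determined by the set of its first \<open>q\<close> values. Sums over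
  subsets are then accessible to induction on the last index and to complementation.\<close>

lemma unshuffle_sum:
  assumes "\<And>q \<sigma>. 1 \<le> q \<Longrightarrow> q \<le> m \<Longrightarrow> \<sigma> \<in> unshuffles q m \<Longrightarrow> g q \<sigma> = h (\<sigma> ` {..<q})"
  shows "(\<Sum>q=1..m. \<Sum>\<sigma>\<in>unshuffles q m. g q \<sigma>) = sum h (Pow {..<m} - {{}})"
proof -
  have "(\<Sum>\<sigma>\<in>unshuffles q m. g q \<sigma>) = (\<Sum>A\<in>{A \<in> Pow {..<m} - {{}}. card A = q}. h A)" if "q \<in> {1..m}" for q
  proof -
    have q: "1 \<le> q" "q \<le> m" using that by auto
    have "(\<Sum>\<sigma>\<in>unshuffles q m. g q \<sigma>) = (\<Sum>\<sigma>\<in>unshuffles q m. h (\<sigma> ` {..<q}))"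
      using assms q by (intro sum.cong) auto
    also have "\<dots> = sum h {A. A \<subseteq> {..<m} \<and> card A = q}"
      using unshuffle_bij[OF q(2)] by (rule sum.reindex_bij_betw)
    also have "{A. A \<subseteq> {..<m} \<and> card A = q} = {A \<in> Pow {..<m} - {{}}. card A = q}"
      using q by auto
    finally show ?thesis .
  qed
  then have "(\<Sum>q=1..m. \<Sum>\<sigma>\<in>unshuffles q m. g q \<sigma>) = (\<Sum>q=1..m. \<Sum>A\<in>{A \<in> Pow {..<m} - {{}}. card A = q}. h A)"
    by (rule sum.cong[OF refl])
  also have "\<dots> = sum h (Pow {..<m} - {{}})"
  proof (rule sum.group)
    show "card ` (Pow {..<m} - {{}}) \<subseteq> {1..m}"
    proof
      fix q assume "q \<in> card ` (Pow {..<m} - {{}})"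
      then obtain A where A: "A \<subseteq> {..<m}" "A \<noteq> {}" "q = card A" by auto
      then have "finite A" by (auto intro: finite_subset)
      then show "q \<in> {1..m}" using A card_mono[of "{..<m}" A] by (auto simp: Suc_le_eq card_gt_0_iff)
    qed
  qed auto
  finally show ?thesis .
qed

subsection \<open>The shift signs\<close>

text \<open>The exponent of the decalage sign: in a list of length \<open>m\<close> the entry at
  position \<open>i\<close>, counted from 0, enters with multiplicity \<open>m - i\<close>.\<close>

fun shift_exp :: "int list \<Rightarrow> int" where
  "shift_exp [] = 0"
| "shift_exp (d # ds) = (int (length ds) + 1) * d + shift_exp ds"

lemma shift_exp_snoc: "shift_exp (ds @ [d]) = shift_exp ds + sum_list ds + d"
  by (induction ds) (auto simp: algebra_simps)

lemma nths_snoc: "nths (xs @ [x]) A = nths xs A @ (if length xs \<in> A then [x] else [])"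
  by (simp add: nths_append)

lemma sum_list_nths: "sum_list (nths ds A) = (\<Sum>i\<in>{..<length ds} \<inter> A. ds ! i)" for ds :: "int list"
proof (induction ds rule: rev_induct)
  case (snoc d ds)
  have "{..<Suc (length ds)} \<inter> A = ({..<length ds} \<inter> A) \<union> (if length ds \<in> A then {length ds} else {})"
    by (auto simp: less_Suc_eq)
  then show ?case
    using snoc by (auto simp: nths_snoc nth_append intro!: sum.cong)
qed simp

lemma ksum_cong: "(\<And>a b. b < a \<Longrightarrow> a < m \<Longrightarrow> g b a = h b a) \<Longrightarrow> ksum g m A = ksum h m A"
  unfolding ksum_def by (intro sum.cong) (auto simp: Inv_def)

text \<open>Compares the decalage sign of the full list with those of the inner and the outer
  bracket. The last term is the contribution of the inner bracket as first entry of the outer one;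
  the induction adds an entry at the right end.\<close>

lemma shift_identity:
  "even (ksum (\<lambda>b a. ds ! a + ds ! b) (length ds) A + shift_exp ds + shift_exp (nths ds A)
    + shift_exp (nths ds (- A)) + int (length (nths ds (- A))) * sum_list (nths ds A))"
proof (induction ds rule: rev_induct)
  case Nil
  then show ?case by (simp add: ksum_def Inv_def)
next
  case (snoc d ds)
  let ?m = "length ds"
  have k: "ksum (\<lambda>b a. (ds @ [d]) ! a + (ds @ [d]) ! b) ?m A = ksum (\<lambda>b a. ds ! a + ds ! b) ?m A"
    by (rule ksum_cong) (auto simp: nth_append)
  have s: "sum_list ds = sum_list (nths ds A) + sum_list (nths ds (- A))"
  proof -
    have "(\<Sum>i<?m. ds ! i) = (\<Sum>i\<in>{..<?m} \<inter> A. ds ! i) + (\<Sum>i\<in>{..<?m} - A. ds ! i)"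
      by (rule sum.Int_Diff) simp
    moreover have "{..<?m} \<inter> - A = {..<?m} - A" by auto
    moreover have "sum_list ds = (\<Sum>i<?m. ds ! i)" by (simp add: sum_list_sum_nth atLeast0LessThan)
    ultimately show ?thesis by (simp add: sum_list_nths)
  qed
  define K where "K = ksum (\<lambda>b a. ds ! a + ds ! b) ?m A"
  have "(\<Sum>b\<in>{..<?m} - A. (ds @ [d]) ! ?m + (ds @ [d]) ! b) = int (length (nths ds (- A))) * d + sum_list (nths ds (- A))"
  proof -
    have "length (nths ds (- A)) = card ({..<?m} - A)"
      unfolding length_nths by (rule arg_cong[of _ _ card]) auto
    moreover have "sum_list (nths ds (- A)) = (\<Sum>b\<in>{..<?m} - A. ds ! b)"
      unfolding sum_list_nths by (rule sum.cong) auto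
    moreover have "(\<Sum>b\<in>{..<?m} - A. (ds @ [d]) ! ?m + (ds @ [d]) ! b) = (\<Sum>b\<in>{..<?m} - A. d + ds ! b)"
      by (rule sum.cong) (auto simp: nth_append)
    ultimately show ?thesis by (simp add: sum.distrib)
  qed
  then have "ksum (\<lambda>b a. (ds @ [d]) ! a + (ds @ [d]) ! b) (length (ds @ [d])) A
    = K + (if ?m \<in> A then int (length (nths ds (- A))) * d + sum_list (nths ds (- A)) else 0)"
    unfolding length_append_singleton ksum_Suc k K_def by simp
  then show ?case
    unfolding nths_snoc shift_exp_snoc s using snoc[folded K_def]
    by (cases "?m \<in> A") (simp_all add: shift_exp_snoc s algebra_simps)
qed

lemma nths_cong: "A \<inter> {..<length xs} = A' \<inter> {..<length xs} \<Longrightarrow> nths xs A = nths xs A'"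
  unfolding nths_filter by (intro arg_cong[of _ _ "map ((!) xs)"] filter_cong) auto

lemma nths_compl:
  assumes "A \<subseteq> {..<m}" "length xs = m"
  shows "nths xs ({..<m} - A) = nths xs (- A)" "nths xs (- ({..<m} - A)) = nths xs A"
  using assms by (auto intro!: nths_cong)

lemma nths_snoc_cases:
  assumes "A \<subseteq> {..<length xs}"
  shows "nths (xs @ [x]) (insert (length xs) A) = nths xs A @ [x]"
    "nths (xs @ [x]) (- insert (length xs) A) = nths xs (- A)"
    "nths (xs @ [x]) A = nths xs A" "nths (xs @ [x]) (- A) = nths xs (- A) @ [x]"
proof -
  have "nths xs (insert (length xs) A) = nths xs A" "nths xs (- insert (length xs) A) = nths xs (- A)"
    by (rule nths_cong; auto)+
  moreover have "length xs \<notin> A" using assms by auto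
  ultimately show "nths (xs @ [x]) (insert (length xs) A) = nths xs A @ [x]"
    "nths (xs @ [x]) (- insert (length xs) A) = nths xs (- A)"
    "nths (xs @ [x]) A = nths xs A" "nths (xs @ [x]) (- A) = nths xs (- A) @ [x]"
    by (simp_all add: nths_snoc)
qed

lemma sum_Pow_Suc:
  fixes h :: "nat set \<Rightarrow> 'a::comm_monoid_add"
  shows "sum h (Pow {..<Suc m}) = (\<Sum>A\<in>Pow {..<m}. h (insert m A)) + (\<Sum>A\<in>Pow {..<m}. h A)"
proof -
  have "Pow {..<Suc m} = insert m ` Pow {..<m} \<union> Pow {..<m}"
    by (simp add: lessThan_Suc Pow_insert Un_commute)
  moreover have "insert m ` Pow {..<m} \<inter> Pow {..<m} = {}" by auto
  moreover have "inj_on (insert m) (Pow {..<m})"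
    by (rule inj_onI) (metis PowD insert_ident lessThan_iff less_irrefl subsetD)
  ultimately show ?thesis by (simp add: sum.union_disjoint sum.reindex)
qed

lemma ksum_restrict: "ksum g m A = ksum g m (A \<inter> {..<m})"
  unfolding ksum_def Inv_def by (intro sum.cong) auto

lemma ksum_insert:
  assumes "A \<subseteq> {..<m}"
  shows "ksum g (Suc m) (insert m A) = ksum g m A + (\<Sum>b\<in>{..<m} - A. g b m)"
    "ksum g (Suc m) A = ksum g m A"
proof -
  have "ksum g m (insert m A) = ksum g m A"
    by (subst (1 2) ksum_restrict) (rule arg_cong[of _ _ "ksum g m"], auto)
  moreover have "{..<m} - insert m A = {..<m} - A" by auto
  ultimately show "ksum g (Suc m) (insert m A) = ksum g m A + (\<Sum>b\<in>{..<m} - A. g b m)"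
    by (simp add: ksum_Suc)
  have "m \<notin> A" using assms by auto
  then show "ksum g (Suc m) A = ksum g m A" by (simp add: ksum_Suc)
qed

text \<open>The sum of the degrees shifted by one, for which the derived brackets are
  symmetric.\<close>

definition shsum :: "int list \<Rightarrow> int" where
  "shsum ds = sum_list ds + int (length ds)"

lemma shsum_simps [simp]: "shsum [] = 0" "shsum (d # ds) = d + 1 + shsum ds" "shsum (xs @ ys) = shsum xs + shsum ys"
  by (simp_all add: shsum_def)

lemma shsum_nths: "shsum (nths ds A) = (\<Sum>i\<in>{..<length ds} \<inter> A. ds ! i + 1)"
proof -
  have "length (nths ds A) = card ({..<length ds} \<inter> A)"
    unfolding length_nths by (rule arg_cong[of _ _ card]) auto
  then show ?thesis by (simp add: shsum_def sum_list_nths sum.distrib)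
qed

text \<open>The Koszul sign exponent of the unshuffle of \<open>A\<close> in shifted
  degrees.\<close>

definition kap :: "int list \<Rightarrow> nat set \<Rightarrow> int" where
  "kap ds A = ksum (\<lambda>b a. (ds ! a + 1) * (ds ! b + 1)) (length ds) A"

lemma kap_snoc:
  assumes "A \<subseteq> {..<length ds}"
  shows "kap (ds @ [d]) (insert (length ds) A) = kap ds A + (d + 1) * shsum (nths ds (- A))"
    "kap (ds @ [d]) A = kap ds A"
proof -
  have 1: "ksum (\<lambda>b a. ((ds @ [d]) ! a + 1) * ((ds @ [d]) ! b + 1)) (length ds) A = kap ds A"
    unfolding kap_def by (rule ksum_cong) (simp add: nth_append)
  have "(\<Sum>b\<in>{..<length ds} - A. ((ds @ [d]) ! length ds + 1) * ((ds @ [d]) ! b + 1)) = (d + 1) * shsum (nths ds (- A))"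
    unfolding shsum_nths sum_distrib_left
    by (intro sum.cong) (auto simp: nth_append)
  then show "kap (ds @ [d]) (insert (length ds) A) = kap ds A + (d + 1) * shsum (nths ds (- A))"
    using ksum_insert(1)[OF assms, of "\<lambda>b a. ((ds @ [d]) ! a + 1) * ((ds @ [d]) ! b + 1)"] 1
    by (simp add: kap_def[of "ds @ [d]"])
  show "kap (ds @ [d]) A = kap ds A"
    using ksum_insert(2)[OF assms, of "\<lambda>b a. ((ds @ [d]) ! a + 1) * ((ds @ [d]) ! b + 1)"] 1
    by (simp add: kap_def[of "ds @ [d]"])
qed

text \<open>Each pair of an element of \<open>A\<close> and one of its complement is reversed by
  exactly one of the two unshuffles, so the sums together run over all pairs and factorise.\<close>

lemma kap_compl:
  assumes "A \<subseteq> {..<length ds}"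
  shows "kap ds A + kap ds ({..<length ds} - A) = shsum (nths ds A) * shsum (nths ds (- A))"
proof -
  let ?m = "length ds" and ?g = "\<lambda>i. ds ! i + 1"
  let ?B = "{..<?m} - A"
  have "kap ds ?B = (\<Sum>(b, a)\<in>prod.swap ` Inv ?m ?B. ?g a * ?g b)"
    unfolding kap_def ksum_def by (subst sum.reindex) (auto simp: case_prod_unfold mult.commute)
  moreover have "kap ds A = (\<Sum>(b, a)\<in>Inv ?m A. ?g a * ?g b)" by (simp add: kap_def ksum_def)
  moreover have "Inv ?m A \<union> prod.swap ` Inv ?m ?B = ?B \<times> A"
  proof (rule set_eqI)
    fix x :: "nat \<times> nat"
    obtain b a where x: "x = (b, a)" by (cases x)
    have "x \<in> prod.swap ` Inv ?m ?B \<longleftrightarrow> (a, b) \<in> Inv ?m ?B" unfolding x by force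
    then show "x \<in> Inv ?m A \<union> prod.swap ` Inv ?m ?B \<longleftrightarrow> x \<in> ?B \<times> A"
      using assms unfolding x Inv_def by (cases a b rule: linorder_cases) auto
  qed
  moreover have "Inv ?m A \<inter> prod.swap ` Inv ?m ?B = {}" by (auto simp: Inv_def)
  ultimately have "kap ds A + kap ds ?B = (\<Sum>(b, a)\<in>?B \<times> A. ?g a * ?g b)"
    by (metis (no_types, lifting) finite_Inv finite_imageI sum.union_disjoint)
  also have "\<dots> = (\<Sum>b\<in>?B. ?g b) * (\<Sum>a\<in>A. ?g a)"
    by (simp only: sum.cartesian_product[symmetric] sum_product) (intro sum.cong refl mult.commute)
  also have "{..<?m} \<inter> A = A" "{..<?m} \<inter> - A = ?B" using assms by auto
  then have "(\<Sum>b\<in>?B. ?g b) * (\<Sum>a\<in>A. ?g a) = shsum (nths ds A) * shsum (nths ds (- A))"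
    by (simp add: shsum_nths mult.commute)
  finally show ?thesis .
qed

lemma list_all2_nths: "list_all2 Q xs ys \<Longrightarrow> list_all2 Q (nths xs A) (nths ys A)"
proof (induction ys arbitrary: xs rule: rev_induct)
  case (snoc y ys)
  then obtain us u where "xs = us @ [u]" "list_all2 Q us ys" "Q u y"
    by (auto simp: list_all2_append2 list_all2_Cons2)
  then show ?case
    using snoc.IH[of us] list_all2_lengthD[of Q us ys] by (auto simp: nths_snoc intro!: list_all2_appendI)
qed simp

context weighted_resolvent
begin

subsection \<open>Iterated derived brackets\<close>

definition Dseq :: "('n + gvar) set \<Rightarrow> ('n, 'k) mpoly sp list \<Rightarrow> ('n, 'k) mpoly sp \<Rightarrow> ('n, 'k) mpoly sp" where
  "Dseq B as F = foldr (DD B) as F"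

lemma Dseq_simps [simp]: "Dseq B [] F = F" "Dseq B (a # as) F = DD B a (Dseq B as F)"
  "Dseq B (as @ [a]) F = Dseq B as (DD B a F)"
  by (simp_all add: Dseq_def)

lemma Dseq_add: "Dseq B as (F + G) = Dseq B as F + Dseq B as G"
  and Dseq_sg: "Dseq B as (sg b F) = sg b (Dseq B as F)"
  by (induction as) (simp_all add: DD_add_right DD_sg_right)

definition homs :: "int list \<Rightarrow> ('n, 'k) mpoly sp list \<Rightarrow> bool" where
  "homs ds as \<longleftrightarrow> list_all2 (\<lambda>d a. a \<in> RR \<and> hom (odd d) a) ds as"

lemma homs_simps [simp]: "homs [] as \<longleftrightarrow> as = []" "homs (d # ds) (a # as) \<longleftrightarrow> a \<in> RR \<and> hom (odd d) a \<and> homs ds as"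
  by (auto simp: homs_def)

lemma homs_length: "homs ds as \<Longrightarrow> length ds = length as"
  unfolding homs_def by (rule list_all2_lengthD)

lemma homs_nths: "homs ds as \<Longrightarrow> homs (nths ds A) (nths as A)"
  unfolding homs_def by (rule list_all2_nths)

text \<open>
  Leibniz rule of the iterated derivations \<open>DD B a\<close> with respect to the Schouten bracket; the sign
  counts the pairs of a later factor of the first and an earlier factor of the second argument.
\<close>

lemma Dseq_Br:
  assumes "homs ds as" "hom (odd \<phi>) F" "hom (odd \<gamma>) G"
  shows "Dseq B as (Br B (odd \<phi>) (odd \<gamma>) F G) = (\<Sum>A\<in>Pow {..<length as}.
    sg (odd (kap ds A + (\<phi> + 1) * shsum (nths ds (- A))))
      (Br B (odd (\<phi> + shsum (nths ds A))) (odd (\<gamma> + shsum (nths ds (- A))))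
        (Dseq B (nths as A) F) (Dseq B (nths as (- A)) G)))"
  using assms
proof (induction as arbitrary: ds F G \<phi> \<gamma> rule: rev_induct)
  case Nil
  then show ?case by (simp add: homs_def kap_def ksum_def Inv_def)
next
  case (snoc a as)
  then obtain es d where ds: "ds = es @ [d]" "homs es as" "a \<in> RR" "hom (odd d) a"
    unfolding homs_def by (auto simp: list_all2_append2 list_all2_Cons2)
  have len: "length es = length as" using ds(2) by (rule homs_length)
  have par: "(odd d = odd \<psi>) = odd (\<psi> + d + 1)" for \<psi> by simp argo
  have h: "hom (odd (\<psi> + d + 1)) (DD B a H)" if "hom (odd \<psi>) H" for \<psi> H
    using hom_DD[OF ds(4) that, of B] unfolding par .
  let ?t = "\<lambda>\<phi> \<gamma> F G A. sg (odd (kap es A + (\<phi> + 1) * shsum (nths es (- A))))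
      (Br B (odd (\<phi> + shsum (nths es A))) (odd (\<gamma> + shsum (nths es (- A))))
        (Dseq B (nths as A) F) (Dseq B (nths as (- A)) G))"
  let ?T = "\<lambda>A. sg (odd (kap ds A + (\<phi> + 1) * shsum (nths ds (- A))))
      (Br B (odd (\<phi> + shsum (nths ds A))) (odd (\<gamma> + shsum (nths ds (- A))))
        (Dseq B (nths (as @ [a]) A) F) (Dseq B (nths (as @ [a]) (- A)) G))"
  \<comment> \<open>The innermost derivation, given by the last argument, falls on \<open>F\<close>
    or on \<open>G\<close>; these are the subsets with and without the last index.\<close>
  have "Dseq B (as @ [a]) (Br B (odd \<phi>) (odd \<gamma>) F G)
    = Dseq B as (Br B (odd (\<phi> + d + 1)) (odd \<gamma>) (DD B a F) G)
    + sg (\<not> odd d \<and> \<not> odd \<phi>) (Dseq B as (Br B (odd \<phi>) (odd (\<gamma> + d + 1)) F (DD B a G)))"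
    using DD_Br[OF ds(4) snoc.prems(2,3) RR_dx_rd[OF ds(3)], of B]
    by (simp only: Dseq_simps Dseq_add Dseq_sg par)
  also have "Dseq B as (Br B (odd (\<phi> + d + 1)) (odd \<gamma>) (DD B a F) G)
    = (\<Sum>A\<in>Pow {..<length as}. ?t (\<phi> + d + 1) \<gamma> (DD B a F) G A)"
    by (rule snoc.IH[OF ds(2) h[OF snoc.prems(2)] snoc.prems(3)])
  also have "Dseq B as (Br B (odd \<phi>) (odd (\<gamma> + d + 1)) F (DD B a G))
    = (\<Sum>A\<in>Pow {..<length as}. ?t \<phi> (\<gamma> + d + 1) F (DD B a G) A)"
    by (rule snoc.IH[OF ds(2) snoc.prems(2) h[OF snoc.prems(3)]])
  also have "(\<Sum>A\<in>Pow {..<length as}. ?t (\<phi> + d + 1) \<gamma> (DD B a F) G A)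
    = (\<Sum>A\<in>Pow {..<length as}. ?T (insert (length as) A))"
  proof (rule sum.cong[OF refl])
    fix A assume "A \<in> Pow {..<length as}"
    then have A: "A \<subseteq> {..<length as}" "A \<subseteq> {..<length es}" by (simp_all add: len)
    note k = kap_snoc[OF A(2), of d, folded ds(1), unfolded len]
      and n = nths_snoc_cases[OF A(2), of d, folded ds(1), unfolded len]
    have p1: "odd (kap es A + (\<phi> + d + 1 + 1) * shsum (nths es (- A)))
      = odd (kap es A + (d + 1) * shsum (nths es (- A)) + (\<phi> + 1) * shsum (nths es (- A)))"
      by (rule arg_cong[of _ _ odd]) (simp add: algebra_simps)
    have p2: "\<phi> + d + 1 + shsum (nths es A) = \<phi> + (shsum (nths es A) + (d + 1 + 0))" by simp
    show "?t (\<phi> + d + 1) \<gamma> (DD B a F) G A = ?T (insert (length as) A)"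
      unfolding k(1) n(1,2) nths_snoc_cases(1,2)[OF A(1)] Dseq_simps shsum_simps p1 p2 ..
  qed
  also have "sg (\<not> odd d \<and> \<not> odd \<phi>) (\<Sum>A\<in>Pow {..<length as}. ?t \<phi> (\<gamma> + d + 1) F (DD B a G) A)
    = (\<Sum>A\<in>Pow {..<length as}. ?T A)"
    unfolding sg_sum
  proof (rule sum.cong[OF refl])
    fix A assume "A \<in> Pow {..<length as}"
    then have A: "A \<subseteq> {..<length as}" "A \<subseteq> {..<length es}" by (simp_all add: len)
    note k = kap_snoc[OF A(2), of d, folded ds(1), unfolded len]
      and n = nths_snoc_cases[OF A(2), of d, folded ds(1), unfolded len]
    have p1: "((\<not> odd d \<and> \<not> odd \<phi>) \<noteq> odd (kap es A + (\<phi> + 1) * shsum (nths es (- A))))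
      = odd (kap es A + (\<phi> + 1) * (shsum (nths es (- A)) + (d + 1 + 0)))"
      by simp argo
    have p2: "\<gamma> + d + 1 + shsum (nths es (- A)) = \<gamma> + (shsum (nths es (- A)) + (d + 1 + 0))" by simp
    show "sg (\<not> odd d \<and> \<not> odd \<phi>) (?t \<phi> (\<gamma> + d + 1) F (DD B a G) A) = ?T A"
      unfolding k(2) n(3,4) nths_snoc_cases(3,4)[OF A(1)] Dseq_simps shsum_simps sg_simps(4) p1 p2 ..
  qed
  finally show ?case by (simp only: length_append_singleton sum_Pow_Suc)
qed

text \<open>The iterated derivations are distributed over the self-bracket of \<pi>. Each of the two
  halves of \<open>Br\<close> yields the whole sum \<open>S\<close>, so
  \<open>S + S = 0\<close>.\<close>

lemma derived_jacobi:
  assumes "homs ds as" and \<pi>: "hom False \<pi>" "rho \<pi> = 0" and B: "B \<subseteq> C"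
    and K: "rho (Dseq B as (DD B \<pi> \<pi>)) = 0"
  shows "(\<Sum>A\<in>Pow {..<length as} - {{}}. sg (odd (kap ds A + shsum (nths ds (- A))))
    (rho (DD B (rho (Dseq B (nths as A) \<pi>)) (Dseq B (nths as (- A)) \<pi>)))) = 0"
proof -
  let ?m = "length as"
  have len: "length ds = ?m" using assms(1) by (rule homs_length)
  define t where "t A = rho (DD B (rho (Dseq B (nths as A) \<pi>)) (Dseq B (nths as (- A)) \<pi>))" for A
  define N where "N A = kap ds A + shsum (nths ds (- A))" for A
  define S where "S = (\<Sum>A\<in>Pow {..<?m}. sg (odd (N A)) (t A))"
  have "Br B False False \<pi> \<pi> = DD B \<pi> \<pi> + DD B \<pi> \<pi>" by (simp add: Br_def)
  then have "0 = rho (Dseq B as (Br B (odd (0::int)) (odd (0::int)) \<pi> \<pi>))"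
    using K by (simp add: Dseq_add rho_add)
  also have "\<dots> = (\<Sum>A\<in>Pow {..<?m}. rho (sg (odd (N A)) (Br B (odd (shsum (nths ds A))) (odd (shsum (nths ds (- A))))
        (Dseq B (nths as A) \<pi>) (Dseq B (nths as (- A)) \<pi>))))"
    using Dseq_Br[OF assms(1), of 0 \<pi> 0 \<pi> B] \<pi>(1) by (simp add: rho_sum N_def)
  \<comment> \<open>The second half of \<open>Br\<close> at \<open>A\<close> is the first half at
    the complement of \<open>A\<close>, with the signs matched by \<open>kap_compl\<close>.\<close>
  also have "\<dots> = (\<Sum>A\<in>Pow {..<?m}. sg (odd (N A)) (t A) + sg (odd (N ({..<?m} - A))) (t ({..<?m} - A)))"
  proof (rule sum.cong[OF refl])
    fix A assume "A \<in> Pow {..<?m}"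
    then have A: "A \<subseteq> {..<?m}" by simp
    let ?A' = "{..<?m} - A"
    note n1 = nths_compl[OF A]
    have "kap ds A + kap ds ?A' = shsum (nths ds A) * shsum (nths ds (- A))"
      using kap_compl[of A ds] A len by simp
    then have e: "kap ds ?A' = shsum (nths ds A) * shsum (nths ds (- A)) - kap ds A" by linarith
    have "odd (N ?A') = (odd (N A) \<noteq> (\<not> (\<not> odd (shsum (nths ds A)) \<and> \<not> odd (shsum (nths ds (- A))))))"
      using n1[OF len] by (simp add: N_def e) argo
    moreover have "t ?A' = rho (DD B (Dseq B (nths as (- A)) \<pi>) (Dseq B (nths as A) \<pi>))"
      unfolding t_def n1[OF refl] by (rule rho_DD[OF B, symmetric])
    moreover have "t A = rho (DD B (Dseq B (nths as A) \<pi>) (Dseq B (nths as (- A)) \<pi>))"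
      unfolding t_def by (rule rho_DD[OF B, symmetric])
    ultimately show "rho (sg (odd (N A)) (Br B (odd (shsum (nths ds A))) (odd (shsum (nths ds (- A))))
        (Dseq B (nths as A) \<pi>) (Dseq B (nths as (- A)) \<pi>)))
      = sg (odd (N A)) (t A) + sg (odd (N ?A')) (t ?A')"
      by (cases "odd (N A)"; cases "odd (shsum (nths ds A))"; cases "odd (shsum (nths ds (- A)))")
         (simp_all add: Br_def rho_diff rho_add rho_minus)
  qed
  also have "\<dots> = S + (\<Sum>A\<in>Pow {..<?m}. sg (odd (N ({..<?m} - A))) (t ({..<?m} - A)))"
    by (simp add: sum.distrib S_def)
  also have "(\<Sum>A\<in>Pow {..<?m}. sg (odd (N ({..<?m} - A))) (t ({..<?m} - A))) = S"
    unfolding S_def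
    by (rule sum.reindex_bij_witness[where i = "\<lambda>A. {..<?m} - A" and j = "\<lambda>A. {..<?m} - A"])
       (auto simp: double_diff)
  finally have "S = 0" using double_eq_0[of S] by simp
  \<comment> \<open>The empty set would give the nullary bracket \<open>rho \<pi>\<close>, which is
    zero.\<close>
  moreover have "t {} = 0" by (simp add: t_def \<pi>(2))
  then have "S = (\<Sum>A\<in>Pow {..<?m} - {{}}. sg (odd (N A)) (t A))"
    unfolding S_def by (intro sum.mono_neutral_right) auto
  ultimately show ?thesis by (simp add: t_def N_def)
qed

end

section \<open>Decalage and stabilisation of iterated brackets\<close>

lemma coef_mult_0: "coef (x * y) 0 = coef x 0 * coef y 0"
proof (induction x rule: sp_induct)
  case (monom M a)
  show ?case
  proof (induction y rule: sp_induct)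
    case (monom N b)
    have "M + N = 0 \<longleftrightarrow> M = 0 \<and> N = 0"
      by (metis keys_add_nat keys_eq_empty Un_empty)
    then show ?case
      using \<open>reduced M\<close> \<open>reduced N\<close> by (auto simp: monom_mult coef_monom)
  qed (simp add: distrib_left)
qed (simp add: distrib_right)

lemma coef_cst_0 [simp]: "coef (cst s) 0 = s"
  by (simp add: cst_def coef_monom)

lemma coef_ep_0 [simp]: "coef (ep x) 0 = coef x 0"
  by (simp add: coef_ep)

lemma coef_dcoef: "derivation d TYPE('s) \<Longrightarrow> coef (dcoef d x) M = d (coef x M)" for x :: "'s::comm_ring_1 sp"
  by (induction x rule: sp_induct) (auto simp: dcoef_monom dcoef_add coef_monom derivationD)

context weighted_resolvent
begin

text \<open>
  The twist by the parity involution is the decalage sign between the symmetric derived brackets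
  and the antisymmetric brackets of an \<open>L\<^sub>\<infinity>\<close>-algebra.
\<close>

primrec Dsh :: "('n + gvar) set \<Rightarrow> ('n, 'k) mpoly sp list \<Rightarrow> ('n, 'k) mpoly sp \<Rightarrow> ('n, 'k) mpoly sp" where
  "Dsh B [] F = F"
| "Dsh B (a # as) F = DD B (epsp (odd (length as + 1)) a) (Dsh B as F)"

lemma Dsh_add: "Dsh B as (F + G) = Dsh B as F + Dsh B as G"
  by (induction as) (simp_all add: DD_add_right)

lemma Dsh_0 [simp]: "Dsh B as 0 = 0"
  using Dsh_add[of B as 0 0] by simp

lemma Dsh_minus: "Dsh B as (- F) = - Dsh B as F"
  using Dsh_add[of B as F "- F"] by (simp add: eq_neg_iff_add_eq_0 add.commute)

lemma Dsh_diff: "Dsh B as (F - G) = Dsh B as F - Dsh B as G"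
  using Dsh_add[of B as F "- G"] by (simp add: Dsh_minus)

lemma Dsh_Dseq: "homs ds as \<Longrightarrow> Dsh B as F = sg (odd (shift_exp ds)) (Dseq B as F)"
  unfolding homs_def
proof (induction rule: list_all2_induct)
  case (Cons d ds a as)
  have len: "length ds = length as" using Cons(2) by (rule list_all2_lengthD)
  have e: "epsp (odd (length as + 1)) a = sg (odd (length as + 1) \<and> odd d) a"
    using Cons(1) by (intro epsp_hom) simp
  have s: "(odd (shift_exp ds) \<noteq> (odd (length as + 1) \<and> odd d)) = odd (shift_exp (d # ds))"
    by (simp add: len) argo
  show ?case unfolding Dsh.simps e Cons.IH DD_sg_left DD_sg_right sg_simps(4) s Dseq_simps ..
qed simp

lemma epsp_hg: "ring_grading hw \<Longrightarrow> x \<in> hg wt hw d \<Longrightarrow> epsp b x \<in> hg wt hw d"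
  by (simp add: epsp_def ring_grading.hg_ep)

lemma Dsh_hg:
  assumes "shifts wt hw zt" "\<And>c. c \<in> B \<Longrightarrow> zt c + wt (xi c) = q"
    and "list_all2 (\<lambda>d a. a \<in> hg wt hw d) ds as" and F: "F \<in> hg wt hw e"
  shows "Dsh B as F \<in> hg wt hw (e + sum_list ds - int (length as) * q)"
  using assms(3)
proof (induction rule: list_all2_induct)
  case (Cons d ds a as)
  have "epsp (odd (length as + 1)) a \<in> hg wt hw d"
    using Cons(1) assms(1) by (intro epsp_hg) (simp_all add: shifts_def)
  from DD_hg[OF assms(1) this Cons(3) assms(2), of B]
  have "DD B (epsp (odd (length as + 1)) a) (Dsh B as F)
    \<in> hg wt hw (d + (e + sum_list ds - int (length as) * q) - q)" by simp
  then show ?case by (simp add: algebra_simps)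
qed (simp add: F)

lemma CN_q:
  assumes "c \<in> CN N"
  shows "vwt wdeg c + wdeg (xi c) = 1" "vwt wc c + wc (xi c) = 1" "zw c + ww (xi c) = - p"
  using vwt_simps[OF CN_C[OF assms]] zw_xi[OF CN_C[OF assms]] by simp_all

text \<open>Only the arguments are differentiated along coordinates; \<open>F\<close> loses momenta,
  which carry no weight.\<close>

lemma Dsh_wz: "B \<subseteq> C \<Longrightarrow> F \<in> hg wz hw_ge e \<Longrightarrow> Dsh B as F \<in> hg wz hw_ge e"
proof (induction as)
  case (Cons a as)
  have "dx c (Dsh B as F) \<in> hg wz hw_ge e" if "c \<in> B" for c
    using dx_hg[OF shifts_ge Cons.IH[OF Cons.prems], of c] vwt_simps(5)[of c] that Cons.prems(1) by auto
  then show ?case using Cons.prems(1) by (simp add: DD_dx_ge)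
qed simp

text \<open>Coordinates of degree above \<open>N\<close> do not occur in the arguments, so their
  derivatives contribute nothing.\<close>

lemma Dsh_RN:
  assumes "\<forall>a\<in>set as. a \<in> RN N" "N \<le> M"
  shows "Dsh (CN M) as F = Dsh (CN N) as F"
  using assms(1)
proof (induction as)
  case (Cons a as)
  have "rd c (epsp b a) = 0" if "c \<in> CN M" "c \<notin> CN N" for c b
  proof (cases c)
    case (Inl j)
    then show ?thesis using that by (simp add: CN_def cdeg_def)
  next
    case (Inr v)
    then have "fst v > N" using that by (auto simp: CN_def cdeg_def)
    have "v \<notin> Poly_Mapping.keys K" if K: "K \<in> mons (epsp b' a)" for K b'
    proof
      assume "v \<in> Poly_Mapping.keys K"
      moreover have "K \<in> mons a" using K by (auto simp: mons_iff epsp_def coef_ep split: if_splits)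
      then have "Poly_Mapping.keys K \<subseteq> vars_upto J N" using Cons.prems by (auto simp: RN_def)
      ultimately have "fst v \<le> N" by (auto simp: vars_upto_def)
      then show False using \<open>fst v > N\<close> by simp
    qed
    then show ?thesis using Inr by (simp add: rd_def dz_def epsp_epsp dvar_notin)
  qed
  then have "DD (CN M) (epsp b a) G = DD (CN N) (epsp b a) G" for b G
    unfolding DD_def using CN_mono[OF assms(2)] finite_CN
    by (intro sum.mono_neutral_right) auto
  then show ?case using Cons by simp
qed simp

text \<open>Without momenta the weight is minus the degree, so a surviving monomial would force
  \<open>a + b \<le> 0\<close>.\<close>

lemma rho_vanish:
  assumes "x \<in> hg wz hw_ge a" "x \<in> hg wdeg hw_ge b" "a + b > 0"
  shows "rho x = 0"
proof (rule sp_eq_0I)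
  fix M assume "M \<in> mons (rho x)"
  then have M: "Poly_Mapping.keys M \<subseteq> V" "M \<in> mons x"
    by (auto simp: rho_def mons_iff coef_restr split: if_splits)
  have "wtm wz M = - wtm wdeg M"
    using M(1) unfolding wtm_def
    by (auto simp: wz_def wdeg_def subset_iff sum_negf simp flip: sum_negf)
  then show False using assms M(2) by (fastforce simp: hg_ge_iff)
qed

lemma RR_bound:
  assumes "a \<in> RR"
  shows "\<exists>N. a \<in> RN N \<and> a \<in> hg wdeg hw_ge (- int N)"
proof -
  have "finite ((\<Union>M\<in>mons a. fst ` Poly_Mapping.keys M) \<union> (\<lambda>M. nat (- wtm wdeg M)) ` mons a)" by simp
  then obtain N where N: "\<forall>n\<in>(\<Union>M\<in>mons a. fst ` Poly_Mapping.keys M) \<union> (\<lambda>M. nat (- wtm wdeg M)) ` mons a. n \<le> N"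
    unfolding finite_nat_set_iff_bounded_le by blast
  have 1: "fst v \<le> N" if "M \<in> mons a" "v \<in> Poly_Mapping.keys M" for M v
    using N that by blast
  have 2: "- wtm wdeg M \<le> int N" if "M \<in> mons a" for M
  proof -
    have "nat (- wtm wdeg M) \<le> N" using N that by blast
    then show ?thesis by simp
  qed
  have "a \<in> RN N" using assms 1 unfolding RN_def RR_iff vars_upto_V by blast
  moreover have "a \<in> hg wdeg hw_ge (- int N)" unfolding hg_ge_iff
  proof (intro ballI)
    fix M assume "M \<in> mons a"
    then show "- int N \<le> wtm wdeg M" using 2[of M] by linarith
  qed
  ultimately show ?thesis by blast
qed

lemma RR_bound_list:
  assumes "set as \<subseteq> RR"
  shows "\<exists>N. \<forall>a\<in>set as. a \<in> RN N \<and> a \<in> hg wdeg hw_ge (- int N)"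
  using assms
proof (induction as)
  case (Cons a as)
  obtain N where "\<forall>a\<in>set as. a \<in> RN N \<and> a \<in> hg wdeg hw_ge (- int N)" using Cons by auto
  moreover obtain N' where "a \<in> RN N' \<and> a \<in> hg wdeg hw_ge (- int N')" using RR_bound[of a] Cons by auto
  moreover have "RN N \<subseteq> RN (max N N')" "RN N' \<subseteq> RN (max N N')" by (simp_all add: RN_mono)
  ultimately show ?case
    by (intro exI[of _ "max N N'"]) (auto intro: hg_ge_mono)
qed simp

text \<open>The arguments bound the degree from below independently of \<open>n\<close>, while the
  weight grows with \<open>n\<close>; eventually \<open>rho_vanish\<close> applies.\<close>

lemma eventually_rho_Dsh:
  assumes "set as \<subseteq> RR" "\<And>n. F n \<in> hg wz hw_ge (int n)" "\<And>n. F n \<in> hg wdeg hw_ge e"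
  shows "\<forall>\<^sub>F n in sequentially. rho (Dsh (CN (n + 1)) as (F n)) = 0"
proof -
  obtain N where N: "\<forall>a\<in>set as. a \<in> RN N \<and> a \<in> hg wdeg hw_ge (- int N)"
    using RR_bound_list[OF assms(1)] by blast
  define b where "b = e + sum_list (replicate (length as) (- int N)) - int (length as) * 1"
  have "rho (Dsh (CN (n + 1)) as (F n)) = 0" if "n \<ge> nat (- b) + 1" for n
  proof (rule rho_vanish)
    show "Dsh (CN (n + 1)) as (F n) \<in> hg wz hw_ge (int n)"
      by (intro Dsh_wz CN_subset assms(2))
    show "Dsh (CN (n + 1)) as (F n) \<in> hg wdeg hw_ge b"
      unfolding b_def using N
      by (intro Dsh_hg[OF shifts_ge] CN_q assms(3)) (auto simp: list_all2_conv_all_nth)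
    show "int n + b > 0" using that by linarith
  qed
  then show ?thesis unfolding eventually_sequentially by blast
qed

lemma Dsh_cst_linear:
  assumes c: "c = cst (kconst s)"
  shows "Dsh B (xs @ (c * a + b) # ys) F = c * Dsh B (xs @ a # ys) F + Dsh B (xs @ b # ys) F"
proof -
  have e: "epsp r (c * x) = c * epsp r x" for r x by (simp add: epsp_def eps_mult c)
  have r: "rd i (c * x) = c * rd i x" for i x by (cases i) (simp_all add: rd_mult c rd_cst)
  have d: "dx i (c * x) = c * dx i x" for i x by (simp add: dx_mult c epsp_def)
  have D1: "DD B (c * x) G = c * DD B x G" for x G by (simp add: DD_def r sum_distrib_left mult.assoc)
  have D2: "DD B x (c * G) = c * DD B x G" for x G
  proof -
    have "rd i x * (c * dx i G) = c * (rd i x * dx i G)" for i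
      by (simp only: c mult.assoc[symmetric] cst_central[of "rd i x" "kconst s"])
    then show ?thesis by (simp add: DD_def d sum_distrib_left)
  qed
  show ?thesis
    by (induction xs) (simp_all add: e D1 D2 epsp_add DD_add_left DD_add_right)
qed

text \<open>The derivations supercommute in shifted degrees. At two neighbouring positions exactly
  one argument is twisted by the involution, and this turns that symmetry into graded
  antisymmetry.\<close>

lemma Dsh_swap:
  assumes "a \<in> RR" "b \<in> RR" "hom p' a" "hom q' b"
  shows "Dsh B (xs @ a # b # ys) F = sg (\<not> (p' \<and> q')) (Dsh B (xs @ b # a # ys) F)"
proof (induction xs)
  case Nil
  let ?r = "odd (length ys + 1)" and ?G = "Dsh B ys F"
  have r: "odd (length (z # ys) + 1) = (\<not> ?r)" for z :: "('n, 'k) mpoly sp" by simp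
  have "DD B a (DD B b ?G) = sg (\<not> p' \<and> \<not> q') (DD B b (DD B a ?G))"
    by (rule DD_commute[OF assms(3,4) RR_dx_rd[OF assms(1)] RR_dx_rd[OF assms(2)]])
  then show ?case
    unfolding append_Nil Dsh.simps r epsp_hom[OF assms(3)] epsp_hom[OF assms(4)] DD_sg_left DD_sg_right sg_simps(4)
    by (cases ?r; cases p'; cases q') simp_all
next
  case (Cons x xs)
  then show ?case by (simp add: DD_sg_right)
qed

lemma Dsh_base_mult:
  assumes "hom p' a" "hom q' b"
  shows "Dsh B (a * b # ys) F = epsp (odd (length ys + 1)) a * Dsh B (b # ys) F
    + sg (p' \<and> q') (epsp (odd (length ys + 1)) b * Dsh B (a # ys) F)"
  using DD_base_mult[OF hom_epsp[OF assms(1)] hom_epsp[OF assms(2)]] by (simp add: epsp_mult)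

lemma DD_DD_Pi0:
  assumes "a \<in> RR" "b \<in> RR"
  shows "DD (CN N) a (DD (CN N) b Pi0)
    = - (\<Sum>j\<in>UNIV. \<Sum>l\<in>UNIV. rd (Inl l) a * (ep (rd (Inl j) b) * cst (Pij j l)))"
proof -
  have Inl: "Inl j \<in> C" "Inl j \<in> CN N" for j by (simp_all add: C_def CN_def cdeg_def)
  have "DD (CN N) b Pi0 = (\<Sum>c\<in>range Inl. rd c b * dx c Pi0)"
    unfolding DD_def using finite_CN Inl
    by (intro sum.mono_neutral_right) (auto simp: CN_def C_def dx_Pi0(2))
  also have "\<dots> = (\<Sum>j\<in>UNIV. \<Sum>l\<in>UNIV. - (rd (Inl j) b * (cst (Pij j l) * xv (Inl l))))"
    by (simp add: sum.reindex dx_Pi0(1) sum_distrib_left sum_negf)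
  finally have b: "DD (CN N) b Pi0 = \<dots>" .
  have "DD (CN N) a (rd (Inl j) b * (cst (Pij j l) * xv (Inl l))) = rd (Inl l) a * (ep (rd (Inl j) b) * cst (Pij j l))" for j l
  proof -
    have "dx c (rd (Inl j) b * (cst (Pij j l) * xv (Inl l)))
      = (if c = Inl l then ep (rd (Inl j) b) * cst (Pij j l) else 0)" if "c \<in> CN N" for c
      using dx_xv[OF Inl(1) CN_C[OF that], of l] RR_dx_rd[OF assms(2)]
      by (auto simp: dx_mult cpar_def cdeg_def epsp_def)
    then have "DD (CN N) a (rd (Inl j) b * (cst (Pij j l) * xv (Inl l)))
      = (\<Sum>c\<in>CN N. if c = Inl l then rd (Inl l) a * (ep (rd (Inl j) b) * cst (Pij j l)) else 0)"
      unfolding DD_def by (intro sum.cong) auto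
    then show ?thesis using Inl(2) by (simp add: finite_CN)
  qed
  then show ?thesis unfolding b by (simp add: DD_sum_right DD_minus_right sum_negf)
qed

lemma RR_wc: "a \<in> RR \<Longrightarrow> F \<in> hg wc hw_eq e \<Longrightarrow> DD (CN N) a F \<in> hg wc hw_eq (e - 1)"
  using DD_hg[OF shifts_eq, of a wc 0 F e "CN N" 1] CN_q(2) unfolding RR_def by auto

lemma RR_wc_ge: "a \<in> RR \<Longrightarrow> F \<in> hg wc hw_ge e \<Longrightarrow> DD (CN N) a F \<in> hg wc hw_ge (e - 1)"
  using DD_hg[OF shifts_ge, of a wc 0 F e "CN N" 1] CN_q(2) hg_eq_ge[of a wc 0] unfolding RR_def by auto

lemma RR_epsp: "a \<in> RR \<Longrightarrow> epsp b a \<in> RR"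
  by (simp add: epsp_def RR_ep)

lemma Dsh_wc:
  assumes "set as \<subseteq> RR" "F \<in> hg wc hw_eq e"
  shows "Dsh (CN N) as F \<in> hg wc hw_eq (e - int (length as))"
  using assms(1)
proof (induction as)
  case (Cons a as)
  then show ?case using RR_wc[OF RR_epsp[of a] Cons.IH] by (simp add: algebra_simps)
qed (simp add: assms(2))

end

section \<open>The brackets as stable values of the finite stages\<close>

locale maurer_cartan = weighted_resolvent P k f J \<delta> w wv p
  for P :: "('n::finite, 'k::field_char_0) mpoly \<Rightarrow> ('n, 'k) mpoly \<Rightarrow> ('n, 'k) mpoly"
    and k f J \<delta> w wv p +
  fixes \<theta> :: "nat \<Rightarrow> ('n, 'k) mpoly sp"
  assumes \<theta>_0: "\<theta> 0 = Pi0" and \<theta>_TT: "\<theta> n \<in> TT" and \<theta>_W: "GC \<Longrightarrow> \<theta> n \<in> W (- p)"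
    and KK_\<theta>: "KK n (\<theta> n) \<in> hg wz hw_ge (int n)"
    and \<theta>_step: "\<theta> (Suc n) - \<theta> n \<in> TT" "\<theta> (Suc n) - \<theta> n \<in> hg wz hw_ge (int n + 1)"
begin

abbreviation Hn :: "nat \<Rightarrow> ('n, 'k) mpoly sp" where "Hn n \<equiv> Ham n (\<theta> n)"

definition T :: "nat \<Rightarrow> ('n, 'k) mpoly sp list \<Rightarrow> ('n, 'k) mpoly sp" where
  "T n as = rho (Dsh (CN (n + 1)) as (Hn n))"

text \<open>On given arguments \<open>T n\<close> is eventually constant in \<open>n\<close>; \<open>br\<close> is its eventual value.\<close>

definition br :: "('n, 'k) mpoly sp list \<Rightarrow> ('n, 'k) mpoly sp" where
  "br as = (THE v. \<forall>\<^sub>F n in sequentially. T n as = v)"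

lemma Hn_hg: "Hn n \<in> hg wdeg hw_eq 2" "GC \<Longrightarrow> Hn n \<in> W (- p)" "Hn n \<in> hg wc hw_ge 1"
  using \<theta>_TT[of n] \<theta>_W[of n] dpart_hg[of "n + 1"] hg_ge_mono[of "\<theta> n" wc 2 1] hg_eq_ge[OF dpart_hg(1)[of "n + 1"]]
  unfolding Ham_def TT_def by (auto intro: gr_eq.hg_add pw.hg_add gr_ge.hg_add)

lemma Hn_step: "Hn (Suc n) - Hn n \<in> hg wz hw_ge (int n)" "Hn (Suc n) - Hn n \<in> hg wdeg hw_eq 2"
proof -
  show "Hn (Suc n) - Hn n \<in> hg wdeg hw_eq 2" by (intro gr_eq.hg_diff Hn_hg)
  have "Hn (Suc n) - Hn n = (\<theta> (Suc n) - \<theta> n) - (\<Sum>c\<in>CN (n + 2) - CN (n + 1). dl c * xv c)"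
  proof -
    have "(\<Sum>c\<in>CN (n + 2). dl c * xv c) = (\<Sum>c\<in>CN (n + 2) - CN (n + 1). dl c * xv c) + (\<Sum>c\<in>CN (n + 1). dl c * xv c)"
      by (intro sum.subset_diff CN_mono finite_CN) simp
    then show ?thesis by (simp add: Ham_def dpart_def)
  qed
  moreover have "dl c * xv c \<in> hg wz hw_ge (int n)" if "c \<in> CN (n + 2) - CN (n + 1)" for c
  proof -
    have "c \<in> C" "int (cdeg c) - 1 \<ge> int n" using that by (auto simp: CN_def)
    then show ?thesis using hg_eq_ge[OF dl_xv(3)] hg_ge_mono by blast
  qed
  moreover have "\<theta> (Suc n) - \<theta> n \<in> hg wz hw_ge (int n)"
    using \<theta>_step(2)[of n] by (rule hg_ge_mono) simp
  ultimately show "Hn (Suc n) - Hn n \<in> hg wz hw_ge (int n)"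
    by (simp only: gr_ge.hg_diff gr_ge.hg_sum)
qed

text \<open>Two things change with the stage: the set of coordinates, which is irrelevant once it
  covers the arguments, and the Hamiltonian, whose increment has growing weight but fixed
  degree.\<close>

lemma T_eventually_const:
  assumes "set as \<subseteq> RR"
  shows "\<exists>v. \<forall>\<^sub>F n in sequentially. T n as = v"
proof -
  obtain N where N: "\<forall>a\<in>set as. a \<in> RN N" using RR_bound_list[OF assms] by blast
  have "\<forall>\<^sub>F n in sequentially. rho (Dsh (CN (n + 1)) as (Hn (Suc n) - Hn n)) = 0"
    using assms Hn_step(1) hg_eq_ge[OF Hn_step(2)] by (rule eventually_rho_Dsh)
  then obtain n0 where n0: "\<And>n. n \<ge> n0 \<Longrightarrow> rho (Dsh (CN (n + 1)) as (Hn (Suc n) - Hn n)) = 0"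
    unfolding eventually_sequentially by blast
  have step: "T (Suc n) as = T n as" if "n \<ge> max n0 N" for n
  proof -
    have "Dsh (CN (Suc n + 1)) as F = Dsh (CN (n + 1)) as F" for F
      using Dsh_RN[OF N, of "Suc n + 1" F] Dsh_RN[OF N, of "n + 1" F] that by simp
    then show ?thesis
      using n0[of n] that unfolding T_def by (simp add: Dsh_diff rho_diff)
  qed
  have "T n as = T (max n0 N) as" if "n \<ge> max n0 N" for n
    using that by (induction n rule: dec_induct) (simp_all add: step)
  then show ?thesis unfolding eventually_sequentially by blast
qed

lemma brI: "\<forall>\<^sub>F n in sequentially. T n as = v \<Longrightarrow> br as = v"
  unfolding br_def
proof (rule the_equality)
  fix u assume "\<forall>\<^sub>F n in sequentially. T n as = v" "\<forall>\<^sub>F n in sequentially. T n as = u"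
  then have "\<forall>\<^sub>F n in sequentially. v = u" by eventually_elim simp
  then show "u = v" by simp
qed

lemma T_br: "set as \<subseteq> RR \<Longrightarrow> \<forall>\<^sub>F n in sequentially. T n as = br as"
  using T_eventually_const brI by metis

lemma br_mem:
  assumes "set as \<subseteq> RR" "\<And>n. T n as \<in> X"
  shows "br as \<in> X"
proof -
  have "\<forall>\<^sub>F n in sequentially. br as \<in> X"
    using T_br[OF assms(1)] by eventually_elim (use assms(2) in metis)
  then show ?thesis by simp
qed

lemma br_RR: "set as \<subseteq> RR \<Longrightarrow> br as \<in> RR"
  by (rule br_mem) (simp_all add: T_def RR_rho)

lemma br_linear:
  assumes "set xs \<subseteq> RR" "set ys \<subseteq> RR" "a \<in> RR" "b \<in> RR"
  shows "br (xs @ (cst (kconst s) * a + b) # ys) = cst (kconst s) * br (xs @ a # ys) + br (xs @ b # ys)"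
proof (rule brI)
  have "\<forall>\<^sub>F n in sequentially. T n (xs @ a # ys) = br (xs @ a # ys)"
    "\<forall>\<^sub>F n in sequentially. T n (xs @ b # ys) = br (xs @ b # ys)"
    using assms by (auto intro!: T_br)
  then show "\<forall>\<^sub>F n in sequentially. T n (xs @ (cst (kconst s) * a + b) # ys)
    = cst (kconst s) * br (xs @ a # ys) + br (xs @ b # ys)"
    by eventually_elim (simp only: T_def Dsh_cst_linear[OF refl] rho_add rho_mult rho_RR[OF RR_cst])
qed

lemma br_deg:
  assumes "set as \<subseteq> RR" "list_all2 (\<lambda>d a. a \<in> hg wdeg hw_eq d) ds as"
  shows "br as \<in> hg wdeg hw_eq (sum_list ds + 2 - int (length as))"
proof (rule br_mem[OF assms(1)])
  fix n
  have "Dsh (CN (n + 1)) as (Hn n) \<in> hg wdeg hw_eq (2 + sum_list ds - int (length as) * 1)"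
    by (intro Dsh_hg[OF shifts_eq] CN_q assms(2) Hn_hg)
  then show "T n as \<in> hg wdeg hw_eq (sum_list ds + 2 - int (length as))"
    unfolding T_def by (intro rho_hg gr_eq.ring_grading_axioms) (simp add: algebra_simps)
qed

lemma br_weight:
  assumes GC "set as \<subseteq> RR" "list_all2 (\<lambda>d a. a \<in> W d) ds as"
  shows "br as \<in> W (sum_list ds + (int (length as) - 1) * p)"
proof (rule br_mem[OF assms(2)])
  fix n
  have "Dsh (CN (n + 1)) as (Hn n) \<in> W (- p + sum_list ds - int (length as) * (- p))"
    by (intro Dsh_hg[OF shifts_W] CN_q assms Hn_hg)
  then show "T n as \<in> W (sum_list ds + (int (length as) - 1) * p)"
    unfolding T_def by (intro rho_hg poly_weight_grading) (simp add: algebra_simps)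
qed

lemma br_swap:
  assumes "set xs \<subseteq> RR" "set ys \<subseteq> RR" "a \<in> RR" "b \<in> RR" "hom p' a" "hom q' b"
  shows "br (xs @ a # b # ys) = sg (\<not> (p' \<and> q')) (br (xs @ b # a # ys))"
proof (rule brI)
  have "\<forall>\<^sub>F n in sequentially. T n (xs @ b # a # ys) = br (xs @ b # a # ys)"
    using assms by (intro T_br) auto
  then show "\<forall>\<^sub>F n in sequentially. T n (xs @ a # b # ys) = sg (\<not> (p' \<and> q')) (br (xs @ b # a # ys))"
    by eventually_elim (simp only: T_def Dsh_swap[OF assms(3-6)] rho_sg)
qed

lemma br_mult:
  assumes "set ys \<subseteq> RR" "a \<in> RR" "b \<in> RR" "hom p' a" "hom q' b"
  shows "br (a * b # ys) = epsp (odd (length ys + 1)) a * br (b # ys)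
    + sg (p' \<and> q') (epsp (odd (length ys + 1)) b * br (a # ys))"
proof (rule brI)
  have "\<forall>\<^sub>F n in sequentially. T n (a # ys) = br (a # ys)" "\<forall>\<^sub>F n in sequentially. T n (b # ys) = br (b # ys)"
    using assms by (auto intro!: T_br)
  then show "\<forall>\<^sub>F n in sequentially. T n (a * b # ys) = epsp (odd (length ys + 1)) a * br (b # ys)
    + sg (p' \<and> q') (epsp (odd (length ys + 1)) b * br (a # ys))"
    by eventually_elim
      (simp only: T_def Dsh_base_mult[OF assms(4,5)] rho_add rho_sg rho_mult rho_RR[OF RR_epsp[OF assms(2)]]
        rho_RR[OF RR_epsp[OF assms(3)]])
qed

text \<open>The twist of a single argument is \<open>ep\<close>, which undoes the involution in
  \<open>dp\<close>. The corrections keep at least one momentum and are removed by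
  \<open>rho\<close>.\<close>

lemma br_single:
  assumes "a \<in> RR"
  shows "br [a] = D0 a"
proof (rule brI)
  obtain N where N: "a \<in> RN N" using RR_bound[OF assms] by blast
  have "T n [a] = D0 a" if "n \<ge> N" for n
  proof -
    have "ep a \<in> RN (n + 1)"
    proof -
      have "mons (ep a) \<subseteq> mons a" by (auto simp: mons_iff coef_ep)
      moreover have "a \<in> RN (n + 1)" using N RN_mono[of N "n + 1"] that by auto
      ultimately show ?thesis by (auto simp: RN_def)
    qed
    then have "dp (n + 1) (ep a) = D0 a" by (simp add: dp_eq)
    moreover have "DD (CN (n + 1)) (ep a) (\<theta> n) \<in> hg wc hw_ge (2 - 1)"
      using \<theta>_TT by (intro RR_wc_ge RR_ep assms) (simp add: TT_def)
    then have "rho (DD (CN (n + 1)) (ep a) (\<theta> n)) = 0" by (simp add: rho_eq_0)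
    ultimately show ?thesis
      by (simp add: T_def DD_Ham[simplified] rho_add rho_RR D0_RR assms)
  qed
  then show "\<forall>\<^sub>F n in sequentially. T n [a] = D0 a" unfolding eventually_sequentially by blast
qed

text \<open>Each argument removes one momentum, and the terms of \<open>dpart\<close> have only
  one.\<close>

lemma T_theta:
  assumes "set as \<subseteq> RR" "length as \<ge> 2"
  shows "T n as = rho (Dsh (CN (n + 1)) as (\<theta> n))"
proof -
  have "Dsh (CN (n + 1)) as (dpart (n + 1)) = 0"
    using Dsh_wc[OF assms(1) dpart_hg(1)] assms(2) by (intro hg_wc_neg) auto
  then show ?thesis by (simp add: T_def Ham_def Dsh_add)
qed

lemma theta_Pi0: "\<theta> n - Pi0 \<in> hg wz hw_ge 1"
proof (induction n)
  case (Suc n)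
  have "\<theta> (Suc n) - \<theta> n \<in> hg wz hw_ge 1" using \<theta>_step(2) by (rule hg_ge_mono) simp
  from gr_ge.hg_add[OF this Suc] show ?case by simp
qed (simp add: \<theta>_0 gr_ge.hg_0)

text \<open>The corrections to \<open>Pi0\<close> have positive weight and brackets do not lower it,
  so the constant term sees \<open>Pi0\<close> only. Compatibility with the quotient thus holds
  already in \<open>S\<close>, before passing to cosets.\<close>

lemma coef_T:
  assumes "set as \<subseteq> RR" "length as \<ge> 2"
  shows "coef (T n as) 0 = coef (Dsh (CN (n + 1)) as Pi0) 0"
proof -
  have "Dsh (CN (n + 1)) as (\<theta> n - Pi0) \<in> hg wz hw_ge 1"
    by (intro Dsh_wz CN_subset theta_Pi0)
  then have "0 \<notin> mons (Dsh (CN (n + 1)) as (\<theta> n - Pi0))" by (fastforce simp: hg_ge_iff)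
  then show ?thesis
    unfolding T_theta[OF assms] by (simp add: mons_iff Dsh_diff rho_def coef_restr)
qed

lemma Dsh_Pi0_0: "set as \<subseteq> RR \<Longrightarrow> length as \<ge> 3 \<Longrightarrow> Dsh (CN N) as Pi0 = 0"
  using Dsh_wc[OF _ Pi0_hg(1)] by (intro hg_wc_neg) auto

lemma coef_br_ge3:
  assumes "set as \<subseteq> RR" "length as \<ge> 3"
  shows "coef (br as) 0 = 0"
  using br_mem[OF assms(1), of "{x. coef x 0 = 0}"] coef_T[OF assms(1)] Dsh_Pi0_0[OF assms] assms(2) by simp

lemma neg_Pij: "- (x * (y * Pij j l)) = x * y * Pij l j"
  by (subst P_skew) (simp add: mult.assoc)

lemma coef_br_2:
  assumes "a \<in> RR" "b \<in> RR"
  shows "coef (br [a, b]) 0 = P (coef a 0) (coef b 0)"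
proof -
  have "coef (T n [a, b]) 0 = P (coef a 0) (coef b 0)" for n
  proof -
    have rd: "coef (rd (Inl j) x) 0 = pd j (coef x 0)" for j x
      by (simp add: rd_def dz_def cpar_def cdeg_def coef_dcoef[OF pd_derivation])
    have "coef (T n [a, b]) 0 = coef (DD (CN (n + 1)) a (DD (CN (n + 1)) (ep b) Pi0)) 0"
      using coef_T[of "[a, b]" n] assms by simp
    also have "\<dots> = - (\<Sum>j\<in>UNIV. \<Sum>l\<in>UNIV. pd l (coef a 0) * (pd j (coef b 0) * Pij j l))"
      by (simp add: DD_DD_Pi0[OF assms(1) RR_ep[OF assms(2)]] coef_sum coef_mult_0 rd)
    also have "\<dots> = (\<Sum>j\<in>UNIV. \<Sum>l\<in>UNIV. pd l (coef a 0) * pd j (coef b 0) * Pij l j)"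
      by (simp only: sum_negf[symmetric] neg_Pij)
    also have "\<dots> = P (coef a 0) (coef b 0)"
      by (subst sum.swap) (simp add: P_expand[of "coef a 0"])
    finally show ?thesis .
  qed
  then have "br [a, b] \<in> {x. coef x 0 = P (coef a 0) (coef b 0)}"
    by (intro br_mem CollectI) (simp_all add: assms)
  then show ?thesis by (rule CollectD)
qed

subsection \<open>The trivial case\<close>

lemma br_trivial_ge3:
  assumes "\<And>n. \<theta> n = Pi0" "set as \<subseteq> RR" "length as \<ge> 3"
  shows "br as = 0"
  using br_mem[OF assms(2), of "{0}"] T_theta[OF assms(2)] Dsh_Pi0_0[OF assms(2,3)] assms(1,3) by simp

lemma br_trivial_2:
  assumes "\<And>n. \<theta> n = Pi0" "a \<in> RR" "b \<in> RR"
  shows "br [a, b] = - (\<Sum>j\<in>UNIV. \<Sum>l\<in>UNIV. rd (Inl l) a * (ep (rd (Inl j) (ep b)) * cst (Pij j l)))"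
proof -
  define v where "v = - (\<Sum>j\<in>UNIV. \<Sum>l\<in>UNIV. rd (Inl l) a * (ep (rd (Inl j) (ep b)) * cst (Pij j l)))"
  have Inl: "Inl j \<in> C" for j by (simp add: C_def)
  have "v \<in> RR"
    unfolding v_def using assms(2,3) by (intro RR_minus RR_sum RR_mult RR_rd RR_ep RR_cst Inl)
  then have "T n [a, b] = v" for n
    using T_theta[of "[a, b]" n] assms DD_DD_Pi0[OF assms(2) RR_ep[OF assms(3)], folded v_def]
    by (simp add: rho_RR)
  then have "br [a, b] \<in> {v}" using assms(2,3) by (intro br_mem) auto
  then show ?thesis by (simp add: v_def)
qed

lemma br_trivial_cst:
  assumes "\<And>n. \<theta> n = Pi0"
  shows "br [cst s, cst t] = cst (P s t)"
proof -
  have "br [cst s, cst t] = - cst (\<Sum>j\<in>UNIV. \<Sum>l\<in>UNIV. pd l s * (pd j t * Pij j l))"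
    using br_trivial_2[OF assms RR_cst RR_cst] by (simp add: rd_cst cst_sum cst_mult)
  also have "\<dots> = cst (\<Sum>j\<in>UNIV. \<Sum>l\<in>UNIV. pd l s * pd j t * Pij l j)"
    by (simp only: cst_minus[symmetric] sum_negf[symmetric] neg_Pij)
  also have "\<dots> = cst (P s t)"
    by (subst sum.swap) (simp add: P_expand[of s])
  finally show ?thesis .
qed

lemma br_trivial_vr:
  assumes "\<And>n. \<theta> n = Pi0" "a \<in> RR" "v \<in> V"
  shows "br [vr v, a] = 0" "br [a, vr v] = 0"
  using br_trivial_2[OF assms(1) RR_vr[OF assms(3)] assms(2)] br_trivial_2[OF assms(1,2) RR_vr[OF assms(3)]]
  by (simp_all add: rd_vr ep_vr rd_sg)

subsection \<open>The Jacobi identities\<close>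

text \<open>Finitely many brackets occur, so at one late stage all of them have their final values
  and the obstruction no longer contributes. There the identity is \<open>derived_jacobi\<close> up
  to signs.\<close>

lemma br_jacobi:
  assumes as: "set as \<subseteq> RR" "list_all2 (\<lambda>d a. a \<in> hg wdeg hw_eq d) ds as"
  shows "(\<Sum>A\<in>Pow {..<length as} - {{}}.
    sg (odd (ksum (\<lambda>b a. ds ! a * ds ! b + 1) (length as) A + int (length (nths as A) * length (nths as (- A)))))
      (br (br (nths as A) # nths as (- A)))) = 0"
proof -
  have sub: "set (nths as A) \<subseteq> RR" for A by (rule subset_trans[OF set_nths_subset as(1)])
  have homs: "homs ds as"
    using as(2) as(1) unfolding homs_def
    by (induction rule: list_all2_induct) (auto intro: hom_wdeg)
  have len: "length ds = length as" using homs by (rule homs_length)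
  \<comment> \<open>The inner brackets must also have stabilised, because they appear as arguments
    of the outer ones.\<close>
  have "\<forall>\<^sub>F n in sequentially. (\<forall>A\<in>Pow {..<length as}. T n (nths as A) = br (nths as A) \<and>
      T n (br (nths as A) # nths as (- A)) = br (br (nths as A) # nths as (- A)))
    \<and> rho (Dsh (CN (n + 1)) as (KK n (\<theta> n))) = 0"
  proof (intro eventually_conj eventually_ball_finite ballI T_br)
    show "\<forall>\<^sub>F n in sequentially. rho (Dsh (CN (n + 1)) as (KK n (\<theta> n))) = 0"
      using as(1) KK_\<theta> hg_eq_ge[OF KK_hg(2)[OF \<theta>_TT]] by (rule eventually_rho_Dsh)
  qed (simp_all add: sub br_RR[OF sub])
  then obtain n where n: "\<And>A. A \<in> Pow {..<length as} \<Longrightarrow> T n (nths as A) = br (nths as A)"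
      "\<And>A. A \<in> Pow {..<length as} \<Longrightarrow> T n (br (nths as A) # nths as (- A)) = br (br (nths as A) # nths as (- A))"
      "rho (Dsh (CN (n + 1)) as (KK n (\<theta> n))) = 0"
    unfolding eventually_sequentially by blast
  let ?B = "CN (n + 1)" and ?H = "Hn n"
  define t where "t A = rho (DD ?B (rho (Dseq ?B (nths as A) ?H)) (Dseq ?B (nths as (- A)) ?H))" for A
  \<comment> \<open>The discrepancy between the two sign conventions, the same for every
    \<open>A\<close>, so it can be taken out of the sum.\<close>
  define c where "c = shsum ds + shift_exp ds"
  have "rho (Dseq ?B as (DD ?B ?H ?H)) = 0"
    using n(3) unfolding Dsh_Dseq[OF homs] KK_def rho_sg by (cases "odd (shift_exp ds)") simp_all
  then have jac: "(\<Sum>A\<in>Pow {..<length as} - {{}}. sg (odd (kap ds A + shsum (nths ds (- A)))) (t A)) = 0"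
    unfolding t_def by (rule derived_jacobi[OF homs Ham_hom[OF \<theta>_TT] rho_eq_0[OF Hn_hg(3)] CN_subset])
  have "sg (odd (ksum (\<lambda>b a. ds ! a * ds ! b + 1) (length as) A + int (length (nths as A) * length (nths as (- A)))))
      (br (br (nths as A) # nths as (- A))) = sg (odd c) (sg (odd (kap ds A + shsum (nths ds (- A)))) (t A))"
    if A: "A \<in> Pow {..<length as}" for A
  proof -
    let ?xs = "nths as A" and ?ys = "nths as (- A)" and ?dA = "nths ds A" and ?dB = "nths ds (- A)"
    define e where "e = sum_list ?dA + 2 - int (length ?xs)"
    have lA: "length ?dA = length ?xs" and lB: "length ?dB = length ?ys"
      using homs_length[OF homs_nths[OF homs]] by auto
    have y: "br ?xs = sg (odd (shift_exp ?dA)) (rho (Dseq ?B ?xs ?H))"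
      using n(1)[OF A] by (simp add: T_def Dsh_Dseq[OF homs_nths[OF homs]] rho_sg)
    have "br ?xs \<in> hg wdeg hw_eq e"
      unfolding e_def by (intro br_deg sub list_all2_nths as(2))
    then have he: "homs (e # ?dB) (br ?xs # ?ys)"
      using homs_nths[OF homs] br_RR[OF sub] by (simp add: hom_wdeg)
    have "br (br ?xs # ?ys) = sg (odd (shift_exp (e # ?dB))) (rho (DD ?B (br ?xs) (Dseq ?B ?ys ?H)))"
      unfolding n(2)[OF A, symmetric] T_def Dsh_Dseq[OF he] rho_sg Dseq_simps ..
    also have "\<dots> = sg (odd (shift_exp (e # ?dB)) \<noteq> odd (shift_exp ?dA)) (t A)"
      unfolding y t_def DD_sg_left rho_sg sg_simps(4) by (rule arg_cong2[of _ _ _ _ sg]) auto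
    finally have z: "br (br ?xs # ?ys) = \<dots>" .
    define a b q m' where "a = shift_exp ?dA" and "b = shift_exp ?dB" and "q = int (length ?xs)" and "m' = int (length ?ys)"
    define s where "s = sum_list ?dA"
    have sh: "shsum ds = s + q + shsum ?dB"
    proof -
      have "shsum ds = (\<Sum>i\<in>{..<length ds}. ds ! i + 1)" using shsum_nths[of ds UNIV] nths_all[of ds UNIV] by simp
      also have "\<dots> = (\<Sum>i\<in>{..<length ds} \<inter> A. ds ! i + 1) + (\<Sum>i\<in>{..<length ds} \<inter> - A. ds ! i + 1)"
        by (subst sum.union_disjoint[symmetric]) (auto intro!: sum.cong)
      also have "\<dots> = shsum ?dA + shsum ?dB" by (simp add: shsum_nths)
      finally show ?thesis by (simp add: shsum_def s_def q_def lA)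
    qed
    define K where "K g = ksum g (length ds) A" for g
    have add: "K g + K h = K (\<lambda>b a. g b a + h b a)" for g h
      by (simp add: K_def ksum_def sum.distrib case_prod_unfold)
    have "even (K (\<lambda>b a. ds ! a * ds ! b + 1) + K (\<lambda>b a. (ds ! a + 1) * (ds ! b + 1)) + K (\<lambda>b a. ds ! a + ds ! b))"
      unfolding add unfolding K_def ksum_def by (intro dvd_sum) auto
    moreover have "even (K (\<lambda>b a. ds ! a + ds ! b) + shift_exp ds + a + b + m' * s)"
      using shift_identity[of ds A] by (simp add: K_def a_def b_def m'_def s_def lB)
    \<comment> \<open>Modulo 2 the exponent \<open>x * y + 1\<close> equals
      \<open>(x + 1) * (y + 1) + (x + y)\<close>. The first summand gives \<open>kap\<close>, and
      the second is evaluated by \<open>shift_identity\<close>.\<close>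
    ultimately have ev: "even (K (\<lambda>b a. ds ! a * ds ! b + 1) + kap ds A + shift_exp ds + a + b + m' * s)"
      unfolding kap_def K_def[symmetric] by presburger
    have "((odd (K (\<lambda>b a. ds ! a * ds ! b + 1) + q * m')) \<noteq> (odd ((m' + 1) * (s + 2 - q) + b) \<noteq> odd a)) = 
      (odd (s + q + shsum ?dB + shift_exp ds) \<noteq> odd (kap ds A + shsum ?dB))"
      using ev by simp argo
    then show ?thesis
      unfolding z sg_simps(4) c_def sh K_def s_def[symmetric] q_def m'_def e_def a_def b_def len lB shift_exp.simps
      by (simp only: of_nat_mult)
  qed
  then have "(\<Sum>A\<in>Pow {..<length as} - {{}}.
    sg (odd (ksum (\<lambda>b a. ds ! a * ds ! b + 1) (length as) A + int (length (nths as A) * length (nths as (- A)))))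
      (br (br (nths as A) # nths as (- A))))
    = sg (odd c) (\<Sum>A\<in>Pow {..<length as} - {{}}. sg (odd (kap ds A + shsum (nths ds (- A)))) (t A))"
    unfolding sg_sum by (intro sum.cong) auto
  then show ?thesis unfolding jac by simp
qed

end

subsection \<open>The graded space of super polynomials\<close>

lemma lookup_gpoly_scale: "Poly_Mapping.lookup (gpoly_scale c a) M = kconst c * Poly_Mapping.lookup a M"
  unfolding gpoly_scale_def by (simp add: Poly_Mapping.map.rep_eq pscale_eq when_def)

lemma vector_space_gpoly_scale: "vector_space (gpoly_scale :: 'k::field \<Rightarrow> ('n, 'k) mpoly gpoly \<Rightarrow> _)"
  by (unfold_locales; rule poly_mapping_eqI)
    (simp_all add: lookup_gpoly_scale lookup_add kconst_add kconst_mult kconst_1 distrib_left distrib_right mult.assoc)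

lemma keys_gpoly_scale: "Poly_Mapping.keys (gpoly_scale c a) \<subseteq> Poly_Mapping.keys a"
  by (auto simp: in_keys_iff lookup_gpoly_scale)

lemma graded_space_gpoly:
  "graded_space gpoly_scale (gpoly_carrier V) (gpoly_gr V :: int \<Rightarrow> ('n, 'k::field) mpoly gpoly set)"
proof -
  interpret vector_space "gpoly_scale :: 'k \<Rightarrow> ('n, 'k) mpoly gpoly \<Rightarrow> _" by (rule vector_space_gpoly_scale)
  have carrier: "subspace (gpoly_carrier V)"
  proof (intro subspaceI carrier_add)
    show "gpoly_scale c x \<in> gpoly_carrier V" if "x \<in> gpoly_carrier V" for c and x :: "('n, 'k) mpoly gpoly"
      using that keys_gpoly_scale[of c x] unfolding in_gpoly_carrier_iff by blast
  qed (simp_all add: in_gpoly_carrier_iff)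
  have gr: "subspace (gpoly_gr V d)" for d
  proof (intro subspaceI)
    show "x + y \<in> gpoly_gr V d" if "x \<in> gpoly_gr V d" "y \<in> gpoly_gr V d" for x y :: "('n, 'k) mpoly gpoly"
      using that Poly_Mapping.keys_add[of x y] subspace_add[OF carrier] unfolding gpoly_gr_def by blast
    show "gpoly_scale c x \<in> gpoly_gr V d" if "x \<in> gpoly_gr V d" for c and x :: "('n, 'k) mpoly gpoly"
      using that keys_gpoly_scale[of c x] subspace_scale[OF carrier] unfolding gpoly_gr_def by blast
  qed (simp add: gpoly_gr_def subspace_0[OF carrier])
  have "\<exists>!c :: int \<Rightarrow> ('n, 'k) mpoly gpoly.
      (\<forall>d. c d \<in> gpoly_gr V d) \<and> finite {d. c d \<noteq> 0} \<and> a = (\<Sum>d | c d \<noteq> 0. c d)"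
    if a: "a \<in> gpoly_carrier V" for a
  proof (rule ex1I)
    define c where "c d = (\<Sum>M\<in>{M\<in>Poly_Mapping.keys a. mon_degree M = d}. Poly_Mapping.single M (Poly_Mapping.lookup a M))" for d
    have c: "Poly_Mapping.lookup (c d) M = (if mon_degree M = d then Poly_Mapping.lookup a M else 0)" for d M
      by (auto simp: c_def lookup_sum lookup_single when_def in_keys_iff)
    have "d \<in> mon_degree ` Poly_Mapping.keys a" if "c d \<noteq> 0" for d
    proof -
      have "Poly_Mapping.keys (c d) \<noteq> {}" using that by simp
      then obtain M where "M \<in> Poly_Mapping.keys (c d)" by blast
      then show ?thesis by (auto simp: c in_keys_iff split: if_splits)
    qed
    then have fin: "finite {d. c d \<noteq> 0}"
      by (intro finite_subset[of "{d. c d \<noteq> 0}" "mon_degree ` Poly_Mapping.keys a"]) auto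
    moreover have "c d \<in> gpoly_gr V d" for d
      using a by (auto simp: gpoly_gr_def in_gpoly_carrier_iff in_keys_iff c split: if_splits)
    moreover have "a = (\<Sum>d | c d \<noteq> 0. c d)"
    proof (rule poly_mapping_eqI)
      fix M
      have "c (mon_degree M) \<noteq> 0" if "Poly_Mapping.lookup a M \<noteq> 0" using that c[of "mon_degree M" M] by auto
      then show "Poly_Mapping.lookup a M = Poly_Mapping.lookup (\<Sum>d | c d \<noteq> 0. c d) M"
        using fin by (auto simp: lookup_sum c)
    qed
    ultimately show "(\<forall>d. c d \<in> gpoly_gr V d) \<and> finite {d. c d \<noteq> 0} \<and> a = (\<Sum>d | c d \<noteq> 0. c d)"
      by blast
    fix c' assume c': "(\<forall>d. c' d \<in> gpoly_gr V d) \<and> finite {d. c' d \<noteq> 0} \<and> a = (\<Sum>d | c' d \<noteq> 0. c' d)"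
    have z: "Poly_Mapping.lookup (c' d) M = 0" if "mon_degree M \<noteq> d" for d M
      using c' that unfolding gpoly_gr_def in_keys_iff[symmetric] by (metis (mono_tags, lifting) in_keys_iff mem_Collect_eq)
    have "Poly_Mapping.lookup a M = Poly_Mapping.lookup (c' (mon_degree M)) M" for M
    proof -
      have "Poly_Mapping.lookup a M = (\<Sum>d | c' d \<noteq> 0. Poly_Mapping.lookup (c' d) M)"
        using c' lookup_sum[of c' "{d. c' d \<noteq> 0}" M] by simp
      also have "\<dots> = (\<Sum>d | c' d \<noteq> 0. if d = mon_degree M then Poly_Mapping.lookup (c' d) M else 0)"
        by (rule sum.cong) (auto simp: z)
      also have "\<dots> = Poly_Mapping.lookup (c' (mon_degree M)) M"
        using c' by simp
      finally show ?thesis .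
    qed
    then show "c' = c"
      by (intro ext poly_mapping_eqI) (auto simp: c z)
  qed
  moreover have "gpoly_gr V d \<subseteq> gpoly_carrier V" for d by (auto simp: gpoly_gr_def)
  ultimately show ?thesis
    unfolding graded_space_def using carrier gr vector_space_axioms by blast
qed

lemma scale_Rep: "gpoly_scale c (Rep_sp x) = Rep_sp (cst (kconst c) * x)"
  by (rule poly_mapping_eqI) (simp add: lookup_gpoly_scale Rep_coef coef_cst_mult)

lemma cst_pm: "cst (kconst (pm n)) * x = sg (odd n) x" for x :: "('n, 'k::comm_ring_1) mpoly sp"
proof -
  have "kconst (- 1) + kconst 1 = (0 :: ('n, 'k) mpoly)" unfolding kconst_add[symmetric] by (simp add: kconst_def)
  then have "kconst (- 1) = - (1 :: ('n, 'k) mpoly)" by (simp add: kconst_1 eq_neg_iff_add_eq_0)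
  then show ?thesis by (simp add: pm_def kconst_1 cst_1 cst_minus)
qed

lemma scale_pm: "gpoly_scale (pm n) (Rep_sp x) = Rep_sp (sg (odd n) x)"
  by (simp add: scale_Rep cst_pm)

lemma Rep_sum: "Rep_sp (sum g A) = (\<Sum>a\<in>A. Rep_sp (g a))"
  by (induction A rule: infinite_finite_induct) (simp_all add: zero_sp.rep_eq plus_sp.rep_eq)

lemma permute_list_adj:
  assumes "Suc i < length xs"
  shows "permute_list (transpose i (Suc i)) xs = take i xs @ xs ! Suc i # xs ! i # drop (Suc (Suc i)) xs"
proof (rule nth_equalityI)
  fix j assume j: "j < length (permute_list (transpose i (Suc i)) xs)"
  have "transpose i (Suc i) permutes {..<length xs}" using assms by (intro permutes_swap_id) auto
  then have l: "permute_list (transpose i (Suc i)) xs ! j = xs ! transpose i (Suc i) j"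
    using j by (simp add: permute_list_nth)
  consider "j < i" | "j = i" | "j = Suc i" | r where "j = i + Suc (Suc r)"
    by (metis less_imp_Suc_add add_Suc_right linorder_neqE_nat not_less_eq)
  then show "permute_list (transpose i (Suc i)) xs ! j = (take i xs @ xs ! Suc i # xs ! i # drop (Suc (Suc i)) xs) ! j"
    unfolding l using assms j by cases (simp_all add: nth_append transpose_def)
qed (use assms in simp)

lemma list_adj: "Suc i < length xs \<Longrightarrow> xs = take i xs @ xs ! i # xs ! Suc i # drop (Suc (Suc i)) xs"
  by (metis Cons_nth_drop_Suc Suc_lessD append_take_drop_id)

section \<open>The P-infinity structure on the resolvent\<close>

context maurer_cartan
begin

definition brG :: "('n, 'k) mpoly gpoly list \<Rightarrow> ('n, 'k) mpoly gpoly" where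
  "brG as = Rep_sp (br (map Abs_sp as))"

abbreviation R where "R \<equiv> gpoly_carrier V :: ('n, 'k) mpoly gpoly set"
abbreviation gr where "gr \<equiv> gpoly_gr V :: int \<Rightarrow> ('n, 'k) mpoly gpoly set"

lemma brG_Rep [simp]: "brG (map Rep_sp xs) = Rep_sp (br xs)"
  by (simp add: brG_def comp_def Rep_sp_inverse)

lemma R_cases:
  assumes "a \<in> R" obtains x where "a = Rep_sp x" "x \<in> RR"
  using assms Rep_Abs_sp[OF assms] RR_Rep by metis

lemma gr_cases:
  assumes "a \<in> gr d" obtains x where "a = Rep_sp x" "x \<in> RR" "x \<in> hg wdeg hw_eq d"
proof -
  have "a \<in> R" using assms by (simp add: gpoly_gr_def)
  then show thesis using assms gr_iff that by (metis R_cases)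
qed

lemma R_list:
  assumes "set as \<subseteq> R" obtains xs where "as = map Rep_sp xs" "set xs \<subseteq> RR"
proof
  show "as = map Rep_sp (map Abs_sp as)"
    using assms by (auto simp: comp_def Rep_Abs_sp intro!: map_idI[symmetric])
  show "set (map Abs_sp as) \<subseteq> RR"
    using assms by (auto simp: RR_Rep Rep_Abs_sp)
qed

lemma gr_list:
  assumes "homogeneous_list gr ds as"
  obtains xs where "as = map Rep_sp xs" "set xs \<subseteq> RR" "list_all2 (\<lambda>d a. a \<in> hg wdeg hw_eq d) ds xs"
proof -
  have "set as \<subseteq> R"
    using assms by (auto simp: homogeneous_list_def list_all2_conv_all_nth in_set_conv_nth gpoly_gr_def)
  then obtain xs where "as = map Rep_sp xs" "set xs \<subseteq> RR" by (rule R_list)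
  moreover from this have "list_all2 (\<lambda>d a. a \<in> hg wdeg hw_eq d) ds xs"
    using assms by (auto simp: homogeneous_list_def list_all2_map2 gr_iff elim: list_all2_mono)
  ultimately show thesis by (rule that)
qed

lemma Rep_R: "Rep_sp x \<in> R \<longleftrightarrow> x \<in> RR"
  by (simp add: RR_Rep)

lemma graded_comm_algebra: "graded_comm_algebra gpoly_scale (\<star>) (gconst 1) R gr"
  unfolding graded_comm_algebra_def
proof (intro conjI allI ballI)
  show "graded_space gpoly_scale R gr" by (rule graded_space_gpoly)
  show "gconst 1 \<in> gr 0"
    unfolding Rep_cst[symmetric] gr_iff by (simp add: RR_cst hg_eq_cst)
  fix d e a b assume "a \<in> gr d" "b \<in> gr e"
  then obtain x y where a: "a = Rep_sp x" "x \<in> RR" "x \<in> hg wdeg hw_eq d"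
    and b: "b = Rep_sp y" "y \<in> RR" "y \<in> hg wdeg hw_eq e" by (metis gr_cases)
  show "a \<star> b \<in> gr (d + e)"
    using a b by (simp add: times_sp.rep_eq[symmetric] gr_iff RR_mult gr_eq.hg_mult)
  have "x * y = sg (odd (d * e)) (y * x)"
    using hom_commute[OF hom_wdeg[OF a(3)] hom_wdeg[OF b(3)]] by simp
  then show "a \<star> b = gpoly_scale ((- 1) powi (d * e)) (b \<star> a)"
    unfolding powi_pm a b times_sp.rep_eq[symmetric] scale_pm by simp
next
  fix a b c s assume "a \<in> R" "b \<in> R" "c \<in> R"
  then obtain x y z where r: "a = Rep_sp x" "b = Rep_sp y" "c = Rep_sp z" by (metis R_cases)
  show "(gpoly_scale s a + b) \<star> c = gpoly_scale s (a \<star> c) + b \<star> c"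
    unfolding r scale_Rep plus_sp.rep_eq[symmetric] times_sp.rep_eq[symmetric] by (simp add: distrib_right mult.assoc)
  have "z * (cst (kconst s) * x) = cst (kconst s) * (z * x)"
    by (simp only: mult.assoc[symmetric] cst_central[of z "kconst s"])
  then show "c \<star> (gpoly_scale s a + b) = gpoly_scale s (c \<star> a) + c \<star> b"
    unfolding r scale_Rep plus_sp.rep_eq[symmetric] times_sp.rep_eq[symmetric] by (simp add: distrib_left)
  show "a \<star> b \<star> c = a \<star> (b \<star> c)"
    unfolding r times_sp.rep_eq[symmetric] by (simp add: mult.assoc)
next
  fix a assume "a \<in> R"
  then obtain x where r: "a = Rep_sp x" by (metis R_cases)
  show "gconst 1 \<star> a = a" "a \<star> gconst 1 = a"
    unfolding r Rep_cst[symmetric] times_sp.rep_eq[symmetric] by (simp_all add: cst_1)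
qed

text \<open>\<open>br_swap\<close> settles adjacent transpositions, and \<open>lsign_comp\<close>
  multiplies the signs along a factorisation. The claim is generalised over the list because the
  induction permutes it.\<close>

lemma br_permute:
  assumes "\<sigma> permutes {..<length xs}" "set xs \<subseteq> RR" "list_all2 (\<lambda>d a. a \<in> hg wdeg hw_eq d) ds xs"
  shows "br xs = cst (kconst (lsign \<sigma> ds)) * br (permute_list \<sigma> xs)"
proof -
  define m where "m = length xs"
  have "\<forall>xs ds. length xs = m \<longrightarrow> set xs \<subseteq> RR \<longrightarrow> list_all2 (\<lambda>d a. a \<in> hg wdeg hw_eq d) ds xs \<longrightarrow>
      br xs = cst (kconst (lsign \<sigma> ds)) * br (permute_list \<sigma> xs)"
    using assms(1) unfolding m_def[symmetric]
  proof (induction rule: perm_adj_induct)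
    case id
    have "lsign id ds = (1 :: 'k)" for ds
      by (simp add: lsign_def koszul_sign_def sign_id) (rule prod.neutral, auto)
    then show ?case by (simp only: permute_list_id kconst_1 cst_1 mult_1_left simp_thms)
  next
    case (swap \<sigma> i)
    show ?case
    proof (intro allI impI)
      fix xs :: "('n, 'k) mpoly sp list" and ds
      assume m: "length xs = m" and xs: "set xs \<subseteq> RR" "list_all2 (\<lambda>d a. a \<in> hg wdeg hw_eq d) ds xs"
      let ?t = "transpose i (Suc i)"
      have len: "length ds = m" using xs(2) m by (simp add: list_all2_lengthD)
      have t: "?t permutes {..<length xs}" "?t permutes {..<length ds}"
        using swap(2) m len by (auto intro!: permutes_swap_id)
      have i: "Suc i < length xs" "i < length xs" using swap(2) m by auto
      have IH: "br (permute_list ?t xs)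
        = cst (kconst (lsign \<sigma> (permute_list ?t ds))) * br (permute_list \<sigma> (permute_list ?t xs))"
        using swap(3) t m xs by (simp add: list_all2_permute_list_iff)
      have "br xs = sg (\<not> (odd (ds ! i) \<and> odd (ds ! Suc i))) (br (permute_list ?t xs))"
        unfolding permute_list_adj[OF i(1)]
      proof (subst (1) list_adj[OF i(1)], rule br_swap)
        show "hom (odd (ds ! i)) (xs ! i)" "hom (odd (ds ! Suc i)) (xs ! Suc i)"
          using xs(2) i by (auto intro!: hom_wdeg simp: list_all2_conv_all_nth)
        show "xs ! i \<in> RR" "xs ! Suc i \<in> RR"
          using subsetD[OF xs(1) nth_mem[OF i(2)]] subsetD[OF xs(1) nth_mem[OF i(1)]] by simp_all
        show "set (take i xs) \<subseteq> RR" "set (drop (Suc (Suc i)) xs) \<subseteq> RR"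
          by (rule subset_trans[OF set_take_subset xs(1)] subset_trans[OF set_drop_subset xs(1)])+
      qed
      also have "(\<not> (odd (ds ! i) \<and> odd (ds ! Suc i))) = odd (ds ! i * ds ! Suc i + 1)" by simp
      also have "sg (odd (ds ! i * ds ! Suc i + 1)) (br (permute_list ?t xs))
        = cst (kconst (lsign ?t ds)) * br (permute_list ?t xs)"
        using swap(2) by (subst lsign_adj) (simp_all add: len cst_pm del: even_plus_one_iff)
      also have "\<dots> = cst (kconst (lsign (?t \<circ> \<sigma>) ds)) * br (permute_list (?t \<circ> \<sigma>) xs)"
        unfolding IH using swap(1) t m len
        by (simp add: permute_list_compose lsign_comp kconst_mult cst_mult mult.assoc)
      finally show "br xs = \<dots>" .
    qed
  qed
  then show ?thesis using assms by (simp add: m_def)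
qed

lemma brG_jacobi:
  assumes "length xs = m" "set xs \<subseteq> RR" "list_all2 (\<lambda>d a. a \<in> hg wdeg hw_eq d) ds xs"
  shows "(\<Sum>q = 1..m. \<Sum>\<sigma>\<in>unshuffles q m. gpoly_scale (of_int (sign \<sigma>) * koszul_sign \<sigma> ds * (-1) ^ (q * (m - q)))
    (brG (brG (take q (permute_list \<sigma> (map Rep_sp xs))) # drop q (permute_list \<sigma> (map Rep_sp xs))))) = 0"
    (is "(\<Sum>q = 1..m. \<Sum>\<sigma>\<in>unshuffles q m. ?g q \<sigma>) = 0")
proof -
  have len: "length ds = m" using assms by (simp add: list_all2_lengthD)
  let ?h = "\<lambda>A. Rep_sp (sg (odd (ksum (\<lambda>b a. ds ! a * ds ! b + 1) (length xs) A + int (length (nths xs A) * length (nths xs (- A)))))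
      (br (br (nths xs A) # nths xs (- A))))"
  have "?g q \<sigma> = ?h (\<sigma> ` {..<q})" if q: "1 \<le> q" "q \<le> m" and \<sigma>: "\<sigma> \<in> unshuffles q m" for q \<sigma>
  proof -
    let ?A = "\<sigma> ` {..<q}"
    have p: "\<sigma> permutes {..<length xs}" using \<sigma> q assms(1) by (simp add: unshuffleD)
    note n = unshuffle_nths[of \<sigma> q xs, unfolded assms(1), OF \<sigma> q(2)]
    have l: "length (nths xs ?A) = q" "length (nths xs (- ?A)) = m - q"
      using q assms(1) by (simp_all add: n[symmetric])
    have "lsign \<sigma> ds = (pm (ksum (\<lambda>b a. ds ! a * ds ! b + 1) m ?A) :: 'k)"
      by (rule lsign_unshuffle[of \<sigma> q ds, unfolded len, OF \<sigma> q(2)])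
    then have "of_int (sign \<sigma>) * koszul_sign \<sigma> ds * (- 1) ^ (q * (m - q))
      = (pm (ksum (\<lambda>b a. ds ! a * ds ! b + 1) m ?A + int (q * (m - q))) :: 'k)"
      by (simp only: lsign_def pow_pm pm_add)
    moreover have "brG (brG (take q (permute_list \<sigma> (map Rep_sp xs))) # drop q (permute_list \<sigma> (map Rep_sp xs)))
      = Rep_sp (br (br (nths xs ?A) # nths xs (- ?A)))"
    proof -
      have "brG (brG (take q (permute_list \<sigma> (map Rep_sp xs))) # drop q (permute_list \<sigma> (map Rep_sp xs)))
        = brG (map Rep_sp (br (nths xs ?A) # nths xs (- ?A)))"
        unfolding permute_list_map[OF p] take_map drop_map n by simp
      then show ?thesis by (simp only: brG_Rep)
    qed
    ultimately show ?thesis by (simp only: scale_pm l assms(1))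
  qed
  then have "(\<Sum>q = 1..m. \<Sum>\<sigma>\<in>unshuffles q m. ?g q \<sigma>) = sum ?h (Pow {..<m} - {{}})"
    by (rule unshuffle_sum)
  also have "\<dots> = 0"
    using br_jacobi[OF assms(2,3)] by (simp only: Rep_sum[symmetric] assms(1) zero_sp.rep_eq)
  finally show ?thesis .
qed

lemma L_infinity: "L_infinity_algebra gpoly_scale R gr brG"
  unfolding L_infinity_algebra_def
proof (intro conjI allI impI ballI)
  show "graded_space gpoly_scale R gr" by (rule graded_space_gpoly)
  fix xs ys a b c assume "a \<in> R" "b \<in> R" "set xs \<subseteq> R" "set ys \<subseteq> R"
  then obtain us vs x y where r: "xs = map Rep_sp us" "ys = map Rep_sp vs" "a = Rep_sp x" "b = Rep_sp y"
    and RR: "set us \<subseteq> RR" "set vs \<subseteq> RR" "x \<in> RR" "y \<in> RR" by (metis R_list R_cases)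
  have "brG (map Rep_sp (us @ (cst (kconst c) * x + y) # vs))
    = gpoly_scale c (brG (map Rep_sp (us @ x # vs))) + brG (map Rep_sp (us @ y # vs))"
    unfolding brG_Rep br_linear[OF RR] scale_Rep plus_sp.rep_eq ..
  then show "brG (xs @ (gpoly_scale c a + b) # ys) = gpoly_scale c (brG (xs @ a # ys)) + brG (xs @ b # ys)"
    by (simp add: r scale_Rep plus_sp.rep_eq del: brG_Rep)
next
  fix ds xs assume "homogeneous_list gr ds xs"
  then obtain us where "xs = map Rep_sp us" "set us \<subseteq> RR" "list_all2 (\<lambda>d a. a \<in> hg wdeg hw_eq d) ds us"
    by (rule gr_list)
  then show "brG xs \<in> gr (sum_list ds + 2 - int (length xs))"
    using br_deg[of us ds] br_RR[of us] by (simp add: gr_iff)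
next
  fix ds xs \<sigma> assume h: "homogeneous_list gr ds xs" "\<sigma> permutes {..<length xs}"
  obtain us where us: "xs = map Rep_sp us" "set us \<subseteq> RR" "list_all2 (\<lambda>d a. a \<in> hg wdeg hw_eq d) ds us"
    using h(1) by (rule gr_list)
  then have p: "\<sigma> permutes {..<length us}" using h(2) by simp
  show "brG xs = gpoly_scale (of_int (sign \<sigma>) * koszul_sign \<sigma> ds) (brG (permute_list \<sigma> xs))"
    unfolding us(1) permute_list_map[OF p] brG_Rep lsign_def[symmetric] scale_Rep
    using br_permute[OF p us(2,3)] by (rule arg_cong)
next
  fix ds xs m assume m: "length xs = m" and h: "homogeneous_list gr ds xs"
  obtain us where us: "xs = map Rep_sp us" "set us \<subseteq> RR" "list_all2 (\<lambda>d a. a \<in> hg wdeg hw_eq d) ds us"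
    using h by (rule gr_list)
  have "length us = m" using m us(1) by simp
  then show "(\<Sum>q = 1..m. \<Sum>\<sigma>\<in>unshuffles q m. gpoly_scale (of_int (sign \<sigma>) * koszul_sign \<sigma> ds * (-1) ^ (q * (m - q)))
    (brG (brG (take q (permute_list \<sigma> xs)) # drop q (permute_list \<sigma> xs)))) = 0"
    unfolding us(1) by (rule brG_jacobi[OF _ us(2,3)])
qed

lemma P_infinity: "P_infinity_algebra gpoly_scale (\<star>) (gconst 1) R gr brG"
  unfolding P_infinity_algebra_def
proof (intro conjI allI impI ballI graded_comm_algebra L_infinity)
  fix d e a b ys assume "a \<in> gr d" "b \<in> gr e" "set ys \<subseteq> R"
  then obtain x y zs where r: "a = Rep_sp x" "b = Rep_sp y" "ys = map Rep_sp zs"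
    and RR: "x \<in> RR" "x \<in> hg wdeg hw_eq d" "y \<in> RR" "y \<in> hg wdeg hw_eq e" "set zs \<subseteq> RR"
    by (metis gr_cases R_list)
  note hom = hom_wdeg[OF RR(2)] hom_wdeg[OF RR(4)]
  let ?m = "int (length ys) + 1"
  have b1: "(odd (length zs + 1) \<and> odd d) = odd (?m * d)" by (simp add: r)
  have b2: "((odd d \<and> odd e) \<noteq> (odd (length zs + 1) \<and> odd e)) = odd (e * (d + ?m))" by (simp add: r) argo
  have "br (x * y # zs) = sg (odd (?m * d)) (x * br (y # zs)) + sg (odd (e * (d + ?m))) (y * br (x # zs))"
    unfolding br_mult[OF RR(5,1,3) hom] epsp_hom[OF hom(1)] epsp_hom[OF hom(2)] sg_mult_left sg_simps(4) b1 b2 ..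
  then have "brG (map Rep_sp (x * y # zs))
    = gpoly_scale (pm (?m * d)) (a \<star> brG (map Rep_sp (y # zs))) + gpoly_scale (pm (e * (d + ?m))) (b \<star> brG (map Rep_sp (x # zs)))"
    unfolding brG_Rep r(1,2) times_sp.rep_eq[symmetric] scale_pm plus_sp.rep_eq[symmetric] by (rule arg_cong)
  then show "let m = int (length ys) + 1 in brG (a \<star> b # ys)
    = gpoly_scale ((- 1) powi (m * d)) (a \<star> brG (b # ys)) + gpoly_scale ((- 1) powi (e * (d + m))) (b \<star> brG (a # ys))"
    unfolding Let_def powi_pm by (simp add: r times_sp.rep_eq del: brG_Rep)
qed

lemma brG_single: "a \<in> R \<Longrightarrow> brG [a] = \<delta> a"
  by (erule R_cases) (use brG_Rep[of "[_]"] in \<open>simp add: br_single Rep_D0\<close>)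

subsection \<open>Compatibility with the quotient\<close>

lemma coset_eqI: "s - t \<in> I \<Longrightarrow> coset I s = coset I t"
proof -
  assume st: "s - t \<in> I"
  have "s - u \<in> I \<longleftrightarrow> t - u \<in> I" for u
    using generated_ideal_closed(2)[OF st, of "t - u"] generated_ideal_closed(2)[OF generated_ideal_closed(4)[OF st], of "s - u"]
    by auto
  then show ?thesis by (auto simp: coset_def ideal_rel_def)
qed

text \<open>Changing the first argument within its coset changes \<open>P\<close> by an element of
  \<open>I\<close>, since \<open>I\<close> is a Poisson ideal; skew symmetry extends this to the
  second argument. All members of the union are therefore the same coset.\<close>

lemma quotient_bracket_coset: "quotient_bracket I P (coset I s) (coset I t) = coset I (P s t)"
proof -
  have eq: "coset I (P s' t') = coset I (P s t)" if "s - s' \<in> I" "t - t' \<in> I" for s' t'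
  proof (rule coset_eqI[symmetric])
    have "P s t = P (s - s') t + P s' t" using P_add_left[of "s - s'" s' t] by simp
    moreover have "P s' t = P s' (t - t') + P s' t'" using P_add_right[of s' "t - t'" t'] by simp
    moreover have "P s' (t - t') = - P (t - t') s'" by (rule P_skew)
    ultimately have "P s t = P (s - s') t + (- P (t - t') s' + P s' t')" by (simp only:)
    then have "P s t - P s' t' = P (s - s') t + - P (t - t') s'"
      unfolding add.assoc[symmetric] by (simp only: add_diff_cancel_right')
    then show "P s t - P s' t' \<in> I"
      using P_I[OF that(1)] generated_ideal_closed(4)[OF P_I[OF that(2)]] by (simp only: generated_ideal_closed(2))
  qed
  have "quotient_bracket I P (coset I s) (coset I t) = (\<Union>s'\<in>coset I s. \<Union>t'\<in>coset I t. coset I (P s t))"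
    unfolding quotient_bracket_def by (intro SUP_cong refl eq) (simp_all add: coset_def ideal_rel_def)
  moreover have "s \<in> coset I s" "t \<in> coset I t"
    using generated_ideal_closed(1) by (simp_all add: coset_def ideal_rel_def)
  then have "coset I s \<noteq> {}" "coset I t \<noteq> {}" by blast+
  ultimately show ?thesis by (simp only: UN_constant if_False)
qed

lemma augmentation_Rep: "augmentation I (Rep_sp x) = coset I (coef x 0)"
  by (simp add: augmentation_def Rep_coef)

lemma compatible: "compatible_with_quotient I P R brG"
  unfolding compatible_with_quotient_def
proof (intro conjI ballI allI impI)
  fix a b assume "a \<in> R" "b \<in> R"
  then obtain x y where r: "a = Rep_sp x" "b = Rep_sp y" "x \<in> RR" "y \<in> RR" by (metis R_cases)
  then show "augmentation I (brG [a, b]) = quotient_bracket I P (augmentation I a) (augmentation I b)"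
    using brG_Rep[of "[x, y]"] by (simp add: augmentation_Rep coef_br_2 quotient_bracket_coset del: brG_Rep)
next
  fix as assume as: "set as \<subseteq> R" "length as \<ge> 1" "length as \<noteq> 2"
  show "augmentation I (brG as) = coset I 0"
  proof (cases "length as = 1")
    case True
    then obtain a where a: "as = [a]" by (auto simp: length_Suc_conv)
    have "\<forall>a\<in>R. augmentation I (\<delta> a) = coset I 0"
      using resolvent by (simp add: resolvent_on_generators_def resolvent_def V_def)
    moreover have "a \<in> R" using as(1) by (simp add: a)
    ultimately show ?thesis unfolding a by (simp only: brG_single)
  next
    case False
    then have l: "length as \<ge> 3" using as(2,3) by linarith
    obtain xs where "as = map Rep_sp xs" "set xs \<subseteq> RR" using as(1) by (rule R_list)
    then show ?thesis using l by (simp only: brG_Rep augmentation_Rep coef_br_ge3 length_map)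
  qed
qed

lemma brG_weight:
  assumes GC
  shows "brackets_internal_degree w wv J m ((int m - 1) * p) brG"
  unfolding brackets_internal_degree_def V_def[symmetric]
proof (intro allI impI)
  fix ds as assume m: "length as = m" and R: "set as \<subseteq> R" and h: "homogeneous_list (gpoly_weight w wv) ds as"
  obtain xs where xs: "as = map Rep_sp xs" "set xs \<subseteq> RR" using R by (rule R_list)
  have "list_all2 (\<lambda>d a. a \<in> W d) ds xs"
    using h xs by (auto simp: homogeneous_list_def list_all2_conv_all_nth W_iff subset_iff)
  then have "br xs \<in> W (sum_list ds + (int (length xs) - 1) * p)"
    by (rule br_weight[OF assms xs(2)])
  then show "brG as \<in> gpoly_weight w wv (sum_list ds + (int m - 1) * p)"
    using m xs(1) by (simp add: W_iff[OF br_RR[OF xs(2)]])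
qed

lemma brG_trivial:
  assumes "\<And>n. \<theta> n = Pi0"
  shows "trivial_brackets P k R brG"
proof -
  have ge3: "brG as = 0" if "set as \<subseteq> R" "length as \<ge> 3" for as
  proof -
    obtain xs where "as = map Rep_sp xs" "set xs \<subseteq> RR" using \<open>set as \<subseteq> R\<close> by (rule R_list)
    then show ?thesis using that by (simp add: br_trivial_ge3[OF assms] zero_sp.rep_eq)
  qed
  have 2: "brG [gconst s, gconst t] = gconst (P s t)" for s t
    using brG_Rep[of "[cst s, cst t]"] by (simp add: br_trivial_cst[OF assms] Rep_cst del: brG_Rep)
  have even_R: "g \<in> R" if "g \<in> even_gens" for g
    using that RR_cst by (auto simp: even_gens_def Rep_cst[symmetric] Rep_R)
  have odd_gen: "\<exists>v\<in>V. g = Rep_sp (vr v)" if "g \<in> odd_gens k" for g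
    using that V_1 by (auto simp: odd_gens_def Rep_vr simp del: One_nat_def)
  have gen_R: "g \<in> R" if "g \<in> even_gens \<union> odd_gens k" for g
    using that even_R odd_gen RR_vr Rep_R by blast
  have odd0: "brG [g, a] = 0" "brG [a, g] = 0" if "g \<in> odd_gens k" "a \<in> R" for g a
  proof -
    obtain v where v: "v \<in> V" "g = Rep_sp (vr v)" using odd_gen[OF \<open>g \<in> odd_gens k\<close>] by blast
    obtain x where x: "a = Rep_sp x" "x \<in> RR" using \<open>a \<in> R\<close> by (rule R_cases)
    show "brG [g, a] = 0" "brG [a, g] = 0"
      using brG_Rep[of "[vr v, x]"] brG_Rep[of "[x, vr v]"] br_trivial_vr[OF assms x(2) v(1)]
      by (simp_all add: v x zero_sp.rep_eq del: brG_Rep)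
  qed
  have "brG gs = 0" if gs: "set gs \<subseteq> even_gens \<union> odd_gens k" "length gs \<ge> 2" "\<not> (length gs = 2 \<and> set gs \<subseteq> even_gens)" for gs
  proof (cases "length gs = 2")
    case True
    then obtain a b where ab: "gs = [a, b]" by (auto simp: numeral_2_eq_2 length_Suc_conv)
    then have "a \<in> odd_gens k \<or> b \<in> odd_gens k" "a \<in> R" "b \<in> R" using gs gen_R by auto
    then show ?thesis using odd0 ab by blast
  next
    case False
    then show ?thesis using gs gen_R by (intro ge3) auto
  qed
  then show ?thesis using ge3 2 unfolding trivial_brackets_def by blast
qed

end

theorem theorem1p4:
  fixes P :: "('n::finite, 'k::field_char_0) mpoly \<Rightarrow> ('n, 'k) mpoly \<Rightarrow> ('n, 'k) mpoly"
    and k :: nat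
    and f :: "nat \<Rightarrow> ('n, 'k) mpoly"
    and J :: "nat \<Rightarrow> nat set"
    and \<delta> :: "('n, 'k) mpoly gpoly \<Rightarrow> ('n, 'k) mpoly gpoly"
    and w :: "'n \<Rightarrow> nat"
    and wv :: "gvar \<Rightarrow> int"
    and p :: int
  defines "I \<equiv> generated_ideal k f"
    and "R \<equiv> (gpoly_carrier (graded_vars J) :: ('n, 'k) mpoly gpoly set)"
    and "gr \<equiv> (gpoly_gr (graded_vars J) :: int \<Rightarrow> ('n, 'k) mpoly gpoly set)"
  assumes "poisson_bracket pscale P"
    and "poisson_ideal P I"
    and "resolvent_on_generators J \<delta> k f"
  shows "\<exists>br :: ('n, 'k) mpoly gpoly list \<Rightarrow> ('n, 'k) mpoly gpoly.
    P_infinity_algebra gpoly_scale (\<star>) (gconst 1) R gr br \<and>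
    (\<forall>a\<in>R. br [a] = \<delta> a) \<and>
    compatible_with_quotient I P R br \<and>
    (graded_case w wv p P k f J \<delta> \<longrightarrow>
       (\<forall>m\<ge>1. brackets_internal_degree w wv J m ((int m - 1) * p) br)) \<and>
    ((\<forall>\<mu>\<in>{1..k}. casimir P (f \<mu>)) \<and> complete_intersection k f \<and> (\<forall>m\<ge>2. J m = {}) \<longrightarrow>
       trivial_brackets P k R br)"
proof -
  interpret weighted_resolvent P k f J \<delta> w wv p
    using assms by unfold_locales auto
  obtain \<theta> where \<theta>: "\<theta> 0 = Pi0 \<and> (\<forall>n. \<theta> n \<in> TT \<and> (GC \<longrightarrow> \<theta> n \<in> W (- p)) \<and> KK n (\<theta> n) \<in> hg wz hw_ge (int n)
      \<and> \<theta> (Suc n) - \<theta> n \<in> TT \<and> \<theta> (Suc n) - \<theta> n \<in> hg wz hw_ge (int n + 1)) \<and> (trivial_case \<longrightarrow> (\<forall>n. \<theta> n = Pi0))"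
    using theta_exists ..
  interpret maurer_cartan P k f J \<delta> w wv p \<theta>
    by unfold_locales (use \<theta> in blast)+
  show ?thesis
    unfolding I_def R_def gr_def V_def[symmetric]
  proof (intro exI[of _ brG] conjI ballI impI allI)
    show "trivial_brackets P k (gpoly_carrier V) brG"
      if "(\<forall>\<mu>\<in>{1..k}. casimir P (f \<mu>)) \<and> complete_intersection k f \<and> (\<forall>m\<ge>2. J m = {})"
    proof (rule brG_trivial)
      show "\<theta> n = Pi0" for n using \<theta> that by blast
    qed
  qed (rule P_infinity brG_single compatible brG_weight; assumption?)+
qed

end
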